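(* Let $1<p\le 2$, let $k\ge 1$, and let $(f,g)\in C_0^3(\mathbb{R}^2)\times C_0^2(\mathbb{R}^2)$ satisfy $\mathrm{supp}(f,g)\subset\{x\in\mathbb{R}^2 : |x|\le k\}$. Assume additionally that $$\int_{\mathbb{R}^2}\{f(x)+g(x)\}\,dx=0.$$ Then there exist a positive constant $\varepsilon_0=\varepsilon_0(f,g,p,k)$ and a positive constant $c$ independent of $\varepsilon$ such that, for every $0<\varepsilon\le\varepsilon_0$ and every $T>0$ satisfying $$ T\le\begin{cases} c\,\varepsilon^{-2p(p-1)/\gamma(p,4)} & \text{if } 1<p<2,\\ \exp(c\,\varepsilon^{-2/3}) & \text{if } p=2,\end{cases} $$ the following holds: if $p=2$, the initial value problem (P) admits a unique solution $u\in C^2(\mathbb{R}^2\times[0,T))$; if $1<p<2$, the integral equation (I) associated with (P) admits a unique solution $u\in C^1(\mathbb{R}^2\times[0,T))$.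
   Context: $\gamma(p,n)=2+(n+1)p-(n-1)p^2$, so $\gamma(p,4)=2+5p-3p^2$. Problem (P) is the two-dimensional initial value problem $$ u_{tt}-\Delta u=\frac{|u|^p}{(1+t)^{p-1}}\ \text{ in }\mathbb{R}^2\times[0,T),\qquad u(x,0)=\varepsilon f(x),\quad u_t(x,0)=\varepsilon\{f(x)+g(x)\},\ x\in\mathbb{R}^2 . $$ (It arises via $u=(1+t)v$ from $v_{tt}-\Delta v+\frac{2}{1+t}v_t=|v|^p$, $v(x,0)=\varepsilon f(x)$, $v_t(x,0)=\varepsilon g(x)$.) The associated integral equation (I) is $$u(x,t)=\varepsilon u_L(x,t)+L(|u|^p)(x,t),\qquad (x,t)\in\mathbb{R}^2\times[0,T),$$ where $$u_L(x,t)=\frac{\partial}{\partial t}R(f|x,t)+R(f+g|x,t),\qquad R(\phi|x,t)=\frac{t}{2\pi}\int_{|\xi|\le1}\frac{\phi(x+t\xi)}{\sqrt{1-|\xi|^2}}\,d\xi,$$ and $$L(F)(x,t)=\frac1{2\pi}\int_0^t\frac{t-\tau}{(1+\tau)^{p-1}}\,d\tau\int_{|\xi|\le1}\frac{F(x+(t-\tau)\xi,\tau)}{\sqrt{1-|\xi|^2}}\,d\xi .$$ *)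

theory Defs
  imports "HOL-Analysis.Analysis"
begin

text \<open>Real-valued functions of class C^n on a set S of a Euclidean space. Differentiability
  is Frechet differentiability within S, and the functions D i are the partial derivatives of f.
  On an open set this is the usual class C^n. On the set of (x, t) with 0 \<le> t < T
  the derivatives are unique as well; at t = 0 they are one-sided in t, and continuity up to
  t = 0 is required.\<close>

primrec C_on :: "nat \<Rightarrow> 'a::euclidean_space set \<Rightarrow> ('a \<Rightarrow> real) \<Rightarrow> bool" where
  "C_on 0 S f \<longleftrightarrow> continuous_on S f"
| "C_on (Suc n) S f \<longleftrightarrow>
    (\<exists>D :: 'a \<Rightarrow> 'a \<Rightarrow> real.
      (\<forall>z\<in>S. (f has_derivative (\<lambda>h. \<Sum>i\<in>Basis. (h \<bullet> i) * D i z)) (at z within S)) \<and>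
      (\<forall>i\<in>Basis. C_on n S (D i)))"

definition supp :: "('a::topological_space \<Rightarrow> 'b::zero) \<Rightarrow> 'a set" where
  "supp \<phi> = closure {x. \<phi> x \<noteq> 0}"

definition C0 :: "nat \<Rightarrow> ('a::euclidean_space \<Rightarrow> real) set" where
  "C0 n = {\<phi>. C_on n UNIV \<phi> \<and> compact (supp \<phi>)}"

definition strauss_gamma :: "real \<Rightarrow> nat \<Rightarrow> real" where
  "strauss_gamma p n = 2 + (real n + 1) * p - (real n - 1) * p\<^sup>2"

definition spacetime :: "real \<Rightarrow> ((real^2) \<times> real) set" where
  "spacetime T = UNIV \<times> {0..<T}"

text \<open>Partial derivatives of a function on space-time. The time derivative is taken within the
  closed half-line, hence it is two-sided for t > 0 and one-sided at t = 0.\<close>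

definition dt :: "((real^2) \<times> real \<Rightarrow> real) \<Rightarrow> (real^2) \<times> real \<Rightarrow> real" where
  "dt u = (\<lambda>(x, t). vector_derivative (\<lambda>s. u (x, s)) (at t within {0..}))"

definition dx :: "2 \<Rightarrow> ((real^2) \<times> real \<Rightarrow> real) \<Rightarrow> (real^2) \<times> real \<Rightarrow> real" where
  "dx i u = (\<lambda>(x, t). vector_derivative (\<lambda>s. u (x + s *\<^sub>R axis i 1, t)) (at 0))"

definition laplacian :: "((real^2) \<times> real \<Rightarrow> real) \<Rightarrow> (real^2) \<times> real \<Rightarrow> real" where
  "laplacian u z = (\<Sum>i\<in>UNIV. dx i (dx i u) z)"

definition solves_IVP ::
    "real \<Rightarrow> (real^2 \<Rightarrow> real) \<Rightarrow> (real^2 \<Rightarrow> real) \<Rightarrow> real \<Rightarrow> real \<Rightarrow> ((real^2) \<times> real \<Rightarrow> real) \<Rightarrow> bool"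
  where
  "solves_IVP p f g \<epsilon> T u \<longleftrightarrow>
    C_on 2 (spacetime T) u \<and>
    (\<forall>(x, t)\<in>spacetime T.
       dt (dt u) (x, t) - laplacian u (x, t) = \<bar>u (x, t)\<bar> powr p / (1 + t) powr (p - 1)) \<and>
    (\<forall>x. u (x, 0) = \<epsilon> * f x) \<and>
    (\<forall>x. dt u (x, 0) = \<epsilon> * (f x + g x))"

text \<open>The weight is singular on the unit circle, where the quotient has the value 0 in HOL; the
  circle is a null set. For continuous functions the integrals below converge absolutely.\<close>

definition R :: "(real^2 \<Rightarrow> real) \<Rightarrow> real^2 \<Rightarrow> real \<Rightarrow> real" where
  "R \<phi> x t = t / (2 * pi) *
     (LINT \<xi>:cball 0 1|lborel. \<phi> (x + t *\<^sub>R \<xi>) / sqrt (1 - (norm \<xi>)\<^sup>2))"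

text \<open>The formula for R makes sense for all real t, so the two-sided derivative is meaningful
  at t = 0, too.\<close>

definition u_L :: "(real^2 \<Rightarrow> real) \<Rightarrow> (real^2 \<Rightarrow> real) \<Rightarrow> real^2 \<Rightarrow> real \<Rightarrow> real" where
  "u_L f g x t = deriv (R f x) t + R (\<lambda>y. f y + g y) x t"

definition L :: "real \<Rightarrow> ((real^2) \<times> real \<Rightarrow> real) \<Rightarrow> real^2 \<Rightarrow> real \<Rightarrow> real" where
  "L p F x t = 1 / (2 * pi) *
     (LINT \<tau>:{0..t}|lborel. (t - \<tau>) / (1 + \<tau>) powr (p - 1) *
       (LINT \<xi>:cball 0 1|lborel. F (x + (t - \<tau>) *\<^sub>R \<xi>, \<tau>) / sqrt (1 - (norm \<xi>)\<^sup>2)))"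

definition solves_integral_eq ::
    "real \<Rightarrow> (real^2 \<Rightarrow> real) \<Rightarrow> (real^2 \<Rightarrow> real) \<Rightarrow> real \<Rightarrow> real \<Rightarrow> ((real^2) \<times> real \<Rightarrow> real) \<Rightarrow> bool"
  where
  "solves_integral_eq p f g \<epsilon> T u \<longleftrightarrow>
    C_on 1 (spacetime T) u \<and>
    (\<forall>(x, t)\<in>spacetime T. u (x, t) = \<epsilon> * u_L f g x t + L p (\<lambda>z. \<bar>u z\<bar> powr p) x t)"

text \<open>Functions on space-time are total in HOL, so two solutions are identified when they agree
  for 0 \<le> t < T.\<close>

definition admits_unique_solution ::
    "real \<Rightarrow> (((real^2) \<times> real \<Rightarrow> real) \<Rightarrow> bool) \<Rightarrow> bool" where
  "admits_unique_solution T sol \<longleftrightarrow>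
    (\<exists>u. sol u \<and> (\<forall>v. sol v \<longrightarrow> (\<forall>z\<in>spacetime T. v z = u z)))"

end

theory Submission
  imports Defs
begin

text \<open>The nonlinearity is put into an integral equation, so existence is a question of a priori
  bounds. Let t' = k + 2 + t and let beta = t' - |x|^2 / t', which is comparable with the distance
  to the light cone. Since f + g has mean zero, the free solution decays like
  t'^(-1/2) beta^(-3/2). Functions of the form t'^(-m) S(beta) have an explicit wave operator,
  and combinations of them with vanishing initial data are supersolutions of the linear equation.
  By Duhamel's formula and the positivity of the two-dimensional fundamental solution, they bound
  the Duhamel term of a source of size t'^(-3/2 - n) beta^(-3/2) or t'^(-3/2 - n) beta^(-1 + kappa)
  by a multiple of t'^(-1/2) beta^(-n), where the factor is t'^kappa / (kappa (1/2 - n)) for the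
  second one. Hence the bound by the sum of the two profiles
  reproduces itself as long as T lies in the range of the theorem; the exponent is n = (3p - 5)/2,
  increased to 1/4 for small p, and n = 1/2 - 1/l with l = 4 + ln t' for p = 2. Cutting the
  nonlinearity off at this bound makes it Lipschitz, the fixed point theorem applies, and the
  solution satisfies the original equation. Regularity follows by differentiating the integral
  equation, and uniqueness from a Gronwall inequality on backward cones.\<close>

section \<open>Continuous partial derivatives\<close>

text \<open>The exponents come from counting powers of t'. Under the weight (1 + t)^(1 - p), the
  p-th power of a function of size t'^(-1/2) has size t'^(-3/2 - q) with q = (3p - 5)/2, and a
  profile \<beta>^(-n) becomes \<beta>^(-np). For n = q one has 1 - np = \<gamma>/2 with \<gamma> =
  \<open>strauss_gamma p 4\<close>: the source is not quite integrable in \<beta>, the loss is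
  T^(\<gamma>/2), and the condition of the theorem says that \<epsilon>^(p(p - 1)) T^(\<gamma>/2) is
  small. Mean value zero improves the free solution from \<beta>^(-1/2) to \<beta>^(-3/2), which is
  integrable, so the free solution itself loses nothing in T. At p = 2 both gaps 1/2 - n and
  \<kappa> = 1 - np would close. Keeping them of order 1/l makes the Duhamel term of size
  \<epsilon>^2 l and its feedback of size l (\<epsilon>^2 l)^2. This has to stay below \<epsilon>^2,
  so \<epsilon>^2 l^3 must be small; this is the exponent 2/3. A single profile cannot be a
  supersolution: t'^(-1/2) \<beta>^(-n) has a positive wave operator, but near the cone it is too
  small for the source. A subtracted correction of order t'^(-1/2 - n) supplies the missing
  part.\<close>

definition has_grad :: "(real^2 \<Rightarrow> real) \<Rightarrow> (2 \<Rightarrow> real^2 \<Rightarrow> real) \<Rightarrow> bool" where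
  "has_grad \<phi> D \<longleftrightarrow> (\<forall>x. (\<phi> has_derivative (\<lambda>h. \<Sum>i\<in>UNIV. h $ i * D i x)) (at x))"

lemma has_grad_cont: "has_grad \<phi> D \<Longrightarrow> continuous_on S \<phi>"
  unfolding has_grad_def
  by (meson continuous_at_imp_continuous_on has_derivative_continuous)

lemma has_grad_real_derivative:
  assumes "has_grad \<phi> D" "\<And>i. ((\<lambda>s. X s $ i) has_real_derivative X' i) (at s within S)"
  shows "((\<lambda>s. \<phi> (X s)) has_real_derivative (\<Sum>i\<in>UNIV. X' i * D i (X s))) (at s within S)"
proof -
  have "((\<lambda>s. X s \<bullet> b) has_derivative (\<lambda>h. (\<chi> i. h * X' i) \<bullet> b)) (at s within S)" if b: "b \<in> Basis" for b
  proof -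
    obtain i where i: "b = axis i 1" using b by (auto simp: Basis_vec_def)
    have "(\<lambda>h. h * X' i) = (*) (X' i)" by (simp add: fun_eq_iff)
    then show ?thesis
      using assms(2)[of i] unfolding i has_field_derivative_def by (simp add: inner_axis)
  qed
  then have "(X has_derivative (\<lambda>h. \<chi> i. h * X' i)) (at s within S)"
    by (subst has_derivative_componentwise_within) blast
  moreover have "(\<phi> has_derivative (\<lambda>h. \<Sum>i\<in>UNIV. h $ i * D i (X s))) (at (X s))"
    using assms(1) by (auto simp: has_grad_def)
  ultimately have "((\<lambda>s. \<phi> (X s)) has_derivative (\<lambda>h. \<Sum>i\<in>UNIV. (\<chi> i. h * X' i) $ i * D i (X s))) (at s within S)"
    by (rule has_derivative_compose)
  moreover have "(\<lambda>h. \<Sum>i\<in>UNIV. (\<chi> i. h * X' i) $ i * D i (X s)) = (*) (\<Sum>i\<in>UNIV. X' i * D i (X s))"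
    by (simp add: fun_eq_iff sum_2 algebra_simps)
  ultimately show ?thesis
    by (simp add: has_field_derivative_def)
qed

lemma has_grad_line:
  assumes "has_grad \<phi> D"
  shows "((\<lambda>s. \<phi> (x + s *\<^sub>R axis i 1)) has_real_derivative D i (x + s *\<^sub>R axis i 1)) (at s within S)"
proof -
  have "((\<lambda>s. (x + s *\<^sub>R axis i 1) $ j) has_real_derivative (if j = i then 1 else 0)) (at s within S)" for j
    by (auto simp: axis_def intro!: derivative_eq_intros)
  from has_grad_real_derivative[OF assms this] show ?thesis
    by (simp add: if_distrib[of "\<lambda>a. a * _"] cong: if_cong)
qed

lemma has_grad_add: "has_grad \<phi> D \<Longrightarrow> has_grad \<psi> E \<Longrightarrow> has_grad (\<lambda>x. \<phi> x + \<psi> x) (\<lambda>i x. D i x + E i x)"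
  unfolding has_grad_def
  by (auto intro!: derivative_eq_intros simp: algebra_simps sum.distrib)

lemma has_grad_cmult: "has_grad \<phi> D \<Longrightarrow> has_grad (\<lambda>x. c * \<phi> x) (\<lambda>i x. c * D i x)"
  unfolding has_grad_def
  by (auto intro!: derivative_eq_intros simp: algebra_simps sum_distrib_left)

lemma vec2_decomp: "(x::real^2) = x$1 *\<^sub>R axis 1 1 + x$2 *\<^sub>R axis 2 1"
  by (simp add: vec_eq_iff forall_2 axis_def)

lemma Basis2: "(Basis :: (real^2) set) = {axis 1 1, axis 2 1}"
  by (auto simp: Basis_vec_def exhaust_2)
    (metis (full_types) exhaust_2)

lemma field_deriv_shift:
  assumes "((\<lambda>h. f (s + h)) has_real_derivative d) (at 0)"
  shows "(f has_real_derivative d) (at s)"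
  using assms DERIV_shift[of f d 0 s] by (simp add: add.commute)

text \<open>The unequal treatment of the variables fits integrals with a variable upper limit: one
  partial derivative is explicit everywhere, the other comes from differentiation under the integral
  at the given point. Working within a product includes the end points of a time interval.\<close>

lemma partials_real2:
  fixes f :: "real \<Rightarrow> real \<Rightarrow> real"
  assumes fx: "((\<lambda>x. f x y) has_real_derivative fx) (at x within X)"
    and fy: "\<And>x y. x \<in> X \<Longrightarrow> y \<in> Y \<Longrightarrow> ((\<lambda>y. f x y) has_real_derivative fy x y) (at y within Y)"
    and c: "continuous_on (X \<times> Y) (\<lambda>(x, y). fy x y)"
    and "x \<in> X" "y \<in> Y" "convex Y"
  shows "((\<lambda>(x, y). f x y) has_derivative (\<lambda>(tx, ty). tx * fx + ty * fy x y)) (at (x, y) within X \<times> Y)"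
proof -
  have "((\<lambda>(x, y). f x y) has_derivative (\<lambda>(tx, ty). (fx * tx) + blinfun_scaleR_left (fy x y) ty)) (at (x, y) within X \<times> Y)"
  proof (rule has_derivative_partialsI[where fy="\<lambda>x y. blinfun_scaleR_left (fy x y)"])
    show "((\<lambda>x. f x y) has_derivative (*) fx) (at x within X)"
      using fx by (simp add: has_field_derivative_def)
    show "((\<lambda>y. f x y) has_derivative blinfun_apply (blinfun_scaleR_left (fy x y))) (at y within Y)"
      if "x \<in> X" "y \<in> Y" for x y
      using fy[OF that] by (simp add: has_field_derivative_def mult.commute[of _ "fy x y"])
    have "continuous_on (X \<times> Y) (\<lambda>z. blinfun_scaleR_left ((\<lambda>(x, y). fy x y) z))"
      by (intro continuous_intros c)
    then show "continuous (at (x, y) within X \<times> Y) (\<lambda>(x, y). blinfun_scaleR_left (fy x y))"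
      using assms(4,5) by (auto simp: continuous_on_eq_continuous_within split_beta')
  qed fact+
  then show ?thesis by (simp add: mult.commute)
qed

lemma has_gradI:
  assumes d: "\<And>x i. ((\<lambda>s. \<phi> (x + s *\<^sub>R axis i 1)) has_real_derivative D i x) (at 0)"
    and c: "\<And>i. continuous_on UNIV (D i)"
  shows "has_grad \<phi> D"
  unfolding has_grad_def
proof
  fix x :: "real^2"
  let ?f = "\<lambda>a b. \<phi> (a *\<^sub>R axis 1 1 + b *\<^sub>R axis 2 1)"
  have d': "((\<lambda>s. \<phi> (x + s *\<^sub>R axis i 1)) has_real_derivative D i (x + s *\<^sub>R axis i 1)) (at s)" for x i s
    using d[of "x + s *\<^sub>R axis i 1" i]
    by - (rule field_deriv_shift, simp add: algebra_simps)
  have "((\<lambda>(x, y). ?f x y) has_derivative (\<lambda>(tx, ty). tx * D 1 (x$1 *\<^sub>R axis 1 1 + x$2 *\<^sub>R axis 2 1) + ty * D 2 (x$1 *\<^sub>R axis 1 1 + x$2 *\<^sub>R axis 2 1)))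
    (at (x$1, x$2) within UNIV \<times> UNIV)"
  proof (rule partials_real2[where fy="\<lambda>a b. D 2 (a *\<^sub>R axis 1 1 + b *\<^sub>R axis 2 1)"])
    show "((\<lambda>xa. ?f xa (x$2)) has_real_derivative D 1 (x$1 *\<^sub>R axis 1 1 + x$2 *\<^sub>R axis 2 1)) (at (x $ 1) within UNIV)"
      using d'[of "x$2 *\<^sub>R axis 2 1" 1] by (simp add: add.commute)
    show "((\<lambda>b. ?f a b) has_real_derivative D 2 (a *\<^sub>R axis 1 1 + b *\<^sub>R axis 2 1)) (at b within UNIV)" for a b
      using d'[of "a *\<^sub>R axis 1 1" 2] by simp
    show "continuous_on (UNIV \<times> UNIV) (\<lambda>(xa, y). D 2 (xa *\<^sub>R axis 1 1 + y *\<^sub>R axis 2 1))"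
      unfolding split_beta by (intro continuous_intros continuous_on_compose2[OF c]) auto
  qed auto
  then have A: "((\<lambda>(x, y). ?f x y) has_derivative (\<lambda>(tx, ty). tx * D 1 x + ty * D 2 x)) (at (x$1, x$2))"
    using vec2_decomp[of x] by simp
  have B: "((\<lambda>x. (x$1, x$2)) has_derivative (\<lambda>h. (h$1, h$2))) (at x)" for x :: "real^2"
    by (intro has_derivative_Pair bounded_linear_imp_has_derivative bounded_linear_vec_nth)
  from has_derivative_compose[OF B A]
  show "(\<phi> has_derivative (\<lambda>h. \<Sum>i\<in>UNIV. h $ i * D i x)) (at x)"
    by (simp add: sum_2 flip: vec2_decomp)
qed

text \<open>Schwarz's theorem with the existence of the second mixed derivative included. Write
  \<open>f s\<close> as \<open>f l\<close> plus the integral of \<open>b\<close> over [l, s],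
  differentiate under the integral in \<theta>, and apply the fundamental theorem of calculus in
  s.\<close>

lemma mixed_partial_interchange:
  fixes f :: "real \<Rightarrow> real \<Rightarrow> real"
  assumes a: "\<And>s \<theta>. s \<in> {l..r} \<Longrightarrow> ((\<lambda>\<theta>. f s \<theta>) has_real_derivative a s \<theta>) (at \<theta>)"
    and b: "\<And>s \<theta>. s \<in> {l..r} \<Longrightarrow> ((\<lambda>s. f s \<theta>) has_real_derivative b s \<theta>) (at s within {l..r})"
    and c: "\<And>s \<theta>. s \<in> {l..r} \<Longrightarrow> ((\<lambda>\<theta>. b s \<theta>) has_real_derivative c s \<theta>) (at \<theta>)"
    and bc: "\<And>\<theta>. continuous_on {l..r} (\<lambda>s. b s \<theta>)"
    and cc: "continuous_on ({l..r} \<times> UNIV) (\<lambda>(s, \<theta>). c s \<theta>)"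
    and s0: "s0 \<in> {l..r}"
  shows "((\<lambda>s. a s \<theta>) has_real_derivative c s0 \<theta>) (at s0 within {l..r})"
proof -
  have A: "a s \<theta> = a l \<theta> + integral {l..s} (\<lambda>\<sigma>. c \<sigma> \<theta>)" if s: "s \<in> {l..r}" for s
  proof -
    have "((\<lambda>\<sigma>. b \<sigma> \<theta>) has_integral (f s \<theta> - f l \<theta>)) {l..s}" for \<theta>
      using s by (intro fundamental_theorem_of_calculus)
        (auto simp flip: has_real_derivative_iff_has_vector_derivative
          intro!: DERIV_subset[OF b])
    from integral_unique[OF this] have e: "f s = (\<lambda>\<theta>. f l \<theta> + integral {l..s} (\<lambda>\<sigma>. b \<sigma> \<theta>))"
      by (simp add: fun_eq_iff)
    have "((\<lambda>\<theta>. integral (cbox l s) (\<lambda>\<sigma>. b \<sigma> \<theta>)) has_real_derivative integral (cbox l s) (\<lambda>\<sigma>. c \<sigma> \<theta>)) (at \<theta> within UNIV)"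
    proof (rule leibniz_rule_field_derivative)
      show "((\<lambda>x. b \<sigma> x) has_real_derivative c \<sigma> \<theta>) (at \<theta> within UNIV)" if "\<sigma> \<in> cbox l s" for \<theta> \<sigma>
        using c[of \<sigma>] that s by auto
      show "(\<lambda>\<sigma>. b \<sigma> x) integrable_on cbox l s" for x
        using s by (intro integrable_continuous continuous_on_subset[OF bc]) auto
      show "continuous_on (UNIV \<times> cbox l s) (\<lambda>(x, t). c t x)"
        unfolding split_beta
        by (rule continuous_on_compose2[OF cc, where f="\<lambda>z. (snd z, fst z)", unfolded split_beta fst_conv snd_conv])
          (use s in \<open>auto intro!: continuous_intros\<close>)
    qed auto
    then have "((\<lambda>\<theta>. f s \<theta>) has_real_derivative (a l \<theta> + integral {l..s} (\<lambda>\<sigma>. c \<sigma> \<theta>))) (at \<theta>)"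
      unfolding e using a[of l \<theta>] s by (auto intro!: derivative_eq_intros)
    with a[OF s, of \<theta>] show ?thesis by (rule DERIV_unique)
  qed
  have "continuous_on {l..r} (\<lambda>\<sigma>. c \<sigma> \<theta>)"
    by (rule continuous_on_compose2[OF cc, where f="\<lambda>s. (s, \<theta>)", unfolded split_beta fst_conv snd_conv])
      (auto intro!: continuous_intros)
  from integral_has_real_derivative[OF this s0]
  have "((\<lambda>s. a l \<theta> + integral {l..s} (\<lambda>\<sigma>. c \<sigma> \<theta>)) has_real_derivative c s0 \<theta>) (at s0 within {l..r})"
    by (auto intro!: derivative_eq_intros)
  then show ?thesis
    by (rule has_field_derivative_transform_within[OF _ zero_less_one s0]) (rule A[symmetric])
qed

section \<open>The weighted mean over the unit disc\<close>

text \<open>Seen as the projection of the unit sphere of three-space, the disc with the weight of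
  the operator R carries spherical coordinates whose polar axis lies in the plane of the disc. In
  these coordinates the singular weight disappears.\<close>

definition pt :: "real \<times> real \<Rightarrow> real^2" where
  "pt z = - (cos (fst z) *\<^sub>R axis 1 1) - (sin (fst z) * cos (snd z)) *\<^sub>R axis 2 1"

text \<open>The mean over the half sphere on which the third coordinate sin a * sin t is
  nonnegative: \<open>sin (fst z)\<close> is the surface density and 2 pi the area. The minus signs
  in \<open>pt\<close> make both coordinates increasing in their angles, as the substitutions in
  \<open>disc_measure\<close> require.\<close>

definition avg :: "(real^2 \<Rightarrow> real) \<Rightarrow> real" where
  "avg h = 1 / (2 * pi) * integral (cbox (0, 0) (pi, pi)) (\<lambda>z. sin (fst z) * h (pt z))"

lemma pt_nth [simp]: "pt z $ 1 = - cos (fst z)" "pt z $ 2 = - (sin (fst z) * cos (snd z))"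
  by (simp_all add: pt_def axis_def)

lemma norm_pt: "norm (pt z) \<le> 1"
proof -
  have "(norm (pt z))\<^sup>2 = (cos (fst z))\<^sup>2 + (sin (fst z))\<^sup>2 * (cos (snd z))\<^sup>2"
    by (simp add: norm_vec_def L2_set_def sum_2 power_mult_distrib)
  also have "\<dots> \<le> (cos (fst z))\<^sup>2 + (sin (fst z))\<^sup>2 * 1"
    by (intro add_left_mono mult_left_mono) (auto simp: abs_square_le_1)
  finally show ?thesis by (simp add: abs_square_le_1)
qed

lemma continuous_on_pt [continuous_intros]:
  "continuous_on S f \<Longrightarrow> continuous_on S (\<lambda>x. pt (f x))"
proof -
  have "continuous_on UNIV pt"
    unfolding pt_def by (intro continuous_intros)
  then show "continuous_on S f \<Longrightarrow> continuous_on S (\<lambda>x. pt (f x))"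
    by (rule continuous_on_compose2) auto
qed

lemma sin_fst_nonneg: "z \<in> cbox (0, 0) (pi, pi) \<Longrightarrow> 0 \<le> sin (fst z)"
  by (cases z) (auto simp: cbox_Pair_eq intro: sin_ge_zero)

lemma avg_integrable:
  assumes "continuous_on (cball 0 1) h"
  shows "(\<lambda>z. sin (fst z) * h (pt z)) integrable_on cbox (0, 0) (pi, pi)"
  by (intro integrable_continuous continuous_intros continuous_on_compose2[OF assms])
    (auto simp: norm_pt)

lemma continuous_on_avg_aux:
  fixes H :: "'a::t2_space \<Rightarrow> real^2 \<Rightarrow> real"
  assumes "continuous_on (U \<times> cball 0 1) (\<lambda>(y, \<xi>). H y \<xi>)"
  shows "continuous_on (U \<times> cbox (0, 0) (pi, pi)) (\<lambda>(y, z). sin (fst z) * H y (pt z))"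
proof -
  have "continuous_on (U \<times> cbox (0, 0) (pi, pi)) (\<lambda>w. H (fst w) (pt (snd w)))"
    by (rule continuous_on_compose2[OF assms, where f="\<lambda>z. (fst z, pt (snd z))", unfolded split_beta fst_conv snd_conv])
      (auto simp: norm_pt intro!: continuous_intros)
  moreover have "continuous_on (U \<times> cbox (0, 0) (pi, pi)) (\<lambda>w. sin (fst (snd w)))"
    by (intro continuous_on_sin continuous_on_fst continuous_on_snd continuous_on_id)
  ultimately show ?thesis
    unfolding split_beta by (rule continuous_on_mult[rotated])
qed

lemma avg_cong: "(\<And>\<xi>. norm \<xi> \<le> 1 \<Longrightarrow> h \<xi> = k \<xi>) \<Longrightarrow> avg h = avg k"
  by (simp add: avg_def norm_pt)

lemma avg_mono:
  assumes "continuous_on (cball 0 1) h" "continuous_on (cball 0 1) k"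
    and "\<And>\<xi>. norm \<xi> \<le> 1 \<Longrightarrow> h \<xi> \<le> k \<xi>"
  shows "avg h \<le> avg k"
  unfolding avg_def
  by (intro mult_left_mono integral_le avg_integrable assms mult_mono sin_fst_nonneg)
    (auto intro: mult_left_mono sin_fst_nonneg assms norm_pt)

lemma avg_add:
  assumes "continuous_on (cball 0 1) h" "continuous_on (cball 0 1) k"
  shows "avg (\<lambda>\<xi>. h \<xi> + k \<xi>) = avg h + avg k"
  unfolding avg_def
  using integral_add[OF avg_integrable[OF assms(1)] avg_integrable[OF assms(2)]]
  by (simp add: algebra_simps add_divide_distrib)

lemma avg_cmult: "avg (\<lambda>\<xi>. c * h \<xi>) = c * avg h"
  by (simp add: avg_def mult.left_commute[of _ c])

lemma avg_minus: "avg (\<lambda>\<xi>. - h \<xi>) = - avg h"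
  using avg_cmult[of "-1" h] by simp

lemma avg_zero [simp]: "avg (\<lambda>\<xi>. 0) = 0"
  by (simp add: avg_def)

lemma avg_const: "avg (\<lambda>_. c) = c"
proof -
  have i: "((\<lambda>x. sin x) has_integral (- cos pi - - cos 0)) {0..pi}"
    by (intro fundamental_theorem_of_calculus)
      (auto simp flip: has_real_derivative_iff_has_vector_derivative intro!: derivative_eq_intros)
  have "integral (cbox (0, 0) (pi, pi)) (\<lambda>z. sin (fst z) * 1) =
    integral (cbox 0 pi) (\<lambda>x. integral (cbox 0 pi) (\<lambda>y::real. sin x))"
    by (subst integral_prod_continuous) (auto intro!: continuous_intros)
  also have "\<dots> = integral {0..pi} (\<lambda>x. pi * sin x)"
    by (simp add: mult.commute)
  also have "\<dots> = 2 * pi"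
    using has_integral_mult_right[OF i, of pi] by (simp add: integral_unique)
  finally have "avg (\<lambda>_. 1) = 1" by (simp add: avg_def)
  then show ?thesis using avg_cmult[of c "\<lambda>_. 1"] by simp
qed

lemma avg_abs_le:
  assumes "continuous_on (cball 0 1) h" "\<And>\<xi>. norm \<xi> \<le> 1 \<Longrightarrow> \<bar>h \<xi>\<bar> \<le> k \<xi>" "continuous_on (cball 0 1) k"
  shows "\<bar>avg h\<bar> \<le> avg k"
proof -
  have "avg h \<le> avg k" "avg (\<lambda>\<xi>. - h \<xi>) \<le> avg k"
    using assms by (auto intro!: avg_mono continuous_intros simp: abs_le_iff)
  then show ?thesis by (simp add: avg_minus abs_le_iff)
qed

lemma continuous_on_avg:
  fixes H :: "'a::t2_space \<Rightarrow> real^2 \<Rightarrow> real"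
  assumes "continuous_on (U \<times> cball 0 1) (\<lambda>(y, \<xi>). H y \<xi>)"
  shows "continuous_on U (\<lambda>y. avg (H y))"
  unfolding avg_def
  by (intro continuous_on_mult continuous_on_const integral_continuous_on_param
      continuous_on_avg_aux assms)

lemma avg_has_derivative:
  fixes H :: "real \<Rightarrow> real^2 \<Rightarrow> real"
  assumes d: "\<And>s \<xi>. s \<in> U \<Longrightarrow> norm \<xi> \<le> 1 \<Longrightarrow> ((\<lambda>s. H s \<xi>) has_real_derivative H' s \<xi>) (at s within U)"
    and c: "\<And>s. s \<in> U \<Longrightarrow> continuous_on (cball 0 1) (H s)"
    and c': "continuous_on (U \<times> cball 0 1) (\<lambda>(s, \<xi>). H' s \<xi>)"
    and U: "s \<in> U" "convex U"
  shows "((\<lambda>s. avg (H s)) has_real_derivative avg (H' s)) (at s within U)"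
  unfolding avg_def
proof (rule DERIV_cmult, rule leibniz_rule_field_derivative)
  show "((\<lambda>s. sin (fst t) * H s (pt t)) has_real_derivative sin (fst t) * H' s (pt t)) (at s within U)"
    if "s \<in> U" for s t
    by (intro DERIV_cmult d that norm_pt)
  show "(\<lambda>z. sin (fst z) * H s (pt z)) integrable_on cbox (0, 0) (pi, pi)" if "s \<in> U" for s
    by (intro avg_integrable c that)
  show "continuous_on (U \<times> cbox (0, 0) (pi, pi)) (\<lambda>(x, z). sin (fst z) * H' x (pt z))"
    by (rule continuous_on_avg_aux[OF c'])
qed (rule U)+

text \<open>In the spherical coordinates the identity for the Laplacian of the mean says that the
  Laplace-Beltrami operator has mean zero; the following is its pointwise algebraic part.\<close>

lemma spherical_laplacian:
  fixes sa :: real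
  assumes "sa * sa = 1 - ca * ca" "st * st = 1 - ct * ct"
  shows "ct * d2 + st * (sa * st * e22) + (2 * sa * ca * d1 - (ca\<^sup>2 - sa\<^sup>2) * ct * d2 +
      sa * (sa * (sa * e11 - ca * ct * e12) - ca * ct * (sa * e21 - ca * ct * e22))) =
    sa * (e11 + e22 - (2 * (- ca * d1 + - (sa * ct) * d2) + (- ca * - ca * e11 + - ca * - (sa * ct) * e12 +
      (- (sa * ct) * - ca * e21 + - (sa * ct) * - (sa * ct) * e22))))"
  using assms by algebra

text \<open>Extend \<psi> to three-space as constant in the third variable. The difference of the
  two integrands is the Laplace-Beltrami operator of its restriction to the sphere; times the
  density it is a divergence in the two angles. The fluxes carry factors sin a and sin t and vanish
  at all four sides of the square.\<close>

lemma avg_laplace_identity: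
  assumes g: "has_grad \<psi> D" and gg: "\<And>i. has_grad (D i) (E i)"
    and c: "\<And>i j. continuous_on UNIV (E i j)"
  shows "avg (\<lambda>\<xi>. 2 * (\<Sum>i\<in>UNIV. \<xi>$i * D i \<xi>) + (\<Sum>i\<in>UNIV. \<Sum>j\<in>UNIV. \<xi>$i * \<xi>$j * E i j \<xi>)) =
    avg (\<lambda>\<xi>. \<Sum>i\<in>UNIV. E i i \<xi>)"
proof -
  have cD: "continuous_on UNIV (D i)" for i using gg has_grad_cont by blast
  note cc = continuous_on_compose2[OF cD] continuous_on_compose2[OF c]
  \<comment> \<open>\<open>P\<close> is sin a times the polar derivative of \<psi> composed with
    \<open>pt\<close>. \<open>Q\<close> is the azimuthal derivative divided by sin a, with the
    quotient already cancelled, so that nothing is singular at the poles.\<close>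
  define P where "P a t = sin a * (sin a * D 1 (pt (a, t)) - cos a * cos t * D 2 (pt (a, t)))" for a t
  define Pa where "Pa a t = 2 * sin a * cos a * D 1 (pt (a,t)) - ((cos a)\<^sup>2 - (sin a)\<^sup>2) * cos t * D 2 (pt (a,t))
     + sin a * (sin a * (sin a * E 1 1 (pt (a,t)) - cos a * cos t * E 1 2 (pt (a,t)))
       - cos a * cos t * (sin a * E 2 1 (pt (a,t)) - cos a * cos t * E 2 2 (pt (a,t))))" for a t
  define Q where "Q a t = sin t * D 2 (pt (a, t))" for a t
  define Qt where "Qt a t = cos t * D 2 (pt (a, t)) + sin t * (sin a * sin t * E 2 2 (pt (a,t)))" for a t
  have da: "((\<lambda>a. h (pt (a, t))) has_real_derivative (sin a * F 1 (pt (a,t)) - cos a * cos t * F 2 (pt (a,t)))) (at a within S)"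
    if "has_grad h F" for h F a t S
  proof -
    have "((\<lambda>a. pt (a, t) $ i) has_real_derivative (if i = 1 then sin a else - (cos a * cos t))) (at a within S)" for i
      using exhaust_2[of i] by (auto intro!: derivative_eq_intros)
    from has_grad_real_derivative[OF that this] show ?thesis by (simp add: sum_2)
  qed
  have dt: "((\<lambda>t. h (pt (a, t))) has_real_derivative (sin a * sin t * F 2 (pt (a,t)))) (at t within S)"
    if "has_grad h F" for h F a t S
  proof -
    have "((\<lambda>t. pt (a, t) $ i) has_real_derivative (if i = 1 then 0 else sin a * sin t)) (at t within S)" for i
      using exhaust_2[of i] by (auto intro!: derivative_eq_intros)
    from has_grad_real_derivative[OF that this] show ?thesis by (simp add: sum_2)
  qed
  have P: "((\<lambda>a. P a t) has_real_derivative Pa a t) (at a within S)" for a t S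
    unfolding P_def Pa_def
    by (rule derivative_eq_intros da[OF gg] refl)+ (simp add: algebra_simps power2_eq_square)
  have Q: "((\<lambda>t. Q a t) has_real_derivative Qt a t) (at t within S)" for a t S
    unfolding Q_def Qt_def
    by (rule derivative_eq_intros dt[OF gg] refl)+ (simp add: algebra_simps)
  have Pi: "integral {0..pi} (\<lambda>a. Pa a t) = 0" for t
  proof -
    have "((\<lambda>a. Pa a t) has_integral P pi t - P 0 t) {0..pi}"
      by (intro fundamental_theorem_of_calculus)
        (auto simp flip: has_real_derivative_iff_has_vector_derivative intro!: P)
    then show ?thesis by (simp add: P_def integral_unique)
  qed
  have Qi: "integral {0..pi} (\<lambda>t. Qt a t) = 0" for a
  proof -
    have "((\<lambda>t. Qt a t) has_integral Q a pi - Q a 0) {0..pi}"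
      by (intro fundamental_theorem_of_calculus)
        (auto simp flip: has_real_derivative_iff_has_vector_derivative intro!: Q)
    then show ?thesis by (simp add: Q_def integral_unique)
  qed
  have cP: "continuous_on (cbox (0, 0) (pi, pi)) (\<lambda>(a, t). Pa a t)"
    and cQ: "continuous_on (cbox (0, 0) (pi, pi)) (\<lambda>(a, t). Qt a t)"
    unfolding Pa_def Qt_def split_beta by (intro continuous_intros cc; simp)+
  have iP: "integral (cbox (0, 0) (pi, pi)) (\<lambda>(a, t). Pa a t) = 0"
    unfolding integral_swap_2dim[OF cP]
    by (subst integral_prod_continuous[OF swap_continuous[OF cP]]) (simp add: Pi)
  have iQ: "integral (cbox (0, 0) (pi, pi)) (\<lambda>(a, t). Qt a t) = 0"
    by (subst integral_prod_continuous[OF cQ]) (simp add: Qi)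
  have "integral (cbox (0, 0) (pi, pi)) (\<lambda>z. Qt (fst z) (snd z) + Pa (fst z) (snd z)) = 0"
    using iP iQ integral_add[OF integrable_continuous[OF cQ] integrable_continuous[OF cP]]
    by (simp add: split_beta)
  moreover have "Qt (fst z) (snd z) + Pa (fst z) (snd z) = sin (fst z) *
    ((\<Sum>i\<in>UNIV. E i i (pt z)) - (2 * (\<Sum>i\<in>UNIV. pt z $ i * D i (pt z))
     + (\<Sum>i\<in>UNIV. \<Sum>j\<in>UNIV. pt z $ i * pt z $ j * E i j (pt z))))" for z
  proof -
    obtain a t where z: "z = (a, t)" by (cases z)
    have s2: "sin a * sin a = 1 - cos a * cos a" "sin t * sin t = 1 - cos t * cos t"
      using sin_squared_eq[of a] sin_squared_eq[of t] by (simp_all add: power2_eq_square)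
    show ?thesis
      unfolding z Pa_def Qt_def sum_2 pt_nth fst_conv snd_conv
      by (rule spherical_laplacian[OF s2])
  qed
  ultimately have "avg (\<lambda>\<xi>. (\<Sum>i\<in>UNIV. E i i \<xi>) - (2 * (\<Sum>i\<in>UNIV. \<xi>$i * D i \<xi>)
     + (\<Sum>i\<in>UNIV. \<Sum>j\<in>UNIV. \<xi>$i * \<xi>$j * E i j \<xi>))) = 0"
    by (simp add: avg_def)
  then have z: "avg (\<lambda>\<xi>. (\<Sum>i\<in>UNIV. E i i \<xi>) + - (2 * (\<Sum>i\<in>UNIV. \<xi>$i * D i \<xi>)
     + (\<Sum>i\<in>UNIV. \<Sum>j\<in>UNIV. \<xi>$i * \<xi>$j * E i j \<xi>))) = 0"
    by (simp only: add_uminus_conv_diff)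
  have c1: "continuous_on (cball 0 1) (\<lambda>\<xi>. \<Sum>i\<in>UNIV. E i i \<xi>)"
    and c2: "continuous_on (cball 0 1) (\<lambda>\<xi>. - (2 * (\<Sum>i\<in>UNIV. \<xi>$i * D i \<xi>)
     + (\<Sum>i\<in>UNIV. \<Sum>j\<in>UNIV. \<xi>$i * \<xi>$j * E i j \<xi>)))"
    by (intro continuous_intros cc; simp)+
  show ?thesis
    using z unfolding avg_add[OF c1 c2] avg_minus by linarith
qed

section \<open>The propagators of the free wave equation\<close>

text \<open>The operator \<open>R\<close> of the statement without its singular weight; the two
  agree on continuous functions by \<open>R_eq_Rm\<close>. It solves the wave equation with data (0,
  \<phi>).\<close>

definition Rm :: "(real^2 \<Rightarrow> real) \<Rightarrow> real^2 \<Rightarrow> real \<Rightarrow> real" where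
  "Rm \<phi> x \<theta> = \<theta> * avg (\<lambda>\<xi>. \<phi> (x + \<theta> *\<^sub>R \<xi>))"

text \<open>The derivative of \<open>Rm\<close> in \<theta>, which solves the wave equation with
  data (\<phi>, 0). The gradient of \<phi> is passed as the argument \<open>D\<close>.\<close>

definition Rd :: "(real^2 \<Rightarrow> real) \<Rightarrow> (2 \<Rightarrow> real^2 \<Rightarrow> real) \<Rightarrow> real^2 \<Rightarrow> real \<Rightarrow> real" where
  "Rd \<phi> D x \<theta> = avg (\<lambda>\<xi>. \<phi> (x + \<theta> *\<^sub>R \<xi>) + \<theta> * (\<Sum>i\<in>UNIV. \<xi> $ i * D i (x + \<theta> *\<^sub>R \<xi>)))"

text \<open>Centre, radius and time are functions of one common parameter, so joint continuity in
  any selection of the variables is an instance.\<close>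

lemma continuous_on_arg:
  fixes S :: "'a::t2_space set"
  assumes F: "continuous_on (UNIV \<times> I) (\<lambda>(x :: real^2, \<tau> :: real). F x \<tau> :: real)"
    and "continuous_on S X" "continuous_on S \<Theta>" "continuous_on S \<tau>" "\<tau> ` S \<subseteq> I"
  shows "continuous_on (S \<times> cball 0 1) (\<lambda>(z, \<xi>). F (X z + \<Theta> z *\<^sub>R \<xi>) (\<tau> z))"
proof -
  have *: "continuous_on (S \<times> cball (0::real^2) 1) (\<lambda>z. f (fst z))" if "continuous_on S f" for f :: "'a \<Rightarrow> 'b::t2_space"
    by (rule continuous_on_compose2[OF that]) (auto intro!: continuous_intros)
  show ?thesis
    unfolding split_beta
    by (rule continuous_on_compose2[OF F, where f="\<lambda>z. (X (fst z) + \<Theta> (fst z) *\<^sub>R snd z, \<tau> (fst z))", unfolded split_beta fst_conv snd_conv])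
      (use assms(5) in \<open>auto intro!: continuous_intros * assms\<close>)
qed

lemma continuous_on_Rm:
  fixes S :: "'a::t2_space set" and F :: "real^2 \<Rightarrow> real \<Rightarrow> real"
  assumes F: "continuous_on (UNIV \<times> I) (\<lambda>(x, \<tau>). F x \<tau>)"
    and "continuous_on S X" "continuous_on S \<Theta>" "continuous_on S \<tau>" "\<tau> ` S \<subseteq> I"
  shows "continuous_on S (\<lambda>z. Rm (\<lambda>x. F x (\<tau> z)) (X z) (\<Theta> z))"
  unfolding Rm_def
  by (intro continuous_on_mult assms continuous_on_avg continuous_on_arg[OF F])

lemma continuous_on_Rd:
  fixes S :: "'a::t2_space set" and F :: "real^2 \<Rightarrow> real \<Rightarrow> real"
  assumes F: "continuous_on (UNIV \<times> I) (\<lambda>(x, \<tau>). F x \<tau>)"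
    and D: "\<And>i. continuous_on (UNIV \<times> I) (\<lambda>(x, \<tau>). D i x \<tau>)"
    and X: "continuous_on S X" "continuous_on S \<Theta>" "continuous_on S \<tau>" "\<tau> ` S \<subseteq> I"
  shows "continuous_on S (\<lambda>z. Rd (\<lambda>x. F x (\<tau> z)) (\<lambda>i x. D i x (\<tau> z)) (X z) (\<Theta> z))"
  unfolding Rd_def
proof (rule continuous_on_avg)
  have *: "continuous_on (S \<times> cball (0::real^2) 1) (\<lambda>z. \<Theta> (fst z))"
    by (rule continuous_on_compose2[OF X(2)]) (auto intro!: continuous_intros)
  show "continuous_on (S \<times> cball 0 1) (\<lambda>(z, \<xi>). F (X z + \<Theta> z *\<^sub>R \<xi>) (\<tau> z) + \<Theta> z * (\<Sum>i\<in>UNIV. \<xi> $ i * D i (X z + \<Theta> z *\<^sub>R \<xi>) (\<tau> z)))"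
    unfolding split_beta
    by (intro continuous_intros * continuous_on_arg[OF F X, unfolded split_beta] continuous_on_arg[OF D X, unfolded split_beta])
qed

lemma continuous_on_Rm':
  fixes S :: "'a::t2_space set"
  assumes F: "continuous_on UNIV \<phi>" and "continuous_on S X" "continuous_on S \<Theta>"
  shows "continuous_on S (\<lambda>z. Rm \<phi> (X z) (\<Theta> z))"
  by (rule continuous_on_Rm[where I=UNIV and F="\<lambda>x _. \<phi> x" and \<tau>="\<lambda>_. 0"])
    (auto intro!: assms continuous_on_compose2[OF F] continuous_intros simp: split_beta)

lemma continuous_on_Rd':
  fixes S :: "'a::t2_space set"
  assumes F: "continuous_on UNIV \<phi>" and D: "\<And>i. continuous_on UNIV (D i)"
    and "continuous_on S X" "continuous_on S \<Theta>"
  shows "continuous_on S (\<lambda>z. Rd \<phi> D (X z) (\<Theta> z))"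
  by (rule continuous_on_Rd[where I=UNIV and F="\<lambda>x _. \<phi> x" and D="\<lambda>i x _. D i x" and \<tau>="\<lambda>_. 0"])
    (auto intro!: assms continuous_on_compose2[OF F] continuous_on_compose2[OF D] continuous_intros simp: split_beta)

lemma Rm_0 [simp]: "Rm \<phi> x 0 = 0" by (simp add: Rm_def)

lemma Rd_0 [simp]: "Rd \<phi> D x 0 = \<phi> x" by (simp add: Rd_def avg_const)

lemma continuous_on_shift:
  "continuous_on UNIV (\<phi> :: real^2 \<Rightarrow> real) \<Longrightarrow> continuous_on S (\<lambda>\<xi>. \<phi> (x + \<theta> *\<^sub>R \<xi>))"
  by (rule continuous_on_compose2) (auto intro!: continuous_intros)

lemma Rm_add:
  assumes "continuous_on UNIV \<phi>" "continuous_on UNIV \<psi>"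
  shows "Rm (\<lambda>x. \<phi> x + \<psi> x) x \<theta> = Rm \<phi> x \<theta> + Rm \<psi> x \<theta>"
  unfolding Rm_def by (subst avg_add) (auto intro!: continuous_on_shift assms simp: algebra_simps)

lemma Rm_cmult: "Rm (\<lambda>x. c * \<phi> x) x \<theta> = c * Rm \<phi> x \<theta>"
  by (simp add: Rm_def avg_cmult)

lemma Rd_cmult: "Rd (\<lambda>x. c * \<phi> x) (\<lambda>i x. c * D i x) x \<theta> = c * Rd \<phi> D x \<theta>"
proof -
  have "Rd (\<lambda>x. c * \<phi> x) (\<lambda>i x. c * D i x) x \<theta> =
    avg (\<lambda>\<xi>. c * (\<phi> (x + \<theta> *\<^sub>R \<xi>) + \<theta> * (\<Sum>i\<in>UNIV. \<xi> $ i * D i (x + \<theta> *\<^sub>R \<xi>))))"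
    unfolding Rd_def by (rule avg_cong) (simp add: sum_2 algebra_simps)
  then show ?thesis unfolding Rd_def avg_cmult .
qed

lemma Rm_mono:
  assumes "continuous_on UNIV \<phi>" "continuous_on UNIV \<psi>" "0 \<le> \<theta>"
    and "\<And>y. dist x y \<le> \<theta> \<Longrightarrow> \<phi> y \<le> \<psi> y"
  shows "Rm \<phi> x \<theta> \<le> Rm \<psi> x \<theta>"
  unfolding Rm_def
  using assms(3) by (intro mult_left_mono avg_mono continuous_on_shift assms)
    (auto simp: dist_norm mult_left_le)

lemma Rm_const: "Rm (\<lambda>_. c) x \<theta> = \<theta> * c"
  by (simp add: Rm_def avg_const)

lemma Rm_cong:
  assumes "0 \<le> \<theta>" "\<And>y. dist x y \<le> \<theta> \<Longrightarrow> \<phi> y = \<psi> y"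
  shows "Rm \<phi> x \<theta> = Rm \<psi> x \<theta>"
  unfolding Rm_def using assms(1)
  by (intro arg_cong[where f="(*) \<theta>"] avg_cong assms(2)) (auto simp: dist_norm mult_left_le)

lemma Rm_abs:
  assumes "continuous_on UNIV \<phi>" "continuous_on UNIV \<psi>" "0 \<le> \<theta>"
    and "\<And>y. dist x y \<le> \<theta> \<Longrightarrow> \<bar>\<phi> y\<bar> \<le> \<psi> y"
  shows "\<bar>Rm \<phi> x \<theta>\<bar> \<le> Rm \<psi> x \<theta>"
proof -
  have "Rm \<phi> x \<theta> \<le> Rm \<psi> x \<theta>" "Rm (\<lambda>x. - 1 * \<phi> x) x \<theta> \<le> Rm \<psi> x \<theta>"
    using assms by (auto intro!: Rm_mono continuous_intros simp: abs_le_iff)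
  then show ?thesis unfolding Rm_cmult by (simp add: abs_le_iff)
qed

lemma continuous_on_parts:
  assumes "\<And>i. has_grad (D i) (E i)" shows "continuous_on S (D i)"
  using assms has_grad_cont by blast

lemma Rm_deriv_t:
  assumes g: "has_grad \<phi> D" and c: "\<And>i. continuous_on UNIV (D i)"
  shows "((\<lambda>\<theta>. Rm \<phi> x \<theta>) has_real_derivative Rd \<phi> D x \<theta>) (at \<theta> within S)"
proof -
  have "((\<lambda>\<theta>. avg (\<lambda>\<xi>. \<phi> (x + \<theta> *\<^sub>R \<xi>))) has_real_derivative avg (\<lambda>\<xi>. \<Sum>i\<in>UNIV. \<xi>$i * D i (x + \<theta> *\<^sub>R \<xi>))) (at \<theta> within UNIV)"
  proof (rule avg_has_derivative)
    show "((\<lambda>s. \<phi> (x + s *\<^sub>R \<xi>)) has_real_derivative (\<Sum>i\<in>UNIV. \<xi> $ i * D i (x + s *\<^sub>R \<xi>))) (at s within UNIV)" for s \<xi>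
      by (rule has_grad_real_derivative[OF g]) (auto intro!: derivative_eq_intros)
    show "continuous_on (cball 0 1) (\<lambda>\<xi>. \<phi> (x + s *\<^sub>R \<xi>))" for s
      by (rule continuous_on_shift[OF has_grad_cont[OF g]])
    show "continuous_on (UNIV \<times> cball 0 1) (\<lambda>(s, \<xi>). \<Sum>i\<in>UNIV. \<xi> $ i * D i (x + s *\<^sub>R \<xi>))"
      unfolding split_beta by (intro continuous_intros continuous_on_compose2[OF c]) auto
  qed auto
  then have "((\<lambda>\<theta>. Rm \<phi> x \<theta>) has_real_derivative avg (\<lambda>\<xi>. \<phi> (x + \<theta> *\<^sub>R \<xi>)) + \<theta> * avg (\<lambda>\<xi>. \<Sum>i\<in>UNIV. \<xi>$i * D i (x + \<theta> *\<^sub>R \<xi>))) (at \<theta>)"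
    unfolding Rm_def by (auto intro!: derivative_eq_intros)
  moreover have "Rd \<phi> D x \<theta> = avg (\<lambda>\<xi>. \<phi> (x + \<theta> *\<^sub>R \<xi>)) + \<theta> * avg (\<lambda>\<xi>. \<Sum>i\<in>UNIV. \<xi>$i * D i (x + \<theta> *\<^sub>R \<xi>))"
    unfolding Rd_def
    by (subst avg_add) (auto intro!: continuous_intros continuous_on_shift has_grad_cont[OF g] c simp: avg_cmult)
  ultimately show ?thesis using has_field_derivative_at_within by metis
qed

lemma Rm_deriv_x:
  assumes g: "has_grad \<phi> D" and c: "\<And>i. continuous_on UNIV (D i)"
  shows "((\<lambda>s. Rm \<phi> (x + s *\<^sub>R axis i 1) \<theta>) has_real_derivative Rm (D i) (x + s *\<^sub>R axis i 1) \<theta>) (at s within S)"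
proof -
  have "((\<lambda>s. avg (\<lambda>\<xi>. \<phi> (x + s *\<^sub>R axis i 1 + \<theta> *\<^sub>R \<xi>))) has_real_derivative avg (\<lambda>\<xi>. D i (x + s *\<^sub>R axis i 1 + \<theta> *\<^sub>R \<xi>))) (at s within UNIV)"
  proof (rule avg_has_derivative)
    show "((\<lambda>s. \<phi> (x + s *\<^sub>R axis i 1 + \<theta> *\<^sub>R \<xi>)) has_real_derivative D i (x + s *\<^sub>R axis i 1 + \<theta> *\<^sub>R \<xi>)) (at s within UNIV)" for s \<xi>
      using has_grad_line[OF g, of "x + \<theta> *\<^sub>R \<xi>" i s UNIV] by (simp add: algebra_simps)
    show "continuous_on (cball 0 1) (\<lambda>\<xi>. \<phi> (x + s *\<^sub>R axis i 1 + \<theta> *\<^sub>R \<xi>))" for s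
      by (rule continuous_on_shift[OF has_grad_cont[OF g]])
    show "continuous_on (UNIV \<times> cball 0 1) (\<lambda>(s, \<xi>). D i (x + s *\<^sub>R axis i 1 + \<theta> *\<^sub>R \<xi>))"
      unfolding split_beta by (intro continuous_intros continuous_on_compose2[OF c]) auto
  qed auto
  then show ?thesis unfolding Rm_def
    by - (rule DERIV_cmult, rule has_field_derivative_at_within)
qed

lemma Rm_has_grad:
  assumes "has_grad \<phi> D" and "\<And>i. continuous_on UNIV (D i)"
  shows "has_grad (\<lambda>x. Rm \<phi> x \<theta>) (\<lambda>i x. Rm (D i) x \<theta>)"
proof (rule has_gradI)
  show "((\<lambda>s. Rm \<phi> (x + s *\<^sub>R axis i 1) \<theta>) has_real_derivative Rm (D i) x \<theta>) (at 0)" for x i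
    using Rm_deriv_x[OF assms, of x i \<theta> 0] by simp
  show "continuous_on UNIV (\<lambda>x. Rm (D i) x \<theta>)" for i
    by (intro continuous_on_Rm' assms continuous_intros)
qed

text \<open>This is the wave equation for \<open>Rm\<close>. For \<theta> nonzero,
  \<open>avg_laplace_identity\<close> is applied to \<xi> -> \<phi>(x + \<theta>\<xi>), where each
  derivative yields a factor \<theta>, and the result is divided by \<theta>. At \<theta> = 0 the
  same identity, applied to a linear function, shows that the remaining mean is zero.\<close>

lemma Rd_deriv_t:
  assumes g: "has_grad \<phi> D" and gg: "\<And>i. has_grad (D i) (E i)"
    and c: "\<And>i j. continuous_on UNIV (E i j)"
  shows "((\<lambda>\<theta>. Rd \<phi> D x \<theta>) has_real_derivative Rm (\<lambda>x. \<Sum>i\<in>UNIV. E i i x) x \<theta>) (at \<theta> within S)"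
proof -
  define H' where "H' \<theta> \<xi> = 2 * (\<Sum>i\<in>UNIV. \<xi>$i * D i (x + \<theta> *\<^sub>R \<xi>)) +
      \<theta> * (\<Sum>i\<in>UNIV. \<Sum>j\<in>UNIV. \<xi>$i * \<xi>$j * E i j (x + \<theta> *\<^sub>R \<xi>))" for \<theta> \<xi>
  have lin: "((\<lambda>s. (x + s *\<^sub>R \<xi>) $ i) has_real_derivative \<xi> $ i) (at s within UNIV)" for \<xi> i s
    by (auto intro!: derivative_eq_intros)
  note dd = has_grad_real_derivative[OF gg lin] has_grad_real_derivative[OF g lin]
  have cD: "continuous_on UNIV (D i)" for i using gg has_grad_cont by blast
  note cc = continuous_on_compose2[OF cD] continuous_on_compose2[OF c] continuous_on_compose2[OF has_grad_cont[OF g, of UNIV]]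
  have "((\<lambda>\<theta>. Rd \<phi> D x \<theta>) has_real_derivative avg (H' \<theta>)) (at \<theta> within UNIV)"
    unfolding Rd_def
  proof (rule avg_has_derivative)
    show "((\<lambda>s. \<phi> (x + s *\<^sub>R \<xi>) + s * (\<Sum>i\<in>UNIV. \<xi> $ i * D i (x + s *\<^sub>R \<xi>))) has_real_derivative H' s \<xi>) (at s within UNIV)" for s \<xi>
      unfolding sum_2 H'_def
      by (rule derivative_eq_intros dd refl)+ (simp add: sum_2 algebra_simps)
    show "continuous_on (cball 0 1) (\<lambda>\<xi>. \<phi> (x + s *\<^sub>R \<xi>) + s * (\<Sum>i\<in>UNIV. \<xi> $ i * D i (x + s *\<^sub>R \<xi>)))" for s
      by (intro continuous_intros cc) auto
    show "continuous_on (UNIV \<times> cball 0 1) (\<lambda>(s, \<xi>). H' s \<xi>)"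
      unfolding split_beta H'_def by (intro continuous_intros cc) auto
  qed auto
  moreover have "avg (H' \<theta>) = Rm (\<lambda>x. \<Sum>i\<in>UNIV. E i i x) x \<theta>"
  proof (cases "\<theta> = 0")
    case True
    have "avg (\<lambda>\<xi>. 2 * (\<Sum>i\<in>UNIV. \<xi>$i * D i x)) = 0"
    proof -
      have g': "has_grad (\<lambda>y. \<Sum>i\<in>UNIV. y$i * D i x) (\<lambda>i _. D i x)"
        unfolding has_grad_def by (auto intro!: derivative_eq_intros bounded_linear.has_derivative[OF bounded_linear_vec_nth] simp: sum_2)
      have g0: "has_grad (\<lambda>_. D i x) (\<lambda>j _. 0)" for i
        unfolding has_grad_def by (auto intro!: derivative_eq_intros)
      show ?thesis using avg_laplace_identity[OF g' g0] by simp
    qed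
    moreover have "H' 0 = (\<lambda>\<xi>. 2 * (\<Sum>i\<in>UNIV. \<xi>$i * D i x))" by (simp add: H'_def fun_eq_iff)
    ultimately show ?thesis using True by simp
  next
    case False
    let ?\<psi> = "\<lambda>\<xi>. \<phi> (x + \<theta> *\<^sub>R \<xi>)"
    have gr: "has_grad (\<lambda>\<xi>. h (x + \<theta> *\<^sub>R \<xi>)) (\<lambda>i \<xi>. \<theta> * F i (x + \<theta> *\<^sub>R \<xi>))"
      if "has_grad h F" for h F
      unfolding has_grad_def
    proof
      fix \<xi>
      have "((\<lambda>\<xi>. x + \<theta> *\<^sub>R \<xi>) has_derivative (\<lambda>k. \<theta> *\<^sub>R k)) (at \<xi>)"
        by (auto intro!: derivative_eq_intros)
      moreover have "(h has_derivative (\<lambda>k. \<Sum>i\<in>UNIV. k $ i * F i (x + \<theta> *\<^sub>R \<xi>))) (at (x + \<theta> *\<^sub>R \<xi>))"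
        using that by (simp add: has_grad_def)
      ultimately have "((\<lambda>\<xi>. h (x + \<theta> *\<^sub>R \<xi>)) has_derivative (\<lambda>k. \<Sum>i\<in>UNIV. (\<theta> *\<^sub>R k) $ i * F i (x + \<theta> *\<^sub>R \<xi>))) (at \<xi>)"
        by (rule has_derivative_compose)
      then show "((\<lambda>\<xi>. h (x + \<theta> *\<^sub>R \<xi>)) has_derivative (\<lambda>k. \<Sum>i\<in>UNIV. k $ i * (\<theta> * F i (x + \<theta> *\<^sub>R \<xi>)))) (at \<xi>)"
        by (simp add: mult_ac)
    qed
    have "avg (\<lambda>\<xi>. 2 * (\<Sum>i\<in>UNIV. \<xi>$i * (\<theta> * D i (x + \<theta> *\<^sub>R \<xi>))) + (\<Sum>i\<in>UNIV. \<Sum>j\<in>UNIV. \<xi>$i * \<xi>$j * (\<theta> * (\<theta> * E i j (x + \<theta> *\<^sub>R \<xi>))))) =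
      avg (\<lambda>\<xi>. \<Sum>i\<in>UNIV. \<theta> * (\<theta> * E i i (x + \<theta> *\<^sub>R \<xi>)))"
      by (rule avg_laplace_identity[OF gr[OF g] has_grad_cmult[OF gr[OF gg]]])
        (intro continuous_intros continuous_on_shift c)
    moreover have "avg (\<lambda>\<xi>. 2 * (\<Sum>i\<in>UNIV. \<xi>$i * (\<theta> * D i (x + \<theta> *\<^sub>R \<xi>))) + (\<Sum>i\<in>UNIV. \<Sum>j\<in>UNIV. \<xi>$i * \<xi>$j * (\<theta> * (\<theta> * E i j (x + \<theta> *\<^sub>R \<xi>))))) = \<theta> * avg (H' \<theta>)"
      unfolding avg_cmult[symmetric] by (rule avg_cong) (simp add: H'_def sum_2 algebra_simps)
    moreover have "avg (\<lambda>\<xi>. \<Sum>i\<in>UNIV. \<theta> * (\<theta> * E i i (x + \<theta> *\<^sub>R \<xi>))) = \<theta> * Rm (\<lambda>x. \<Sum>i\<in>UNIV. E i i x) x \<theta>"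
      unfolding Rm_def avg_cmult[symmetric] by (rule avg_cong) (simp add: sum_2 algebra_simps)
    ultimately show ?thesis using False by simp
  qed
  ultimately show ?thesis using has_field_derivative_at_within by metis
qed

text \<open>Differentiating the definition of \<open>Rd\<close> would produce the derivative of
  \<open>D j\<close> in direction i, while the claim contains the derivative of \<open>D i\<close>
  in direction j. Interchanging the derivatives of the mean avoids comparing them.\<close>

lemma Rd_deriv_x:
  assumes g: "has_grad \<phi> D" and c: "\<And>i. continuous_on UNIV (D i)"
    and gg: "has_grad (D i) E" and cE: "\<And>j. continuous_on UNIV (E j)"
  shows "((\<lambda>s. Rd \<phi> D (x + s *\<^sub>R axis i 1) \<theta>) has_real_derivative Rd (D i) E x \<theta>) (at 0)"
proof -
  have "((\<lambda>s. Rd \<phi> D (x + s *\<^sub>R axis i 1) \<theta>) has_real_derivative Rd (D i) E (x + 0 *\<^sub>R axis i 1) \<theta>) (at 0 within {-1..1})"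
  proof (rule mixed_partial_interchange[where f="\<lambda>s. Rm \<phi> (x + s *\<^sub>R axis i 1)" and a="\<lambda>s. Rd \<phi> D (x + s *\<^sub>R axis i 1)"
        and b="\<lambda>s. Rm (D i) (x + s *\<^sub>R axis i 1)" and c="\<lambda>s. Rd (D i) E (x + s *\<^sub>R axis i 1)"])
    show "((\<lambda>\<theta>. Rm \<phi> (x + s *\<^sub>R axis i 1) \<theta>) has_real_derivative Rd \<phi> D (x + s *\<^sub>R axis i 1) \<theta>) (at \<theta>)" for s \<theta>
      by (rule Rm_deriv_t[OF g c])
    show "((\<lambda>s. Rm \<phi> (x + s *\<^sub>R axis i 1) \<theta>) has_real_derivative Rm (D i) (x + s *\<^sub>R axis i 1) \<theta>) (at s within {- 1..1})" for s \<theta>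
      by (rule Rm_deriv_x[OF g c])
    show "((\<lambda>\<theta>. Rm (D i) (x + s *\<^sub>R axis i 1) \<theta>) has_real_derivative Rd (D i) E (x + s *\<^sub>R axis i 1) \<theta>) (at \<theta>)" for s \<theta>
      by (rule Rm_deriv_t[OF gg cE])
    show "continuous_on {- 1..1} (\<lambda>s. Rm (D i) (x + s *\<^sub>R axis i 1) \<theta>)" for \<theta>
      by (intro continuous_on_Rm' c continuous_intros)
    show "continuous_on ({- 1..1} \<times> UNIV) (\<lambda>(s, \<theta>). Rd (D i) E (x + s *\<^sub>R axis i 1) \<theta>)"
      unfolding split_beta by (intro continuous_on_Rd' c cE continuous_intros)
  qed auto
  moreover have "at (0::real) within {-1..1} = at 0"
    by (rule at_within_interior) simp
  ultimately show ?thesis by simp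
qed

lemma Rd_has_grad:
  assumes "has_grad \<phi> D" and gg: "\<And>i. has_grad (D i) (E i)" and "\<And>i j. continuous_on UNIV (E i j)"
  shows "has_grad (\<lambda>x. Rd \<phi> D x \<theta>) (\<lambda>i x. Rd (D i) (E i) x \<theta>)"
  by (rule has_gradI)
    (auto intro!: Rd_deriv_x continuous_on_Rd' assms continuous_on_parts[OF gg] continuous_intros)

section \<open>The Duhamel operator\<close>

text \<open>The time interval is closed, unlike the one in \<open>spacetime\<close>, so that
  compactness is available up to the final time. A function on \<open>spacetime T\<close> is treated
  on [0, T'] for each T' < T.\<close>

definition cstrip :: "real \<Rightarrow> (real^2 \<Rightarrow> real \<Rightarrow> real) \<Rightarrow> bool" where
  "cstrip T F \<longleftrightarrow> continuous_on (UNIV \<times> {0..T}) (\<lambda>(x, \<tau>). F x \<tau>)"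

lemma cstrip_slice: "cstrip T F \<Longrightarrow> \<tau> \<in> {0..T} \<Longrightarrow> continuous_on S (\<lambda>x. F x \<tau>)"
  unfolding cstrip_def
  by (rule continuous_on_compose2[where f="\<lambda>x. (x, \<tau>)" and g="\<lambda>(x, \<tau>). F x \<tau>", unfolded split_beta fst_conv snd_conv])
    (auto intro!: continuous_intros simp: split_beta)

lemma cstrip_compose:
  assumes "cstrip T F" "continuous_on S X" "continuous_on S \<tau>" "\<tau> ` S \<subseteq> {0..T}"
  shows "continuous_on S (\<lambda>z. F (X z) (\<tau> z))"
  by (rule continuous_on_compose2[OF assms(1)[unfolded cstrip_def], where f="\<lambda>z. (X z, \<tau> z)", unfolded split_beta fst_conv snd_conv])
    (use assms in \<open>auto intro!: continuous_intros\<close>)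

lemma cstrip_mono: "cstrip T F \<Longrightarrow> T' \<le> T \<Longrightarrow> cstrip T' F"
  unfolding cstrip_def by (erule continuous_on_subset) auto

lemma cstrip_const: "cstrip T (\<lambda>x t. c)"
  and cstrip_add: "cstrip T F \<Longrightarrow> cstrip T G \<Longrightarrow> cstrip T (\<lambda>x t. F x t + G x t)"
  and cstrip_diff: "cstrip T F \<Longrightarrow> cstrip T G \<Longrightarrow> cstrip T (\<lambda>x t. F x t - G x t)"
  and cstrip_mult: "cstrip T F \<Longrightarrow> cstrip T G \<Longrightarrow> cstrip T (\<lambda>x t. F x t * G x t)"
  and cstrip_minus: "cstrip T F \<Longrightarrow> cstrip T (\<lambda>x t. - F x t)"
  and cstrip_sum: "(\<And>i. cstrip T (H i)) \<Longrightarrow> cstrip T (\<lambda>x t. \<Sum>i\<in>(UNIV::2 set). H i x t)"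
  and cstrip_abs: "cstrip T F \<Longrightarrow> cstrip T (\<lambda>x t. \<bar>F x t\<bar>)"
  and cstrip_time: "continuous_on {0..T} g \<Longrightarrow> cstrip T (\<lambda>x t. g t)"
  unfolding cstrip_def split_beta sum_2
  by (auto intro!: continuous_intros)
    (rule continuous_on_compose2, assumption, auto intro!: continuous_intros)

lemmas cstrip_intros = cstrip_const cstrip_add cstrip_diff cstrip_mult cstrip_minus cstrip_sum cstrip_abs cstrip_time

section \<open>Volterra integrals: continuity and differentiation in time\<close>

lemma integral_rescale:
  fixes f :: "real \<Rightarrow> real"
  assumes "0 \<le> t" "continuous_on {0..t} f"
  shows "integral {0..t} f = t * integral {0..1} (\<lambda>\<sigma>. f (t * \<sigma>))"
proof (cases "t = 0")
  case False
  then have t: "t > 0" using assms by simp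
  have "(f has_integral integral {0..t} f) {0..t}"
    using integrable_continuous_real[OF assms(2)] by (simp add: has_integral_integral)
  from has_integral_stretch_real[OF this False]
  have "((\<lambda>x. f (t * x)) has_integral (1 / t) * integral {0..t} f) ((\<lambda>x. x / t) ` {0..t})"
    using t by simp
  moreover have "(\<lambda>x. x / t) ` {0..t} = {0..1}"
    using t by (auto simp: image_iff field_simps intro!: bexI[of _ "_ * t"])
  ultimately have "((\<lambda>x. f (t * x)) has_integral (1 / t) * integral {0..t} f) {0..1}" by simp
  then show ?thesis using t by (simp add: integral_unique)
qed simp

text \<open>The substitution \<tau> = t \<sigma> turns the moving interval into [0, 1], and a
  parameter integral over a fixed compact interval is continuous.\<close>

lemma continuous_on_volterra:
  fixes G :: "'a::t2_space \<Rightarrow> real \<Rightarrow> real \<Rightarrow> real"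
  assumes G: "continuous_on (U \<times> UNIV \<times> {0..T}) (\<lambda>(z, \<theta>, \<tau>). G z \<theta> \<tau>)"
  shows "continuous_on (U \<times> {0..T}) (\<lambda>(z, t). integral {0..t} (\<lambda>\<tau>. G z (t - \<tau>) \<tau>))"
proof -
  note G' = continuous_on_compose2[OF G, unfolded split_beta]
  have *: "integral {0..t} (\<lambda>\<tau>. G z (t - \<tau>) \<tau>) = t * integral (cbox 0 1) (\<lambda>\<sigma>. G z (t - t * \<sigma>) (t * \<sigma>))"
    if "z \<in> U" "t \<in> {0..T}" for z t
    unfolding box_real using that
    by (intro integral_rescale[where f="\<lambda>\<tau>. G z (t - \<tau>) \<tau>"])
      (auto intro!: continuous_intros continuous_on_compose2[OF G, where f="\<lambda>\<tau>. (z, t - \<tau>, \<tau>)", unfolded split_beta fst_conv snd_conv])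
  have ts: "t * \<sigma> \<in> {0..T}" if "t \<in> {0..T}" "\<sigma> \<in> {0..1}" for t \<sigma> :: real
  proof -
    have "t * \<sigma> \<le> T * 1" using that by (intro mult_mono) auto
    then show ?thesis using that by auto
  qed
  have "continuous_on (U \<times> {0..T}) (\<lambda>w. snd w * integral (cbox 0 1) (\<lambda>\<sigma>. G (fst w) (snd w - snd w * \<sigma>) (snd w * \<sigma>)))"
  proof (intro continuous_intros integral_continuous_on_param)
    show "continuous_on ((U \<times> {0..T}) \<times> cbox 0 1) (\<lambda>(w, \<sigma>). G (fst w) (snd w - snd w * \<sigma>) (snd w * \<sigma>))"
      unfolding split_beta
      by (rule continuous_on_compose2[OF G, where f="\<lambda>w. (fst (fst w), snd (fst w) - snd (fst w) * snd w, snd (fst w) * snd w)", unfolded split_beta fst_conv snd_conv])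
        (use ts in \<open>auto intro!: continuous_intros\<close>)
  qed
  then show ?thesis
    by (rule continuous_on_eq) (auto simp: *)
qed

text \<open>The t in the integrand and the t in the upper limit are separated into x and y, the
  resulting function of two variables is differentiated, and the diagonal is inserted. Off the
  diagonal x - \<tau> may be negative, hence the hypotheses for all real \<theta>.\<close>

lemma volterra_deriv_t:
  fixes G :: "real \<Rightarrow> real \<Rightarrow> real"
  assumes d: "\<And>\<theta> \<tau>. \<tau> \<in> {0..T} \<Longrightarrow> ((\<lambda>\<theta>. G \<theta> \<tau>) has_real_derivative G' \<theta> \<tau>) (at \<theta>)"
    and c: "continuous_on (UNIV \<times> {0..T}) (\<lambda>(\<theta>, \<tau>). G \<theta> \<tau>)"
    and c': "continuous_on (UNIV \<times> {0..T}) (\<lambda>(\<theta>, \<tau>). G' \<theta> \<tau>)"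
    and t: "t \<in> {0..T}"
  shows "((\<lambda>t. integral {0..t} (\<lambda>\<tau>. G (t - \<tau>) \<tau>)) has_real_derivative G 0 t + integral {0..t} (\<lambda>\<tau>. G' (t - \<tau>) \<tau>)) (at t within {0..T})"
proof -
  note cc = continuous_on_compose2[OF c, where f="\<lambda>z. (f z, g z)" for f g, unfolded split_beta fst_conv snd_conv]
  note cc' = continuous_on_compose2[OF c', where f="\<lambda>z. (f z, g z)" for f g, unfolded split_beta fst_conv snd_conv]
  have 1: "((\<lambda>(x, y). integral {0..y} (\<lambda>\<tau>. G (x - \<tau>) \<tau>)) has_derivative
      (\<lambda>(tx, ty). tx * integral {0..t} (\<lambda>\<tau>. G' (t - \<tau>) \<tau>) + ty * G (t - t) t)) (at (t, t) within {0..T} \<times> {0..T})"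
  proof (rule partials_real2[where fy="\<lambda>x y. G (x - y) y"])
    have "((\<lambda>x. integral (cbox 0 t) (\<lambda>\<tau>. G (x - \<tau>) \<tau>)) has_real_derivative integral (cbox 0 t) (\<lambda>\<tau>. G' (t - \<tau>) \<tau>)) (at t within {0..T})"
    proof (rule leibniz_rule_field_derivative)
      show "((\<lambda>x. G (x - \<tau>) \<tau>) has_real_derivative G' (x - \<tau>) \<tau>) (at x within {0..T})"
        if "\<tau> \<in> cbox 0 t" for x \<tau>
      proof -
        have "\<tau> \<in> {0..T}" using that t by auto
        have "((\<lambda>x. x - \<tau>) has_real_derivative 1) (at x within {0..T})"
          by (auto intro!: derivative_eq_intros)
        from DERIV_chain2[where f="\<lambda>\<theta>. G \<theta> \<tau>", OF d[OF \<open>\<tau> \<in> {0..T}\<close>] this]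
        show ?thesis by simp
      qed
      show "(\<lambda>\<tau>. G (x - \<tau>) \<tau>) integrable_on cbox 0 t" for x
        by (intro integrable_continuous cc) (use t in \<open>auto intro!: continuous_intros\<close>)
      show "continuous_on ({0..T} \<times> cbox 0 t) (\<lambda>(x, \<tau>). G' (x - \<tau>) \<tau>)"
        unfolding split_beta by (intro cc') (use t in \<open>auto intro!: continuous_intros\<close>)
    qed (use t in auto)
    then show "((\<lambda>x. integral {0..t} (\<lambda>\<tau>. G (x - \<tau>) \<tau>)) has_real_derivative integral {0..t} (\<lambda>\<tau>. G' (t - \<tau>) \<tau>)) (at t within {0..T})"
      by simp
    show "((\<lambda>y. integral {0..y} (\<lambda>\<tau>. G (x - \<tau>) \<tau>)) has_real_derivative G (x - y) y) (at y within {0..T})" if "y \<in> {0..T}" for x y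
      by (rule integral_has_real_derivative[OF _ that]) (intro cc; use t in \<open>auto intro!: continuous_intros\<close>)
    show "continuous_on ({0..T} \<times> {0..T}) (\<lambda>(x, y). G (x - y) y)"
      unfolding split_beta by (intro cc) (auto intro!: continuous_intros)
  qed (use t in auto)
  have 2: "((\<lambda>t. (t, t)) has_derivative (\<lambda>h. (h, h))) (at t within {0..T})"
    by (auto intro!: derivative_eq_intros)
  have "((\<lambda>t. (\<lambda>(x, y). integral {0..y} (\<lambda>\<tau>. G (x - \<tau>) \<tau>)) (t, t)) has_derivative
    (\<lambda>h. (\<lambda>(tx, ty). tx * integral {0..t} (\<lambda>\<tau>. G' (t - \<tau>) \<tau>) + ty * G (t - t) t) (h, h))) (at t within {0..T})"
    by (rule has_derivative_in_compose[OF 2]) (rule has_derivative_subset[OF 1], auto)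
  moreover have "(\<lambda>h. h * a + h * b) = (*) (b + a)" for a b :: real
    by (auto simp: algebra_simps)
  ultimately show ?thesis by (simp add: has_field_derivative_def)
qed

text \<open>The Duhamel term with zero initial data. The weight (1 + \<tau>)^(1 - p) of the operator
  \<open>L\<close> is treated as a factor of \<open>F\<close>, see \<open>L_eq_calL\<close>.\<close>

definition calL :: "(real^2 \<Rightarrow> real \<Rightarrow> real) \<Rightarrow> real^2 \<Rightarrow> real \<Rightarrow> real" where
  "calL F x t = integral {0..t} (\<lambda>\<tau>. Rm (\<lambda>y. F y \<tau>) x (t - \<tau>))"

text \<open>The time derivative of \<open>calL F\<close>; there is no boundary term because
  \<open>Rm\<close> vanishes at \<theta> = 0.\<close>

definition calLd :: "(real^2 \<Rightarrow> real \<Rightarrow> real) \<Rightarrow> (2 \<Rightarrow> real^2 \<Rightarrow> real \<Rightarrow> real) \<Rightarrow> real^2 \<Rightarrow> real \<Rightarrow> real" where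
  "calLd F D x t = integral {0..t} (\<lambda>\<tau>. Rd (\<lambda>y. F y \<tau>) (\<lambda>i y. D i y \<tau>) x (t - \<tau>))"

lemma cstrip_Rm:
  fixes S :: "'a::t2_space set"
  assumes "cstrip T F" "continuous_on S X" "continuous_on S \<Theta>" "continuous_on S \<tau>" "\<tau> ` S \<subseteq> {0..T}"
  shows "continuous_on S (\<lambda>z. Rm (\<lambda>x. F x (\<tau> z)) (X z) (\<Theta> z))"
  using assms continuous_on_Rm unfolding cstrip_def by blast

lemma cstrip_Rd:
  fixes S :: "'a::t2_space set"
  assumes "cstrip T F" "\<And>i. cstrip T (D i)" "continuous_on S X" "continuous_on S \<Theta>" "continuous_on S \<tau>" "\<tau> ` S \<subseteq> {0..T}"
  shows "continuous_on S (\<lambda>z. Rd (\<lambda>x. F x (\<tau> z)) (\<lambda>i x. D i x (\<tau> z)) (X z) (\<Theta> z))"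
  using assms(1,2) unfolding cstrip_def by (rule continuous_on_Rd) fact+

lemma cstrip_calL:
  assumes "cstrip T F" shows "cstrip T (calL F)"
  unfolding calL_def cstrip_def
  by (rule continuous_on_volterra, unfold split_beta, rule cstrip_Rm[OF assms]) (auto intro!: continuous_intros)

lemma cstrip_calLd:
  assumes "cstrip T F" "\<And>i. cstrip T (D i)" shows "cstrip T (calLd F D)"
  unfolding calLd_def cstrip_def
  by (rule continuous_on_volterra, unfold split_beta, rule cstrip_Rd[OF assms]) (auto intro!: continuous_intros)

lemma has_grad_integral:
  assumes g: "\<And>\<tau>. \<tau> \<in> {0..t} \<Longrightarrow> has_grad (\<lambda>x. H x \<tau>) (\<lambda>i x. K i x \<tau>)"
    and H: "cstrip t H" and K: "\<And>i. cstrip t (K i)"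
  shows "has_grad (\<lambda>x. integral {0..t} (H x)) (\<lambda>i x. integral {0..t} (K i x))"
proof (rule has_gradI)
  show "((\<lambda>s. integral {0..t} (H (x + s *\<^sub>R axis i 1))) has_real_derivative integral {0..t} (K i x)) (at 0)" for x i
  proof -
    have "((\<lambda>s. integral (cbox 0 t) (H (x + s *\<^sub>R axis i 1))) has_real_derivative integral (cbox 0 t) (K i (x + 0 *\<^sub>R axis i 1))) (at 0 within UNIV)"
    proof (rule leibniz_rule_field_derivative)
      show "((\<lambda>s. H (x + s *\<^sub>R axis i 1) \<tau>) has_real_derivative K i (x + s *\<^sub>R axis i 1) \<tau>) (at s within UNIV)" if "\<tau> \<in> cbox 0 t" for s \<tau>
        by (rule has_grad_line[OF g]) (use that in auto)
      show "H (x + s *\<^sub>R axis i 1) integrable_on cbox 0 t" for s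
        by (intro integrable_continuous cstrip_compose[OF H]) (auto intro!: continuous_intros)
      show "continuous_on (UNIV \<times> cbox 0 t) (\<lambda>(s, \<tau>). K i (x + s *\<^sub>R axis i 1) \<tau>)"
        unfolding split_beta by (rule cstrip_compose[OF K]) (auto intro!: continuous_intros)
    qed auto
    then show ?thesis by simp
  qed
  show "continuous_on UNIV (\<lambda>x. integral {0..t} (K i x))" for i
    unfolding box_real[symmetric]
    by (rule integral_continuous_on_param, unfold split_beta, rule cstrip_compose[OF K]) (auto intro!: continuous_intros)
qed

context
  fixes T :: real and F :: "real^2 \<Rightarrow> real \<Rightarrow> real" and D :: "2 \<Rightarrow> real^2 \<Rightarrow> real \<Rightarrow> real"
  assumes F: "cstrip T F" and D: "\<And>i. cstrip T (D i)"
    and g: "\<And>\<tau>. \<tau> \<in> {0..T} \<Longrightarrow> has_grad (\<lambda>x. F x \<tau>) (\<lambda>i x. D i x \<tau>)"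
begin

lemma calL_has_grad:
  assumes t: "t \<in> {0..T}"
  shows "has_grad (\<lambda>x. calL F x t) (\<lambda>i x. calL (D i) x t)"
  unfolding calL_def
proof (rule has_grad_integral)
  show "has_grad (\<lambda>x. Rm (\<lambda>y. F y \<tau>) x (t - \<tau>)) (\<lambda>i x. Rm (\<lambda>y. D i y \<tau>) x (t - \<tau>))" if "\<tau> \<in> {0..t}" for \<tau>
    by (rule Rm_has_grad[OF g]) (use that t in \<open>auto intro!: cstrip_slice[OF D]\<close>)
  show "cstrip t (\<lambda>x \<tau>. Rm (\<lambda>y. F y \<tau>) x (t - \<tau>))"
    "cstrip t (\<lambda>x \<tau>. Rm (\<lambda>y. D i y \<tau>) x (t - \<tau>))" for i
    unfolding cstrip_def split_beta using t
    by (auto intro!: cstrip_Rm[OF F] cstrip_Rm[OF D] continuous_intros)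
qed

lemma calL_deriv_t:
  assumes t: "t \<in> {0..T}"
  shows "((\<lambda>t. calL F x t) has_real_derivative calLd F D x t) (at t within {0..T})"
proof -
  have "((\<lambda>t. integral {0..t} (\<lambda>\<tau>. Rm (\<lambda>y. F y \<tau>) x (t - \<tau>))) has_real_derivative
     Rm (\<lambda>y. F y t) x 0 + integral {0..t} (\<lambda>\<tau>. Rd (\<lambda>y. F y \<tau>) (\<lambda>i y. D i y \<tau>) x (t - \<tau>))) (at t within {0..T})"
  proof (rule volterra_deriv_t[OF _ _ _ t])
    show "((\<lambda>\<theta>. Rm (\<lambda>y. F y \<tau>) x \<theta>) has_real_derivative Rd (\<lambda>y. F y \<tau>) (\<lambda>i y. D i y \<tau>) x \<theta>) (at \<theta>)" if "\<tau> \<in> {0..T}" for \<theta> \<tau>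
      by (rule Rm_deriv_t[OF g[OF that]]) (rule cstrip_slice[OF D that])
    show "continuous_on (UNIV \<times> {0..T}) (\<lambda>(\<theta>, \<tau>). Rm (\<lambda>y. F y \<tau>) x \<theta>)"
      "continuous_on (UNIV \<times> {0..T}) (\<lambda>(\<theta>, \<tau>). Rd (\<lambda>y. F y \<tau>) (\<lambda>i y. D i y \<tau>) x \<theta>)"
      unfolding split_beta by (rule cstrip_Rm[OF F] cstrip_Rd[OF F D]; auto intro!: continuous_intros)+
  qed
  then show ?thesis by (simp add: calL_def calLd_def)
qed

context
  fixes E :: "2 \<Rightarrow> 2 \<Rightarrow> real^2 \<Rightarrow> real \<Rightarrow> real"
  assumes E: "\<And>i j. cstrip T (E i j)"
    and gg: "\<And>\<tau> i. \<tau> \<in> {0..T} \<Longrightarrow> has_grad (\<lambda>x. D i x \<tau>) (\<lambda>j x. E i j x \<tau>)"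
begin

lemma calLd_has_grad:
  assumes t: "t \<in> {0..T}"
  shows "has_grad (\<lambda>x. calLd F D x t) (\<lambda>i x. calLd (D i) (E i) x t)"
  unfolding calLd_def
proof (rule has_grad_integral)
  show "has_grad (\<lambda>x. Rd (\<lambda>y. F y \<tau>) (\<lambda>i y. D i y \<tau>) x (t - \<tau>)) (\<lambda>i x. Rd (\<lambda>y. D i y \<tau>) (\<lambda>j y. E i j y \<tau>) x (t - \<tau>))" if "\<tau> \<in> {0..t}" for \<tau>
    by (rule Rd_has_grad[OF g gg]) (use that t in \<open>auto intro!: cstrip_slice[OF E]\<close>)
  show "cstrip t (\<lambda>x \<tau>. Rd (\<lambda>y. F y \<tau>) (\<lambda>i y. D i y \<tau>) x (t - \<tau>))"
    "cstrip t (\<lambda>x \<tau>. Rd (\<lambda>y. D i y \<tau>) (\<lambda>j y. E i j y \<tau>) x (t - \<tau>))" for i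
    unfolding cstrip_def split_beta using t
    by (auto intro!: cstrip_Rd[OF F D] cstrip_Rd[OF D E] continuous_intros)
qed

text \<open>The boundary term of the Volterra integral is \<open>Rd\<close> at \<theta> = 0, that
  is, F itself. Together with \<open>calL_has_grad\<close> this is the inhomogeneous wave
  equation.\<close>

lemma calLd_deriv_t:
  assumes t: "t \<in> {0..T}"
  shows "((\<lambda>t. calLd F D x t) has_real_derivative F x t + calL (\<lambda>x \<tau>. \<Sum>i\<in>UNIV. E i i x \<tau>) x t) (at t within {0..T})"
proof -
  have "((\<lambda>t. integral {0..t} (\<lambda>\<tau>. Rd (\<lambda>y. F y \<tau>) (\<lambda>i y. D i y \<tau>) x (t - \<tau>))) has_real_derivative
     Rd (\<lambda>y. F y t) (\<lambda>i y. D i y t) x 0 + integral {0..t} (\<lambda>\<tau>. Rm (\<lambda>y. \<Sum>i\<in>UNIV. E i i y \<tau>) x (t - \<tau>))) (at t within {0..T})"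
  proof (rule volterra_deriv_t[OF _ _ _ t])
    show "((\<lambda>\<theta>. Rd (\<lambda>y. F y \<tau>) (\<lambda>i y. D i y \<tau>) x \<theta>) has_real_derivative Rm (\<lambda>y. \<Sum>i\<in>UNIV. E i i y \<tau>) x \<theta>) (at \<theta>)" if "\<tau> \<in> {0..T}" for \<theta> \<tau>
      by (rule Rd_deriv_t[OF g[OF that] gg[OF that]]) (rule cstrip_slice[OF E that])
    show "continuous_on (UNIV \<times> {0..T}) (\<lambda>(\<theta>, \<tau>). Rm (\<lambda>y. \<Sum>i\<in>UNIV. E i i y \<tau>) x \<theta>)"
      "continuous_on (UNIV \<times> {0..T}) (\<lambda>(\<theta>, \<tau>). Rd (\<lambda>y. F y \<tau>) (\<lambda>i y. D i y \<tau>) x \<theta>)"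
      unfolding split_beta by (rule cstrip_Rm[OF cstrip_sum[OF E]] cstrip_Rd[OF F D]; auto intro!: continuous_intros)+
  qed
  then show ?thesis by (simp add: calL_def calLd_def)
qed

end

end

text \<open>This is where the positivity of the two-dimensional fundamental solution enters. The
  functions are compared only on the backward cone of (x, t), which expresses the finite speed of
  propagation.\<close>

lemma calL_mono:
  assumes "cstrip T F" "cstrip T K" "t \<in> {0..T}"
    and "\<And>y \<tau>. 0 \<le> \<tau> \<Longrightarrow> \<tau> \<le> t \<Longrightarrow> dist x y \<le> t - \<tau> \<Longrightarrow> F y \<tau> \<le> K y \<tau>"
  shows "calL F x t \<le> calL K x t"
  unfolding calL_def
proof (rule integral_le)
  show "(\<lambda>\<tau>. Rm (\<lambda>y. F y \<tau>) x (t - \<tau>)) integrable_on {0..t}"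
    "(\<lambda>\<tau>. Rm (\<lambda>y. K y \<tau>) x (t - \<tau>)) integrable_on {0..t}"
    using assms(3) by (auto intro!: integrable_continuous_real cstrip_Rm[OF assms(1)] cstrip_Rm[OF assms(2)] continuous_intros)
  show "Rm (\<lambda>y. F y \<tau>) x (t - \<tau>) \<le> Rm (\<lambda>y. K y \<tau>) x (t - \<tau>)" if "\<tau> \<in> {0..t}" for \<tau>
    using that assms by (intro Rm_mono cstrip_slice[OF assms(1)] cstrip_slice[OF assms(2)]) auto
qed

lemma calL_cmult: "calL (\<lambda>x t. c * F x t) x t = c * calL F x t"
  by (simp add: calL_def Rm_cmult)

lemma calL_add:
  assumes "cstrip T F" "cstrip T K" "t \<in> {0..T}"
  shows "calL (\<lambda>x t. F x t + K x t) x t = calL F x t + calL K x t"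
proof -
  have "(\<lambda>\<tau>. Rm (\<lambda>y. F y \<tau>) x (t - \<tau>)) integrable_on {0..t}"
    "(\<lambda>\<tau>. Rm (\<lambda>y. K y \<tau>) x (t - \<tau>)) integrable_on {0..t}"
    using assms(3) by (auto intro!: integrable_continuous_real cstrip_Rm[OF assms(1)] cstrip_Rm[OF assms(2)] continuous_intros)
  then have "calL F x t + calL K x t = integral {0..t} (\<lambda>\<tau>. Rm (\<lambda>y. F y \<tau>) x (t - \<tau>) + Rm (\<lambda>y. K y \<tau>) x (t - \<tau>))"
    by (simp add: calL_def integral_add)
  also have "\<dots> = calL (\<lambda>x t. F x t + K x t) x t"
    unfolding calL_def using assms
    by (intro integral_cong Rm_add[symmetric] cstrip_slice[OF assms(1)] cstrip_slice[OF assms(2)]) auto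
  finally show ?thesis ..
qed

lemma calL_diff:
  assumes "cstrip T F" "cstrip T K" "t \<in> {0..T}"
  shows "calL (\<lambda>x t. F x t - K x t) x t = calL F x t - calL K x t"
  using calL_add[OF assms(1) cstrip_minus[OF assms(2)] assms(3), of x] calL_cmult[of "-1" K x t] by simp

lemma calL_cong:
  assumes "\<And>y \<tau>. 0 \<le> \<tau> \<Longrightarrow> \<tau> \<le> t \<Longrightarrow> dist x y \<le> t - \<tau> \<Longrightarrow> F y \<tau> = K y \<tau>"
  shows "calL F x t = calL K x t"
  unfolding calL_def by (intro integral_cong Rm_cong assms) auto

lemma calL_abs:
  assumes "cstrip T F" "cstrip T K" "t \<in> {0..T}"
    and "\<And>y \<tau>. 0 \<le> \<tau> \<Longrightarrow> \<tau> \<le> t \<Longrightarrow> dist x y \<le> t - \<tau> \<Longrightarrow> \<bar>F y \<tau>\<bar> \<le> K y \<tau>"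
  shows "\<bar>calL F x t\<bar> \<le> calL K x t"
proof -
  have "calL F x t \<le> calL K x t" "calL (\<lambda>x t. -1 * F x t) x t \<le> calL K x t"
    using assms by (auto intro!: calL_mono[where T=T] cstrip_intros simp: abs_le_iff)
  then show ?thesis unfolding calL_cmult by (simp add: abs_le_iff)
qed

text \<open>In the norm weighted by exp(-\<kappa> t) the Duhamel operator has norm at most
  1/\<kappa>^2. Large \<kappa> therefore makes it a contraction.\<close>

lemma calL_exp_le:
  assumes "0 < \<kappa>" "0 \<le> t"
  shows "calL (\<lambda>_ \<tau>. exp (\<kappa> * \<tau>)) x t \<le> exp (\<kappa> * t) / \<kappa>\<^sup>2"
proof -
  have "((\<lambda>\<tau>. (t - \<tau>) * exp (\<kappa> * \<tau>)) has_integral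
     ((t - t) * exp (\<kappa> * t) / \<kappa> + exp (\<kappa> * t) / \<kappa>\<^sup>2) - ((t - 0) * exp (\<kappa> * 0) / \<kappa> + exp (\<kappa> * 0) / \<kappa>\<^sup>2)) {0..t}"
    using assms
    by (intro fundamental_theorem_of_calculus)
      (auto simp flip: has_real_derivative_iff_has_vector_derivative simp: field_simps power2_eq_square intro!: derivative_eq_intros)
  then have "calL (\<lambda>_ \<tau>. exp (\<kappa> * \<tau>)) x t = exp (\<kappa> * t) / \<kappa>\<^sup>2 - t / \<kappa> - 1 / \<kappa>\<^sup>2"
    by (simp add: calL_def Rm_const integral_unique)
  also have "\<dots> \<le> exp (\<kappa> * t) / \<kappa>\<^sup>2"
  proof -
    have "0 \<le> t / \<kappa>" "0 \<le> 1 / \<kappa>\<^sup>2" using assms by simp_all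
    then show ?thesis by linarith
  qed
  finally show ?thesis .
qed

text \<open>The mixed derivative of the time-dependent mean is obtained by interchanging derivatives of
  the mean, so the mixed partial derivatives of v themselves need not be compared.\<close>

lemma duhamel:
  assumes v: "cstrip T v" and vx: "\<And>i. cstrip T (vx i)" and vxx: "\<And>i j. cstrip T (vxx i j)"
    and vt: "cstrip T vt" and vtx: "\<And>i. cstrip T (vtx i)" and vtt: "cstrip T vtt"
    and g: "\<And>\<tau>. \<tau> \<in> {0..T} \<Longrightarrow> has_grad (\<lambda>x. v x \<tau>) (\<lambda>i x. vx i x \<tau>)"
    and gg: "\<And>\<tau> i. \<tau> \<in> {0..T} \<Longrightarrow> has_grad (\<lambda>x. vx i x \<tau>) (\<lambda>j x. vxx i j x \<tau>)"
    and gt: "\<And>\<tau>. \<tau> \<in> {0..T} \<Longrightarrow> has_grad (\<lambda>x. vt x \<tau>) (\<lambda>i x. vtx i x \<tau>)"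
    and dt: "\<And>x \<tau>. \<tau> \<in> {0..T} \<Longrightarrow> ((\<lambda>\<tau>. v x \<tau>) has_real_derivative vt x \<tau>) (at \<tau> within {0..T})"
    and dtt: "\<And>x \<tau>. \<tau> \<in> {0..T} \<Longrightarrow> ((\<lambda>\<tau>. vt x \<tau>) has_real_derivative vtt x \<tau>) (at \<tau> within {0..T})"
    and t: "t \<in> {0..T}"
  shows "v x t = Rd (\<lambda>y. v y 0) (\<lambda>i y. vx i y 0) x t + Rm (\<lambda>y. vt y 0) x t
    + calL (\<lambda>y \<tau>. vtt y \<tau> - (\<Sum>i\<in>UNIV. vxx i i y \<tau>)) x t"
proof -
  let ?I = "{0..T}"
  have Rs: "((\<lambda>s. Rm (\<lambda>y. w y s) x \<theta>) has_real_derivative Rm (\<lambda>y. w' y s) x \<theta>) (at s within ?I)"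
    if w: "cstrip T w" "cstrip T w'" and d: "\<And>x \<tau>. \<tau> \<in> ?I \<Longrightarrow> ((\<lambda>\<tau>. w x \<tau>) has_real_derivative w' x \<tau>) (at \<tau> within ?I)"
      and s: "s \<in> ?I" for w w' s \<theta>
    unfolding Rm_def
  proof (rule DERIV_cmult, rule avg_has_derivative)
    show "continuous_on (cball 0 1) (\<lambda>\<xi>. w (x + \<theta> *\<^sub>R \<xi>) s)" if "s \<in> ?I" for s
      using that by (intro cstrip_compose[OF w(1)]) (auto intro!: continuous_intros)
    show "continuous_on (?I \<times> cball 0 1) (\<lambda>(s, \<xi>). w' (x + \<theta> *\<^sub>R \<xi>) s)"
      unfolding split_beta by (intro cstrip_compose[OF w(2)]) (auto intro!: continuous_intros)
  qed (use s d in auto)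
  let ?lap = "\<lambda>y \<tau>. \<Sum>i\<in>UNIV. vxx i i y \<tau>"
  let ?c = "\<lambda>s \<theta>. Rd (\<lambda>y. vt y s) (\<lambda>i y. vtx i y s) x \<theta>"
  have cc: "continuous_on (?I \<times> UNIV) (\<lambda>(s, \<theta>). ?c s \<theta>)"
    unfolding split_beta by (intro cstrip_Rd[OF vt vtx]) (auto intro!: continuous_intros)
  have dc: "((\<lambda>\<theta>. Rm (\<lambda>y. vt y s) x \<theta>) has_real_derivative ?c s \<theta>) (at \<theta> within S)" if "s \<in> ?I" for s \<theta> S
    by (rule Rm_deriv_t[OF gt[OF that]]) (rule cstrip_slice[OF vtx that])
  have mixed: "((\<lambda>s. Rd (\<lambda>y. v y s) (\<lambda>i y. vx i y s) x \<theta>) has_real_derivative ?c s \<theta>) (at s within ?I)"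
    if "s \<in> ?I" for s \<theta>
  proof (rule mixed_partial_interchange[where f="\<lambda>s. Rm (\<lambda>y. v y s) x" and a="\<lambda>s. Rd (\<lambda>y. v y s) (\<lambda>i y. vx i y s) x"
      and b="\<lambda>s. Rm (\<lambda>y. vt y s) x" and c="?c", OF _ _ _ _ cc that])
    show "((\<lambda>\<theta>. Rm (\<lambda>y. v y s) x \<theta>) has_real_derivative Rd (\<lambda>y. v y s) (\<lambda>i y. vx i y s) x \<theta>) (at \<theta>)" if "s \<in> ?I" for s \<theta>
      by (rule Rm_deriv_t[OF g[OF that]]) (rule cstrip_slice[OF vx that])
    show "((\<lambda>s. Rm (\<lambda>y. v y s) x \<theta>) has_real_derivative Rm (\<lambda>y. vt y s) x \<theta>) (at s within ?I)" if "s \<in> ?I" for s \<theta>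
      by (rule Rs[OF v vt dt that])
    show "((\<lambda>\<theta>. Rm (\<lambda>y. vt y s) x \<theta>) has_real_derivative ?c s \<theta>) (at \<theta>)" if "s \<in> ?I" for s \<theta>
      by (rule dc[OF that])
    show "continuous_on ?I (\<lambda>s. Rm (\<lambda>y. vt y s) x \<theta>)" for \<theta>
      by (intro cstrip_Rm[OF vt]) (auto intro!: continuous_intros)
  qed
  have line: "((\<lambda>s. H s (t - s)) has_real_derivative a s (t - s) - b s (t - s)) (at s within {0..t})"
    if a: "\<And>s \<theta>. s \<in> ?I \<Longrightarrow> ((\<lambda>s. H s \<theta>) has_real_derivative a s \<theta>) (at s within ?I)"
      and b: "\<And>s \<theta>. s \<in> ?I \<Longrightarrow> ((\<lambda>\<theta>. H s \<theta>) has_real_derivative b s \<theta>) (at \<theta>)"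
      and c: "continuous_on (?I \<times> UNIV) (\<lambda>(s, \<theta>). b s \<theta>)" and s: "s \<in> {0..t}" for H a b s
  proof -
    have sI: "s \<in> ?I" using s t by auto
    have 1: "((\<lambda>(s, \<theta>). H s \<theta>) has_derivative (\<lambda>(ts, t\<theta>). ts * a s (t - s) + t\<theta> * b s (t - s))) (at (s, t - s) within ?I \<times> UNIV)"
      by (rule partials_real2) (use a b c sI in auto)
    have 2: "((\<lambda>s. (s, t - s)) has_derivative (\<lambda>h. (h, - h))) (at s within {0..t})"
      by (auto intro!: derivative_eq_intros)
    have "((\<lambda>s. (\<lambda>(s, \<theta>). H s \<theta>) (s, t - s)) has_derivative (\<lambda>h. (\<lambda>(ts, t\<theta>). ts * a s (t - s) + t\<theta> * b s (t - s)) (h, - h))) (at s within {0..t})"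
      by (rule has_derivative_in_compose[OF 2]) (rule has_derivative_subset[OF 1], use t in auto)
    moreover have "(\<lambda>h. h * \<alpha> - h * \<beta>) = (*) (\<alpha> - \<beta>)" for \<alpha> \<beta> :: real
      by (auto simp: algebra_simps)
    ultimately show ?thesis by (simp add: has_field_derivative_def)
  qed
  \<comment> \<open>\<open>J s\<close> is the value at (x, t) of the free solution that continues
    the state of v at time s. So \<open>J t\<close> is v(x, t), \<open>J 0\<close> is the free
    solution with the data of v, and the derivative of \<open>J\<close> is the propagated wave
    operator of v.\<close>
  define J where "J s = Rd (\<lambda>y. v y s) (\<lambda>i y. vx i y s) x (t - s) + Rm (\<lambda>y. vt y s) x (t - s)" for s
  have "(J has_real_derivative (?c s (t - s) - Rm (\<lambda>y. ?lap y s) x (t - s)) + (Rm (\<lambda>y. vtt y s) x (t - s) - ?c s (t - s))) (at s within {0..t})"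
    if s: "s \<in> {0..t}" for s
    unfolding J_def
  proof (rule DERIV_add)
    show "((\<lambda>s. Rd (\<lambda>y. v y s) (\<lambda>i y. vx i y s) x (t - s)) has_real_derivative ?c s (t - s) - Rm (\<lambda>y. ?lap y s) x (t - s)) (at s within {0..t})"
    proof (rule line[OF mixed _ _ s])
      show "((\<lambda>\<theta>. Rd (\<lambda>y. v y s) (\<lambda>i y. vx i y s) x \<theta>) has_real_derivative Rm (\<lambda>y. ?lap y s) x \<theta>) (at \<theta>)" if "s \<in> ?I" for s \<theta>
        by (rule Rd_deriv_t[OF g[OF that] gg[OF that]]) (rule cstrip_slice[OF vxx that])
      show "continuous_on (?I \<times> UNIV) (\<lambda>(s, \<theta>). Rm (\<lambda>y. ?lap y s) x \<theta>)"
        unfolding split_beta by (rule cstrip_Rm[OF cstrip_sum[OF vxx]]) (auto intro!: continuous_intros)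
    qed
    show "((\<lambda>s. Rm (\<lambda>y. vt y s) x (t - s)) has_real_derivative Rm (\<lambda>y. vtt y s) x (t - s) - ?c s (t - s)) (at s within {0..t})"
      by (rule line[OF Rs[OF vt vtt dtt] dc cc s])
  qed
  then have J: "(J has_real_derivative Rm (\<lambda>y. vtt y s - ?lap y s) x (t - s)) (at s within {0..t})" if "s \<in> {0..t}" for s
  proof -
    have sI: "s \<in> ?I" using that t by auto
    have "Rm (\<lambda>y. vtt y s + -1 * ?lap y s) x (t - s) = Rm (\<lambda>y. vtt y s) x (t - s) + Rm (\<lambda>y. -1 * ?lap y s) x (t - s)"
      by (rule Rm_add) (intro cstrip_slice[OF vtt sI] continuous_intros cstrip_slice[OF vxx sI])+
    then have "Rm (\<lambda>y. vtt y s - ?lap y s) x (t - s) = (?c s (t - s) - Rm (\<lambda>y. ?lap y s) x (t - s)) + (Rm (\<lambda>y. vtt y s) x (t - s) - ?c s (t - s))"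
      unfolding Rm_cmult by simp
    then show ?thesis using \<open>\<And>s. s \<in> {0..t} \<Longrightarrow> _\<close>[OF that] by simp
  qed
  have "((\<lambda>s. Rm (\<lambda>y. vtt y s - ?lap y s) x (t - s)) has_integral J t - J 0) {0..t}"
    using t by (intro fundamental_theorem_of_calculus) (auto simp flip: has_real_derivative_iff_has_vector_derivative intro!: J)
  then have "calL (\<lambda>y \<tau>. vtt y \<tau> - ?lap y \<tau>) x t = J t - J 0"
    by (simp add: calL_def integral_unique)
  then show ?thesis by (simp add: J_def)
qed

section \<open>Volterra equations\<close>

text \<open>On the compact backward cone the function |e| exp(-\<kappa> t) attains its maximum. At
  the maximal point the integral term is at most C/\<kappa>^2 times the maximum; with \<kappa>^2 =
  2C + 1 this is at most half of it and can be absorbed (the summand 1 keeps \<kappa> positive for C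
  = 0). Compactness of the cone replaces any control of e for large x.\<close>

lemma gronwall_cone:
  assumes e: "cstrip T e" and C: "0 \<le> C" and \<eta>: "0 \<le> \<eta>" and t0: "t0 \<in> {0..T}"
    and h: "\<And>x t. 0 \<le> t \<Longrightarrow> t \<le> t0 \<Longrightarrow> dist x0 x \<le> t0 - t \<Longrightarrow>
      \<bar>e x t\<bar> \<le> \<eta> + C * calL (\<lambda>x t. \<bar>e x t\<bar>) x t"
  shows "\<bar>e x0 t0\<bar> \<le> 2 * \<eta> * exp (sqrt (2 * C + 1) * t0)"
proof -
  define \<kappa> where "\<kappa> = sqrt (2 * C + 1)"
  have \<kappa>: "\<kappa> > 0" "\<kappa>\<^sup>2 = 2 * C + 1" using C by (simp_all add: \<kappa>_def)
  define \<Gamma> where "\<Gamma> = {z :: (real^2) \<times> real. 0 \<le> snd z \<and> snd z \<le> t0 \<and> dist x0 (fst z) \<le> t0 - snd z}"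
  define w where "w z = \<bar>e (fst z) (snd z)\<bar> * exp (- \<kappa> * snd z)" for z
  have "closed \<Gamma>"
    unfolding \<Gamma>_def
    by (intro closed_Collect_conj closed_Collect_le continuous_intros)
  moreover have "\<Gamma> \<subseteq> cball x0 t0 \<times> {0..t0}" by (auto simp: \<Gamma>_def)
  then have "bounded \<Gamma>"
    by (rule bounded_subset[rotated]) (intro bounded_Times bounded_cball bounded_closed_interval)
  ultimately have "compact \<Gamma>" by (simp add: compact_eq_bounded_closed)
  moreover have "(x0, t0) \<in> \<Gamma>" using t0 by (simp add: \<Gamma>_def)
  moreover have "continuous_on \<Gamma> w"
    unfolding w_def using t0
    by (intro continuous_intros cstrip_compose[OF e]) (auto simp: \<Gamma>_def)
  ultimately obtain z where z: "z \<in> \<Gamma>" "\<And>y. y \<in> \<Gamma> \<Longrightarrow> w y \<le> w z"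
    using continuous_attains_sup[of \<Gamma> w] by blast
  obtain x1 t1 where zx: "z = (x1, t1)" by (cases z)
  define M where "M = w z"
  have M0: "0 \<le> M" by (simp add: M_def w_def)
  have eM: "\<bar>e y \<tau>\<bar> \<le> M * exp (\<kappa> * \<tau>)" if "(y, \<tau>) \<in> \<Gamma>" for y \<tau>
  proof -
    have "w (y, \<tau>) * exp (\<kappa> * \<tau>) \<le> M * exp (\<kappa> * \<tau>)"
      using z(2)[OF that] by (simp add: M_def)
    moreover have "\<bar>e y \<tau>\<bar> = w (y, \<tau>) * exp (\<kappa> * \<tau>)"
      by (simp add: w_def mult.assoc flip: exp_add)
    ultimately show ?thesis by simp
  qed
  have t1: "0 \<le> t1" "t1 \<le> t0" "dist x0 x1 \<le> t0 - t1" using z(1) by (auto simp: \<Gamma>_def zx)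
  have "calL (\<lambda>x t. \<bar>e x t\<bar>) x1 t1 \<le> calL (\<lambda>_ \<tau>. M * exp (\<kappa> * \<tau>)) x1 t1"
  proof (rule calL_mono[where T=T])
    show "\<bar>e y \<tau>\<bar> \<le> M * exp (\<kappa> * \<tau>)" if "0 \<le> \<tau>" "\<tau> \<le> t1" "dist x1 y \<le> t1 - \<tau>" for y \<tau>
      using that t1 dist_triangle[of x0 y x1] by (intro eM) (auto simp: \<Gamma>_def)
  qed (use t0 t1 in \<open>auto intro!: cstrip_intros e continuous_intros\<close>)
  also have "\<dots> \<le> M * (exp (\<kappa> * t1) / \<kappa>\<^sup>2)"
    unfolding calL_cmult by (intro mult_left_mono calL_exp_le \<kappa> t1 M0)
  finally have "C * calL (\<lambda>x t. \<bar>e x t\<bar>) x1 t1 \<le> C * (M * (exp (\<kappa> * t1) / \<kappa>\<^sup>2))"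
    by (rule mult_left_mono[OF _ C])
  also have "\<dots> = (C / (2 * C + 1)) * (M * exp (\<kappa> * t1))" by (simp add: \<kappa>)
  also have "\<dots> \<le> (1 / 2) * (M * exp (\<kappa> * t1))"
    using C M0 by (intro mult_right_mono) (auto simp: field_simps)
  finally have "\<bar>e x1 t1\<bar> \<le> \<eta> + (1 / 2) * (M * exp (\<kappa> * t1))"
    using h[OF t1] by linarith
  moreover have "M * exp (\<kappa> * t1) = \<bar>e x1 t1\<bar>" by (simp add: M_def w_def zx exp_minus)
  ultimately have "M * exp (\<kappa> * t1) \<le> 2 * \<eta>" by linarith
  moreover have "M * 1 \<le> M * exp (\<kappa> * t1)" using \<kappa> t1 M0 by (intro mult_left_mono) auto
  ultimately have "M \<le> 2 * \<eta>" by linarith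
  then have "M * exp (\<kappa> * t0) \<le> 2 * \<eta> * exp (\<kappa> * t0)" by (intro mult_right_mono) auto
  with eM[OF \<open>(x0, t0) \<in> \<Gamma>\<close>] show ?thesis unfolding \<kappa>_def by linarith
qed

text \<open>The unknown of the fixed point equation is exp(-\<kappa> t) u in the space of bounded
  continuous functions. There the map has Lipschitz constant C/\<kappa>^2, which is at most 1/2 for
  \<kappa>^2 = 2C + 1.\<close>

lemma volterra_fixpoint:
  assumes A: "cstrip T A" and Ab: "\<And>x t. t \<in> {0..T} \<Longrightarrow> \<bar>A x t\<bar> \<le> a"
    and B: "\<And>u. cstrip T u \<Longrightarrow> cstrip T (\<lambda>x t. B x t (u x t))"
    and lip: "\<And>x t y z. t \<in> {0..T} \<Longrightarrow> \<bar>B x t y - B x t z\<bar> \<le> C * \<bar>y - z\<bar>"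
    and Bb: "\<And>x t. t \<in> {0..T} \<Longrightarrow> \<bar>B x t 0\<bar> \<le> b" and T: "0 \<le> T" and C: "0 \<le> C"
  obtains u M where "cstrip T u" "\<And>x t. t \<in> {0..T} \<Longrightarrow> \<bar>u x t\<bar> \<le> M"
    "\<And>x t. t \<in> {0..T} \<Longrightarrow> u x t = A x t + calL (\<lambda>x t. B x t (u x t)) x t"
proof -
  define \<kappa> where "\<kappa> = sqrt (2 * C + 1)"
  have \<kappa>: "\<kappa> > 0" "\<kappa>\<^sup>2 = 2 * C + 1" using C by (simp_all add: \<kappa>_def)
  \<comment> \<open>Elements of the Banach space are functions for all real times. Times are clamped
    to [0, T], so that the image is defined, continuous and bounded everywhere.\<close>
  define cl where "cl t = max 0 (min t T)" for t
  have cl: "cl t \<in> {0..T}" "t \<in> {0..T} \<Longrightarrow> cl t = t" for t using T by (auto simp: cl_def)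
  define ext where "ext w x t = exp (\<kappa> * t) * apply_bcontfun w (x, t)" for w :: "((real^2) \<times> real) \<Rightarrow>\<^sub>C real" and x t
  have cext: "cstrip T (ext w)" for w
    unfolding cstrip_def ext_def split_beta by (auto intro!: continuous_intros continuous_on_apply_bcontfun)
  define F where "F w z = exp (- \<kappa> * cl (snd z)) * (A (fst z) (cl (snd z)) + calL (\<lambda>x t. B x t (ext w x t)) (fst z) (cl (snd z)))" for w z
  have ccl: "continuous_on S (\<lambda>z. cl (snd z))" for S :: "((real^2) \<times> real) set"
    unfolding cl_def by (intro continuous_intros)
  have b0: "0 \<le> b" using Bb[of 0 0] T by force
  have Lb: "\<bar>calL G x t\<bar> \<le> K * (exp (\<kappa> * t) / \<kappa>\<^sup>2)"
    if G: "cstrip T G" "\<And>y \<tau>. \<tau> \<in> {0..T} \<Longrightarrow> \<bar>G y \<tau>\<bar> \<le> K * exp (\<kappa> * \<tau>)" and K: "0 \<le> K" and t: "t \<in> {0..T}" for G K x t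
  proof -
    have "\<bar>calL G x t\<bar> \<le> calL (\<lambda>_ \<tau>. K * exp (\<kappa> * \<tau>)) x t"
      using t by (intro calL_abs[OF G(1)] G(2) cstrip_intros continuous_intros) auto
    also have "\<dots> \<le> K * (exp (\<kappa> * t) / \<kappa>\<^sup>2)"
      unfolding calL_cmult using t by (intro mult_left_mono calL_exp_le \<kappa> K) auto
    finally show ?thesis .
  qed
  have Fb: "F w \<in> bcontfun" for w
  proof -
    have "continuous_on UNIV (F w)"
      unfolding F_def
      by (intro continuous_intros ccl cstrip_compose[OF A] cstrip_compose[OF cstrip_calL[OF B[OF cext]]])
        (use cl in auto)
    moreover have "\<bar>F w z\<bar> \<le> a + (b + C * norm w) * (1 / \<kappa>\<^sup>2)" for z
    proof -
      let ?t = "cl (snd z)" and ?K = "b + C * norm w"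
      have "\<bar>calL (\<lambda>x t. B x t (ext w x t)) (fst z) ?t\<bar> \<le> ?K * (exp (\<kappa> * ?t) / \<kappa>\<^sup>2)"
      proof (rule Lb[OF B[OF cext]])
        show "\<bar>B y \<tau> (ext w y \<tau>)\<bar> \<le> ?K * exp (\<kappa> * \<tau>)" if "\<tau> \<in> {0..T}" for y \<tau>
        proof -
          have "\<bar>B y \<tau> (ext w y \<tau>)\<bar> \<le> b + C * \<bar>ext w y \<tau>\<bar>"
            using lip[OF that, of y "ext w y \<tau>" 0] Bb[OF that, of y] by simp
          also have "\<dots> \<le> b * exp (\<kappa> * \<tau>) + C * (exp (\<kappa> * \<tau>) * norm w)"
          proof (rule add_mono)
            show "b \<le> b * exp (\<kappa> * \<tau>)" using b0 \<kappa> that by (simp add: mult_le_cancel_left1)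
            have "\<bar>apply_bcontfun w (y, \<tau>)\<bar> \<le> norm w" using norm_bounded[of w "(y, \<tau>)"] by simp
            then show "C * \<bar>ext w y \<tau>\<bar> \<le> C * (exp (\<kappa> * \<tau>) * norm w)"
              by (intro mult_left_mono C) (simp add: ext_def abs_mult)
          qed
          finally show ?thesis by (simp add: algebra_simps)
        qed
      qed (use cl b0 C in auto)
      then have "\<bar>A (fst z) ?t + calL (\<lambda>x t. B x t (ext w x t)) (fst z) ?t\<bar> \<le> a + ?K * (exp (\<kappa> * ?t) / \<kappa>\<^sup>2)"
        using Ab[OF cl(1)[of "snd z"], of "fst z"] by linarith
      then have "\<bar>F w z\<bar> \<le> exp (- \<kappa> * ?t) * (a + ?K * (exp (\<kappa> * ?t) / \<kappa>\<^sup>2))"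
        unfolding F_def abs_mult by (simp add: mult_left_mono)
      also have "\<dots> = exp (- \<kappa> * ?t) * a + ?K * (1 / \<kappa>\<^sup>2)"
        by (simp add: exp_minus field_simps)
      also have "\<dots> \<le> 1 * a + ?K * (1 / \<kappa>\<^sup>2)"
      proof (intro add_mono mult_right_mono order_refl)
        show "0 \<le> a" using Ab[of 0 0] T by force
        show "exp (- \<kappa> * ?t) \<le> 1" using \<kappa> cl(1)[of "snd z"] by simp
      qed auto
      finally show ?thesis by simp
    qed
    ultimately show ?thesis
      by (auto simp: bcontfun_def bounded_iff intro!: exI[of _ "a + (b + C * norm w) * (1 / \<kappa>\<^sup>2)"])
  qed
  define \<Phi> where "\<Phi> w = Bcontfun (F w)" for w
  have app: "apply_bcontfun (\<Phi> w) z = F w z" for w z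
    by (simp add: \<Phi>_def Bcontfun_inverse[OF Fb])
  have "dist (\<Phi> w) (\<Phi> w') \<le> (1 / 2) * dist w w'" for w w'
  proof (rule dist_bound)
    fix z :: "(real^2) \<times> real"
    let ?t = "cl (snd z)"
    have "\<bar>calL (\<lambda>x t. B x t (ext w x t) - B x t (ext w' x t)) (fst z) ?t\<bar> \<le> (C * dist w w') * (exp (\<kappa> * ?t) / \<kappa>\<^sup>2)"
    proof (rule Lb[OF cstrip_diff[OF B[OF cext] B[OF cext]]])
      show "\<bar>B y \<tau> (ext w y \<tau>) - B y \<tau> (ext w' y \<tau>)\<bar> \<le> (C * dist w w') * exp (\<kappa> * \<tau>)" if "\<tau> \<in> {0..T}" for y \<tau>
      proof -
        have "\<bar>B y \<tau> (ext w y \<tau>) - B y \<tau> (ext w' y \<tau>)\<bar> \<le> C * \<bar>ext w y \<tau> - ext w' y \<tau>\<bar>"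
          by (rule lip[OF that])
        also have "\<bar>ext w y \<tau> - ext w' y \<tau>\<bar> = exp (\<kappa> * \<tau>) * dist (apply_bcontfun w (y, \<tau>)) (apply_bcontfun w' (y, \<tau>))"
          by (simp add: ext_def dist_real_def abs_mult flip: right_diff_distrib)
        also have "C * \<dots> \<le> C * (exp (\<kappa> * \<tau>) * dist w w')"
          by (intro mult_left_mono C dist_bounded) auto
        finally show ?thesis by (simp add: mult_ac)
      qed
    qed (use cl C in auto)
    moreover have "calL (\<lambda>x t. B x t (ext w x t) - B x t (ext w' x t)) (fst z) ?t =
      calL (\<lambda>x t. B x t (ext w x t)) (fst z) ?t - calL (\<lambda>x t. B x t (ext w' x t)) (fst z) ?t"
      by (rule calL_diff[OF B[OF cext] B[OF cext] cl(1)])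
    ultimately have "exp (- \<kappa> * ?t) * \<bar>calL (\<lambda>x t. B x t (ext w x t)) (fst z) ?t - calL (\<lambda>x t. B x t (ext w' x t)) (fst z) ?t\<bar>
        \<le> exp (- \<kappa> * ?t) * ((C * dist w w') * (exp (\<kappa> * ?t) / \<kappa>\<^sup>2))"
      by (intro mult_left_mono) auto
    also have "\<dots> = (C / (2 * C + 1)) * dist w w'" by (simp add: exp_minus \<kappa> field_simps)
    also have "\<dots> \<le> (1 / 2) * dist w w'" using C by (intro mult_right_mono) (auto simp: field_simps)
    finally show "dist (apply_bcontfun (\<Phi> w) z) (apply_bcontfun (\<Phi> w') z) \<le> (1 / 2) * dist w w'"
      by (simp add: app F_def dist_real_def abs_mult flip: right_diff_distrib)
  qed
  then obtain w where w: "\<Phi> w = w" using banach_fix_type[of "1/2" \<Phi>] by auto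
  show thesis
  proof (rule that[of "ext w" "exp (\<kappa> * T) * norm w"])
    show "cstrip T (ext w)" by (rule cext)
    show "\<bar>ext w x t\<bar> \<le> exp (\<kappa> * T) * norm w" if "t \<in> {0..T}" for x t
      using that \<kappa> norm_bounded[of w "(x, t)"] unfolding ext_def abs_mult
      by (intro mult_mono) auto
    show "ext w x t = A x t + calL (\<lambda>x t. B x t (ext w x t)) x t" if "t \<in> {0..T}" for x t
    proof -
      have "ext w x t = exp (\<kappa> * t) * F w (x, t)" using app[of w "(x, t)"] w by (simp add: ext_def)
      then show ?thesis using cl(2)[OF that] by (simp add: F_def exp_minus)
    qed
  qed
qed

lemma calL_const_le: "0 \<le> c \<Longrightarrow> t \<in> {0..T} \<Longrightarrow> calL (\<lambda>_ _. c) x t \<le> c * exp T"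
proof -
  assume c: "0 \<le> c" and t: "t \<in> {0..T}"
  have "calL (\<lambda>_ _. c) x t \<le> calL (\<lambda>_ \<tau>. c * exp (1 * \<tau>)) x t"
    using c t by (intro calL_mono[where T=T] cstrip_intros continuous_intros) (auto simp: mult_le_cancel_left1)
  also have "\<dots> \<le> c * (exp (1 * t) / 1\<^sup>2)"
    unfolding calL_cmult using t by (intro mult_left_mono c calL_exp_le) auto
  also have "\<dots> \<le> c * exp T" using t c by (auto intro!: mult_left_mono)
  finally show ?thesis .
qed

lemma calL_shift: "calL (\<lambda>x t. F (x + k) t) x t = calL F (x + k) t"
  by (simp add: calL_def Rm_def add_ac)

text \<open>The additional real variable lets one lemma treat A, u and the products with N(u), where
  the point and the value of u are perturbed together.\<close>

lemma uniform_continuity_strip: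
  fixes G :: "real^2 \<Rightarrow> real \<Rightarrow> real \<Rightarrow> real"
  assumes G: "continuous_on (UNIV \<times> {0..T} \<times> UNIV) (\<lambda>(x, t, y). G x t y)" and "0 < \<eta>"
  obtains d where "0 < d" "\<And>x t y k y'. dist x0 x \<le> r \<Longrightarrow> t \<in> {0..T} \<Longrightarrow> \<bar>y\<bar> \<le> M \<Longrightarrow> \<bar>y'\<bar> \<le> M \<Longrightarrow> norm k \<le> d \<Longrightarrow> \<bar>y' - y\<bar> \<le> d
    \<Longrightarrow> \<bar>G (x + k) t y' - G x t y\<bar> \<le> \<eta>"
proof -
  let ?K = "cball x0 (r + 1) \<times> {0..T} \<times> {-M..M}"
  have "uniformly_continuous_on ?K (\<lambda>(x, t, y). G x t y)"
    by (intro compact_uniformly_continuous continuous_on_subset[OF G] compact_Times) auto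
  then obtain d where d: "d > 0" "\<And>z z'. z \<in> ?K \<Longrightarrow> z' \<in> ?K \<Longrightarrow> dist z' z < d \<Longrightarrow>
      dist ((\<lambda>(x, t, y). G x t y) z') ((\<lambda>(x, t, y). G x t y) z) < \<eta>"
    using \<open>0 < \<eta>\<close> unfolding uniformly_continuous_on_def by metis
  show thesis
  proof (rule that[of "min 1 (d / 3)"])
    fix x k :: "real^2" and t y y'
    assume a: "dist x0 x \<le> r" "t \<in> {0..T}" "\<bar>y\<bar> \<le> M" "\<bar>y'\<bar> \<le> M" "norm k \<le> min 1 (d / 3)" "\<bar>y' - y\<bar> \<le> min 1 (d / 3)"
    have "dist x0 (x + k) \<le> dist x0 x + norm k" by (metis add_diff_cancel_left' dist_norm dist_triangle dist_commute)
    then have in1: "(x, t, y) \<in> ?K" "(x + k, t, y') \<in> ?K" using a by (auto simp: abs_le_iff)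
    have "dist (x + k, t, y') (x, t, y) \<le> norm k + (0 + \<bar>y' - y\<bar>)"
      unfolding dist_Pair_Pair
      by (rule order_trans[OF sqrt_sum_squares_le_sum]) (auto simp: dist_norm)
    also have "\<dots> < d" using a d(1) by linarith
    finally show "\<bar>G (x + k) t y' - G x t y\<bar> \<le> \<eta>"
      using d(2)[OF in1] by (simp add: dist_real_def)
  qed (use d in auto)
qed

lemma cstrip_shift: "cstrip T F \<Longrightarrow> cstrip T (\<lambda>x t. F (x + k) t)"
  unfolding cstrip_def[of T "\<lambda>x t. F (x + k) t"] split_beta
  by (rule cstrip_compose) (auto intro!: continuous_intros)

lemma mvt_unit:
  fixes f :: "real \<Rightarrow> real"
  assumes "\<And>s. (f has_real_derivative f' s) (at s)"
  obtains s where "0 \<le> s" "s \<le> 1" "f 1 - f 0 = f' s"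
proof -
  have "\<exists>z>0. z < 1 \<and> f 1 - f 0 = (1 - 0) * f' z"
    by (rule MVT2) (use assms in auto)
  then obtain z where "0 < z" "z < 1" "f 1 - f 0 = (1 - 0) * f' z" by blast
  then show thesis by (intro that[of z]) auto
qed

lemma has_grad_segment:
  assumes "has_grad \<phi> D"
  shows "((\<lambda>s. \<phi> (x + (s * h) *\<^sub>R axis i 1)) has_real_derivative h * D i (x + (s * h) *\<^sub>R axis i 1)) (at s)"
proof -
  have "((\<lambda>s. s * h) has_real_derivative h) (at s)" by (auto intro!: derivative_eq_intros)
  from DERIV_chain2[where f="\<lambda>s. \<phi> (x + s *\<^sub>R axis i 1)", OF has_grad_line[OF assms] this]
  show ?thesis by (simp add: mult.commute)
qed

text \<open>The candidate v for the gradient is obtained first, as the solution of the formally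
  differentiated equation. The error of the difference quotient then satisfies a Gronwall inequality
  with a small inhomogeneous term. The form c * N(u) serves two purposes: N is the nonlinearity for
  first derivatives, and N is the identity with c a multiple of u for second derivatives when p =
  2.\<close>

lemma volterra_differentiable:
  fixes N N' :: "real \<Rightarrow> real"
  assumes T: "0 \<le> T" and u: "cstrip T u" and ub: "\<And>x t. t \<in> {0..T} \<Longrightarrow> \<bar>u x t\<bar> \<le> M"
    and eq: "\<And>x t. t \<in> {0..T} \<Longrightarrow> u x t = A x t + calL (\<lambda>x t. c x t * N (u x t)) x t"
    and gA: "\<And>t. t \<in> {0..T} \<Longrightarrow> has_grad (\<lambda>x. A x t) (\<lambda>i x. Ax i x t)"
    and Ax: "\<And>i. cstrip T (Ax i)" and Ab: "\<And>i x t. t \<in> {0..T} \<Longrightarrow> \<bar>Ax i x t\<bar> \<le> a"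
    and c: "cstrip T c" and cx: "\<And>i. cstrip T (cx i)"
    and gc: "\<And>t. t \<in> {0..T} \<Longrightarrow> has_grad (\<lambda>x. c x t) (\<lambda>i x. cx i x t)"
    and cb: "\<And>x t. t \<in> {0..T} \<Longrightarrow> \<bar>c x t\<bar> \<le> b" "\<And>i x t. t \<in> {0..T} \<Longrightarrow> \<bar>cx i x t\<bar> \<le> b"
    and N: "\<And>y. (N has_real_derivative N' y) (at y)" and N': "continuous_on UNIV N'"
  obtains v V where "\<And>i. cstrip T (v i)" "\<And>i x t. t \<in> {0..T} \<Longrightarrow> \<bar>v i x t\<bar> \<le> V"
    "\<And>t. t \<in> {0..T} \<Longrightarrow> has_grad (\<lambda>x. u x t) (\<lambda>i x. v i x t)"
    "\<And>i x t. t \<in> {0..T} \<Longrightarrow> v i x t = Ax i x t + calL (\<lambda>x t. cx i x t * N (u x t) + c x t * N' (u x t) * v i x t) x t"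
proof -
  have cN: "continuous_on S N" for S using N by (meson DERIV_continuous continuous_at_imp_continuous_on)
  have cN': "continuous_on S N'" for S using N' continuous_on_subset by blast
  have cNu: "cstrip T (\<lambda>x t. N (w x t))" "cstrip T (\<lambda>x t. N' (w x t))" if "cstrip T w" for w
    using that unfolding cstrip_def split_beta
    by (auto intro!: continuous_on_compose2[OF cN[of UNIV]] continuous_on_compose2[OF cN'[of UNIV]])
  have M0: "0 \<le> M" using ub[of 0 0] T by force
  have b0: "0 \<le> b" using cb(1)[of 0 0] T by force
  obtain n where n0: "0 \<le> n" and n: "\<And>y. \<bar>y\<bar> \<le> M \<Longrightarrow> \<bar>N y\<bar> \<le> n" "\<And>y. \<bar>y\<bar> \<le> M \<Longrightarrow> \<bar>N' y\<bar> \<le> n"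
  proof -
    have "bounded (N ` {-M..M})" "bounded (N' ` {-M..M})"
      by (intro compact_imp_bounded compact_continuous_image cN cN' compact_Icc)+
    then obtain n1 n2 where "\<forall>y\<in>{-M..M}. \<bar>N y\<bar> \<le> n1" "\<forall>y\<in>{-M..M}. \<bar>N' y\<bar> \<le> n2"
      unfolding bounded_iff by auto
    then show thesis
      by (intro that[of "max 0 (max n1 n2)"]) (auto simp: abs_le_iff le_max_iff_disj)
  qed
  define C where "C = b * n"
  have C0: "0 \<le> C" using b0 n0 by (simp add: C_def)
  have cNb: "\<bar>c x t * N' y\<bar> \<le> C" if "t \<in> {0..T}" "\<bar>y\<bar> \<le> M" for x t y
    unfolding abs_mult C_def using that b0 by (intro mult_mono cb n) auto
  \<comment> \<open>The differentiated equation is linear in v with bounded coefficients, hence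
    globally Lipschitz.\<close>
  have "\<exists>v V. cstrip T v \<and> (\<forall>x. \<forall>t\<in>{0..T}. \<bar>v x t\<bar> \<le> V) \<and>
      (\<forall>x. \<forall>t\<in>{0..T}. v x t = Ax i x t + calL (\<lambda>x t. cx i x t * N (u x t) + c x t * N' (u x t) * v x t) x t)" for i
  proof (rule volterra_fixpoint[of T "Ax i" a "\<lambda>x t y. cx i x t * N (u x t) + c x t * N' (u x t) * y" C "b * n"])
    show "cstrip T (\<lambda>x t. cx i x t * N (u x t) + c x t * N' (u x t) * w x t)" if "cstrip T w" for w
      by (intro cstrip_intros cx c cNu u that)
    show "\<bar>cx i x t * N (u x t) + c x t * N' (u x t) * y - (cx i x t * N (u x t) + c x t * N' (u x t) * z)\<bar> \<le> C * \<bar>y - z\<bar>" if t: "t \<in> {0..T}" for x t y z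
    proof -
      have "\<bar>cx i x t * N (u x t) + c x t * N' (u x t) * y - (cx i x t * N (u x t) + c x t * N' (u x t) * z)\<bar> = \<bar>c x t * N' (u x t)\<bar> * \<bar>y - z\<bar>"
        unfolding abs_mult[symmetric] by (simp add: algebra_simps)
      then show ?thesis using cNb[OF t ub[OF t]] by (simp add: mult_right_mono)
    qed
    show "\<bar>cx i x t * N (u x t) + c x t * N' (u x t) * 0\<bar> \<le> b * n" if "t \<in> {0..T}" for x t
      unfolding mult_zero_right add_0_right abs_mult using that b0 by (intro mult_mono cb n ub) auto
    show "\<exists>v V. cstrip T v \<and> (\<forall>x. \<forall>t\<in>{0..T}. \<bar>v x t\<bar> \<le> V) \<and>
      (\<forall>x. \<forall>t\<in>{0..T}. v x t = Ax i x t + calL (\<lambda>x t. cx i x t * N (u x t) + c x t * N' (u x t) * v x t) x t)"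
      if "cstrip T w" "\<And>x t. t \<in> {0..T} \<Longrightarrow> \<bar>w x t\<bar> \<le> W"
        "\<And>x t. t \<in> {0..T} \<Longrightarrow> w x t = Ax i x t + calL (\<lambda>x t. cx i x t * N (u x t) + c x t * N' (u x t) * w x t) x t" for w W
      by (intro exI[of _ w] exI[of _ W] conjI ballI allI that)
  qed (use Ax Ab T C0 in auto)
  note ex = this
  define Q where "Q i z \<longleftrightarrow> cstrip T (fst z) \<and> (\<forall>x. \<forall>t\<in>{0..T}. \<bar>fst z x t\<bar> \<le> snd z) \<and>
      (\<forall>x. \<forall>t\<in>{0..T}. fst z x t = Ax i x t + calL (\<lambda>x t. cx i x t * N (u x t) + c x t * N' (u x t) * fst z x t) x t)" for i z
  have "\<forall>i. \<exists>z. Q i z"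
  proof
    fix i
    from ex[of i] obtain v V where "Q i (v, V)" unfolding Q_def fst_conv snd_conv by (elim exE) 
    then show "\<exists>z. Q i z" by (rule exI)
  qed
  then obtain q where q: "\<forall>i. Q i (q i)" by (rule choice[THEN exE])
  define v where "v i = fst (q i)" for i
  define V0 where "V0 i = snd (q i)" for i
  have v: "cstrip T (v i)" for i
    using q[rule_format, of i] unfolding Q_def v_def by (rule conjunct1)
  have vb0: "\<bar>v i x t\<bar> \<le> V0 i" if "t \<in> {0..T}" for i x t
    using q[rule_format, of i] that unfolding Q_def v_def V0_def by (elim conjE) (rule bspec, erule spec)
  have veq: "v i x t = Ax i x t + calL (\<lambda>x t. cx i x t * N (u x t) + c x t * N' (u x t) * v i x t) x t" if "t \<in> {0..T}" for i x t
    using q[rule_format, of i] that unfolding Q_def v_def by (elim conjE) (rule bspec, erule spec)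
  define V where "V = max (V0 1) (V0 2)"
  have vb: "\<bar>v i x t\<bar> \<le> V" if "t \<in> {0..T}" for i x t
    using vb0[OF that, of i x] exhaust_2[of i] unfolding V_def by (auto simp: le_max_iff_disj)
  have V0: "0 \<le> V" using vb[of 0 undefined 0] T by force
  have deriv: "((\<lambda>s. u (x0 + s *\<^sub>R axis i 1) t0) has_real_derivative v i x0 t0) (at 0)" if t0: "t0 \<in> {0..T}" for x0 t0 i
  proof -
    let ?e = "axis i 1 :: real^2"
    have "\<exists>\<delta>>0. \<forall>h. h \<noteq> 0 \<and> \<bar>h\<bar> < \<delta> \<longrightarrow> \<bar>(u (x0 + h *\<^sub>R ?e) t0 - u x0 t0) / h - v i x0 t0\<bar> < r" if r: "0 < r" for r
    proof -
      \<comment> \<open>\<eta> K collects the inhomogeneous part: \<eta> from the difference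
        quotient of A, and \<eta> (1 + V) exp T from the Duhamel term of a constant.
        \<open>E\<close> is the Gronwall factor, and \<eta> is chosen such that 2 \<eta> K E =
        r/2.\<close>
      define K where "K = 1 + (1 + V) * exp T"
      define E where "E = exp (sqrt (2 * C + 1) * T)"
      have K: "0 < K" using V0 by (simp add: K_def add_pos_nonneg)
      have E: "0 < E" by (simp add: E_def)
      define \<eta> where "\<eta> = r / (4 * K * E)"
      have \<eta>: "0 < \<eta>" using r K E by (simp add: \<eta>_def)
      note cc = cstrip_compose[where X="\<lambda>z. fst z" and \<tau>="\<lambda>z. fst (snd z)"]
      have GA: "continuous_on (UNIV \<times> {0..T} \<times> UNIV) (\<lambda>(x, t, y :: real). Ax i x t)"
        and Gu: "continuous_on (UNIV \<times> {0..T} \<times> UNIV) (\<lambda>(x, t, y :: real). u x t)"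
        and GP: "continuous_on (UNIV \<times> {0..T} \<times> UNIV) (\<lambda>(x, t, y). cx i x t * N y)"
        and GQ: "continuous_on (UNIV \<times> {0..T} \<times> UNIV) (\<lambda>(x, t, y). c x t * N' y)"
        unfolding split_beta
        by (auto intro!: continuous_intros cc[OF Ax] cc[OF u] cc[OF cx] cc[OF c]
            continuous_on_compose2[OF cN[of UNIV]] continuous_on_compose2[OF cN'[of UNIV]])
      obtain d1 where d1: "0 < d1" "\<And>x t y k y'. dist x0 x \<le> T \<Longrightarrow> t \<in> {0..T} \<Longrightarrow> \<bar>y\<bar> \<le> M \<Longrightarrow> \<bar>y'\<bar> \<le> M \<Longrightarrow> norm k \<le> d1 \<Longrightarrow> \<bar>y' - y\<bar> \<le> d1
        \<Longrightarrow> \<bar>Ax i (x + k) t - Ax i x t\<bar> \<le> \<eta>" using uniform_continuity_strip[OF GA \<eta>] by blast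
      obtain d2 where d2: "0 < d2" "\<And>x t y k y'. dist x0 x \<le> T \<Longrightarrow> t \<in> {0..T} \<Longrightarrow> \<bar>y\<bar> \<le> M \<Longrightarrow> \<bar>y'\<bar> \<le> M \<Longrightarrow> norm k \<le> d2 \<Longrightarrow> \<bar>y' - y\<bar> \<le> d2
        \<Longrightarrow> \<bar>cx i (x + k) t * N y' - cx i x t * N y\<bar> \<le> \<eta>" using uniform_continuity_strip[OF GP \<eta>] by blast
      obtain d3 where d3: "0 < d3" "\<And>x t y k y'. dist x0 x \<le> T \<Longrightarrow> t \<in> {0..T} \<Longrightarrow> \<bar>y\<bar> \<le> M \<Longrightarrow> \<bar>y'\<bar> \<le> M \<Longrightarrow> norm k \<le> d3 \<Longrightarrow> \<bar>y' - y\<bar> \<le> d3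
        \<Longrightarrow> \<bar>c (x + k) t * N' y' - c x t * N' y\<bar> \<le> \<eta>" using uniform_continuity_strip[OF GQ \<eta>] by blast
      define d where "d = min d1 (min d2 d3)"
      have d: "0 < d" using d1 d2 d3 by (simp add: d_def)
      obtain d4 where d4: "0 < d4" "\<And>x t y k y'. dist x0 x \<le> T \<Longrightarrow> t \<in> {0..T} \<Longrightarrow> \<bar>y\<bar> \<le> M \<Longrightarrow> \<bar>y'\<bar> \<le> M \<Longrightarrow> norm k \<le> d4 \<Longrightarrow> \<bar>y' - y\<bar> \<le> d4
        \<Longrightarrow> \<bar>u (x + k) t - u x t\<bar> \<le> d" using uniform_continuity_strip[OF Gu d] by blast
      show ?thesis
      proof (intro exI[of _ "min d d4"] conjI allI impI)
        show "0 < min d d4" using d d4 by simp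
        fix h assume h: "h \<noteq> 0 \<and> \<bar>h\<bar> < min d d4"
        define F where "F x t = c x t * N (u x t)" for x t
        define F' where "F' x t = cx i x t * N (u x t) + c x t * N' (u x t) * v i x t" for x t
        have cF: "cstrip T F" "cstrip T F'"
          unfolding F_def F'_def by (intro cstrip_intros cx c cNu u v)+
        define e where "e x t = (1 / h) * (u (x + h *\<^sub>R ?e) t - u x t) - v i x t" for x t
        have ce: "cstrip T e" unfolding e_def by (intro cstrip_intros cstrip_shift[OF u] u v)
        define Q where "Q x t = (1 / h) * (F (x + h *\<^sub>R ?e) t - F x t) - F' x t" for x t
        have cQ: "cstrip T Q" unfolding Q_def by (intro cstrip_intros cstrip_shift[OF cF(1)] cF)
        have e_eq: "e x t = ((1 / h) * (A (x + h *\<^sub>R ?e) t - A x t) - Ax i x t) + calL Q x t" if t: "t \<in> {0..T}" for x t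
        proof -
          have "calL Q x t = calL (\<lambda>x t. (1 / h) * (F (x + h *\<^sub>R ?e) t - F x t)) x t - calL F' x t"
            unfolding Q_def by (rule calL_diff[OF _ cF(2) t]) (intro cstrip_intros cstrip_shift[OF cF(1)] cF)
          also have "\<dots> = (1 / h) * (calL F (x + h *\<^sub>R ?e) t - calL F x t) - calL F' x t"
            unfolding calL_cmult calL_diff[OF cstrip_shift[OF cF(1)] cF(1) t] calL_shift ..
          finally show ?thesis
            using eq[OF t, folded F_def] veq[OF t, of i, folded F'_def]
            by (simp add: e_def algebra_simps)
        qed
        have bound: "\<bar>Q x t\<bar> \<le> \<eta> * (1 + V) + C * \<bar>e x t\<bar>" "\<bar>(1 / h) * (A (x + h *\<^sub>R ?e) t - A x t) - Ax i x t\<bar> \<le> \<eta>"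
          if t: "t \<in> {0..T}" and x: "dist x0 x \<le> T" for x t
        proof -
          have small: "norm ((s * h) *\<^sub>R ?e) \<le> d" "norm ((s * h) *\<^sub>R ?e) \<le> d4" if "0 \<le> s" "s \<le> 1" for s
          proof -
            have "s * \<bar>h\<bar> \<le> 1 * \<bar>h\<bar>" using that by (intro mult_right_mono) auto
            moreover have "norm ((s * h) *\<^sub>R ?e) = s * \<bar>h\<bar>" using that by (simp add: abs_mult)
            moreover have "\<bar>h\<bar> < d" "\<bar>h\<bar> < d4" using h by auto
            ultimately show "norm ((s * h) *\<^sub>R ?e) \<le> d" "norm ((s * h) *\<^sub>R ?e) \<le> d4" by linarith+
          qed
          obtain s where s: "0 \<le> s" "s \<le> 1" "A (x + h *\<^sub>R ?e) t - A x t = h * Ax i (x + (s * h) *\<^sub>R ?e) t"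
            using mvt_unit[OF has_grad_segment[OF gA[OF t], of x h i]] by auto
          have "\<bar>Ax i (x + (s * h) *\<^sub>R ?e) t - Ax i x t\<bar> \<le> \<eta>"
            using d1(2)[OF x t, of 0 0] small[OF s(1,2)] M0 d by (simp add: d_def)
          then show "\<bar>(1 / h) * (A (x + h *\<^sub>R ?e) t - A x t) - Ax i x t\<bar> \<le> \<eta>" using h s by simp
          define \<delta> where "\<delta> = u (x + h *\<^sub>R ?e) t - u x t"
          have \<delta>: "\<bar>\<delta>\<bar> \<le> d" unfolding \<delta>_def
            using d4(2)[OF x t, of 0 0 "h *\<^sub>R ?e"] small(2)[of 1] M0 d4(1) by simp
          \<comment> \<open>The mean value theorem is used once, on the segment along which the
            point x and the value of u move simultaneously. This gives a single intermediate s for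
            both terms, and the intermediate value of u stays in [-M, M].\<close>
          have "((\<lambda>s. c (x + (s * h) *\<^sub>R ?e) t * N (u x t + s * \<delta>)) has_real_derivative
              h * cx i (x + (s * h) *\<^sub>R ?e) t * N (u x t + s * \<delta>) + c (x + (s * h) *\<^sub>R ?e) t * (N' (u x t + s * \<delta>) * \<delta>)) (at s)" for s
          proof (rule DERIV_cong, rule DERIV_mult[OF has_grad_segment[OF gc[OF t]]])
            show "((\<lambda>s. N (u x t + s * \<delta>)) has_real_derivative N' (u x t + s * \<delta>) * \<delta>) (at s)"
              by (rule DERIV_chain2[OF N]) (auto intro!: derivative_eq_intros)
          qed (simp add: algebra_simps)
          from mvt_unit[OF this] obtain s where s: "0 \<le> s" "s \<le> 1"
            and Fs: "c (x + h *\<^sub>R ?e) t * N (u x t + \<delta>) - c x t * N (u x t) =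
              h * cx i (x + (s * h) *\<^sub>R ?e) t * N (u x t + s * \<delta>) + c (x + (s * h) *\<^sub>R ?e) t * (N' (u x t + s * \<delta>) * \<delta>)"
            by auto
          define x' where "x' = x + (s * h) *\<^sub>R ?e"
          define y' where "y' = u x t + s * \<delta>"
          have y': "\<bar>y'\<bar> \<le> M"
          proof -
            have "\<bar>y'\<bar> = \<bar>(1 - s) * u x t + s * u (x + h *\<^sub>R ?e) t\<bar>" by (simp add: y'_def \<delta>_def algebra_simps)
            also have "\<dots> \<le> (1 - s) * M + s * M"
              using s ub[OF t] by (intro order_trans[OF abs_triangle_ineq] add_mono) (auto simp: abs_mult intro!: mult_left_mono)
            finally show ?thesis by (simp add: algebra_simps)
          qed
          have yy: "\<bar>y' - u x t\<bar> \<le> d"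
          proof -
            have "s * \<bar>\<delta>\<bar> \<le> 1 * \<bar>\<delta>\<bar>" using s by (intro mult_right_mono) auto
            then show ?thesis using \<delta> s by (simp add: y'_def abs_mult)
          qed
          have P: "\<bar>cx i x' t * N y' - cx i x t * N (u x t)\<bar> \<le> \<eta>"
            unfolding x'_def using d2(2)[OF x t ub[OF t] y'] small(1)[OF s] yy by (simp add: d_def)
          have R: "\<bar>c x' t * N' y' - c x t * N' (u x t)\<bar> \<le> \<eta>"
            unfolding x'_def using d3(2)[OF x t ub[OF t] y'] small(1)[OF s] yy by (simp add: d_def)
          have FQ: "(1 / h) * (F (x + h *\<^sub>R ?e) t - F x t) = cx i x' t * N y' + c x' t * N' y' * ((1 / h) * \<delta>)"
          proof -
            have "F (x + h *\<^sub>R ?e) t - F x t = h * (cx i x' t * N y') + c x' t * N' y' * \<delta>"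
              using Fs by (simp add: F_def \<delta>_def x'_def y'_def mult_ac)
            then show ?thesis using h by (simp add: field_simps)
          qed
          \<comment> \<open>The difference quotient of u is e + v. Inserting this produces e with a
            coefficient bounded by C, while everything else is a difference controlled by
            \<eta>.\<close>
          have "(1 / h) * \<delta> = e x t + v i x t" by (simp add: e_def \<delta>_def)
          then have "Q x t = (cx i x' t * N y' - cx i x t * N (u x t)) + (c x' t * N' y' - c x t * N' (u x t)) * v i x t + c x' t * N' y' * e x t"
            unfolding Q_def F'_def FQ by (simp only: algebra_simps)
          also have "\<bar>\<dots>\<bar> \<le> \<eta> + \<eta> * V + C * \<bar>e x t\<bar>"
          proof (intro order_trans[OF abs_triangle_ineq] add_mono P)
            show "\<bar>(c x' t * N' y' - c x t * N' (u x t)) * v i x t\<bar> \<le> \<eta> * V"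
              unfolding abs_mult[of _ "v i x t"] using \<eta> by (intro mult_mono R vb[OF t]) auto
            show "\<bar>c x' t * N' y' * e x t\<bar> \<le> C * \<bar>e x t\<bar>"
              unfolding abs_mult[of _ "e x t"] by (intro mult_right_mono cNb[OF t y']) auto
          qed
          finally show "\<bar>Q x t\<bar> \<le> \<eta> * (1 + V) + C * \<bar>e x t\<bar>" by (simp add: algebra_simps)
        qed
        have "\<bar>e x0 t0\<bar> \<le> 2 * (\<eta> * K) * exp (sqrt (2 * C + 1) * t0)"
        proof (rule gronwall_cone[OF ce C0 _ t0])
          show "0 \<le> \<eta> * K" using \<eta> K by simp
          fix x t assume xt: "0 \<le> t" "t \<le> t0" "dist x0 x \<le> t0 - t"
          have t: "t \<in> {0..T}" using xt t0 by auto
          have x: "dist x0 x \<le> T" using xt t0 by auto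
          have "\<bar>calL Q x t\<bar> \<le> calL (\<lambda>x t. \<eta> * (1 + V) + C * \<bar>e x t\<bar>) x t"
          proof (rule calL_abs[OF cQ _ t])
            show "cstrip T (\<lambda>x t. \<eta> * (1 + V) + C * \<bar>e x t\<bar>)" by (intro cstrip_intros ce)
            fix y \<tau> assume y: "0 \<le> \<tau>" "\<tau> \<le> t" "dist x y \<le> t - \<tau>"
            show "\<bar>Q y \<tau>\<bar> \<le> \<eta> * (1 + V) + C * \<bar>e y \<tau>\<bar>"
              using y t0 xt dist_triangle[of x0 y x] by (intro bound(1)) auto
          qed
          also have "\<dots> = calL (\<lambda>x t. \<eta> * (1 + V)) x t + C * calL (\<lambda>x t. \<bar>e x t\<bar>) x t"
            unfolding calL_cmult[symmetric] by (rule calL_add[OF _ _ t]; intro cstrip_intros ce)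
          also have "\<dots> \<le> \<eta> * (1 + V) * exp T + C * calL (\<lambda>x t. \<bar>e x t\<bar>) x t"
            using \<eta> V0 by (intro add_right_mono calL_const_le t) auto
          finally show "\<bar>e x t\<bar> \<le> \<eta> * K + C * calL (\<lambda>x t. \<bar>e x t\<bar>) x t"
            using bound(2)[OF t x] unfolding e_eq[OF t] K_def by (simp add: algebra_simps)
        qed
        also have "\<dots> \<le> 2 * (\<eta> * K) * E"
          unfolding E_def using t0 C0 \<eta> K by (intro mult_left_mono) (auto intro!: mult_left_mono)
        also have "\<dots> = r / 2" using K E by (simp add: \<eta>_def field_simps)
        also have "\<dots> < r" using r by simp
        finally show "\<bar>(u (x0 + h *\<^sub>R ?e) t0 - u x0 t0) / h - v i x0 t0\<bar> < r" by (simp add: e_def)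
      qed
    qed
    then have "(\<lambda>h. (u (x0 + h *\<^sub>R ?e) t0 - u x0 t0) / h) \<midarrow>0\<rightarrow> v i x0 t0"
      by (intro LIM_I) auto
    then show ?thesis by (simp add: DERIV_def)
  qed
  show thesis
    by (rule that[OF v vb _ veq]) (auto intro!: has_gradI deriv cstrip_slice[OF v])
qed

section \<open>Supersolutions\<close>

text \<open>The maximum makes the function vanish for \<beta> \<le> 1 if j is positive.\<close>

definition cutpow :: "real \<Rightarrow> nat \<Rightarrow> real \<Rightarrow> real" where
  "cutpow s j \<beta> = (max 1 \<beta>) powr (- s) * (1 - 1 / max 1 \<beta>) ^ j"

lemma cutpow_le1: "\<beta> \<le> 1 \<Longrightarrow> 0 < j \<Longrightarrow> cutpow s j \<beta> = 0"
  by (simp add: cutpow_def max_def)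

lemma cutpow_ge1: "1 \<le> \<beta> \<Longrightarrow> cutpow s j \<beta> = \<beta> powr (- s) * (1 - 1 / \<beta>) ^ j"
  by (simp add: cutpow_def max_def)

lemma cutpow_nonneg: "0 \<le> cutpow s j \<beta>"
  by (auto simp: cutpow_def max_def field_simps)

lemma continuous_on_cutpow [continuous_intros]:
  assumes "continuous_on S f" shows "continuous_on S (\<lambda>x. cutpow s j (f x))"
proof -
  have "continuous_on UNIV (\<lambda>\<beta>::real. (max 1 \<beta>) powr (- s) * (1 - 1 / max 1 \<beta>) ^ j)"
    by (intro continuous_intros) auto
  then show ?thesis unfolding cutpow_def[abs_def]
    by (rule continuous_on_compose2[OF _ assms]) auto
qed

lemma powr_shift: "0 < t \<Longrightarrow> t powr (- m - real n) = t powr (- m) / t ^ n"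
  by (simp add: powr_diff powr_realpow)

text \<open>The zero of order at least two at \<beta> = 1 makes the function differentiable there,
  and the derivative stays in the family with one order less. Starting from order 3 one gets two
  continuous derivatives, enough for the wave operator.\<close>

lemma cutpow_deriv:
  "(cutpow s (Suc (Suc j)) has_real_derivative - s * cutpow (s + 1) (Suc (Suc j)) \<beta> + Suc (Suc j) * cutpow (s + 2) (Suc j) \<beta>) (at \<beta>)"
proof -
  let ?j = "Suc (Suc j)"
  consider "\<beta> < 1" | "\<beta> = 1" | "\<beta> > 1" by linarith
  then show ?thesis
  proof cases
    case 1
    have "((\<lambda>_. 0) has_real_derivative 0) (at \<beta>)" by simp
    then have "(cutpow s ?j has_real_derivative 0) (at \<beta>)"
      by (rule DERIV_cong_ev[OF refl _ refl, THEN iffD1, rotated])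
        (use 1 in \<open>auto simp: cutpow_le1 eventually_nhds intro!: exI[of _ "{..<1}"]\<close>)
    then show ?thesis using 1 by (simp add: cutpow_le1)
  next
    case 3
    have g: "((\<lambda>\<beta>::real. 1 - 1 / \<beta>) has_real_derivative 1 / \<beta>\<^sup>2) (at \<beta>)"
      using 3 by (auto intro!: derivative_eq_intros simp: power2_eq_square)
    have p: "((\<lambda>\<beta>. \<beta> powr (- s)) has_real_derivative - s * \<beta> powr (- s - 1)) (at \<beta>)"
      using 3 by (intro has_real_derivative_powr) auto
    have "((\<lambda>\<beta>. \<beta> powr (- s) * (1 - 1 / \<beta>) ^ ?j) has_real_derivative
       - s * (\<beta> powr (- s - 1) * (1 - 1 / \<beta>) ^ ?j) + ?j * (\<beta> powr (-s) / \<beta>\<^sup>2 * (1 - 1 / \<beta>) ^ Suc j)) (at \<beta>)"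
      by (rule DERIV_cong[OF DERIV_mult[OF p DERIV_power[OF g, of ?j]]]) simp
    moreover have "\<beta> powr (- s) / \<beta>\<^sup>2 = \<beta> powr (- (s + 2))"
      using 3 powr_shift[of \<beta> s 2] by (simp add: algebra_simps)
    moreover have "- s - 1 = - (s + 1)" by simp
    ultimately have "((\<lambda>\<beta>. \<beta> powr (- s) * (1 - 1 / \<beta>) ^ ?j) has_real_derivative
       - s * cutpow (s + 1) ?j \<beta> + ?j * cutpow (s + 2) (Suc j) \<beta>) (at \<beta>)"
      using 3 by (simp only: cutpow_ge1 less_imp_le)
    then show ?thesis
      by (rule DERIV_cong_ev[OF refl _ refl, THEN iffD1, rotated])
        (use 3 in \<open>auto simp: cutpow_ge1 eventually_nhds intro!: exI[of _ "{1<..}"]\<close>)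
  next
    case 2
    \<comment> \<open>At the junction the function is zero to the left. To the right, for h up to 1,
      it is at most 2^|s| h^2, since 1 - 1/(1 + h) is at most h and the exponent is at least
      2.\<close>
    have "(\<lambda>h. (cutpow s ?j (1 + h) - cutpow s ?j 1) / h) \<midarrow>0\<rightarrow> 0"
    proof (rule Lim_null_comparison)
      show "((\<lambda>h. 2 powr \<bar>s\<bar> * \<bar>h\<bar>) \<longlongrightarrow> 0) (at 0)"
        by (auto intro!: tendsto_eq_intros)
      show "\<forall>\<^sub>F h in at 0. norm ((cutpow s ?j (1 + h) - cutpow s ?j 1) / h) \<le> 2 powr \<bar>s\<bar> * \<bar>h\<bar>"
        unfolding eventually_at
      proof (intro exI[of _ 1] conjI ballI impI)
        fix h :: real assume h: "h \<noteq> 0 \<and> dist h 0 < 1"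
        show "norm ((cutpow s ?j (1 + h) - cutpow s ?j 1) / h) \<le> 2 powr \<bar>s\<bar> * \<bar>h\<bar>"
        proof (cases "h > 0")
          case True
          then have h1: "h \<le> 1" using h by (simp add: dist_real_def)
          have "(1 + h) powr (- s) \<le> 2 powr \<bar>s\<bar>"
            using True h1 by (intro order_trans[OF powr_mono[of "-s" "\<bar>s\<bar>"] powr_mono2]) auto
          moreover have "(1 - 1 / (1 + h)) ^ ?j \<le> (1 - 1 / (1 + h)) ^ 2"
            using True by (intro power_decreasing) (auto simp: field_simps)
          moreover have "(1 - 1 / (1 + h)) ^ 2 \<le> h ^ 2"
            using True by (intro power_mono) (auto simp: field_simps)
          moreover have "0 \<le> (1 - 1 / (1 + h)) ^ ?j"
            using True by (intro zero_le_power) (auto simp: field_simps)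
          ultimately have "cutpow s ?j (1 + h) \<le> 2 powr \<bar>s\<bar> * h ^ 2"
            unfolding cutpow_ge1[of "1 + h", OF less_imp_le[OF less_add_same_cancel1[THEN iffD2, OF True]]]
            by (intro mult_mono) auto
          then have "cutpow s ?j (1 + h) / h \<le> 2 powr \<bar>s\<bar> * h"
            using True by (simp add: field_simps power2_eq_square)
          then show ?thesis using True cutpow_nonneg[of s ?j "1 + h"] by (simp add: cutpow_le1)
        qed (use h in \<open>auto simp: cutpow_le1 mult_le_0_iff\<close>)
      qed auto
    qed
    then have "(cutpow s ?j has_real_derivative 0) (at 1)" by (simp add: DERIV_def)
    then show ?thesis using 2 by (simp add: cutpow_le1)
  qed
qed

text \<open>Comparable with the distance t - |x| to the light cone.\<close>

definition bt :: "real^2 \<Rightarrow> real \<Rightarrow> real" where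
  "bt x t = t - (x \<bullet> x) / t"

text \<open>\<open>bt x t\<close> is the Lorentz form t^2 - |x|^2 divided by t. Unlike t - |x| it is
  smooth at x = 0, and it is homogeneous of degree one in (x, t), so that the wave operator of
  \<open>hyp\<close> is an Euler operator in \<beta> plus one further term.\<close>

definition hyp :: "real \<Rightarrow> (real \<Rightarrow> real) \<Rightarrow> real^2 \<Rightarrow> real \<Rightarrow> real" where
  "hyp m S x t = t powr (- m) * S (bt x t)"

section \<open>The wave operator of the self-similar profiles\<close>

lemma bt_le: "0 < t \<Longrightarrow> bt x t \<le> t" by (simp add: bt_def)

lemma has_grad_nth: "has_grad (\<lambda>x. x $ i) (\<lambda>j x. if j = i then 1 else 0)"
  unfolding has_grad_def
  by (auto intro!: derivative_eq_intros bounded_linear.has_derivative[OF bounded_linear_vec_nth] simp: if_distrib cong: if_cong)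

lemma has_grad_mult:
  "has_grad \<phi> D \<Longrightarrow> has_grad \<psi> E \<Longrightarrow> has_grad (\<lambda>x. \<phi> x * \<psi> x) (\<lambda>i x. D i x * \<psi> x + \<phi> x * E i x)"
  unfolding has_grad_def
  by (auto intro!: derivative_eq_intros simp: algebra_simps sum.distrib sum_distrib_left sum_distrib_right)

lemma has_grad_cong: "has_grad \<phi> D \<Longrightarrow> (\<And>x. \<phi> x = \<psi> x) \<Longrightarrow> (\<And>i x. D i x = E i x) \<Longrightarrow> has_grad \<psi> E"
proof -
  assume "has_grad \<phi> D" and e: "\<And>x. \<phi> x = \<psi> x" "\<And>i x. D i x = E i x"
  moreover have "\<phi> = \<psi>" "D = E" by (simp_all add: fun_eq_iff e)
  ultimately show "has_grad \<psi> E" by simp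
qed

lemma inner2: "(x::real^2) \<bullet> x = x$1 * x$1 + x$2 * x$2"
  by (simp add: inner_vec_def sum_2)

lemma has_grad_inner: "has_grad (\<lambda>x. x \<bullet> x) (\<lambda>i x. 2 * x $ i)"
proof (rule has_grad_cong[OF has_grad_add[OF has_grad_mult[OF has_grad_nth has_grad_nth] has_grad_mult[OF has_grad_nth has_grad_nth]]])
  show "x $ 1 * x $ 1 + x $ 2 * x $ 2 = x \<bullet> x" for x :: "real^2" by (simp add: inner2)
  show "(if i = 1 then 1 else 0) * x $ 1 + x $ 1 * (if i = 1 then 1 else 0) + ((if i = 2 then 1 else 0) * x $ 2 + x $ 2 * (if i = 2 then 1 else 0)) = 2 * x $ i"
    for i and x :: "real^2" using exhaust_2[of i] by auto
qed

lemma has_grad_compose: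
  assumes "has_grad \<phi> D" "\<And>y. (S has_real_derivative S' y) (at y)"
  shows "has_grad (\<lambda>x. S (\<phi> x)) (\<lambda>i x. S' (\<phi> x) * D i x)"
  unfolding has_grad_def
proof
  fix x
  have "((\<lambda>x. S (\<phi> x)) has_derivative (\<lambda>h. S' (\<phi> x) * (\<Sum>i\<in>UNIV. h $ i * D i x))) (at x)"
    by (rule has_derivative_compose[OF assms(1)[unfolded has_grad_def, rule_format]
          assms(2)[unfolded has_field_derivative_def]])
  then show "((\<lambda>x. S (\<phi> x)) has_derivative (\<lambda>h. \<Sum>i\<in>UNIV. h $ i * (S' (\<phi> x) * D i x))) (at x)"
    by (simp add: sum_distrib_left mult.left_commute)
qed

lemma hyp_has_grad:
  assumes "\<And>y. (S has_real_derivative S' y) (at y)" "0 < t"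
  shows "has_grad (\<lambda>x. hyp m S x t) (\<lambda>i x. - 2 * x $ i * hyp (m + 1) S' x t)"
proof (rule has_grad_cong)
  show "has_grad (\<lambda>x. t powr (- m) * S (t + (- 1 / t) * (x \<bullet> x))) (\<lambda>i x. t powr (- m) * (S' (t + (- 1 / t) * (x \<bullet> x)) * (0 + (- 1 / t) * (2 * x $ i))))"
    by (intro has_grad_cmult has_grad_compose assms(1) has_grad_add has_grad_inner)
      (simp add: has_grad_def)
  show "t powr (- m) * S (t + (- 1 / t) * (x \<bullet> x)) = hyp m S x t" for x
    by (simp add: hyp_def bt_def)
  show "t powr (- m) * (S' (t + (- 1 / t) * (x \<bullet> x)) * (0 + (- 1 / t) * (2 * x $ i))) = - 2 * x $ i * hyp (m + 1) S' x t" for x i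
    using assms(2) powr_shift[of t m 1] by (simp add: hyp_def bt_def)
qed

lemma hyp_deriv_t:
  assumes "\<And>y. (S has_real_derivative S' y) (at y)" "0 < t"
  shows "((\<lambda>t. hyp m S x t) has_real_derivative
    - m * hyp (m + 1) S x t + hyp m S' x t + (x \<bullet> x) * hyp (m + 2) S' x t) (at t)"
proof -
  have "((\<lambda>t. bt x t) has_real_derivative 1 + (x \<bullet> x) / t\<^sup>2) (at t)"
    unfolding bt_def using assms(2) by (auto intro!: derivative_eq_intros simp: power2_eq_square)
  from DERIV_chain2[where f=S, OF assms(1) this]
  have "((\<lambda>t. hyp m S x t) has_real_derivative
    (- m * t powr (- m - 1)) * S (bt x t) + t powr (- m) * (S' (bt x t) * (1 + (x \<bullet> x) / t\<^sup>2))) (at t)"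
    unfolding hyp_def using assms(2) by (auto intro!: derivative_eq_intros)
  moreover have "t powr (- m - 1) = t powr (- (m + 1))" by simp
  moreover have "t powr (- (m + 2)) = t powr (- m) / t\<^sup>2" using assms(2) powr_shift[of t m 2] by simp
  ultimately show ?thesis by (simp add: hyp_def algebra_simps)
qed

lemma cstrip_hyp:
  assumes "continuous_on UNIV S"
  shows "cstrip T (\<lambda>x \<tau>. hyp m S x (1 + \<tau>))"
  unfolding cstrip_def split_beta hyp_def bt_def
  by (intro continuous_intros continuous_on_compose2[OF assms]) auto

lemma cstrip_inner: "cstrip T (\<lambda>x \<tau>. x \<bullet> x)"
  and cstrip_nth: "cstrip T (\<lambda>x \<tau>. x $ i)"
  unfolding cstrip_def split_beta by (intro continuous_intros)+

text \<open>The term (2 - 4m) r^(-m - 1) S' dominates near the cone; it vanishes for m = 1/2 and has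
  the sign of -S' for m > 1/2. Time starts at r = 1, where \<beta> = 1 - |y|^2 is at most 1, so the
  vanishing of S and S' below 1 removes the initial data.\<close>

lemma hyp_duhamel:
  assumes S: "\<And>y. (S has_real_derivative S' y) (at y)" and S': "\<And>y. (S' has_real_derivative S'' y) (at y)"
    and S'': "continuous_on UNIV S''" and z: "\<And>y. y \<le> 1 \<Longrightarrow> S y = 0" "\<And>y. y \<le> 1 \<Longrightarrow> S' y = 0"
    and t: "0 \<le> t"
  shows "hyp m S x (1 + t) = calL (\<lambda>y \<tau>. (1 + \<tau>) powr (- m - 2) *
      (m * (m + 1) * S (bt y (1 + \<tau>)) + (2 * m + 2) * (bt y (1 + \<tau>) * S' (bt y (1 + \<tau>))) + (bt y (1 + \<tau>))\<^sup>2 * S'' (bt y (1 + \<tau>)))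
      + (2 - 4 * m) * ((1 + \<tau>) powr (- m - 1) * S' (bt y (1 + \<tau>)))) x t"
proof -
  have cS: "continuous_on UNIV S" "continuous_on UNIV S'"
    using S S' by (meson DERIV_continuous continuous_at_imp_continuous_on)+
  note ci = cstrip_intros cstrip_hyp[OF cS(1)] cstrip_hyp[OF cS(2)] cstrip_hyp[OF S''] cstrip_inner cstrip_nth
  define v where "v x \<tau> = hyp m S x (1 + \<tau>)" for x \<tau>
  define vx where "vx i x \<tau> = - 2 * x $ i * hyp (m + 1) S' x (1 + \<tau>)" for i x \<tau>
  define vxx where "vxx i j x \<tau> = (- 2 * (if j = i then 1 else 0)) * hyp (m + 1) S' x (1 + \<tau>) + (- 2 * x $ i) * (- 2 * x $ j * hyp (m + 1 + 1) S'' x (1 + \<tau>))" for i j :: 2 and x \<tau>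
  define vt where "vt x \<tau> = - m * hyp (m + 1) S x (1 + \<tau>) + hyp m S' x (1 + \<tau>) + (x \<bullet> x) * hyp (m + 2) S' x (1 + \<tau>)" for x \<tau>
  define vtx where "vtx i x \<tau> = - m * (- 2 * x $ i * hyp (m + 1 + 1) S' x (1 + \<tau>)) + (- 2 * x $ i * hyp (m + 1) S'' x (1 + \<tau>))
     + (2 * x $ i * hyp (m + 2) S' x (1 + \<tau>) + (x \<bullet> x) * (- 2 * x $ i * hyp (m + 2 + 1) S'' x (1 + \<tau>)))" for i x \<tau>
  define vtt where "vtt x \<tau> = - m * (- (m + 1) * hyp (m + 1 + 1) S x (1 + \<tau>) + hyp (m + 1) S' x (1 + \<tau>) + (x \<bullet> x) * hyp (m + 1 + 2) S' x (1 + \<tau>))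
     + (- m * hyp (m + 1) S' x (1 + \<tau>) + hyp m S'' x (1 + \<tau>) + (x \<bullet> x) * hyp (m + 2) S'' x (1 + \<tau>))
     + (x \<bullet> x) * (- (m + 2) * hyp (m + 2 + 1) S' x (1 + \<tau>) + hyp (m + 2) S'' x (1 + \<tau>) + (x \<bullet> x) * hyp (m + 2 + 2) S'' x (1 + \<tau>))" for x \<tau>
  have sh: "((\<lambda>\<tau>. f (1 + \<tau>)) has_real_derivative d) (at \<tau> within A)" if "(f has_real_derivative d) (at (1 + \<tau>))" for f d \<tau> A
  proof -
    have "((\<lambda>\<tau>. 1 + \<tau>) has_real_derivative 1) (at \<tau> within A)" by (auto intro!: derivative_eq_intros)
    from DERIV_chain2[where f=f, OF that this] show ?thesis by simp
  qed
  have "v x t = Rd (\<lambda>y. v y 0) (\<lambda>i y. vx i y 0) x t + Rm (\<lambda>y. vt y 0) x t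
    + calL (\<lambda>y \<tau>. vtt y \<tau> - (\<Sum>i\<in>UNIV. vxx i i y \<tau>)) x t"
  proof (rule duhamel[where T=t and v=v and vx=vx and vxx=vxx and vt=vt and vtx=vtx and vtt=vtt])
    show "cstrip t v" unfolding v_def[abs_def] by (intro ci)
    show "cstrip t (vx i)" for i unfolding vx_def[abs_def] by (intro ci)
    show "cstrip t (vxx i j)" for i j unfolding vxx_def[abs_def] by (intro ci)
    show "cstrip t vt" unfolding vt_def[abs_def] by (intro ci)
    show "cstrip t (vtx i)" for i unfolding vtx_def[abs_def] by (intro ci)
    show "cstrip t vtt" unfolding vtt_def[abs_def] by (intro ci)
    show "has_grad (\<lambda>x. v x \<tau>) (\<lambda>i x. vx i x \<tau>)" if "\<tau> \<in> {0..t}" for \<tau>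
      unfolding v_def vx_def using that by (intro hyp_has_grad S) auto
    show "has_grad (\<lambda>x. vx i x \<tau>) (\<lambda>j x. vxx i j x \<tau>)" if "\<tau> \<in> {0..t}" for \<tau> i
      unfolding vx_def vxx_def using that
      by (intro has_grad_mult hyp_has_grad S' has_grad_cmult has_grad_nth) auto
    show "has_grad (\<lambda>x. vt x \<tau>) (\<lambda>i x. vtx i x \<tau>)" if "\<tau> \<in> {0..t}" for \<tau>
      unfolding vt_def vtx_def using that
      by (intro has_grad_add has_grad_cmult has_grad_mult has_grad_inner hyp_has_grad S S') auto
    show "((\<lambda>\<tau>. v x \<tau>) has_real_derivative vt x \<tau>) (at \<tau> within {0..t})" if "\<tau> \<in> {0..t}" for x \<tau>
      unfolding v_def vt_def using that by (intro sh hyp_deriv_t S) auto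
    show "((\<lambda>\<tau>. vt x \<tau>) has_real_derivative vtt x \<tau>) (at \<tau> within {0..t})" if "\<tau> \<in> {0..t}" for x \<tau>
      unfolding vt_def vtt_def using that by (intro DERIV_add DERIV_cmult sh hyp_deriv_t S S') auto
  qed (use t in auto)
  moreover have "v y 0 = 0" "vx i y 0 = 0" "vt y 0 = 0" for y i
    using z by (simp_all add: v_def vx_def vt_def hyp_def bt_def)
  moreover have "vtt y \<tau> - (\<Sum>i\<in>UNIV. vxx i i y \<tau>) = (1 + \<tau>) powr (- m - 2) *
      (m * (m + 1) * S (bt y (1 + \<tau>)) + (2 * m + 2) * (bt y (1 + \<tau>) * S' (bt y (1 + \<tau>))) + (bt y (1 + \<tau>))\<^sup>2 * S'' (bt y (1 + \<tau>)))
      + (2 - 4 * m) * ((1 + \<tau>) powr (- m - 1) * S' (bt y (1 + \<tau>)))" if "0 \<le> \<tau>" for y \<tau>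
  proof -
    define r where "r = 1 + \<tau>"
    have r: "0 < r" using that by (simp add: r_def)
    define b where "b = bt y r"
    \<comment> \<open>The definition of \<beta> solved for |y|^2. It eliminates y and leaves an
      identity in r and \<beta>.\<close>
    have q: "y \<bullet> y = r * (r - b)" using r by (simp add: b_def bt_def field_simps)
    have p0: "r powr (- b) = r powr (- m) / r ^ n" if "b = m + real n" for b n
      using powr_shift[OF r, of m n] that by simp
    have p: "r powr (- (m + 1)) = r powr (-m) / r ^ 1" "r powr (- (m + 2)) = r powr (-m) / r^2" "r powr (- (m + 1 + 1)) = r powr (-m) / r^2"
      "r powr (- (m + 1 + 2)) = r powr (-m) / r^3" "r powr (- (m + 2 + 1)) = r powr (-m) / r^3"  "r powr (- (m + 2 + 2)) = r powr (-m) / r^4"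
      by (rule p0, simp)+
    have p': "r powr (- m - 2) = r powr (-m) / r^2" "r powr (- m - 1) = r powr (-m) / r ^ 1"
      using powr_shift[OF r, of m 1] powr_shift[OF r, of m 2] by simp_all
    define R where "R = r powr (- m)"
    have yy: "y $ 1 * y $ 1 + y $ 2 * y $ 2 = r * (r - b)" using q by (simp add: inner2)
    have "(\<Sum>i\<in>UNIV. vxx i i y \<tau>) = - 4 * (R / r * S' b) + 4 * (y $ 1 * y $ 1 + y $ 2 * y $ 2) * (R / r^2 * S'' b)"
      unfolding vxx_def hyp_def r_def[symmetric] b_def[symmetric] p p' R_def[symmetric] by (simp add: sum_2 algebra_simps)
    then have lap: "(\<Sum>i\<in>UNIV. vxx i i y \<tau>) = - 4 * (R / r * S' b) + 4 * (r * (r - b)) * (R / r^2 * S'' b)"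
      unfolding yy .
    show ?thesis
      unfolding lap vtt_def hyp_def r_def[symmetric] b_def[symmetric] p p' R_def[symmetric] q
      using r by (simp add: field_simps eval_nat_numeral)
  qed
  then have "calL (\<lambda>y \<tau>. vtt y \<tau> - (\<Sum>i\<in>UNIV. vxx i i y \<tau>)) x t = calL (\<lambda>y \<tau>. (1 + \<tau>) powr (- m - 2) *
      (m * (m + 1) * S (bt y (1 + \<tau>)) + (2 * m + 2) * (bt y (1 + \<tau>) * S' (bt y (1 + \<tau>))) + (bt y (1 + \<tau>))\<^sup>2 * S'' (bt y (1 + \<tau>)))
      + (2 - 4 * m) * ((1 + \<tau>) powr (- m - 1) * S' (bt y (1 + \<tau>)))) x t"
    by (intro calL_cong) auto
  ultimately show ?thesis
    by (simp add: v_def Rd_def Rm_def)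
qed

text \<open>The derivative of \<open>cutpow s 3\<close>, as given by
  \<open>cutpow_deriv\<close>.\<close>

definition dcut :: "real \<Rightarrow> real \<Rightarrow> real" where
  "dcut s \<beta> = - s * cutpow (s + 1) 3 \<beta> + 3 * cutpow (s + 2) 2 \<beta>"

text \<open>With \<theta> = \<beta> d/d\<beta> this is (\<theta> + m) (\<theta> + m + 1) applied to cutpow s 3.\<close>

definition eul :: "real \<Rightarrow> real \<Rightarrow> real \<Rightarrow> real" where
  "eul m s \<beta> = (m + 1 - s) * ((m - s) * cutpow s 3 \<beta> + 3 * cutpow (s + 1) 2 \<beta>)
    + 3 * ((m - s - 1) * cutpow (s + 1) 2 \<beta> + 2 * cutpow (s + 2) 1 \<beta>)"

text \<open>The polynomial in y = 1/\<beta> that remains of \<open>eul\<close> after taking out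
  \<beta>^(-s) and one zero at \<beta> = 1, see \<open>eul_expand\<close>. Estimates of the Euler
  part thus reduce to polynomials on [0, 1].\<close>

definition eulp :: "real \<Rightarrow> real \<Rightarrow> real \<Rightarrow> real" where
  "eulp m s y = (m + 1 - s) * ((m - s) * (1 - y)\<^sup>2 + 3 * (y * (1 - y))) + 3 * ((m - s - 1) * (y * (1 - y)) + 2 * y\<^sup>2)"

lemma cutpow_mult: "0 < j \<Longrightarrow> \<beta> * cutpow (s + 1) j \<beta> = cutpow s j \<beta>"
proof (cases "\<beta> > 1")
  case True
  then have "\<beta> * \<beta> powr (- (s + 1)) = \<beta> powr (- s)"
    using powr_shift[of \<beta> s 1] by simp
  then show ?thesis using True by (simp add: cutpow_ge1 mult.assoc[symmetric])
qed (simp add: cutpow_le1)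

lemma cutpow_add:
  assumes "1 \<le> \<beta>" shows "cutpow (s + real a) j \<beta> = \<beta> powr (- s) * ((1 / \<beta>) ^ a * (1 - 1 / \<beta>) ^ j)"
  using assms powr_shift[of \<beta> s a] by (simp add: cutpow_ge1 power_one_over field_simps)

lemma eul_expand:
  assumes "1 \<le> \<beta>" shows "eul m s \<beta> = \<beta> powr (- s) * (1 - 1 / \<beta>) * eulp m s (1 / \<beta>)"
proof -
  define y where "y = 1 / \<beta>"
  define P where "P = \<beta> powr (- s)"
  have c: "cutpow s 3 \<beta> = P * (1 - y) ^ 3" "cutpow (s + 1) 2 \<beta> = P * (y * (1 - y)\<^sup>2)" "cutpow (s + 2) 1 \<beta> = P * (y\<^sup>2 * (1 - y))"
    using cutpow_add[OF assms, of s 0 3] cutpow_add[OF assms, of s 1 2] cutpow_add[OF assms, of s 2 1]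
    by (simp_all add: y_def P_def)
  show ?thesis unfolding eul_def eulp_def c y_def[symmetric] P_def[symmetric] by algebra
qed

lemma dcut_le1: "\<beta> \<le> 1 \<Longrightarrow> dcut s \<beta> = 0" by (simp add: dcut_def cutpow_le1)
lemma eul_le1: "\<beta> \<le> 1 \<Longrightarrow> eul m s \<beta> = 0" by (simp add: eul_def cutpow_le1)

lemma continuous_on_dcut: "continuous_on S f \<Longrightarrow> continuous_on S (\<lambda>x. dcut s (f x))"
  and continuous_on_eul: "continuous_on S f \<Longrightarrow> continuous_on S (\<lambda>x. eul m s (f x))"
  unfolding dcut_def eul_def by (intro continuous_intros; assumption)+

text \<open>The wave operator of \<open>hyp m (cutpow s 3)\<close> at time r, see
  \<open>hyp_cutpow_eq\<close>.\<close>

definition boxcut :: "real \<Rightarrow> real \<Rightarrow> real^2 \<Rightarrow> real \<Rightarrow> real" where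
  "boxcut m s y r = r powr (- m - 2) * eul m s (bt y r) + (2 - 4 * m) * (r powr (- m - 1) * dcut s (bt y r))"

lemma hyp_cutpow_eq:
  assumes "0 \<le> t"
  shows "hyp m (cutpow s 3) x (1 + t) = calL (\<lambda>y \<tau>. boxcut m s y (1 + \<tau>)) x t"
proof -
  define S'' where "S'' \<beta> = - s * (- (s + 1) * cutpow (s + 2) 3 \<beta> + 3 * cutpow (s + 3) 2 \<beta>)
    + 3 * (- (s + 2) * cutpow (s + 3) 2 \<beta> + 2 * cutpow (s + 4) 1 \<beta>)" for \<beta>
  have d3: "(cutpow s 3 has_real_derivative - s * cutpow (s + 1) 3 y + 3 * cutpow (s + 2) 2 y) (at y)" for s y
    using cutpow_deriv[of s 1 y] by (simp add: numeral_3_eq_3 numeral_2_eq_2)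
  have d2: "(cutpow s 2 has_real_derivative - s * cutpow (s + 1) 2 y + 2 * cutpow (s + 2) 1 y) (at y)" for s y
    using cutpow_deriv[of s 0 y] by (simp add: numeral_2_eq_2)
  have "hyp m (cutpow s 3) x (1 + t) = calL (\<lambda>y \<tau>. (1 + \<tau>) powr (- m - 2) *
      (m * (m + 1) * cutpow s 3 (bt y (1 + \<tau>)) + (2 * m + 2) * (bt y (1 + \<tau>) * dcut s (bt y (1 + \<tau>))) + (bt y (1 + \<tau>))\<^sup>2 * S'' (bt y (1 + \<tau>)))
      + (2 - 4 * m) * ((1 + \<tau>) powr (- m - 1) * dcut s (bt y (1 + \<tau>)))) x t"
  proof (rule hyp_duhamel)
    show "(cutpow s 3 has_real_derivative dcut s y) (at y)" for y
      unfolding dcut_def by (rule d3)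
    show "(dcut s has_real_derivative S'' y) (at y)" for y
    proof -
      have "((\<lambda>\<beta>. - s * cutpow (s + 1) 3 \<beta> + 3 * cutpow (s + 2) 2 \<beta>) has_real_derivative
        - s * (- (s + 1) * cutpow (s + 1 + 1) 3 y + 3 * cutpow (s + 1 + 2) 2 y)
        + 3 * (- (s + 2) * cutpow (s + 2 + 1) 2 y + 2 * cutpow (s + 2 + 2) 1 y)) (at y)"
        by (intro DERIV_add DERIV_cmult d3 d2)
      then show ?thesis unfolding dcut_def[abs_def] S''_def by (simp add: add.assoc)
    qed
    show "continuous_on UNIV S''" unfolding S''_def[abs_def] by (intro continuous_intros)
  qed (use assms in \<open>auto simp: cutpow_le1 dcut_le1\<close>)
  moreover have "m * (m + 1) * cutpow s 3 \<beta> + (2 * m + 2) * (\<beta> * dcut s \<beta>) + \<beta>\<^sup>2 * S'' \<beta> = eul m s \<beta>" for \<beta>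
  proof -
    have 1: "\<beta> * cutpow (s + 1) 3 \<beta> = cutpow s 3 \<beta>" "\<beta> * cutpow (s + 2) 2 \<beta> = cutpow (s + 1) 2 \<beta>"
      "\<beta> * cutpow (s + 2) 3 \<beta> = cutpow (s + 1) 3 \<beta>" "\<beta> * cutpow (s + 3) 2 \<beta> = cutpow (s + 2) 2 \<beta>"
      "\<beta> * cutpow (s + 4) 1 \<beta> = cutpow (s + 3) 1 \<beta>" "\<beta> * cutpow (s + 3) 1 \<beta> = cutpow (s + 2) 1 \<beta>"
      using cutpow_mult[of 3 \<beta> s] cutpow_mult[of 2 \<beta> "s + 1"] cutpow_mult[of 3 \<beta> "s + 1"] cutpow_mult[of 2 \<beta> "s + 2"]
        cutpow_mult[of 1 \<beta> "s + 3"] cutpow_mult[of 1 \<beta> "s + 2"] by (simp_all add: add.assoc)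
    have a1: "\<beta> * dcut s \<beta> = - s * cutpow s 3 \<beta> + 3 * cutpow (s + 1) 2 \<beta>"
      unfolding dcut_def 1[symmetric] by (simp add: algebra_simps)
    have a2: "\<beta>\<^sup>2 * S'' \<beta> = - s * (- (s + 1) * cutpow s 3 \<beta> + 3 * cutpow (s + 1) 2 \<beta>)
        + 3 * (- (s + 2) * cutpow (s + 1) 2 \<beta> + 2 * cutpow (s + 2) 1 \<beta>)"
    proof -
      have "\<beta>\<^sup>2 * S'' \<beta> = - s * (- (s + 1) * (\<beta> * (\<beta> * cutpow (s + 2) 3 \<beta>)) + 3 * (\<beta> * (\<beta> * cutpow (s + 3) 2 \<beta>)))
        + 3 * (- (s + 2) * (\<beta> * (\<beta> * cutpow (s + 3) 2 \<beta>)) + 2 * (\<beta> * (\<beta> * cutpow (s + 4) 1 \<beta>)))"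
        unfolding S''_def by (simp add: algebra_simps power2_eq_square)
      then show ?thesis unfolding 1 .
    qed
    show ?thesis unfolding a1 a2 eul_def by (simp add: algebra_simps)
  qed
  ultimately show ?thesis by (simp add: boxcut_def)
qed

section \<open>The supersolution and the two source estimates\<close>

lemma continuous_on_bt1: "0 \<le> T \<Longrightarrow> 0 < c \<Longrightarrow> continuous_on (UNIV \<times> {0..T}) (\<lambda>z. bt (fst z) (c + snd z))"
  unfolding bt_def by (intro continuous_intros) auto

lemma cstrip_cut:
  assumes "0 \<le> T" "0 < c" shows "cstrip T (\<lambda>x \<tau>. (c + \<tau>) powr a * cutpow s j (bt x (c + \<tau>)))"
  unfolding cstrip_def split_beta using assms
  by (intro continuous_intros continuous_on_bt1) auto

lemma cstrip_boxcut:
  assumes "0 \<le> T" shows "cstrip T (\<lambda>x \<tau>. boxcut m s x (1 + \<tau>))"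
  unfolding cstrip_def split_beta boxcut_def using assms
  by (intro continuous_intros continuous_on_bt1 continuous_on_eul continuous_on_dcut) auto

text \<open>Sorting by k = 1/2 - n isolates the constant k, because k ((1 - y) + y)^2 = k, and all
  remaining terms are nonnegative. This lower bound is the origin of the factor 1/(1/2 - n) in the
  source estimates.\<close>

lemma eulp_half:
  assumes "1 / 4 \<le> n" "n < 1 / 2" "0 \<le> y" "y \<le> 1"
  shows "1 / 2 - n \<le> eulp (1 / 2) n y"
proof -
  define k where "k = 1 / 2 - n"
  have k: "0 < k" "k \<le> 1 / 4" using assms by (auto simp: k_def)
  have "eulp (1 / 2) n y = (1 + k) * (k * (1 - y)\<^sup>2 + 3 * (y * (1 - y))) + 3 * ((k - 1) * (y * (1 - y)) + 2 * y\<^sup>2)"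
    unfolding eulp_def k_def by (simp add: algebra_simps)
  also have "\<dots> = k + k * k * (1 - y)\<^sup>2 + 4 * (k * (y * (1 - y))) + (6 - k) * y\<^sup>2"
    by (simp add: algebra_simps power2_eq_square)
  also have "\<dots> \<ge> k" using k assms by (simp add: add_nonneg_nonneg)
  finally show ?thesis by (simp add: k_def)
qed

text \<open>The supersolution is \<Lambda> times the profile with m = 1/2 minus corrections with m =
  1/2 + n. For the corrections 2 - 4m = -4n, so subtracting them yields the positive term 4n r^(-3/2
  - n) S', which dominates the source. Their Euler part, bounded by Z, is absorbed by the first
  profile, whose singular term vanishes and whose Euler part is positive.\<close>

lemma comparison:
  assumes n: "1 / 4 \<le> n" "n < 1 / 2" and t: "0 \<le> t"
    and Z: "\<And>\<beta>. 1 < \<beta> \<Longrightarrow> \<beta> \<le> 1 + t \<Longrightarrow> c1 * eul (1 / 2 + n) s1 \<beta> + c2 * eul (1 / 2 + n) s2 \<beta> \<le> Z * (1 - 1 / \<beta>)"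
    and G: "\<And>\<beta>. 1 < \<beta> \<Longrightarrow> c * cutpow s j \<beta> \<le> c1 * dcut s1 \<beta> + c2 * dcut s2 \<beta>"
    and nn: "\<And>\<beta>. 1 < \<beta> \<Longrightarrow> 0 \<le> c1 * cutpow s1 3 \<beta> + c2 * cutpow s2 3 \<beta>"
    and Z0: "0 \<le> Z" and j: "0 < j" and c: "0 \<le> c"
  shows "c * calL (\<lambda>y \<tau>. (1 + \<tau>) powr (- 3 / 2 - n) * cutpow s j (bt y (1 + \<tau>))) x t
     \<le> Z / (1 / 2 - n) * ((1 + t) powr (- 1 / 2) * cutpow n 3 (bt x (1 + t)))"
proof -
  define \<Lambda> where "\<Lambda> = Z / (1 / 2 - n)"
  have \<Lambda>: "0 \<le> \<Lambda>" "\<Lambda> * (1 / 2 - n) = Z" using Z0 n by (simp_all add: \<Lambda>_def)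
  let ?f = "\<lambda>y \<tau>. \<Lambda> * boxcut (1 / 2) n y (1 + \<tau>) + (- c1 * boxcut (1 / 2 + n) s1 y (1 + \<tau>) + - c2 * boxcut (1 / 2 + n) s2 y (1 + \<tau>))"
  have cb: "cstrip t (\<lambda>y \<tau>. boxcut m s y (1 + \<tau>))" for m s by (rule cstrip_boxcut[OF t])
  have tt: "t \<in> {0..t}" using t by simp
  have "c * calL (\<lambda>y \<tau>. (1 + \<tau>) powr (- 3 / 2 - n) * cutpow s j (bt y (1 + \<tau>))) x t =
     calL (\<lambda>y \<tau>. c * ((1 + \<tau>) powr (- 3 / 2 - n) * cutpow s j (bt y (1 + \<tau>)))) x t"
    by (simp add: calL_cmult)
  also have "\<dots> \<le> calL ?f x t"
  proof (rule calL_mono[where T=t])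
    show "cstrip t (\<lambda>y \<tau>. c * ((1 + \<tau>) powr (- 3 / 2 - n) * cutpow s j (bt y (1 + \<tau>))))"
      by (intro cstrip_mult[OF cstrip_const] cstrip_cut t) simp
    show "cstrip t ?f" by (intro cstrip_add cstrip_mult[OF cstrip_const] cb)
    fix y \<tau> assume \<tau>: "0 \<le> \<tau>" "\<tau> \<le> t"
    define r where "r = 1 + \<tau>"
    define \<beta> where "\<beta> = bt y r"
    have r: "1 \<le> r" using \<tau> by (simp add: r_def)
    show "c * ((1 + \<tau>) powr (- 3 / 2 - n) * cutpow s j (bt y (1 + \<tau>))) \<le> ?f y \<tau>"
    proof (cases "\<beta> \<le> 1")
      case True
      then show ?thesis unfolding boxcut_def r_def[symmetric] \<beta>_def[symmetric]
        by (simp add: cutpow_le1 eul_le1 dcut_le1 j)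
    next
      case False
      then have b: "1 < \<beta>" by simp
      have br: "\<beta> \<le> r" using bt_le[of r y] r by (simp add: \<beta>_def)
      define y0 where "y0 = 1 / \<beta>"
      have y0: "0 \<le> y0" "y0 \<le> 1" using b by (simp_all add: y0_def)
      have e1: "(1 / 2 - n) * (\<beta> powr (- n) * (1 - 1 / \<beta>)) \<le> eul (1 / 2) n \<beta>"
      proof -
        have "\<beta> powr (- n) * (1 - 1 / \<beta>) * (1 / 2 - n) \<le> \<beta> powr (- n) * (1 - 1 / \<beta>) * eulp (1 / 2) n y0"
          using b y0 by (intro mult_left_mono eulp_half n) auto
        then show ?thesis using b by (simp add: eul_expand y0_def mult_ac)
      qed
      \<comment> \<open>Since \<beta> is at most r, the additional factor r^(-n) of the corrections
        turns into \<beta>^(-n), the profile of the main term. The choice \<Lambda> (1/2 - n) = Z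
        then lets the main term absorb the error.\<close>
      have "r powr (- n) \<le> \<beta> powr (- n)" using b br n by (intro powr_mono2') auto
      then have "Z * (r powr (- n) * (1 - 1 / \<beta>)) \<le> Z * (\<beta> powr (- n) * (1 - 1 / \<beta>))"
        using b Z0 by (intro mult_left_mono mult_right_mono) auto
      also have "\<dots> = \<Lambda> * ((1 / 2 - n) * (\<beta> powr (- n) * (1 - 1 / \<beta>)))" using \<Lambda>(2) by (simp add: mult.assoc[symmetric])
      also have "\<dots> \<le> \<Lambda> * eul (1 / 2) n \<beta>" by (intro mult_left_mono e1 \<Lambda>)
      finally have A: "r powr (- n) * (Z * (1 - 1 / \<beta>)) \<le> \<Lambda> * eul (1 / 2) n \<beta>" by (simp add: mult_ac)
      have "r powr (- n) * (c1 * eul (1 / 2 + n) s1 \<beta> + c2 * eul (1 / 2 + n) s2 \<beta>) \<le> r powr (- n) * (Z * (1 - 1 / \<beta>))"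
        using b br \<tau> by (intro mult_left_mono Z) (auto simp: r_def)
      with A have B: "r powr (- n) * (c1 * eul (1 / 2 + n) s1 \<beta> + c2 * eul (1 / 2 + n) s2 \<beta>) \<le> \<Lambda> * eul (1 / 2) n \<beta>"
        by linarith
      \<comment> \<open>Here n at least 1/4 is used: the coefficient 4n is at least one.\<close>
      have C: "c * cutpow s j \<beta> \<le> 4 * n * (c1 * dcut s1 \<beta> + c2 * dcut s2 \<beta>)"
      proof -
        have "1 * (c1 * dcut s1 \<beta> + c2 * dcut s2 \<beta>) \<le> 4 * n * (c1 * dcut s1 \<beta> + c2 * dcut s2 \<beta>)"
          using n G[OF b] cutpow_nonneg[of s j \<beta>] c order_trans[OF mult_nonneg_nonneg G[OF b]]
          by (intro mult_right_mono) auto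
        then have "c1 * dcut s1 \<beta> + c2 * dcut s2 \<beta> \<le> 4 * n * (c1 * dcut s1 \<beta> + c2 * dcut s2 \<beta>)" by simp
        then show ?thesis by (rule order_trans[OF G[OF b]])
      qed
      have p: "r powr (- (1 / 2 + n) - 2) = r powr (- 5 / 2) * r powr (- n)" "r powr (- (1 / 2 + n) - 1) = r powr (- 3 / 2 - n)"
        "r powr (- (1 / 2) - 2) = r powr (- 5 / 2)"
        unfolding powr_add[symmetric] by (rule arg_cong[where f="\<lambda>s. r powr s"]; simp)+
      have "?f y \<tau> = r powr (- 5 / 2) * (\<Lambda> * eul (1 / 2) n \<beta> - r powr (- n) * (c1 * eul (1 / 2 + n) s1 \<beta> + c2 * eul (1 / 2 + n) s2 \<beta>))
         + r powr (- 3 / 2 - n) * (4 * n * (c1 * dcut s1 \<beta> + c2 * dcut s2 \<beta>))"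
        unfolding boxcut_def r_def[symmetric] \<beta>_def[symmetric] p by (simp add: algebra_simps)
      also have "\<dots> \<ge> 0 + r powr (- 3 / 2 - n) * (c * cutpow s j \<beta>)"
        using B C by (intro add_mono mult_left_mono mult_nonneg_nonneg) auto
      finally show ?thesis unfolding r_def[symmetric] \<beta>_def[symmetric] by (simp add: mult_ac)
    qed
  qed (rule tt)
  also have "\<dots> = \<Lambda> * hyp (1 / 2) (cutpow n 3) x (1 + t) + (- c1 * hyp (1 / 2 + n) (cutpow s1 3) x (1 + t) + - c2 * hyp (1 / 2 + n) (cutpow s2 3) x (1 + t))"
    unfolding hyp_cutpow_eq[OF t] calL_cmult[symmetric]
    by (subst calL_add[OF _ _ tt], (intro cstrip_add cstrip_mult[OF cstrip_const] cb)+)+ simp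
  also have "\<dots> \<le> \<Lambda> * hyp (1 / 2) (cutpow n 3) x (1 + t)"
  proof -
    let ?\<beta> = "bt x (1 + t)"
    have "0 \<le> c1 * cutpow s1 3 ?\<beta> + c2 * cutpow s2 3 ?\<beta>"
      using nn[of ?\<beta>] by (cases "1 < ?\<beta>") (auto simp: cutpow_le1)
    then have "0 \<le> (1 + t) powr (- (1 / 2 + n)) * (c1 * cutpow s1 3 ?\<beta> + c2 * cutpow s2 3 ?\<beta>)" by simp
    then show ?thesis by (simp add: hyp_def algebra_simps)
  qed
  finally show ?thesis by (simp add: \<Lambda>_def hyp_def)
qed

text \<open>24 = 3 * 5 + 3 * (1 + 2), from estimating the factors separately by m + 1 + \<kappa> at
  most 3 and m + \<kappa> at most 2.\<close>

lemma eulp_le: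
  assumes "3 / 4 \<le> m" "m \<le> 1" "0 \<le> \<kappa>" "\<kappa> \<le> 1" "0 \<le> y" "y \<le> 1"
  shows "eulp m (- \<kappa>) y \<le> 24"
proof -
  have y: "0 \<le> y * (1 - y)" "y * (1 - y) \<le> 1" "(1 - y)\<^sup>2 \<le> 1" "0 \<le> (1 - y)\<^sup>2" "y\<^sup>2 \<le> 1" "0 \<le> y\<^sup>2"
    using assms by (auto simp: power_le_one mult_le_one)
  have 1: "(m + \<kappa>) * (1 - y)\<^sup>2 \<le> 2 * 1" "(m + \<kappa> - 1) * (y * (1 - y)) \<le> 1 * 1"
    using assms y by (intro mult_mono; simp)+ 
  have "(m + 1 + \<kappa>) * ((m + \<kappa>) * (1 - y)\<^sup>2 + 3 * (y * (1 - y))) \<le> 3 * 5"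
    using assms y 1 by (intro mult_mono) auto
  then show ?thesis using 1 y unfolding eulp_def by (simp add: algebra_simps)
qed

lemma eulp_half_ge:
  assumes "3 / 4 \<le> m" "m \<le> 1" "0 \<le> y" "y \<le> 1"
  shows "- 3 \<le> eulp m (1 / 2) y"
proof -
  have y: "0 \<le> y * (1 - y)" "y * (1 - y) \<le> 1" "(1 - y)\<^sup>2 \<le> 1" "0 \<le> (1 - y)\<^sup>2" "0 \<le> y\<^sup>2"
    using assms by (auto simp: power_le_one mult_le_one)
  have "0 \<le> (m + 1 - 1 / 2) * ((m - 1 / 2) * (1 - y)\<^sup>2 + 3 * (y * (1 - y)))"
    using assms y by (intro mult_nonneg_nonneg add_nonneg_nonneg) auto
  moreover have "(3 / 2 - m) * (y * (1 - y)) \<le> 1 * 1"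
    using assms y by (intro mult_mono) auto
  moreover have "(m - 1 / 2 - 1) * (y * (1 - y)) = - ((3 / 2 - m) * (y * (1 - y)))"
    by (simp add: algebra_simps)
  ultimately have "- 3 + 0 \<le> 3 * ((m - 1 / 2 - 1) * (y * (1 - y))) + 6 * y\<^sup>2"
    using y by (intro add_mono) auto
  with \<open>0 \<le> (m + 1 - 1 / 2) * _\<close> show ?thesis unfolding eulp_def by argo
qed

text \<open>A source like \<beta>^(-3/2) is integrable in \<beta>: the cut-off version of 2 -
  \<beta>^(-1/2) is a bounded correction whose derivative is at least half of the source. The
  derivative of the first term pays for the error that the cut-off causes in the second. The
  constant is 51 = 2 * 24 + 3, doubled because of the factor 1/2.\<close>

lemma source_cone:
  assumes n: "1 / 4 \<le> n" "n < 1 / 2" and t: "0 \<le> t"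
  shows "calL (\<lambda>y \<tau>. (1 + \<tau>) powr (- 3 / 2 - n) * cutpow (3 / 2) 3 (bt y (1 + \<tau>))) x t
     \<le> 102 / (1 / 2 - n) * ((1 + t) powr (- 1 / 2) * cutpow n 3 (bt x (1 + t)))"
proof -
  have "1 / 2 * calL (\<lambda>y \<tau>. (1 + \<tau>) powr (- 3 / 2 - n) * cutpow (3 / 2) 3 (bt y (1 + \<tau>))) x t
     \<le> 51 / (1 / 2 - n) * ((1 + t) powr (- 1 / 2) * cutpow n 3 (bt x (1 + t)))"
  proof (rule comparison[where ?c1.0=2 and ?s1.0=0 and ?c2.0="-1" and ?s2.0="1/2", OF n t])
    fix \<beta> :: real assume b: "1 < \<beta>"
    have y: "0 \<le> 1 / \<beta>" "1 / \<beta> \<le> 1" using b by auto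
    have bh: "\<beta> powr (- (1 / 2)) \<le> 1" "0 \<le> \<beta> powr (- (1 / 2))" using b powr_mono[of "-(1/2)" 0 \<beta>] by auto
    {
      have "2 * eulp (1 / 2 + n) 0 (1 / \<beta>) \<le> 2 * 24"
        using eulp_le[of "1 / 2 + n" 0 "1 / \<beta>"] n y by simp
      moreover have "\<beta> powr (- (1 / 2)) * - eulp (1 / 2 + n) (1 / 2) (1 / \<beta>) \<le> 1 * 3"
      proof -
        have "- eulp (1 / 2 + n) (1 / 2) (1 / \<beta>) \<le> 3" using eulp_half_ge[of "1 / 2 + n" "1 / \<beta>"] n y by simp
        then have "\<beta> powr (- (1 / 2)) * - eulp (1 / 2 + n) (1 / 2) (1 / \<beta>) \<le> \<beta> powr (- (1 / 2)) * 3"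
          using bh by (intro mult_left_mono)
        then show ?thesis using bh by linarith
      qed
      ultimately have "(1 - 1 / \<beta>) * (2 * eulp (1 / 2 + n) 0 (1 / \<beta>) + \<beta> powr (- (1 / 2)) * - eulp (1 / 2 + n) (1 / 2) (1 / \<beta>)) \<le> (1 - 1 / \<beta>) * 51"
        using b by (intro mult_left_mono) auto
      then show "2 * eul (1 / 2 + n) 0 \<beta> + - 1 * eul (1 / 2 + n) (1 / 2) \<beta> \<le> 51 * (1 - 1 / \<beta>)"
        using b by (simp add: eul_expand) (simp add: algebra_simps)
    }
    have c5: "cutpow (5 / 2) 2 \<beta> \<le> cutpow 2 2 \<beta>"
      using b by (simp add: cutpow_ge1 mult_right_mono)
    then show "1 / 2 * cutpow (3 / 2) 3 \<beta> \<le> 2 * dcut 0 \<beta> + - 1 * dcut (1 / 2) \<beta>"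
      using cutpow_nonneg[of 2 2 \<beta>] by (simp add: dcut_def)
    have "cutpow (1 / 2) 3 \<beta> \<le> cutpow 0 3 \<beta>"
      using b bh by (simp add: cutpow_ge1 mult_left_le_one_le)
    then show "0 \<le> 2 * cutpow 0 3 \<beta> + - 1 * cutpow (1 / 2) 3 \<beta>"
      using cutpow_nonneg[of 0 3 \<beta>] by simp
  qed auto
  moreover have "102 / (1 / 2 - n) * w = 2 * (51 / (1 / 2 - n) * w)" for w by simp
  ultimately show ?thesis by simp
qed

text \<open>The correction is the cut-off version of \<beta>^\<kappa> / \<kappa>, whose derivative
  is at least \<beta>^(\<kappa> - 1). It is unbounded, and its size for \<beta> up to 1 + t is the
  price (1 + t)^\<kappa> / \<kappa>.\<close>

lemma source_spread:
  assumes n: "1 / 4 \<le> n" "n < 1 / 2" and t: "0 \<le> t" and \<kappa>: "0 < \<kappa>" "\<kappa> \<le> 1"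
  shows "calL (\<lambda>y \<tau>. (1 + \<tau>) powr (- 3 / 2 - n) * cutpow (1 - \<kappa>) 3 (bt y (1 + \<tau>))) x t
     \<le> 24 * (1 + t) powr \<kappa> / \<kappa> / (1 / 2 - n) * ((1 + t) powr (- 1 / 2) * cutpow n 3 (bt x (1 + t)))"
proof -
  have "1 * calL (\<lambda>y \<tau>. (1 + \<tau>) powr (- 3 / 2 - n) * cutpow (1 - \<kappa>) 3 (bt y (1 + \<tau>))) x t
     \<le> 24 * (1 + t) powr \<kappa> / \<kappa> / (1 / 2 - n) * ((1 + t) powr (- 1 / 2) * cutpow n 3 (bt x (1 + t)))"
  proof (rule comparison[where ?c1.0="1 / \<kappa>" and ?s1.0="- \<kappa>" and ?c2.0=0 and ?s2.0=0, OF n t])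
    fix \<beta> :: real assume b: "1 < \<beta>"
    have y: "0 \<le> 1 / \<beta>" "1 / \<beta> \<le> 1" using b by auto
    show "1 / \<kappa> * eul (1 / 2 + n) (- \<kappa>) \<beta> + 0 * eul (1 / 2 + n) 0 \<beta> \<le> 24 * (1 + t) powr \<kappa> / \<kappa> * (1 - 1 / \<beta>)"
      if "\<beta> \<le> 1 + t"
    proof -
      have "\<beta> powr \<kappa> * (1 - 1 / \<beta>) * eulp (1 / 2 + n) (- \<kappa>) (1 / \<beta>) \<le> \<beta> powr \<kappa> * (1 - 1 / \<beta>) * 24"
        using b n \<kappa> y by (intro mult_left_mono eulp_le) auto
      also have "\<dots> \<le> (1 + t) powr \<kappa> * (1 - 1 / \<beta>) * 24"
        using b that \<kappa> by (intro mult_right_mono powr_mono2) auto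
      finally have "eul (1 / 2 + n) (- \<kappa>) \<beta> \<le> (1 + t) powr \<kappa> * (1 - 1 / \<beta>) * 24"
        using b by (simp add: eul_expand)
      then have "1 / \<kappa> * eul (1 / 2 + n) (- \<kappa>) \<beta> \<le> 1 / \<kappa> * ((1 + t) powr \<kappa> * (1 - 1 / \<beta>) * 24)"
        using \<kappa> by (intro mult_left_mono) auto
      then show ?thesis by (simp add: mult_ac)
    qed
    show "1 * cutpow (1 - \<kappa>) 3 \<beta> \<le> 1 / \<kappa> * dcut (- \<kappa>) \<beta> + 0 * dcut 0 \<beta>"
      using cutpow_nonneg[of "2 - \<kappa>" 2 \<beta>] \<kappa> by (simp add: dcut_def field_simps)
    show "0 \<le> 1 / \<kappa> * cutpow (- \<kappa>) 3 \<beta> + 0 * cutpow 0 3 \<beta>"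
      using cutpow_nonneg \<kappa> by simp
  qed (use \<kappa> t in auto)
  then show ?thesis by simp
qed

text \<open>The left side omits the source during the first s units of time, which only lowers the
  value for a nonnegative source. In this way estimates starting at time 1 become estimates starting
  at time K.\<close>

lemma calL_time_shift:
  assumes F: "cstrip (t + s) F" and nn: "\<And>y \<tau>. 0 \<le> \<tau> \<Longrightarrow> \<tau> \<le> t + s \<Longrightarrow> 0 \<le> F y \<tau>" and s: "0 \<le> s" and t: "0 \<le> t"
  shows "calL (\<lambda>y \<tau>. F y (\<tau> + s)) x t \<le> calL F x (t + s)"
proof -
  let ?g = "\<lambda>\<tau>. Rm (\<lambda>y. F y \<tau>) x (t + s - \<tau>)"
  have c: "continuous_on {0..t + s} ?g"
    by (intro cstrip_Rm[OF F]) (auto intro!: continuous_intros)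
  have nng: "0 \<le> ?g \<tau>" if "0 \<le> \<tau>" "\<tau> \<le> t + s" for \<tau>
  proof -
    have "continuous_on UNIV (\<lambda>y. F y \<tau>)" using that by (intro cstrip_slice[OF F]) auto
    from Rm_mono[OF continuous_on_const this, of "t + s - \<tau>" x 0] show ?thesis
      using that nn by (simp add: Rm_const)
  qed
  have "(?g has_integral integral {s..t + s} ?g) {s..t + s}"
    using s by (intro integrable_integral integrable_continuous_real continuous_on_subset[OF c]) auto
  from has_integral_affinity[of ?g _ s "t + s" 1 s, unfolded cbox_interval, OF this]
  have "((\<lambda>\<tau>. ?g (\<tau> + s)) has_integral integral {s..t + s} ?g) ((\<lambda>\<tau>. \<tau> - s) ` {s..t + s})"
    by simp
  moreover have "(\<lambda>\<tau>. \<tau> - s) ` {s..t + s} = {0..t}"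
    by (auto simp: image_iff intro!: bexI[of _ "_ + s"])
  ultimately have "((\<lambda>\<tau>. Rm (\<lambda>y. F y (\<tau> + s)) x (t - \<tau>)) has_integral integral {s..t + s} ?g) {0..t}"
    by simp
  then have "calL (\<lambda>y \<tau>. F y (\<tau> + s)) x t = integral {s..t + s} ?g"
    by (simp add: calL_def integral_unique)
  also have "\<dots> \<le> integral {0..t + s} ?g"
    using s t nng c by (intro integral_subset_le integrable_continuous_real) (auto intro: continuous_on_subset)
  finally show ?thesis by (simp add: calL_def)
qed

section \<open>The integral operators of the statement\<close>

definition vec2 :: "real \<Rightarrow> real \<Rightarrow> real^2" where
  "vec2 a b = a *\<^sub>R axis 1 1 + b *\<^sub>R axis 2 1"

lemma vec2_nth [simp]: "vec2 a b $ 1 = a" "vec2 a b $ 2 = b"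
  by (simp_all add: vec2_def axis_def)

lemma norm_vec2: "(norm (vec2 a b))\<^sup>2 = a\<^sup>2 + b\<^sup>2"
  by (simp add: norm_vec_def L2_set_def sum_2)

lemma measurable_vec2 [measurable]: "(\<lambda>z. vec2 (fst z) (snd z)) \<in> borel_measurable (lborel \<Otimes>\<^sub>M lborel)"
proof -
  have "(\<lambda>z. vec2 (fst z) (snd z)) \<in> borel_measurable borel"
    unfolding vec2_def by (intro borel_measurable_continuous_onI continuous_intros)
  then show ?thesis by (simp add: lborel_prod)
qed

lemma measurable_vec2' [measurable (raw)]:
  assumes [measurable]: "f \<in> borel_measurable M" "g \<in> borel_measurable M"
  shows "(\<lambda>x. vec2 (f x) (g x)) \<in> borel_measurable M"
  unfolding vec2_def by measurable

lemma lborel_vec2: "(lborel :: (real^2) measure) = distr (lborel \<Otimes>\<^sub>M lborel) borel (\<lambda>z. vec2 (fst z) (snd z))"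
proof (rule lborel_eqI)
  fix l u :: "real^2" assume le: "\<And>b. b \<in> Basis \<Longrightarrow> l \<bullet> b \<le> u \<bullet> b"
  have b: "l $ 1 \<le> u $ 1" "l $ 2 \<le> u $ 2"
    using le[of "axis 1 1"] le[of "axis 2 1"] by (auto simp: Basis2 inner_axis)
  have "(\<lambda>z. vec2 (fst z) (snd z)) -` box l u \<inter> space (lborel \<Otimes>\<^sub>M lborel) = {l$1<..<u$1} \<times> {l$2<..<u$2}"
    by (auto simp: mem_box Basis2 inner_axis space_pair_measure)
  then have "emeasure (distr (lborel \<Otimes>\<^sub>M lborel) borel (\<lambda>z. vec2 (fst z) (snd z))) (box l u) =
    emeasure (lborel \<Otimes>\<^sub>M lborel) ({l$1<..<u$1} \<times> {l$2<..<u$2})"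
    by (subst emeasure_distr) auto
  also have "\<dots> = ennreal (u$1 - l$1) * ennreal (u$2 - l$2)"
    using b by (subst lborel.emeasure_pair_measure_Times) auto
  also have "\<dots> = ennreal (\<Prod>b\<in>Basis. (u - l) \<bullet> b)"
  proof -
    have "axis 1 1 \<noteq> (axis 2 1 :: real^2)" by (simp add: axis_eq_axis)
    then show ?thesis using b by (simp add: Basis2 inner_axis ennreal_mult)
  qed
  finally show "emeasure (distr (lborel \<Otimes>\<^sub>M lborel) borel (\<lambda>z. vec2 (fst z) (snd z))) (box l u) = ennreal (\<Prod>b\<in>Basis. (u - l) \<bullet> b)" .
qed simp

lemma pt_vec2: "pt z = vec2 (- cos (fst z)) (- (sin (fst z) * cos (snd z)))"
  by (simp add: pt_def vec2_def)

lemma measurable_disc_weight [measurable]: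
  "(\<lambda>\<xi>::real^2. indicator (cball 0 1) \<xi> / sqrt (1 - (norm \<xi>)\<^sup>2) :: real) \<in> borel_measurable borel"
proof -
  have "(\<lambda>\<xi>::real^2. sqrt (1 - (norm \<xi>)\<^sup>2)) \<in> borel_measurable borel"
    by (intro borel_measurable_continuous_onI continuous_intros)
  moreover have "(indicator (cball 0 1) :: real^2 \<Rightarrow> real) \<in> borel_measurable borel"
    by (intro borel_measurable_indicator borel_closed closed_cball)
  ultimately show ?thesis by (rule borel_measurable_divide[rotated])
qed

lemma measurable_box_weight [measurable]:
  "(\<lambda>z::real \<times> real. indicator (cbox (0, 0) (pi, pi)) z * sin (fst z) :: real) \<in> borel_measurable borel"
  by (intro borel_measurable_times borel_measurable_indicator borel_closed closed_cbox
      borel_measurable_continuous_onI continuous_on_sin continuous_on_fst continuous_on_id)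

text \<open>Two substitutions in nonnegative integrals: b = -sqrt(1 - a^2) cos \<theta> cancels the
  weight, and after exchanging the integrals a = -cos \<alpha> creates the density sin \<alpha>. As
  an identity of measures it transfers integrals without a separate integrability proof for the
  singular weight.\<close>

lemma disc_measure:
  "density lborel (\<lambda>\<xi>::real^2. ennreal (indicator (cball 0 1) \<xi> / sqrt (1 - (norm \<xi>)\<^sup>2))) =
   distr (density lborel (\<lambda>z. ennreal (indicator (cbox (0, 0) (pi, pi)) z * sin (fst z)))) borel pt"
    (is "?M1 = ?M2")
proof (rule measure_eqI)
  show "sets ?M1 = sets ?M2" by simp
  fix A :: "(real^2) set" assume "A \<in> sets ?M1"
  then have A [measurable]: "A \<in> sets borel" by simp
  let ?IA = "\<lambda>a b. indicator A (vec2 a b) :: real"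
  let ?w = "\<lambda>a b. indicator (cball 0 1) (vec2 a b) / sqrt (1 - (a\<^sup>2 + b\<^sup>2)) :: real"
  \<comment> \<open>For a = 1 and a = -1 the slice of the disc is a single point and the two sides
    may differ; these values form a null set.\<close>
  have inner: "(\<integral>\<^sup>+b. ennreal (?w a b) * indicator A (vec2 a b) \<partial>lborel) =
      (\<integral>\<^sup>+\<theta>. ennreal (?IA a (- (sqrt (1 - a\<^sup>2) * cos \<theta>)) * indicator {-1..1} a * indicator {0..pi} \<theta>) \<partial>lborel)"
    if "a \<noteq> 1" "a \<noteq> -1" for a
  proof (cases "\<bar>a\<bar> < 1")
    case False
    then have "1 < \<bar>a\<bar>" using that by linarith
    then have "1 < a\<^sup>2" using one_less_power[of "\<bar>a\<bar>" 2] by simp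
    then have "1 < (norm (vec2 a b))\<^sup>2" for b unfolding norm_vec2 using zero_le_power2[of b] by linarith
    then have "vec2 a b \<notin> cball 0 1" for b using power_le_one[of "norm (vec2 a b)" 2] by (force simp: not_le[symmetric])
    moreover have "a \<notin> {-1..1}" using \<open>1 < \<bar>a\<bar>\<close> by auto
    ultimately show ?thesis by simp
  next
    case True
    define s where "s = sqrt (1 - a\<^sup>2)"
    have s: "0 < s" "s\<^sup>2 = 1 - a\<^sup>2" using True by (auto simp: s_def abs_square_less_1 intro!: less_imp_le)
    let ?f = "\<lambda>b. ?IA a b / sqrt (1 - (a\<^sup>2 + b\<^sup>2))"
    have m: "set_borel_measurable borel {- s * cos 0..- s * cos pi} ?f"
      unfolding set_borel_measurable_def by measurable
    have "ennreal (?w a b) * indicator A (vec2 a b) = ennreal (?f b * indicator {- s * cos 0..- s * cos pi} b)" for b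
    proof -
      have "vec2 a b \<in> cball 0 1 \<longleftrightarrow> (norm (vec2 a b))\<^sup>2 \<le> 1" by (simp add: abs_square_le_1)
      also have "\<dots> \<longleftrightarrow> b\<^sup>2 \<le> s\<^sup>2" unfolding norm_vec2 s(2) by auto
      also have "\<dots> \<longleftrightarrow> b \<in> {-s..s}" using s(1) by (auto simp: abs_le_square_iff[symmetric] abs_le_iff)
      finally show ?thesis by (auto simp: indicator_def)
    qed
    then have "(\<integral>\<^sup>+b. ennreal (?w a b) * indicator A (vec2 a b) \<partial>lborel) = (\<integral>\<^sup>+b. ennreal (?f b * indicator {- s * cos 0..- s * cos pi} b) \<partial>lborel)"
      by simp
    also have "\<dots> = (\<integral>\<^sup>+\<theta>. ennreal (?f (- s * cos \<theta>) * (s * sin \<theta>) * indicator {0..pi} \<theta>) \<partial>lborel)"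
      by (rule nn_integral_substitution[where f="?f" and g="\<lambda>\<theta>. - s * cos \<theta>" and a=0 and b=pi, OF m])
        (use s in \<open>auto intro!: derivative_eq_intros continuous_intros mult_nonneg_nonneg sin_ge_zero\<close>)
    also have "\<dots> = (\<integral>\<^sup>+\<theta>. ennreal (?IA a (- (s * cos \<theta>)) * indicator {-1..1} a * indicator {0..pi} \<theta>) \<partial>lborel)"
    proof (rule nn_integral_cong_AE)
      \<comment> \<open>The square root equals s * sin \<theta> and cancels the Jacobian, except at
        \<theta> = 0 and \<theta> = pi, where the quotient has the value 0 in HOL.\<close>
      have "AE \<theta> in lborel. \<theta> \<noteq> 0" "AE \<theta> in lborel. \<theta> \<noteq> pi" by (rule AE_lborel_singleton)+
      then show "AE \<theta> in lborel. ennreal (?f (- s * cos \<theta>) * (s * sin \<theta>) * indicator {0..pi} \<theta>) = ennreal (?IA a (- (s * cos \<theta>)) * indicator {-1..1} a * indicator {0..pi} \<theta>)"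
      proof eventually_elim
        case (elim \<theta>)
        show ?case
        proof (cases "\<theta> \<in> {0..pi}")
          case True
          then have sp: "0 < sin \<theta>" using elim by (intro sin_gt_zero) auto
          have "1 - (a\<^sup>2 + (- s * cos \<theta>)\<^sup>2) = (s * sin \<theta>)\<^sup>2"
            using s(2) by (simp add: power_mult_distrib sin_squared_eq algebra_simps)
          then have "sqrt (1 - (a\<^sup>2 + (- s * cos \<theta>)\<^sup>2)) = s * sin \<theta>" using s sp by simp
          moreover have "a \<in> {-1..1}" using \<open>\<bar>a\<bar> < 1\<close> by auto
          ultimately show ?thesis using s sp by simp
        qed simp
      qed
    qed
    finally show ?thesis by (simp add: s_def)
  qed
  have [measurable]: "(\<lambda>z. indicator (cball 0 1) (vec2 (fst z) (snd z)) / sqrt (1 - ((fst z)\<^sup>2 + (snd z)\<^sup>2)) :: real)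
      \<in> borel_measurable (lborel \<Otimes>\<^sub>M lborel)"
    using measurable_compose[OF measurable_vec2 measurable_disc_weight] by (simp add: norm_vec2)
  have [measurable]: "(\<lambda>z. indicator (cbox (0, 0) (pi, pi)) z * sin (fst z) :: real) \<in> borel_measurable (lborel \<Otimes>\<^sub>M lborel)"
    using measurable_box_weight by (simp add: lborel_prod)
  have "emeasure ?M1 A = (\<integral>\<^sup>+\<xi>. ennreal (indicator (cball 0 1) \<xi> / sqrt (1 - (norm \<xi>)\<^sup>2)) * indicator A \<xi> \<partial>lborel)"
    by (simp add: emeasure_density)
  also have "\<dots> = (\<integral>\<^sup>+z. ennreal (indicator (cball 0 1) (vec2 (fst z) (snd z)) / sqrt (1 - (norm (vec2 (fst z) (snd z)))\<^sup>2)) * indicator A (vec2 (fst z) (snd z)) \<partial>(lborel \<Otimes>\<^sub>M lborel))"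
    by (subst lborel_vec2) (subst nn_integral_distr; simp)
  also have "\<dots> = (\<integral>\<^sup>+a. \<integral>\<^sup>+b. ennreal (?w a b) * indicator A (vec2 a b) \<partial>lborel \<partial>lborel)"
    unfolding norm_vec2 by (subst lborel.nn_integral_fst[symmetric]) auto
  also have "\<dots> = (\<integral>\<^sup>+a. \<integral>\<^sup>+\<theta>. ennreal (?IA a (- (sqrt (1 - a\<^sup>2) * cos \<theta>)) * indicator {-1..1} a * indicator {0..pi} \<theta>) \<partial>lborel \<partial>lborel)"
  proof (rule nn_integral_cong_AE)
    have "AE a in lborel. a \<noteq> (1::real)" "AE a in lborel. a \<noteq> (-1::real)" by (rule AE_lborel_singleton)+
    then show "AE a in lborel. (\<integral>\<^sup>+b. ennreal (?w a b) * indicator A (vec2 a b) \<partial>lborel) =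
      (\<integral>\<^sup>+\<theta>. ennreal (?IA a (- (sqrt (1 - a\<^sup>2) * cos \<theta>)) * indicator {-1..1} a * indicator {0..pi} \<theta>) \<partial>lborel)"
      by eventually_elim (rule inner)
  qed
  also have "\<dots> = (\<integral>\<^sup>+\<theta>. \<integral>\<^sup>+a. ennreal (?IA a (- (sqrt (1 - a\<^sup>2) * cos \<theta>)) * indicator {-1..1} a * indicator {0..pi} \<theta>) \<partial>lborel \<partial>lborel)"
    by (rule lborel_pair.Fubini'[symmetric]) measurable
  also have "\<dots> = (\<integral>\<^sup>+\<theta>. \<integral>\<^sup>+\<alpha>. ennreal (indicator (cbox (0, 0) (pi, pi)) (\<alpha>, \<theta>) * sin \<alpha>) * indicator A (pt (\<alpha>, \<theta>)) \<partial>lborel \<partial>lborel)"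
  proof (rule nn_integral_cong)
    fix \<theta> :: real
    let ?f = "\<lambda>a. ?IA a (- (sqrt (1 - a\<^sup>2) * cos \<theta>)) * indicator {0..pi} \<theta>"
    have m: "set_borel_measurable borel {- cos 0..- cos pi} ?f"
      unfolding set_borel_measurable_def by measurable
    have "(\<integral>\<^sup>+a. ennreal (?IA a (- (sqrt (1 - a\<^sup>2) * cos \<theta>)) * indicator {-1..1} a * indicator {0..pi} \<theta>) \<partial>lborel) =
      (\<integral>\<^sup>+a. ennreal (?f a * indicator {- cos 0..- cos pi} a) \<partial>lborel)"
      by (simp add: mult_ac)
    also have "\<dots> = (\<integral>\<^sup>+\<alpha>. ennreal (?f (- cos \<alpha>) * sin \<alpha> * indicator {0..pi} \<alpha>) \<partial>lborel)"
      by (rule nn_integral_substitution[where f="?f" and g="\<lambda>\<theta>. - cos \<theta>" and a=0 and b=pi, OF m])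
        (auto intro!: derivative_eq_intros continuous_intros sin_ge_zero)
    also have "\<dots> = (\<integral>\<^sup>+\<alpha>. ennreal (indicator (cbox (0, 0) (pi, pi)) (\<alpha>, \<theta>) * sin \<alpha>) * indicator A (pt (\<alpha>, \<theta>)) \<partial>lborel)"
    proof (rule nn_integral_cong)
      fix \<alpha> :: real
      show "ennreal (?f (- cos \<alpha>) * sin \<alpha> * indicator {0..pi} \<alpha>) = ennreal (indicator (cbox (0, 0) (pi, pi)) (\<alpha>, \<theta>) * sin \<alpha>) * indicator A (pt (\<alpha>, \<theta>))"
      proof (cases "\<alpha> \<in> {0..pi}")
        case True
        then have "0 \<le> sin \<alpha>" by (auto intro: sin_ge_zero)
        moreover have "1 - (- cos \<alpha>)\<^sup>2 = (sin \<alpha>)\<^sup>2" by (simp add: sin_squared_eq)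
        ultimately have "sqrt (1 - (- cos \<alpha>)\<^sup>2) = sin \<alpha>" by simp
        then show ?thesis using True by (auto simp: pt_vec2 indicator_def cbox_Pair_eq)
      qed (auto simp: indicator_def cbox_Pair_eq)
    qed
    finally show "(\<integral>\<^sup>+a. ennreal (?IA a (- (sqrt (1 - a\<^sup>2) * cos \<theta>)) * indicator {-1..1} a * indicator {0..pi} \<theta>) \<partial>lborel) =
      (\<integral>\<^sup>+\<alpha>. ennreal (indicator (cbox (0, 0) (pi, pi)) (\<alpha>, \<theta>) * sin \<alpha>) * indicator A (pt (\<alpha>, \<theta>)) \<partial>lborel)" .
  qed
  also have "\<dots> = (\<integral>\<^sup>+\<alpha>. \<integral>\<^sup>+\<theta>. ennreal (indicator (cbox (0, 0) (pi, pi)) (\<alpha>, \<theta>) * sin \<alpha>) * indicator A (pt (\<alpha>, \<theta>)) \<partial>lborel \<partial>lborel)"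
    unfolding pt_vec2 fst_conv snd_conv by (rule lborel_pair.Fubini') measurable
  also have "\<dots> = (\<integral>\<^sup>+z. ennreal (indicator (cbox (0, 0) (pi, pi)) z * sin (fst z)) * indicator A (pt z) \<partial>(lborel \<Otimes>\<^sub>M lborel))"
    unfolding pt_vec2 by (subst lborel.nn_integral_fst[symmetric]) auto
  also have "\<dots> = emeasure ?M2 A"
  proof -
    have [measurable]: "pt \<in> borel_measurable borel"
      using continuous_on_pt[OF continuous_on_id, of UNIV] by (simp add: borel_measurable_continuous_onI)
    have [measurable]: "pt -` A \<in> sets borel" using measurable_sets[of pt borel borel A] by simp
    have "emeasure ?M2 A = emeasure (density lborel (\<lambda>z. ennreal (indicator (cbox (0, 0) (pi, pi)) z * sin (fst z)))) (pt -` A)"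
      by (subst emeasure_distr) auto
    also have "\<dots> = (\<integral>\<^sup>+z. ennreal (indicator (cbox (0, 0) (pi, pi)) z * sin (fst z)) * indicator A (pt z) \<partial>lborel)"
      by (subst emeasure_density) (simp_all add: indicator_vimage)
    finally show ?thesis by (simp add: lborel_prod)
  qed
  finally show "emeasure ?M1 A = emeasure ?M2 A" .
qed

lemma disc_integral:
  assumes h: "continuous_on UNIV h"
  shows "(LINT \<xi>:cball 0 1|lborel. h \<xi> / sqrt (1 - (norm \<xi>)\<^sup>2)) = 2 * pi * avg h"
proof -
  have [measurable]: "h \<in> borel_measurable borel" by (rule borel_measurable_continuous_onI[OF h])
  have [measurable]: "pt \<in> borel_measurable borel"
    using continuous_on_pt[OF continuous_on_id, of UNIV] by (simp add: borel_measurable_continuous_onI)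
  have nn: "0 \<le> indicator (cball 0 1) \<xi> / sqrt (1 - (norm \<xi>)\<^sup>2)" for \<xi> :: "real^2"
    by (auto simp: indicator_def power_le_one)
  have nn2: "0 \<le> indicator (cbox (0, 0) (pi, pi)) z * sin (fst z)" for z :: "real \<times> real"
    using sin_fst_nonneg[of z] by (auto simp: indicator_def)
  have "(LINT \<xi>:cball 0 1|lborel. h \<xi> / sqrt (1 - (norm \<xi>)\<^sup>2)) = (\<integral>\<xi>. (indicator (cball 0 1) \<xi> / sqrt (1 - (norm \<xi>)\<^sup>2)) *\<^sub>R h \<xi> \<partial>lborel)"
    by (simp add: set_lebesgue_integral_def)
  also have "\<dots> = (\<integral>\<xi>. h \<xi> \<partial>density lborel (\<lambda>\<xi>::real^2. ennreal (indicator (cball 0 1) \<xi> / sqrt (1 - (norm \<xi>)\<^sup>2))))"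
    by (rule integral_density[symmetric]) (auto simp: nn)
  also have "\<dots> = (\<integral>z. h (pt z) \<partial>density lborel (\<lambda>z. ennreal (indicator (cbox (0, 0) (pi, pi)) z * sin (fst z))))"
    unfolding disc_measure by (subst integral_distr) auto
  also have "\<dots> = (\<integral>z. (indicator (cbox (0, 0) (pi, pi)) z * sin (fst z)) *\<^sub>R h (pt z) \<partial>lborel)"
    by (rule integral_density) (auto simp: nn2)
  also have "\<dots> = (LINT z:cbox (0, 0) (pi, pi)|lborel. sin (fst z) * h (pt z))"
    by (simp add: set_lebesgue_integral_def mult.assoc)
  also have "\<dots> = integral (cbox (0, 0) (pi, pi)) (\<lambda>z. sin (fst z) * h (pt z))"
    unfolding set_integrable_def
    by (intro set_borel_integral_eq_integral(2), unfold set_integrable_def)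
      (intro borel_integrable_compact compact_cbox continuous_intros continuous_on_compose2[OF h]; simp)
  finally show ?thesis by (simp add: avg_def)
qed

lemma R_eq_Rm:
  assumes "continuous_on UNIV \<phi>" shows "R \<phi> x t = Rm \<phi> x t"
  using disc_integral[OF continuous_on_shift[OF assms], of x t] by (simp add: R_def Rm_def)

lemma u_L_eq:
  assumes f: "has_grad f D" "\<And>i. continuous_on UNIV (D i)" and g: "continuous_on UNIV g"
  shows "u_L f g x t = Rd f D x t + Rm (\<lambda>y. f y + g y) x t"
proof -
  have c: "continuous_on UNIV f" by (rule has_grad_cont[OF f(1)])
  have "R f x = Rm f x" using R_eq_Rm[OF c] by (simp add: fun_eq_iff)
  then have "deriv (R f x) t = Rd f D x t"
    using Rm_deriv_t[OF f, of x t UNIV] by (simp add: DERIV_imp_deriv)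
  then show ?thesis
    unfolding u_L_def by (simp add: R_eq_Rm continuous_on_add[OF c g])
qed

lemma L_eq_calL:
  assumes F: "cstrip t (\<lambda>x \<tau>. F (x, \<tau>))" and t: "0 \<le> t"
  shows "L p F x t = calL (\<lambda>x \<tau>. (1 + \<tau>) powr (1 - p) * F (x, \<tau>)) x t"
proof -
  have p: "1 / (1 + \<tau>) powr (p - 1) = (1 + \<tau>) powr (1 - p)" for \<tau> :: real
    using powr_minus_divide[of "1 + \<tau>" "p - 1"] by simp
  define G where "G \<tau> = Rm (\<lambda>x. (1 + \<tau>) powr (1 - p) * F (x, \<tau>)) x (t - \<tau>)" for \<tau>
  have G: "continuous_on {0..t} G"
    unfolding G_def
    by (rule cstrip_Rm[of t]) (auto intro!: cstrip_mult[OF cstrip_time F] continuous_intros)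
  have "(LINT \<tau>:{0..t}|lborel. (t - \<tau>) / (1 + \<tau>) powr (p - 1) *
       (LINT \<xi>:cball 0 1|lborel. F (x + (t - \<tau>) *\<^sub>R \<xi>, \<tau>) / sqrt (1 - (norm \<xi>)\<^sup>2))) = (LINT \<tau>:{0..t}|lborel. 2 * pi * G \<tau>)"
  proof (rule set_lebesgue_integral_cong)
    show "\<forall>\<tau>. \<tau> \<in> {0..t} \<longrightarrow> (t - \<tau>) / (1 + \<tau>) powr (p - 1) *
       (LINT \<xi>:cball 0 1|lborel. F (x + (t - \<tau>) *\<^sub>R \<xi>, \<tau>) / sqrt (1 - (norm \<xi>)\<^sup>2)) = 2 * pi * G \<tau>"
    proof (intro allI impI)
      fix \<tau> assume \<tau>: "\<tau> \<in> {0..t}"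
      have "continuous_on UNIV (\<lambda>y. F (y, \<tau>))" by (rule cstrip_slice[OF F \<tau>])
      from disc_integral[OF continuous_on_shift[OF this]]
      show "(t - \<tau>) / (1 + \<tau>) powr (p - 1) *
       (LINT \<xi>:cball 0 1|lborel. F (x + (t - \<tau>) *\<^sub>R \<xi>, \<tau>) / sqrt (1 - (norm \<xi>)\<^sup>2)) = 2 * pi * G \<tau>"
        unfolding G_def Rm_cmult by (simp add: Rm_def p[symmetric])
    qed
  qed simp
  also have "\<dots> = integral {0..t} (\<lambda>\<tau>. 2 * pi * G \<tau>)"
    by (intro set_borel_integral_eq_integral borel_integrable_atLeastAtMost' continuous_intros G)
  also have "\<dots> = 2 * pi * integral {0..t} G" by simp
  finally show ?thesis unfolding L_def calL_def G_def[symmetric] by simp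
qed

section \<open>Decay of the free solution\<close>

lemma Rm_zero_outside:
  assumes "\<And>y. k < norm y \<Longrightarrow> \<phi> y = 0" "0 \<le> t" "t + k < norm x"
  shows "Rm \<phi> x t = 0"
proof -
  have "Rm \<phi> x t = Rm (\<lambda>_. 0) x t"
  proof (rule Rm_cong[OF assms(2)])
    fix y assume "dist x y \<le> t"
    then show "\<phi> y = 0" using assms norm_triangle_ineq2[of x y] by (intro assms(1)) (simp add: dist_norm)
  qed
  then show ?thesis by (simp add: Rm_const)
qed

lemma Rd_zero_outside:
  assumes "\<And>y. k < norm y \<Longrightarrow> \<phi> y = 0" "\<And>i y. k < norm y \<Longrightarrow> D i y = 0" "0 \<le> t" "t + k < norm x"
  shows "Rd \<phi> D x t = 0"
proof -
  have "Rd \<phi> D x t = avg (\<lambda>_. 0)"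
    unfolding Rd_def
  proof (rule avg_cong)
    fix \<xi> :: "real^2" assume "norm \<xi> \<le> 1"
    then have "norm (t *\<^sub>R \<xi>) \<le> t" using assms(3) by (simp add: mult_left_le)
    then have "k < norm (x + t *\<^sub>R \<xi>)" using assms(4) norm_diff_ineq[of x "t *\<^sub>R \<xi>"] by linarith
    then show "\<phi> (x + t *\<^sub>R \<xi>) + t * (\<Sum>i\<in>UNIV. \<xi> $ i * D i (x + t *\<^sub>R \<xi>)) = 0"
      using assms(1,2) by simp
  qed
  then show ?thesis by simp
qed

lemma Rm_bound:
  assumes "continuous_on UNIV \<phi>" "\<And>y. \<bar>\<phi> y\<bar> \<le> M" "0 \<le> t"
  shows "\<bar>Rm \<phi> x t\<bar> \<le> M * t"
  using Rm_abs[OF assms(1) continuous_on_const assms(3), of x M] assms(2) by (simp add: Rm_const mult.commute)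

lemma Rd_bound:
  assumes c: "continuous_on UNIV \<phi>" "\<And>i. continuous_on UNIV (D i)"
    and M: "\<And>y. \<bar>\<phi> y\<bar> \<le> M" "\<And>i y. \<bar>D i y\<bar> \<le> M" and t: "0 \<le> t"
  shows "\<bar>Rd \<phi> D x t\<bar> \<le> M * (1 + 2 * t)"
proof -
  have "\<bar>Rd \<phi> D x t\<bar> \<le> avg (\<lambda>_. M * (1 + 2 * t))"
    unfolding Rd_def
  proof (rule avg_abs_le)
    show "continuous_on (cball 0 1) (\<lambda>\<xi>. \<phi> (x + t *\<^sub>R \<xi>) + t * (\<Sum>i\<in>UNIV. \<xi> $ i * D i (x + t *\<^sub>R \<xi>)))"
      by (intro continuous_intros continuous_on_shift c)
    fix \<xi> :: "real^2" assume \<xi>: "norm \<xi> \<le> 1"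
    have "\<bar>\<xi> $ i * D i y\<bar> \<le> 1 * M" for i y
      unfolding abs_mult using component_le_norm_cart[of \<xi> i] \<xi> M by (intro mult_mono) auto
    note * = this
    have "\<bar>\<Sum>i\<in>UNIV. \<xi> $ i * D i y\<bar> \<le> 2 * M" for y
      using *[of 1 y] *[of 2 y] unfolding sum_2 by linarith
    then have "\<bar>t * (\<Sum>i\<in>UNIV. \<xi> $ i * D i (x + t *\<^sub>R \<xi>))\<bar> \<le> t * (2 * M)"
      unfolding abs_mult using t by (intro mult_mono) auto
    then show "\<bar>\<phi> (x + t *\<^sub>R \<xi>) + t * (\<Sum>i\<in>UNIV. \<xi> $ i * D i (x + t *\<^sub>R \<xi>))\<bar> \<le> M * (1 + 2 * t)"
      using M(1)[of "x + t *\<^sub>R \<xi>"] by (simp add: algebra_simps)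
  qed simp
  then show ?thesis by (simp add: avg_const)
qed

text \<open>For t > |x| + k the support of \<phi> lies inside the disc of radius t about x and away
  from its boundary circle. After the change of variables the indicator of the disc can be omitted
  and the kernel is bounded on the support.\<close>

lemma Rm_kernel:
  assumes c: "continuous_on UNIV \<phi>" and s: "\<And>y. k < norm y \<Longrightarrow> \<phi> y = 0" and t: "norm x + k < t" and k: "0 \<le> k"
  shows "Rm \<phi> x t = 1 / (2 * pi) * (LINT y|lborel. \<phi> y * (1 / sqrt (t\<^sup>2 - (norm (x - y))\<^sup>2)))"
proof -
  have t0: "0 < t" using t k norm_ge_zero[of x] by linarith
  have [measurable]: "\<phi> \<in> borel_measurable borel" by (rule borel_measurable_continuous_onI[OF c])
  define h where "h y = \<phi> y * (1 / sqrt (t\<^sup>2 - (norm (x - y))\<^sup>2))" for y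
  have hm[measurable]: "h \<in> borel_measurable borel"
  proof -
    have "(\<lambda>y. sqrt (t\<^sup>2 - (norm (x - y))\<^sup>2)) \<in> borel_measurable borel"
      by (intro borel_measurable_continuous_onI continuous_intros)
    then show ?thesis unfolding h_def by measurable
  qed
  have "(LINT y|lborel. h y) = (LINT y|density (distr lborel borel (\<lambda>\<xi>. x + t *\<^sub>R \<xi>)) (\<lambda>_. \<bar>t\<bar> ^ DIM(real^2)). h y)"
    using lborel_affine[of t x] t0 by simp
  also have "\<dots> = (LINT \<xi>|lborel. t\<^sup>2 * h (x + t *\<^sub>R \<xi>))"
    using t0 by (subst integral_real_density) (auto simp: integral_distr)
  also have "(\<lambda>\<xi>. t\<^sup>2 * h (x + t *\<^sub>R \<xi>)) = (\<lambda>\<xi>. t * (indicator (cball 0 1) \<xi> *\<^sub>R (\<phi> (x + t *\<^sub>R \<xi>) / sqrt (1 - (norm \<xi>)\<^sup>2))))"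
  proof
    fix \<xi> :: "real^2"
    show "t\<^sup>2 * h (x + t *\<^sub>R \<xi>) = t * (indicator (cball 0 1) \<xi> *\<^sub>R (\<phi> (x + t *\<^sub>R \<xi>) / sqrt (1 - (norm \<xi>)\<^sup>2)))"
    proof (cases "norm \<xi> \<le> 1")
      case True
      have "t\<^sup>2 - (norm (x - (x + t *\<^sub>R \<xi>)))\<^sup>2 = t\<^sup>2 * (1 - (norm \<xi>)\<^sup>2)"
        by (simp add: power_mult_distrib algebra_simps)
      then have "sqrt (t\<^sup>2 - (norm (x - (x + t *\<^sub>R \<xi>)))\<^sup>2) = t * sqrt (1 - (norm \<xi>)\<^sup>2)"
        using t0 by (simp only: real_sqrt_mult real_sqrt_abs abs_of_pos)
      then show ?thesis using True t0 unfolding h_def by (simp add: power2_eq_square)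
    next
      case False
      \<comment> \<open>Outside the unit disc the point x + t \<xi> misses the support, so the value
        of the square root of a negative number does no harm.\<close>
      then have "t * 1 \<le> t * norm \<xi>" using t0 by (intro mult_left_mono) auto
      then have "t \<le> norm (t *\<^sub>R \<xi>)" using t0 by simp
      then have "k < norm (x + t *\<^sub>R \<xi>)" using t norm_diff_ineq[of "t *\<^sub>R \<xi>" x] by (simp add: add.commute)
      then show ?thesis using False s by (simp add: h_def)
    qed
  qed
  also have "(LINT \<xi>|lborel. t * (indicator (cball 0 1) \<xi> *\<^sub>R (\<phi> (x + t *\<^sub>R \<xi>) / sqrt (1 - (norm \<xi>)\<^sup>2)))) = t * (2 * pi * avg (\<lambda>\<xi>. \<phi> (x + t *\<^sub>R \<xi>)))"
    unfolding integral_mult_right_zero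
    using disc_integral[OF continuous_on_shift[OF c], of x t] by (simp add: set_lebesgue_integral_def)
  finally show ?thesis using t0 by (simp add: Rm_def h_def)
qed

lemma inverse_sqrt_diff:
  assumes "0 < d" "d \<le> a" "d \<le> b"
  shows "\<bar>1 / sqrt a - 1 / sqrt b\<bar> \<le> \<bar>a - b\<bar> / (2 * (d * sqrt d))"
proof -
  have s: "sqrt d \<le> sqrt a" "sqrt d \<le> sqrt b" "0 < sqrt d" using assms by auto
  have p: "0 < sqrt a" "0 < sqrt b" using s by linarith+
  have "\<bar>1 / sqrt a - 1 / sqrt b\<bar> = \<bar>a - b\<bar> / ((sqrt a + sqrt b) * (sqrt a * sqrt b))"
  proof -
    have "1 / sqrt a - 1 / sqrt b = (sqrt b - sqrt a) / (sqrt a * sqrt b)"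
      using p by (simp add: diff_divide_distrib)
    also have "\<dots> = ((sqrt a + sqrt b) * (sqrt b - sqrt a)) / ((sqrt a + sqrt b) * (sqrt a * sqrt b))"
      using p by (intro mult_divide_mult_cancel_left[symmetric]) linarith
    also have "(sqrt a + sqrt b) * (sqrt b - sqrt a) = b - a"
      using assms by (simp add: algebra_simps flip: power2_eq_square)
    finally show ?thesis using p by (simp add: abs_mult abs_minus_commute)
  qed
  also have "\<dots> \<le> \<bar>a - b\<bar> / (2 * (d * sqrt d))"
  proof (rule divide_left_mono)
    have s1: "2 * sqrt d \<le> sqrt a + sqrt b" using s by linarith
    have s2: "sqrt d * sqrt d \<le> sqrt a * sqrt b" using s by (intro mult_mono) linarith+
    have "2 * sqrt d * (sqrt d * sqrt d) \<le> (sqrt a + sqrt b) * (sqrt a * sqrt b)"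
      using p assms by (intro mult_mono s1 s2) auto
    then show "2 * (d * sqrt d) \<le> (sqrt a + sqrt b) * (sqrt a * sqrt b)" using assms by (simp add: mult_ac)
    show "0 < (sqrt a + sqrt b) * (sqrt a * sqrt b) * (2 * (d * sqrt d))"
      using p assms by (intro mult_pos_pos add_pos_pos) auto
  qed auto
  finally show ?thesis .
qed

lemma integrable_compact_support:
  fixes \<phi> :: "real^2 \<Rightarrow> real"
  assumes c: "continuous_on UNIV \<phi>" and s: "\<And>y. k < norm y \<Longrightarrow> \<phi> y = 0"
  shows "integrable lborel \<phi>"
proof -
  have "integrable lborel (\<lambda>y. indicator (cball 0 k) y *\<^sub>R \<phi> y)"
    by (intro borel_integrable_compact continuous_on_subset[OF c]) auto
  moreover have "(\<lambda>y. indicator (cball 0 k) y *\<^sub>R \<phi> y) = \<phi>"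
    using s by (auto simp: fun_eq_iff indicator_def not_le)
  ultimately show ?thesis by simp
qed

lemma kernel_difference:
  fixes \<phi> :: "real^2 \<Rightarrow> real"
  assumes c: "continuous_on UNIV \<phi>" and s: "\<And>y. k < norm y \<Longrightarrow> \<phi> y = 0"
    and w: "w1 \<in> borel_measurable borel" "w2 \<in> borel_measurable borel"
    and b: "\<And>y. norm y \<le> k \<Longrightarrow> \<bar>w1 y\<bar> \<le> B1" "\<And>y. norm y \<le> k \<Longrightarrow> \<bar>w2 y\<bar> \<le> B1"
    and d: "\<And>y. norm y \<le> k \<Longrightarrow> \<bar>w1 y - w2 y\<bar> \<le> B"
  shows "\<bar>(LINT y|lborel. \<phi> y * w1 y) - (LINT y|lborel. \<phi> y * w2 y)\<bar> \<le> (LINT y|lborel. \<bar>\<phi> y\<bar>) * B"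
proof -
  have [measurable]: "\<phi> \<in> borel_measurable borel" by (rule borel_measurable_continuous_onI[OF c])
  note w[measurable]
  have i: "integrable lborel \<phi>" by (rule integrable_compact_support[OF c s])
  have iw: "integrable lborel (\<lambda>y. \<phi> y * v y)" if [measurable]: "v \<in> borel_measurable borel" and "\<And>y. norm y \<le> k \<Longrightarrow> \<bar>v y\<bar> \<le> B1" for v
  proof (rule Bochner_Integration.integrable_bound[OF integrable_mult_left[OF integrable_abs[OF i], of B1]])
    show "AE y in lborel. norm (\<phi> y * v y) \<le> norm (\<bar>\<phi> y\<bar> * B1)"
    proof (rule AE_I2)
      fix y
      show "norm (\<phi> y * v y) \<le> norm (\<bar>\<phi> y\<bar> * B1)"
      proof (cases "norm y \<le> k")
        case True
        then show ?thesis using that(2)[OF True] by (auto simp: abs_mult intro!: mult_left_mono)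
      qed (simp add: s)
    qed
  qed measurable
  have "(LINT y|lborel. \<phi> y * w1 y) - (LINT y|lborel. \<phi> y * w2 y) = (LINT y|lborel. \<phi> y * w1 y - \<phi> y * w2 y)"
    by (rule Bochner_Integration.integral_diff[symmetric]) (intro iw w b; assumption)+
  also have "\<bar>\<dots>\<bar> \<le> (LINT y|lborel. \<bar>\<phi> y\<bar> * B)"
    unfolding real_norm_def[symmetric]
  proof (rule order_trans[OF integral_norm_bound], rule Bochner_Integration.integral_mono)
    show "integrable lborel (\<lambda>y. norm (\<phi> y * w1 y - \<phi> y * w2 y))"
      by (intro integrable_norm Bochner_Integration.integrable_diff iw w b; assumption)
    show "integrable lborel (\<lambda>y. norm (\<phi> y) * B)" using i by (intro integrable_mult_left integrable_norm)
    fix y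
    show "norm (\<phi> y * w1 y - \<phi> y * w2 y) \<le> norm (\<phi> y) * B"
    proof (cases "norm y \<le> k")
      case True
      then show ?thesis using d[OF True] by (auto simp: abs_mult right_diff_distrib[symmetric] intro!: mult_left_mono)
    qed (simp add: s)
  qed
  finally show ?thesis by simp
qed

text \<open>The right side is a product with factors s - |x - y|, at least t - |x| - k, and s + |x -
  y|, at least t.\<close>

lemma kernel_distance:
  assumes "norm x + k < t" "0 \<le> k" "norm y \<le> k" "t \<le> s"
  shows "(t - norm x - k) * t \<le> s\<^sup>2 - (norm (x - y))\<^sup>2"
proof -
  let ?z = "norm (x - y)"
  have z: "?z \<le> norm x + k" using norm_triangle_ineq4[of x y] assms by linarith
  have "(t - norm x - k) * t \<le> (s - ?z) * (s + ?z)"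
    using z assms norm_ge_zero[of x] norm_ge_zero[of "x - y"] by (intro mult_mono) linarith+
  then show ?thesis by (simp add: algebra_simps power2_eq_square)
qed

lemma measurable_kernel: "(\<lambda>y::real^2. 1 / sqrt (t\<^sup>2 - (norm (x - y))\<^sup>2)) \<in> borel_measurable borel"
  by (intro borel_measurable_divide borel_measurable_const borel_measurable_continuous_onI continuous_intros)

lemma inverse_sqrt_le: "0 < d \<Longrightarrow> d \<le> a \<Longrightarrow> \<bar>1 / sqrt a\<bar> \<le> 1 / sqrt d"
  by (auto intro!: divide_left_mono)

text \<open>Since \<phi> has mean zero, the kernel at y = 0 may be subtracted. The difference of the
  kernels over |y| at most k gains a factor of order k t / d, so the bound is a multiple of t^(-1/2)
  (t - |x| - k)^(-3/2).\<close>

lemma Rm_mean_zero_interior: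
  assumes c: "continuous_on UNIV \<phi>" and s: "\<And>y. k < norm y \<Longrightarrow> \<phi> y = 0" and t: "norm x + k < t" and k: "0 \<le> k"
    and z: "(LINT y|lborel. \<phi> y) = 0"
  defines "d \<equiv> (t - norm x - k) * t"
  shows "\<bar>Rm \<phi> x t\<bar> \<le> (LINT y|lborel. \<bar>\<phi> y\<bar>) * (k * t / (d * sqrt d))"
proof -
  have t0: "0 < t" using t k norm_ge_zero[of x] by linarith
  have d: "0 < d" using t t0 by (simp add: d_def)
  have dist: "d \<le> t\<^sup>2 - (norm (x - y))\<^sup>2" if "norm y \<le> k" for y
    unfolding d_def by (rule kernel_distance[OF t k that order_refl])
  have "\<bar>(LINT y|lborel. \<phi> y * (1 / sqrt (t\<^sup>2 - (norm (x - y))\<^sup>2))) - (LINT y|lborel. \<phi> y * (1 / sqrt (t\<^sup>2 - (norm (x - 0))\<^sup>2)))\<bar>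
    \<le> (LINT y|lborel. \<bar>\<phi> y\<bar>) * (k * t / (d * sqrt d))"
  proof (rule kernel_difference[OF c s, where ?B1.0="1 / sqrt d"])
    fix y :: "real^2" assume y: "norm y \<le> k"
    show "\<bar>1 / sqrt (t\<^sup>2 - (norm (x - y))\<^sup>2)\<bar> \<le> 1 / sqrt d" "\<bar>1 / sqrt (t\<^sup>2 - (norm (x - 0))\<^sup>2)\<bar> \<le> 1 / sqrt d"
      using dist[OF y] dist[of 0] k by (intro inverse_sqrt_le d; simp)+
    have "\<bar>1 / sqrt (t\<^sup>2 - (norm (x - y))\<^sup>2) - 1 / sqrt (t\<^sup>2 - (norm (x - 0))\<^sup>2)\<bar>
      \<le> \<bar>(t\<^sup>2 - (norm (x - y))\<^sup>2) - (t\<^sup>2 - (norm (x - 0))\<^sup>2)\<bar> / (2 * (d * sqrt d))"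
      using dist[OF y] dist[of 0] k by (intro inverse_sqrt_diff d) auto
    also have "\<dots> \<le> (k * (2 * t)) / (2 * (d * sqrt d))"
    proof (rule divide_right_mono)
      have "(t\<^sup>2 - (norm (x - y))\<^sup>2) - (t\<^sup>2 - (norm (x - 0))\<^sup>2) = (norm x - norm (x - y)) * (norm x + norm (x - y))"
        by (simp add: algebra_simps power2_eq_square)
      moreover have "\<bar>norm x - norm (x - y)\<bar> \<le> k" using norm_triangle_ineq3[of x "x - y"] y by simp
      moreover have "norm x + norm (x - y) \<le> 2 * t" using norm_triangle_ineq4[of x y] y t k by linarith
      ultimately show "\<bar>(t\<^sup>2 - (norm (x - y))\<^sup>2) - (t\<^sup>2 - (norm (x - 0))\<^sup>2)\<bar> \<le> k * (2 * t)"
        using k by (simp only: abs_mult) (intro mult_mono, auto)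
    qed (use d in auto)
    finally show "\<bar>1 / sqrt (t\<^sup>2 - (norm (x - y))\<^sup>2) - 1 / sqrt (t\<^sup>2 - (norm (x - 0))\<^sup>2)\<bar> \<le> k * t / (d * sqrt d)"
      using d by simp
  qed (assumption | rule measurable_kernel borel_measurable_const)+
  then have I: "\<bar>LINT y|lborel. \<phi> y * (1 / sqrt (t\<^sup>2 - (norm (x - y))\<^sup>2))\<bar> \<le> (LINT y|lborel. \<bar>\<phi> y\<bar>) * (k * t / (d * sqrt d))"
    using z by simp
  have "\<bar>1 / (2 * pi)\<bar> * \<bar>LINT y|lborel. \<phi> y * (1 / sqrt (t\<^sup>2 - (norm (x - y))\<^sup>2))\<bar> \<le> 1 * ((LINT y|lborel. \<bar>\<phi> y\<bar>) * (k * t / (d * sqrt d)))"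
    using I pi_gt3 by (intro mult_mono) auto
  moreover have "Rm \<phi> x t = 1 / (2 * pi) * (LINT y|lborel. \<phi> y * (1 / sqrt (t\<^sup>2 - (norm (x - y))\<^sup>2)))"
    by (rule Rm_kernel[OF c _ t k]) (rule s)
  ultimately show ?thesis unfolding abs_mult by simp
qed

lemma derivative_bound:
  fixes F :: "real \<Rightarrow> real"
  assumes F: "(F has_real_derivative D) (at t)" and b: "\<And>s. t < s \<Longrightarrow> s \<le> 2 * t \<Longrightarrow> \<bar>F s - F t\<bar> \<le> B * (s - t)" and t: "0 < t"
  shows "\<bar>D\<bar> \<le> B"
proof -
  have "((\<lambda>s. (F s - F t) / (s - t)) \<longlongrightarrow> D) (at t within {t<..})"
    using has_field_derivative_at_within[OF F] by (simp add: has_field_derivative_iff)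
  then have "((\<lambda>s. \<bar>(F s - F t) / (s - t)\<bar>) \<longlongrightarrow> \<bar>D\<bar>) (at_right t)"
    by (rule tendsto_rabs)
  moreover have "\<forall>\<^sub>F s in at_right t. \<bar>(F s - F t) / (s - t)\<bar> \<le> B"
    using eventually_at_right_real[of t "2 * t"] t
    by (auto elim!: eventually_mono simp: abs_divide pos_divide_le_eq intro!: b)
  ultimately show ?thesis by (rule tendsto_upperbound) simp
qed

text \<open>\<open>Rd\<close> is a limit of difference quotients of \<open>Rm\<close> in time, and
  the difference falls on the kernel. Differentiating the kernel in time gives the same decay that
  mean value zero gives in \<open>Rm_mean_zero_interior\<close>.\<close>

lemma Rd_interior:
  assumes g: "has_grad \<phi> D" "\<And>i. continuous_on UNIV (D i)" and s: "\<And>y. k < norm y \<Longrightarrow> \<phi> y = 0" and t: "norm x + k < t" and k: "0 \<le> k"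
  defines "d \<equiv> (t - norm x - k) * t"
  shows "\<bar>Rd \<phi> D x t\<bar> \<le> (LINT y|lborel. \<bar>\<phi> y\<bar>) * (3 * t / (d * sqrt d))"
proof (rule derivative_bound[OF Rm_deriv_t[OF g]])
  have c: "continuous_on UNIV \<phi>" by (rule has_grad_cont[OF g(1)])
  show t0: "0 < t" using t k norm_ge_zero[of x] by linarith
  have d: "0 < d" using t t0 by (simp add: d_def)
  fix r assume r: "t < r" "r \<le> 2 * t"
  have dist: "d \<le> t\<^sup>2 - (norm (x - y))\<^sup>2" "d \<le> r\<^sup>2 - (norm (x - y))\<^sup>2" if "norm y \<le> k" for y
    unfolding d_def using r by (intro kernel_distance[OF t k that]; simp)+
  have "\<bar>(LINT y|lborel. \<phi> y * (1 / sqrt (r\<^sup>2 - (norm (x - y))\<^sup>2))) - (LINT y|lborel. \<phi> y * (1 / sqrt (t\<^sup>2 - (norm (x - y))\<^sup>2)))\<bar>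
    \<le> (LINT y|lborel. \<bar>\<phi> y\<bar>) * (3 * t * (r - t) / (d * sqrt d))"
  proof (rule kernel_difference[OF c s, where ?B1.0="1 / sqrt d"])
    fix y :: "real^2" assume y: "norm y \<le> k"
    show "\<bar>1 / sqrt (r\<^sup>2 - (norm (x - y))\<^sup>2)\<bar> \<le> 1 / sqrt d" "\<bar>1 / sqrt (t\<^sup>2 - (norm (x - y))\<^sup>2)\<bar> \<le> 1 / sqrt d"
      by (intro inverse_sqrt_le d dist y)+
    have "\<bar>1 / sqrt (r\<^sup>2 - (norm (x - y))\<^sup>2) - 1 / sqrt (t\<^sup>2 - (norm (x - y))\<^sup>2)\<bar>
      \<le> \<bar>(r\<^sup>2 - (norm (x - y))\<^sup>2) - (t\<^sup>2 - (norm (x - y))\<^sup>2)\<bar> / (2 * (d * sqrt d))"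
      using dist[OF y] by (intro inverse_sqrt_diff d) auto
    also have "\<dots> \<le> (2 * (3 * t * (r - t))) / (2 * (d * sqrt d))"
    proof (rule divide_right_mono)
      have "(r\<^sup>2 - (norm (x - y))\<^sup>2) - (t\<^sup>2 - (norm (x - y))\<^sup>2) = (r + t) * (r - t)"
        by (simp add: algebra_simps power2_eq_square)
      moreover have "(r + t) * (r - t) \<le> (6 * t) * (r - t)" using r t0 by (intro mult_right_mono) auto
      moreover have "0 \<le> (r + t) * (r - t)" using r t0 by simp
      ultimately show "\<bar>(r\<^sup>2 - (norm (x - y))\<^sup>2) - (t\<^sup>2 - (norm (x - y))\<^sup>2)\<bar> \<le> 2 * (3 * t * (r - t))" by simp
    qed (use d in auto)
    also have "\<dots> = 3 * t * (r - t) / (d * sqrt d)" by (rule mult_divide_mult_cancel_left) simp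
    finally show "\<bar>1 / sqrt (r\<^sup>2 - (norm (x - y))\<^sup>2) - 1 / sqrt (t\<^sup>2 - (norm (x - y))\<^sup>2)\<bar> \<le> 3 * t * (r - t) / (d * sqrt d)" .
  qed (assumption | rule measurable_kernel)+
  then have "\<bar>1 / (2 * pi)\<bar> * \<bar>(LINT y|lborel. \<phi> y * (1 / sqrt (r\<^sup>2 - (norm (x - y))\<^sup>2))) - (LINT y|lborel. \<phi> y * (1 / sqrt (t\<^sup>2 - (norm (x - y))\<^sup>2)))\<bar>
    \<le> 1 * ((LINT y|lborel. \<bar>\<phi> y\<bar>) * (3 * t * (r - t) / (d * sqrt d)))"
    using pi_gt3 by (intro mult_mono) auto
  moreover have t': "norm x + k < r" using t r by linarith
  moreover have "Rm \<phi> x q = 1 / (2 * pi) * (LINT y|lborel. \<phi> y * (1 / sqrt (q\<^sup>2 - (norm (x - y))\<^sup>2)))" if "norm x + k < q" for q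
    by (rule Rm_kernel[OF c _ that k]) (rule s)
  note this[OF t] this[OF t']
  ultimately show "\<bar>Rm \<phi> x r - Rm \<phi> x t\<bar> \<le> (LINT y|lborel. \<bar>\<phi> y\<bar>) * (3 * t / (d * sqrt d)) * (r - t)"
    unfolding \<open>Rm \<phi> x t = _\<close> \<open>Rm \<phi> x r = _\<close> right_diff_distrib[symmetric] abs_mult
    by (simp only: times_divide_eq_left times_divide_eq_right mult_1 mult_ac)
qed

lemma calL_source_shift:
  assumes K: "1 \<le> K" and t: "0 \<le> t"
  shows "calL (\<lambda>y \<tau>. (K + \<tau>) powr a * cutpow s j (bt y (K + \<tau>))) x t
    \<le> calL (\<lambda>y \<tau>. (1 + \<tau>) powr a * cutpow s j (bt y (1 + \<tau>))) x (t + (K - 1))"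
proof -
  have e: "1 + (\<tau> + (K - 1)) = K + \<tau>" for \<tau> by simp
  show ?thesis
    using calL_time_shift[OF cstrip_cut[of "t + (K - 1)" 1 a s j], of x] K t
    by (simp add: e cutpow_nonneg)
qed

lemma source_cone_shifted:
  assumes "1 / 4 \<le> n" "n < 1 / 2" "1 \<le> K" "0 \<le> t"
  shows "calL (\<lambda>y \<tau>. (K + \<tau>) powr (- 3 / 2 - n) * cutpow (3 / 2) 3 (bt y (K + \<tau>))) x t
     \<le> 102 / (1 / 2 - n) * ((K + t) powr (- 1 / 2) * cutpow n 3 (bt x (K + t)))"
  using order_trans[OF calL_source_shift[OF assms(3,4)] source_cone[OF assms(1,2), of "t + (K - 1)" x]] assms
  by (simp add: add.commute)

lemma source_spread_shifted:
  assumes "1 / 4 \<le> n" "n < 1 / 2" "1 \<le> K" "0 \<le> t" "0 < \<kappa>" "\<kappa> \<le> 1"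
  shows "calL (\<lambda>y \<tau>. (K + \<tau>) powr (- 3 / 2 - n) * cutpow (1 - \<kappa>) 3 (bt y (K + \<tau>))) x t
     \<le> 24 * (K + t) powr \<kappa> / \<kappa> / (1 / 2 - n) * ((K + t) powr (- 1 / 2) * cutpow n 3 (bt x (K + t)))"
  using order_trans[OF calL_source_shift[OF assms(3,4)] source_spread[OF assms(1,2) _ assms(5,6), of "t + (K - 1)" x]] assms
  by (simp add: add.commute)

lemma bt_bounds:
  assumes "norm x \<le> t" "0 < t"
  shows "t - norm x \<le> bt x t" "bt x t \<le> 2 * (t - norm x)"
proof -
  have e: "bt x t = t - norm x * norm x / t" by (simp add: bt_def dot_square_norm power2_eq_square)
  have "norm x * norm x / t \<le> norm x" using assms mult_left_mono[OF assms(1), of "norm x"] by (simp add: divide_le_eq)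
  then show "t - norm x \<le> bt x t" by (simp add: e)
  have "0 \<le> (t - norm x) * (t - norm x) / t" using assms by simp
  then have "0 \<le> t - 2 * norm x + norm x * norm x / t" using assms by (simp add: field_simps)
  then show "bt x t \<le> 2 * (t - norm x)" by (simp add: e)
qed

text \<open>This explains the shift by k + 2: where |x| is at most t + k, one has \<beta> at least
  t' - |x|, hence at least 2, and the cut-off factor costs no more than 8.\<close>

lemma cutpow_lower:
  assumes "2 \<le> \<beta>" "\<beta> \<le> B" "0 \<le> s"
  shows "B powr (- s) / 8 \<le> cutpow s 3 \<beta>"
proof -
  have "(1 / 2) ^ 3 \<le> (1 - 1 / \<beta>) ^ 3" using assms by (intro power_mono) (auto simp: field_simps)
  moreover have "B powr (- s) \<le> \<beta> powr (- s)" using assms by (intro powr_mono2') auto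
  ultimately have "B powr (- s) * (1 / 2) ^ 3 \<le> \<beta> powr (- s) * (1 - 1 / \<beta>) ^ 3"
    by (intro mult_mono) auto
  then show ?thesis using assms by (simp add: cutpow_ge1 power3_eq_cube)
qed

lemma cutpow_le_one:
  assumes "0 \<le> s" shows "cutpow s j \<beta> \<le> 1"
proof -
  have m: "1 \<le> max 1 \<beta>" by simp
  have "max 1 \<beta> powr (- s) \<le> max 1 \<beta> powr 0" using assms m by (intro powr_mono) linarith+
  moreover have "max 1 \<beta> powr 0 = 1" using m by (simp del: max_less_iff_conj)
  moreover have "(1 - 1 / max 1 \<beta>) ^ j \<le> 1" by (intro power_le_one) (auto simp: field_simps)
  ultimately show ?thesis unfolding cutpow_def
    by (intro mult_le_one) (auto simp: field_simps)
qed

lemma C_on_has_grad: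
  fixes \<phi> :: "real^2 \<Rightarrow> real"
  assumes "C_on (Suc n) UNIV \<phi>"
  obtains D where "has_grad \<phi> D" "\<And>i. C_on n UNIV (D i)"
proof -
  obtain D where D: "\<And>z. (\<phi> has_derivative (\<lambda>h. \<Sum>i\<in>Basis. (h \<bullet> i) * D i z)) (at z)" "\<And>i. i \<in> Basis \<Longrightarrow> C_on n UNIV (D i)"
    using assms by auto
  have ne: "axis 1 1 \<noteq> (axis 2 1 :: real^2)" by (simp add: axis_eq_axis)
  show thesis
  proof (rule that[of "\<lambda>i. D (axis i 1)"])
    show "has_grad \<phi> (\<lambda>i. D (axis i 1))"
      using D(1) ne by (simp add: has_grad_def Basis2 sum_2 inner_axis)
    show "C_on n UNIV (D (axis i 1))" for i by (intro D(2) axis_in_Basis_iff[THEN iffD2]) simp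
  qed
qed

lemma has_grad_zero_outside:
  assumes "has_grad \<phi> D" "\<And>y. k < norm y \<Longrightarrow> \<phi> y = 0" "k < norm y"
  shows "D i y = 0"
proof -
  have o: "open {y :: real^2. k < norm y}" by (intro open_Collect_less continuous_intros)
  have "((\<lambda>s. \<phi> (y + s *\<^sub>R axis i 1)) has_real_derivative D i (y + 0 *\<^sub>R axis i 1)) (at 0)"
    by (rule has_grad_line[OF assms(1)])
  moreover have "((\<lambda>s. \<phi> (y + s *\<^sub>R axis i 1)) has_real_derivative 0) (at 0)"
  proof (rule DERIV_cong_ev[OF refl _ refl, THEN iffD2])
    have "((\<lambda>s::real. y + s *\<^sub>R axis i 1) \<longlongrightarrow> y + 0 *\<^sub>R axis i 1) (nhds 0)"
      by (intro tendsto_intros filterlim_ident)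
    from topological_tendstoD[OF this o] have "\<forall>\<^sub>F s in nhds 0. k < norm (y + s *\<^sub>R axis i 1)" using assms(3) by simp
    then show "\<forall>\<^sub>F s in nhds 0. \<phi> (y + s *\<^sub>R axis i 1) = 0" by eventually_elim (rule assms(2))
    show "((\<lambda>s. 0) has_real_derivative 0) (at 0)" by simp
  qed
  ultimately show ?thesis using DERIV_unique by fastforce
qed

lemma bounded_compact_support:
  fixes \<phi> :: "'a \<Rightarrow> real^2 \<Rightarrow> real"
  assumes "finite I" "\<And>i. i \<in> I \<Longrightarrow> continuous_on UNIV (\<phi> i)" "\<And>i y. i \<in> I \<Longrightarrow> k < norm y \<Longrightarrow> \<phi> i y = 0"
  obtains M where "0 \<le> M" "\<And>i y. i \<in> I \<Longrightarrow> \<bar>\<phi> i y\<bar> \<le> M"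
proof -
  have "\<exists>M. \<forall>y. \<bar>\<phi> i y\<bar> \<le> M" if i: "i \<in> I" for i
  proof -
    have "bounded (\<phi> i ` cball 0 k)"
      by (intro compact_imp_bounded compact_continuous_image continuous_on_subset[OF assms(2)[OF i]]) auto
    then obtain M where M: "\<forall>y\<in>cball 0 k. \<bar>\<phi> i y\<bar> \<le> M" by (auto simp: bounded_iff)
    have "\<bar>\<phi> i y\<bar> \<le> max M 0" for y
      using M assms(3)[OF i, of y] by (cases "norm y \<le> k") (auto simp: le_max_iff_disj)
    then show ?thesis by blast
  qed
  then obtain m where m: "\<And>i y. i \<in> I \<Longrightarrow> \<bar>\<phi> i y\<bar> \<le> m i" by metis
  have m0: "0 \<le> m i" if "i \<in> I" for i using m[OF that, of 0] by linarith
  show thesis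
  proof (rule that[of "sum m I"])
    show "0 \<le> sum m I" by (intro sum_nonneg m0)
    show "\<bar>\<phi> i y\<bar> \<le> sum m I" if "i \<in> I" for i y
      using m[OF that, of y] member_le_sum[OF that, of m] m0 assms(1) by force
  qed
qed

text \<open>Here h stands for f + g, and f1, f2, f3, h1, h2 are iterated partial derivatives.\<close>

locale free_wave =
  fixes f :: "real^2 \<Rightarrow> real" and f1 f2 f3 and h :: "real^2 \<Rightarrow> real" and h1 h2 and k :: real
  assumes f1: "has_grad f f1" and f2: "\<And>i. has_grad (f1 i) (f2 i)" and f3: "\<And>i j. has_grad (f2 i j) (f3 i j)"
    and cf3: "\<And>i j l. continuous_on UNIV (f3 i j l)"
    and h1: "has_grad h h1" and h2: "\<And>i. has_grad (h1 i) (h2 i)" and ch2: "\<And>i j. continuous_on UNIV (h2 i j)"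
    and fs: "\<And>y. k < norm y \<Longrightarrow> f y = 0" and hs: "\<And>y. k < norm y \<Longrightarrow> h y = 0"
    and k: "1 \<le> k" and mean: "(LINT y|lborel. h y) = 0"
begin

lemma cf: "continuous_on UNIV f" "continuous_on UNIV (f1 i)" "continuous_on UNIV (f2 i j)"
  and ch: "continuous_on UNIV h" "continuous_on UNIV (h1 i)"
  using has_grad_cont[OF f1] has_grad_cont[OF f2] has_grad_cont[OF f3] has_grad_cont[OF h1] has_grad_cont[OF h2] by blast+

lemma supports: "k < norm y \<Longrightarrow> f1 i y = 0" "k < norm y \<Longrightarrow> f2 i j y = 0" "k < norm y \<Longrightarrow> f3 i j l y = 0"
  "k < norm y \<Longrightarrow> h1 i y = 0" "k < norm y \<Longrightarrow> h2 i j y = 0"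
proof -
  have 1: "f1 i y = 0" if "k < norm y" for i y by (rule has_grad_zero_outside[OF f1 fs that])
  have 2: "f2 i j y = 0" if "k < norm y" for i j y by (rule has_grad_zero_outside[OF f2 1 that])
  have 3: "f3 i j l y = 0" if "k < norm y" for i j l y by (rule has_grad_zero_outside[OF f3 2 that])
  have 4: "h1 i y = 0" if "k < norm y" for i y by (rule has_grad_zero_outside[OF h1 hs that])
  have 5: "h2 i j y = 0" if "k < norm y" for i j y by (rule has_grad_zero_outside[OF h2 4 that])
  show "k < norm y \<Longrightarrow> f1 i y = 0" "k < norm y \<Longrightarrow> f2 i j y = 0" "k < norm y \<Longrightarrow> f3 i j l y = 0"
    "k < norm y \<Longrightarrow> h1 i y = 0" "k < norm y \<Longrightarrow> h2 i j y = 0" by (rule 1 2 3 4 5; assumption)+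
qed

definition "lapf x = (\<Sum>i\<in>UNIV. f2 i i x)"
definition "lapf1 j x = (\<Sum>i\<in>UNIV. f3 i i j x)"
definition "laph x = (\<Sum>i\<in>UNIV. h2 i i x)"

definition "w x t = Rd f f1 x t + Rm h x t"
definition "wx i x t = Rd (f1 i) (f2 i) x t + Rm (h1 i) x t"
definition "wxx i j x t = Rd (f2 i j) (f3 i j) x t + Rm (h2 i j) x t"
definition "wt x t = Rm lapf x t + Rd h h1 x t"
definition "wtx i x t = Rm (lapf1 i) x t + Rd (h1 i) (h2 i) x t"
text \<open>\<open>wxt\<close> is the time derivative of \<open>wx\<close>, and \<open>wtx\<close>
  the gradient of \<open>wt\<close>. They involve the third derivatives of f in different orders;
  both are carried along so that no symmetry has to be proved.\<close>

definition "wxt i x t = Rm (\<lambda>x. \<Sum>j\<in>UNIV. f3 i j j x) x t + Rd (h1 i) (h2 i) x t"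
definition "wtt x t = Rd lapf lapf1 x t + Rm laph x t"

lemma lapf_grad: "has_grad lapf lapf1"
proof -
  have "has_grad (\<lambda>x. f2 1 1 x + f2 2 2 x) (\<lambda>i x. f3 1 1 i x + f3 2 2 i x)"
    by (intro has_grad_add f3)
  then show ?thesis by (simp add: lapf_def[abs_def] lapf1_def[abs_def] sum_2)
qed

lemma c_lap: "continuous_on UNIV lapf" "continuous_on UNIV (lapf1 i)" "continuous_on UNIV laph"
  "continuous_on UNIV (\<lambda>x. \<Sum>j\<in>UNIV. f3 i j j x)"
  unfolding lapf_def[abs_def] lapf1_def[abs_def] laph_def[abs_def] by (intro continuous_intros cf cf3 ch2)+

lemma cstrip_w: "cstrip T w" "cstrip T (wx i)" "cstrip T (wxx i j)" "cstrip T wt" "cstrip T (wtx i)" "cstrip T (wxt i)" "cstrip T wtt"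
  unfolding cstrip_def split_beta w_def wx_def wxx_def wt_def wtx_def wxt_def wtt_def
  by (intro continuous_intros continuous_on_Rd' continuous_on_Rm' cf cf3 ch ch2 c_lap)+

lemma w_grad: "has_grad (\<lambda>x. w x t) (\<lambda>i x. wx i x t)" "has_grad (\<lambda>x. wx i x t) (\<lambda>j x. wxx i j x t)" "has_grad (\<lambda>x. wt x t) (\<lambda>i x. wtx i x t)"
  unfolding w_def wx_def wxx_def wt_def wtx_def
  by (intro has_grad_add Rd_has_grad Rm_has_grad f1 f2 f3 h1 h2 lapf_grad cf cf3 ch ch2 c_lap)+

lemma w_deriv_t: "((\<lambda>t. w x t) has_real_derivative wt x t) (at t within S)"
  "((\<lambda>t. wx i x t) has_real_derivative wxt i x t) (at t within S)"
  "((\<lambda>t. wt x t) has_real_derivative wtt x t) (at t within S)"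
proof -
  have 1: "((\<lambda>t. Rd f f1 x t) has_real_derivative Rm lapf x t) (at t within S)"
    unfolding lapf_def[abs_def] by (rule Rd_deriv_t[OF f1 f2 cf(3)])
  have 2: "((\<lambda>t. Rd (f1 i) (f2 i) x t) has_real_derivative Rm (\<lambda>x. \<Sum>j\<in>UNIV. f3 i j j x) x t) (at t within S)"
    by (rule Rd_deriv_t[OF f2 f3 cf3])
  have 3: "((\<lambda>t. Rd h h1 x t) has_real_derivative Rm laph x t) (at t within S)"
    unfolding laph_def[abs_def] by (rule Rd_deriv_t[OF h1 h2 ch2])
  show "((\<lambda>t. w x t) has_real_derivative wt x t) (at t within S)"
    unfolding w_def wt_def by (intro DERIV_add 1 Rm_deriv_t h1 ch)
  show "((\<lambda>t. wx i x t) has_real_derivative wxt i x t) (at t within S)"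
    unfolding wx_def wxt_def by (intro DERIV_add 2 Rm_deriv_t h2 ch2)
  show "((\<lambda>t. wt x t) has_real_derivative wtt x t) (at t within S)"
    unfolding wt_def wtt_def using DERIV_add[OF Rm_deriv_t[OF lapf_grad c_lap(2)] 3] by (simp add: add.commute)
qed

lemma w_wave: "wtt x t = (\<Sum>i\<in>UNIV. wxx i i x t)"
proof -
  have a: "Rm laph x t = Rm (h2 1 1) x t + Rm (h2 2 2) x t"
    unfolding laph_def[abs_def] sum_2 by (rule Rm_add[OF ch2 ch2])
  have "Rd lapf lapf1 x t = Rd (f2 1 1) (f3 1 1) x t + Rd (f2 2 2) (f3 2 2) x t"
    unfolding Rd_def
    by (subst avg_add[symmetric], (intro continuous_intros continuous_on_shift cf cf3)+, rule avg_cong)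
      (simp add: lapf_def lapf1_def sum_2 algebra_simps)
  with a show ?thesis by (simp add: wtt_def wxx_def sum_2)
qed

lemma w_0: "w x 0 = f x" "wt x 0 = h x" "wx i x 0 = f1 i x"
  by (simp_all add: w_def wt_def wx_def)

lemma w_outside:
  assumes "0 \<le> t" "t + k < norm x" shows "w x t = 0" "wt x t = 0"
proof -
  have "Rd f f1 x t = 0" by (rule Rd_zero_outside[OF fs supports(1) assms])
  moreover have "Rm h x t = 0" by (rule Rm_zero_outside[OF hs assms])
  moreover have "Rm lapf x t = 0" by (rule Rm_zero_outside[OF _ assms]) (simp add: lapf_def supports)
  moreover have "Rd h h1 x t = 0" by (rule Rd_zero_outside[OF hs supports(4) assms])
  ultimately show "w x t = 0" "wt x t = 0" by (simp_all add: w_def wt_def)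
qed

lemma w_bound: "\<exists>M\<ge>0. \<forall>x. \<forall>t\<ge>0. \<bar>w x t\<bar> \<le> M * (1 + t) \<and> \<bar>wt x t\<bar> \<le> M * (1 + t) \<and>
    (\<forall>i. \<bar>wx i x t\<bar> \<le> M * (1 + t)) \<and> (\<forall>i j. \<bar>wxx i j x t\<bar> \<le> M * (1 + t))"
proof -
  let ?F = "{f, h, lapf} \<union> range f1 \<union> range h1 \<union> (\<Union>i. range (f2 i)) \<union> (\<Union>i. range (h2 i)) \<union> (\<Union>i j. range (f3 i j))"
  obtain M where M0: "0 \<le> M" and M: "\<And>\<phi> y. \<phi> \<in> ?F \<Longrightarrow> \<bar>\<phi> y\<bar> \<le> M"
  proof (rule bounded_compact_support[of ?F "\<lambda>\<phi>. \<phi>" k])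
    show "finite ?F" by simp
    show "continuous_on UNIV \<phi>" if "\<phi> \<in> ?F" for \<phi> using that cf ch c_lap cf3 ch2 by auto
    show "\<phi> y = 0" if "\<phi> \<in> ?F" "k < norm y" for \<phi> y using that fs hs supports by (auto simp: lapf_def)
  qed blast
  have Rm: "\<bar>Rm \<phi> x t\<bar> \<le> M * t" if "\<phi> \<in> ?F" "continuous_on UNIV \<phi>" "0 \<le> t" for \<phi> x t
    using that M by (intro Rm_bound) auto
  have Rd: "\<bar>Rd \<phi> D x t\<bar> \<le> M * (1 + 2 * t)" if "\<phi> \<in> ?F" "\<And>i. D i \<in> ?F" "continuous_on UNIV \<phi>" "\<And>i. continuous_on UNIV (D i)" "0 \<le> t" for \<phi> D x t
    using that(3-5) M[OF that(1)] M[OF that(2)] by (intro Rd_bound) auto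
  have s: "\<bar>a + b\<bar> \<le> 4 * M * (1 + t)" if "\<bar>a\<bar> \<le> M * (1 + 2 * t)" "\<bar>b\<bar> \<le> M * t" "0 \<le> t" for a b t
    using that M0 mult_nonneg_nonneg[OF M0 that(3)] by (simp add: algebra_simps)
  have mem: "f \<in> ?F" "h \<in> ?F" "lapf \<in> ?F" "f1 i \<in> ?F" "h1 i \<in> ?F" "f2 i j \<in> ?F" "h2 i j \<in> ?F" "f3 i j l \<in> ?F" for i j l
    using UN_I[of i UNIV "f2 i j" "\<lambda>i. range (f2 i)"] UN_I[of i UNIV "h2 i j" "\<lambda>i. range (h2 i)"]
      UN_I[of i UNIV "f3 i j l" "\<lambda>i. \<Union>j. range (f3 i j)"] UN_I[of j UNIV "f3 i j l" "\<lambda>j. range (f3 i j)"]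
    by (auto simp only: Un_iff insert_iff rangeI UNIV_I simp_thms)
  show ?thesis
  proof (intro exI[of _ "4 * M"] conjI allI impI)
    show "0 \<le> 4 * M" using M0 by simp
    fix x t i j assume t: "0 \<le> (t::real)"
    show "\<bar>w x t\<bar> \<le> 4 * M * (1 + t)" unfolding w_def by (intro s Rd Rm cf ch t mem)
    show "\<bar>wt x t\<bar> \<le> 4 * M * (1 + t)" unfolding wt_def add.commute[of "Rm _ _ _"] by (intro s Rd Rm c_lap ch t mem)
    show "\<bar>wx i x t\<bar> \<le> 4 * M * (1 + t)" unfolding wx_def by (intro s Rd Rm cf ch t mem)
    show "\<bar>wxx i j x t\<bar> \<le> 4 * M * (1 + t)" unfolding wxx_def by (intro s Rd Rm cf cf3 ch2 t mem)
  qed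
qed

text \<open>Near the light cone the decay follows from the comparison argument, applied to the free
  solution multiplied by a function of time that switches off the initial data.\<close>

lemma w_decay_cone: obtains C where "0 < C" "\<And>x t. 0 \<le> t \<Longrightarrow> \<bar>w x t\<bar> \<le> C * (k + 2 + t) powr (- 1 / 2)"
proof -
  obtain M where M0: "0 \<le> M" and M: "\<forall>x. \<forall>t\<ge>0. \<bar>w x t\<bar> \<le> M * (1 + t) \<and> \<bar>wt x t\<bar> \<le> M * (1 + t) \<and>
    (\<forall>i. \<bar>wx i x t\<bar> \<le> M * (1 + t)) \<and> (\<forall>i j. \<bar>wxx i j x t\<bar> \<le> M * (1 + t))"
    using w_bound by (elim exE conjE)
  have Mw: "\<bar>w x t\<bar> \<le> M * (1 + t)" and Mwt: "\<bar>wt x t\<bar> \<le> M * (1 + t)" if "0 \<le> t" for x t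
    using M that by simp_all
  define K where "K = k + 2"
  have K: "1 \<le> K" using k by (simp add: K_def)
  \<comment> \<open>The power makes \<eta> and \<eta>1 vanish at time 0, so \<eta> w has zero data.
    Its wave operator \<eta>2 w + 2 \<eta>1 wt carries a factor exp(-t), which beats the linear
    growth in \<open>w_bound\<close>.\<close>
  define \<eta> where "\<eta> t = (1 - exp (- t)) ^ 3" for t :: real
  define \<eta>1 where "\<eta>1 t = 3 * (1 - exp (- t))\<^sup>2 * exp (- t)" for t :: real
  define \<eta>2 where "\<eta>2 t = 6 * (1 - exp (- t)) * (exp (- t))\<^sup>2 - 3 * (1 - exp (- t))\<^sup>2 * exp (- t)" for t :: real
  have d1: "(\<eta> has_real_derivative \<eta>1 t) (at t within S)" and d2: "(\<eta>1 has_real_derivative \<eta>2 t) (at t within S)" for t S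
    unfolding \<eta>_def[abs_def] \<eta>1_def[abs_def] \<eta>2_def
    by (auto intro!: derivative_eq_intros simp: power2_eq_square algebra_simps)
  have c\<eta>: "continuous_on S \<eta>" "continuous_on S \<eta>1" "continuous_on S \<eta>2" for S
    unfolding \<eta>_def[abs_def] \<eta>1_def[abs_def] \<eta>2_def[abs_def] by (intro continuous_intros)+
  define F where "F x t = \<eta>2 t * w x t + 2 * (\<eta>1 t * wt x t)" for x t
  have repr: "\<eta> t * w x t = calL F x t" if t: "0 \<le> t" for x t
  proof -
    have "\<eta> t * w x t = Rd (\<lambda>y. \<eta> 0 * w y 0) (\<lambda>i y. \<eta> 0 * wx i y 0) x t + Rm (\<lambda>y. \<eta>1 0 * w y 0 + \<eta> 0 * wt y 0) x t
      + calL (\<lambda>y \<tau>. (\<eta>2 \<tau> * w y \<tau> + \<eta>1 \<tau> * wt y \<tau> + (\<eta>1 \<tau> * wt y \<tau> + \<eta> \<tau> * wtt y \<tau>)) - (\<Sum>i\<in>UNIV. \<eta> \<tau> * wxx i i y \<tau>)) x t"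
    proof (rule duhamel[where T=t and v="\<lambda>x t. \<eta> t * w x t" and vx="\<lambda>i x t. \<eta> t * wx i x t" and vxx="\<lambda>i j x t. \<eta> t * wxx i j x t"
        and vt="\<lambda>x t. \<eta>1 t * w x t + \<eta> t * wt x t" and vtx="\<lambda>i x t. \<eta>1 t * wx i x t + \<eta> t * wtx i x t"])
      show "((\<lambda>\<tau>. \<eta> \<tau> * w x \<tau>) has_real_derivative \<eta>1 \<tau> * w x \<tau> + \<eta> \<tau> * wt x \<tau>) (at \<tau> within {0..t})" for x \<tau>
        by (rule DERIV_cong[OF DERIV_mult[OF d1 w_deriv_t(1)]]) simp
      show "((\<lambda>\<tau>. \<eta>1 \<tau> * w x \<tau> + \<eta> \<tau> * wt x \<tau>) has_real_derivative \<eta>2 \<tau> * w x \<tau> + \<eta>1 \<tau> * wt x \<tau> + (\<eta>1 \<tau> * wt x \<tau> + \<eta> \<tau> * wtt x \<tau>)) (at \<tau> within {0..t})" for x \<tau>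
        by (rule DERIV_cong[OF DERIV_add[OF DERIV_mult[OF d2 w_deriv_t(1)] DERIV_mult[OF d1 w_deriv_t(3)]]]) simp
    qed (use t in \<open>auto intro!: cstrip_intros cstrip_w c\<eta> has_grad_cmult has_grad_add w_grad\<close>)
    also have "(\<lambda>y \<tau>. (\<eta>2 \<tau> * w y \<tau> + \<eta>1 \<tau> * wt y \<tau> + (\<eta>1 \<tau> * wt y \<tau> + \<eta> \<tau> * wtt y \<tau>)) - (\<Sum>i\<in>UNIV. \<eta> \<tau> * wxx i i y \<tau>)) = F"
      by (simp add: fun_eq_iff F_def w_wave sum_distrib_left[symmetric])
    finally show ?thesis by (simp add: \<eta>_def \<eta>1_def Rd_def Rm_def)
  qed
  \<comment> \<open>12 = 6 + 2 * 3 comes from the bounds on \<eta>2 and \<eta>1, 3125 K^4 from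
    replacing exp(-\<tau>) (1 + \<tau>) by a power of K + \<tau>, and 8 from
    \<open>cutpow_lower\<close>.\<close>
  define C1 where "C1 = 12 * M * 3125 * K ^ 4 * 8"
  have C10: "0 \<le> C1" using M0 K by (simp add: C1_def)
  have Fb: "\<bar>F y \<tau>\<bar> \<le> C1 * ((K + \<tau>) powr (- 3 / 2 - 1 / 4) * cutpow (3 / 2) 3 (bt y (K + \<tau>)))" if \<tau>: "0 \<le> \<tau>" for y \<tau>
  proof (cases "norm y \<le> \<tau> + k")
    case False
    then show ?thesis using w_outside[OF \<tau>, of y] C10 cutpow_nonneg by (simp add: F_def)
  next
    case True
    define E where "E = exp (- \<tau>)"
    have E: "0 < E" "E \<le> 1" using \<tau> by (simp_all add: E_def)
    have e1: "\<bar>\<eta>1 \<tau>\<bar> \<le> 3 * E"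
    proof -
      have "3 * (1 - E)\<^sup>2 * E \<le> 3 * 1 * E" using E by (intro mult_right_mono mult_left_mono power_le_one) auto
      then show ?thesis using E by (simp add: \<eta>1_def E_def[symmetric])
    qed
    have e2: "\<bar>\<eta>2 \<tau>\<bar> \<le> 6 * E"
    proof -
      have a: "3 * (1 - E)\<^sup>2 * E \<le> 3 * 1 * E" "0 \<le> 3 * (1 - E)\<^sup>2 * E" using E by (auto intro!: mult_right_mono mult_left_mono power_le_one)
      have "6 * (1 - E) * E\<^sup>2 \<le> 6 * 1 * E" using E by (intro mult_mono) (auto simp: power2_eq_square mult_le_cancel_right1)
      moreover have "0 \<le> 6 * (1 - E) * E\<^sup>2" using E by simp
      ultimately show ?thesis using a unfolding \<eta>2_def E_def[symmetric] by linarith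
    qed
    have "\<bar>F y \<tau>\<bar> \<le> 6 * E * (M * (1 + \<tau>)) + 2 * (3 * E * (M * (1 + \<tau>)))"
      unfolding F_def
    proof (rule order_trans[OF abs_triangle_ineq], rule add_mono)
      show "\<bar>\<eta>2 \<tau> * w y \<tau>\<bar> \<le> 6 * E * (M * (1 + \<tau>))"
        unfolding abs_mult using E by (intro mult_mono e2 Mw \<tau>) auto
      have "\<bar>\<eta>1 \<tau> * wt y \<tau>\<bar> \<le> 3 * E * (M * (1 + \<tau>))"
        unfolding abs_mult using E by (intro mult_mono e1 Mwt \<tau>) auto
      then show "\<bar>2 * (\<eta>1 \<tau> * wt y \<tau>)\<bar> \<le> 2 * (3 * E * (M * (1 + \<tau>)))" by (simp add: abs_mult)
    qed
    also have "\<dots> = 12 * M * (E * (1 + \<tau>))" by simp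
    also have "\<dots> \<le> 12 * M * (3125 * K ^ 4 * (K + \<tau>) powr (- 4))"
    proof (rule mult_left_mono)
      \<comment> \<open>The fifth power gives the bound 5^5 = 3125 for exp(-\<tau>) (1 + \<tau>)^5.
        One factor 1 + \<tau> is the growth of w; the other four give (K + \<tau>)^(-4), and 4
        exceeds 3/2 + 1/4 + 3/2.\<close>
      have "1 + \<tau> \<le> 5 * exp (\<tau> / 5)" using exp_ge_add_one_self[of "\<tau> / 5"] by linarith
      then have "(1 + \<tau>) ^ 5 \<le> (5 * exp (\<tau> / 5)) ^ 5" using \<tau> by (intro power_mono) auto
      also have "\<dots> = 3125 * exp \<tau>" by (simp add: power_mult_distrib flip: exp_of_nat_mult)
      finally have 1: "E * (1 + \<tau>) ^ 5 \<le> 3125" by (simp add: E_def exp_minus field_simps)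
      have 2: "(K + \<tau>) ^ 4 \<le> K ^ 4 * (1 + \<tau>) ^ 4"
      proof -
        have "K + \<tau> \<le> K * (1 + \<tau>)" using K \<tau> mult_right_mono[OF K \<tau>] by (simp add: algebra_simps)
        then have "(K + \<tau>) ^ 4 \<le> (K * (1 + \<tau>)) ^ 4" using K \<tau> by (intro power_mono) auto
        then show ?thesis by (simp add: power_mult_distrib)
      qed
      have "E * (1 + \<tau>) * (K + \<tau>) ^ 4 \<le> E * (1 + \<tau>) * (K ^ 4 * (1 + \<tau>) ^ 4)"
        using E \<tau> by (intro mult_left_mono 2) auto
      also have "\<dots> = K ^ 4 * (E * (1 + \<tau>) ^ 5)" by (simp add: eval_nat_numeral algebra_simps)
      also have "\<dots> \<le> K ^ 4 * 3125" using K by (intro mult_left_mono 1) auto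
      finally have "E * (1 + \<tau>) \<le> 3125 * K ^ 4 / (K + \<tau>) ^ 4" using K \<tau> by (simp add: field_simps)
      moreover have "(K + \<tau>) powr (- 4) = 1 / (K + \<tau>) ^ 4" using powr_shift[of "K + \<tau>" 0 4] K \<tau> by simp
      ultimately show "E * (1 + \<tau>) \<le> 3125 * K ^ 4 * (K + \<tau>) powr (- 4)" by simp
    qed (use M0 in simp)
    also have "\<dots> = C1 * ((K + \<tau>) powr (- 4) / 8)" by (simp add: C1_def)
    also have "\<dots> \<le> C1 * ((K + \<tau>) powr (- 3 / 2 - 1 / 4) * cutpow (3 / 2) 3 (bt y (K + \<tau>)))"
    proof (rule mult_left_mono[OF _ C10])
      have pos: "1 \<le> K + \<tau>" using K \<tau> by simp
      have "2 \<le> bt y (K + \<tau>)" using bt_bounds(1)[of y "K + \<tau>"] True pos by (simp add: K_def)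
      then have c: "(K + \<tau>) powr (- (3 / 2)) / 8 \<le> cutpow (3 / 2) 3 (bt y (K + \<tau>))"
        using bt_le[of "K + \<tau>" y] pos by (intro cutpow_lower) auto
      have "(K + \<tau>) powr (- 4) \<le> (K + \<tau>) powr (- 3 / 2 - 1 / 4 + - (3 / 2))"
        using pos by (intro powr_mono) auto
      then have "(K + \<tau>) powr (- 4) / 8 \<le> (K + \<tau>) powr (- 3 / 2 - 1 / 4) * ((K + \<tau>) powr (- (3 / 2)) / 8)"
        unfolding powr_add by simp
      also have "\<dots> \<le> (K + \<tau>) powr (- 3 / 2 - 1 / 4) * cutpow (3 / 2) 3 (bt y (K + \<tau>))"
        by (intro mult_left_mono c) auto
      finally show "(K + \<tau>) powr (- 4) / 8 \<le> (K + \<tau>) powr (- 3 / 2 - 1 / 4) * cutpow (3 / 2) 3 (bt y (K + \<tau>))" .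
    qed
    finally show ?thesis .
  qed
  have vb: "\<bar>\<eta> t * w x t\<bar> \<le> C1 * (408 * (K + t) powr (- 1 / 2))" if t: "0 \<le> t" for x t
  proof -
    have "\<bar>calL F x t\<bar> \<le> calL (\<lambda>y \<tau>. C1 * ((K + \<tau>) powr (- 3 / 2 - 1 / 4) * cutpow (3 / 2) 3 (bt y (K + \<tau>)))) x t"
    proof (rule calL_abs[where T=t])
      show "cstrip t F" unfolding F_def[abs_def] by (intro cstrip_intros cstrip_w c\<eta>)
      show "cstrip t (\<lambda>y \<tau>. C1 * ((K + \<tau>) powr (- 3 / 2 - 1 / 4) * cutpow (3 / 2) 3 (bt y (K + \<tau>))))"
        using K t by (intro cstrip_mult[OF cstrip_const] cstrip_cut) auto
    qed (use t Fb in auto)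
    also have "\<dots> \<le> C1 * (102 / (1 / 2 - 1 / 4) * ((K + t) powr (- 1 / 2) * cutpow (1 / 4) 3 (bt x (K + t))))"
      unfolding calL_cmult by (intro mult_left_mono C10 source_cone_shifted K t) auto
    also have "\<dots> \<le> C1 * (102 / (1 / 2 - 1 / 4) * ((K + t) powr (- 1 / 2) * 1))"
    proof (intro mult_left_mono C10)
      show "cutpow (1 / 4) 3 (bt x (K + t)) \<le> 1" by (rule cutpow_le_one) simp
    qed auto
    finally show ?thesis using repr[OF t, of x] by simp
  qed
  \<comment> \<open>The first summand serves t at least 1, where \<eta> is at least 1/8 and 408 =
    102/(1/2 - 1/4); the second serves t < 1 through the crude bound; the last makes the constant
    positive.\<close>
  define C where "C = 8 * (C1 * 408) + 2 * M * sqrt (K + 1) + 1"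
  show thesis
  proof (rule that[of C])
    show "0 < C" using C10 M0 K by (simp add: C_def add_nonneg_pos)
    fix x :: "real^2" and t :: real assume t: "0 \<le> t"
    let ?p = "(K + t) powr (- 1 / 2)"
    have p0: "0 \<le> ?p" by simp
    have "\<bar>w x t\<bar> \<le> 8 * (C1 * 408) * ?p + 2 * M * sqrt (K + 1) * ?p"
    proof (cases "1 \<le> t")
      case True
      have "exp (- t) \<le> 1 / 2"
      proof -
        have "2 \<le> exp t" using exp_ge_add_one_self[of t] True by linarith
        then show ?thesis by (simp add: exp_minus field_simps)
      qed
      then have "(1 / 2) ^ 3 \<le> \<eta> t" unfolding \<eta>_def by (intro power_mono) auto
      then have "1 / 8 * \<bar>w x t\<bar> \<le> \<eta> t * \<bar>w x t\<bar>" by (intro mult_right_mono) (auto simp: power3_eq_cube)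
      also have "\<dots> \<le> \<bar>\<eta> t * w x t\<bar>" by (simp add: abs_mult mult_right_mono)
      also have "\<dots> \<le> C1 * (408 * ?p)" by (rule vb[OF t])
      finally have "\<bar>w x t\<bar> \<le> 8 * (C1 * 408) * ?p" by simp
      moreover have "0 \<le> 2 * M * sqrt (K + 1) * ?p" using M0 K by simp
      ultimately show ?thesis by linarith
    next
      case False
      have "1 \<le> sqrt (K + 1) * ?p"
      proof -
        have "(K + 1) powr (- 1 / 2) \<le> ?p" using K t False by (intro powr_mono2') auto
        then have "sqrt (K + 1) * (K + 1) powr (- 1 / 2) \<le> sqrt (K + 1) * ?p" using K by (intro mult_left_mono) auto
        moreover have "sqrt (K + 1) * (K + 1) powr (- 1 / 2) = 1"
          using K by (simp add: powr_half_sqrt[symmetric] flip: powr_add)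
        ultimately show ?thesis by simp
      qed
      then have "2 * M * 1 \<le> 2 * M * (sqrt (K + 1) * ?p)" using M0 by (intro mult_left_mono) auto
      moreover have "M * (1 + t) \<le> M * 2" using M0 False by (intro mult_left_mono) auto
      ultimately have "\<bar>w x t\<bar> \<le> 2 * M * sqrt (K + 1) * ?p" using Mw[OF t, of x] by (simp add: mult_ac)
      moreover have "0 \<le> 8 * (C1 * 408) * ?p" using C10 by simp
      ultimately show ?thesis by linarith
    qed
    also have "\<dots> \<le> C * ?p" by (simp add: C_def algebra_simps)
    finally show "\<bar>w x t\<bar> \<le> C * (k + 2 + t) powr (- 1 / 2)" by (simp add: K_def)
  qed
qed

text \<open>The regions are separated by b = t - |x|. For b < -k the solution vanishes. For b < 2k
  the variable \<beta> is bounded, powers of \<beta> cost a constant, and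
  \<open>w_decay_cone\<close> suffices. For b at least 2k one has t - |x| - k at least b/2, and the
  kernel estimates apply.\<close>

lemma w_decay: obtains C where "0 < C"
  "\<And>x t. 0 \<le> t \<Longrightarrow> \<bar>w x t\<bar> \<le> C * ((k + 2 + t) powr (- 1 / 2) * cutpow (3 / 2) 3 (bt x (k + 2 + t)))"
proof -
  obtain C1 where C1: "0 < C1" and cone: "\<And>x t. 0 \<le> t \<Longrightarrow> \<bar>w x t\<bar> \<le> C1 * (k + 2 + t) powr (- 1 / 2)"
    using w_decay_cone by metis
  define K where "K = k + 2"
  have K: "3 \<le> K" "K \<le> 3 * k" using k by (auto simp: K_def)
  define A where "A = 3 * (LINT y|lborel. \<bar>f y\<bar>) + k * (LINT y|lborel. \<bar>h y\<bar>)"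
  have A0: "0 \<le> A" using k by (auto simp: A_def intro!: add_nonneg_nonneg mult_nonneg_nonneg Bochner_Integration.integral_nonneg)
  \<comment> \<open>An upper bound of \<beta> in the region b < 2k, from \<beta> at most 2 (K +
    b).\<close>
  define B where "B = 2 * (K + 2 * k)"
  have B: "0 < B" using K k by (simp add: B_def)
  \<comment> \<open>For b at least 2k: 2^(3/2) stems from d at least b t / 2, 5^(3/2) from \<beta>
    at most 5b, and (5/2)^(1/2) from K + t at most (5/2) t.\<close>
  define c2 where "c2 = 2 powr (3 / 2) * (5 powr (3 / 2) * (5 / 2) powr (1 / 2) :: real)"
  have c20: "0 \<le> c2" by (simp add: c2_def)
  define C where "C = 8 * (C1 * B powr (3 / 2) + A * c2)"
  show thesis
  proof (rule that[of C])
    show C: "0 < C" using C1 B A0 c20 by (simp add: C_def add_pos_nonneg)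
    fix x :: "real^2" and t :: real assume t: "0 \<le> t"
    define \<beta> where "\<beta> = bt x (K + t)"
    define p where "p = (K + t) powr (- 1 / 2)"
    have p0: "0 \<le> p" by (simp add: p_def)
    have "\<bar>w x t\<bar> \<le> C * (p * cutpow (3 / 2) 3 \<beta>)"
    proof (cases "norm x \<le> t + k")
      case False
      then show ?thesis using w_outside[OF t, of x] C p0 cutpow_nonneg by simp
    next
      case True
      define b where "b = t - norm x"
      have xk: "norm x \<le> K + t" "0 < K + t" using True K t by (auto simp: K_def)
      have \<beta>2: "2 \<le> \<beta>" "\<beta> \<le> 2 * (K + b)"
        using bt_bounds[OF xk] True by (auto simp: \<beta>_def b_def K_def)
      show ?thesis
      proof (cases "b < 2 * k")
        case True
        then have "\<beta> \<le> B" using \<beta>2 by (simp add: B_def)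
        then have c: "B powr (- (3 / 2)) / 8 \<le> cutpow (3 / 2) 3 \<beta>" using \<beta>2 by (intro cutpow_lower) auto
        have "\<bar>w x t\<bar> \<le> C1 * p" using cone[OF t, of x] by (simp add: p_def K_def)
        also have "\<dots> = 8 * (C1 * B powr (3 / 2)) * (p * (B powr (- (3 / 2)) / 8))"
          using B by (simp add: powr_minus field_simps)
        also have "\<dots> \<le> 8 * (C1 * B powr (3 / 2)) * (p * cutpow (3 / 2) 3 \<beta>)"
          using C1 p0 by (intro mult_left_mono c) auto
        also have "\<dots> \<le> C * (p * cutpow (3 / 2) 3 \<beta>)"
          using A0 c20 p0 cutpow_nonneg by (intro mult_right_mono mult_nonneg_nonneg) (auto simp: C_def)
        finally show ?thesis .
      next
        case False
        have b: "2 * k \<le> b" "0 < b" using False k by auto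
        have tb: "b \<le> t" by (simp add: b_def)
        have tp: "0 < t" using tb b by linarith
        have xt: "norm x + k < t" using b k by (simp add: b_def)
        define d where "d = (t - norm x - k) * t"
        have d: "b * t / 2 \<le> d"
        proof -
          have "b / 2 * t \<le> (t - norm x - k) * t" using b tp by (intro mult_right_mono) (auto simp: b_def)
          then show ?thesis by (simp add: d_def)
        qed
        have bt0: "0 < b * t / 2" using b tp by simp
        have "\<bar>w x t\<bar> \<le> \<bar>Rd f f1 x t\<bar> + \<bar>Rm h x t\<bar>" unfolding w_def by (rule abs_triangle_ineq)
        also have "\<dots> \<le> (LINT y|lborel. \<bar>f y\<bar>) * (3 * t / (d * sqrt d)) + (LINT y|lborel. \<bar>h y\<bar>) * (k * t / (d * sqrt d))"
          unfolding d_def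
        proof (rule add_mono)
          show "\<bar>Rd f f1 x t\<bar> \<le> (LINT y|lborel. \<bar>f y\<bar>) * (3 * t / ((t - norm x - k) * t * sqrt ((t - norm x - k) * t)))"
            by (rule Rd_interior[OF f1 cf(2) fs xt]) (use k in auto)
          show "\<bar>Rm h x t\<bar> \<le> (LINT y|lborel. \<bar>h y\<bar>) * (k * t / ((t - norm x - k) * t * sqrt ((t - norm x - k) * t)))"
            by (rule Rm_mean_zero_interior[OF ch(1) hs xt _ mean]) (use k in auto)
        qed
        also have "\<dots> = A * (t / (d * sqrt d))" by (simp add: A_def algebra_simps add_divide_distrib)
        also have "\<dots> \<le> A * (c2 * (p * \<beta> powr (- (3 / 2))))"
        proof (rule mult_left_mono[OF _ A0])
          have "t / (d * sqrt d) \<le> t / ((b * t / 2) * sqrt (b * t / 2))"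
            using d bt0 tp by (intro divide_left_mono mult_mono mult_pos_pos) auto
          also have "\<dots> = t * (b * t / 2) powr (- (3 / 2))"
          proof -
            have "(b * t / 2) powr (3 / 2) = (b * t / 2) powr (1 + 1 / 2)" by simp
            also have "\<dots> = (b * t / 2) * sqrt (b * t / 2)"
              unfolding powr_add using bt0 by (simp only: powr_one powr_half_sqrt less_imp_le)
            finally have e: "(b * t / 2) powr (3 / 2) = (b * t / 2) * sqrt (b * t / 2)" .
            show ?thesis unfolding powr_minus e by (rule divide_inverse)
          qed
          also have "(b * t / 2) powr (- (3 / 2)) = 2 powr (3 / 2) * (b powr (- (3 / 2)) * t powr (- (3 / 2)))"
            using b tp by (simp add: powr_mult powr_divide powr_minus field_simps)
          also have "t * (2 powr (3 / 2) * (b powr (- (3 / 2)) * t powr (- (3 / 2)))) = 2 powr (3 / 2) * (b powr (- (3 / 2)) * t powr (- (1 / 2)))"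
          proof -
            have "t * t powr (- (3 / 2)) = t powr (1 + - (3 / 2))" unfolding powr_add using tp by simp
            then show ?thesis by (simp add: mult_ac)
          qed
          also have "\<dots> \<le> 2 powr (3 / 2) * ((5 powr (3 / 2) * \<beta> powr (- (3 / 2))) * ((5 / 2) powr (1 / 2) * p))"
          proof (intro mult_left_mono mult_mono)
            have "2 * (K + b) \<le> 2 * (3 * k + b)" using K by simp
            moreover have "3 * (2 * k) \<le> 3 * b" using b by simp
            ultimately have "\<beta> \<le> 5 * b" using \<beta>2(2) by argo
            then have "(5 * b) powr (- (3 / 2)) \<le> \<beta> powr (- (3 / 2))" using \<beta>2 by (intro powr_mono2') auto
            then have "5 powr (3 / 2) * (5 * b) powr (- (3 / 2)) \<le> 5 powr (3 / 2) * \<beta> powr (- (3 / 2))" by (intro mult_left_mono) auto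
            moreover have "(5 * b) powr (- (3 / 2)) = 5 powr (- (3 / 2)) * b powr (- (3 / 2))" by (rule powr_mult)
            moreover have "(5 :: real) powr (3 / 2) * 5 powr (- (3 / 2)) = 1" by (simp flip: powr_add)
            ultimately show "b powr (- (3 / 2)) \<le> 5 powr (3 / 2) * \<beta> powr (- (3 / 2))"
              by (simp add: mult.assoc[symmetric])
            have "K + t \<le> 5 / 2 * t" using K b tb by linarith
            then have "(5 / 2 * t) powr (- (1 / 2)) \<le> p" unfolding p_def using xk by (simp only: minus_divide_left) (intro powr_mono2', auto)
            then have "(5 / 2) powr (1 / 2) * (5 / 2 * t) powr (- (1 / 2)) \<le> (5 / 2) powr (1 / 2) * p" by (intro mult_left_mono) auto
            moreover have "(5 / 2 * t) powr (- (1 / 2)) = (5 / 2) powr (- (1 / 2)) * t powr (- (1 / 2))" by (rule powr_mult)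
            moreover have "(5 / 2 :: real) powr (1 / 2) * (5 / 2) powr (- (1 / 2)) = 1" by (simp flip: powr_add)
            moreover have "Y \<le> a * p" if "a * X \<le> a * p" "X = a' * Y" "a * a' = 1" for a a' X Y :: real
              using that by (simp add: mult.assoc[symmetric])
            ultimately show "t powr (- (1 / 2)) \<le> (5 / 2) powr (1 / 2) * p" by blast
          qed auto
          finally show "t / (d * sqrt d) \<le> c2 * (p * \<beta> powr (- (3 / 2)))" by (simp add: c2_def mult_ac)
        qed
        also have "\<dots> \<le> A * (c2 * (p * (8 * cutpow (3 / 2) 3 \<beta>)))"
          using cutpow_lower[OF \<beta>2(1) order_refl, of "3 / 2"] A0 c20 p0 by (intro mult_left_mono) auto
        also have "\<dots> = 8 * (A * c2) * (p * cutpow (3 / 2) 3 \<beta>)" by simp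
        also have "\<dots> \<le> C * (p * cutpow (3 / 2) 3 \<beta>)"
          using C1 p0 cutpow_nonneg by (intro mult_right_mono mult_nonneg_nonneg) (auto simp: C_def)
        finally show ?thesis .
      qed
    qed
    then show "\<bar>w x t\<bar> \<le> C * ((k + 2 + t) powr (- 1 / 2) * cutpow (3 / 2) 3 (bt x (k + 2 + t)))"
      by (simp add: p_def \<beta>_def K_def)
  qed
qed

end

section \<open>Functions of class C^n on space-time\<close>

lemma C_on_continuous: "C_on n S \<phi> \<Longrightarrow> continuous_on S \<phi>"
proof (cases n)
  case (Suc m)
  assume "C_on n S \<phi>"
  then show ?thesis unfolding Suc
    by (auto intro: has_derivative_continuous_on)
qed simp

lemma spacetime_sum:
  "(\<Sum>b\<in>Basis. ((a, c) \<bullet> b) * d b) = (\<Sum>i\<in>UNIV. a $ i * d (axis i 1, 0)) + c * d ((0::real^2), 1::real)"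
proof -
  have ne: "axis 1 1 \<noteq> (axis 2 1 :: real^2)" by (simp add: axis_eq_axis)
  show ?thesis
  proof -
    have B: "(Basis :: ((real^2) \<times> real) set) = {(axis 1 1, 0), (axis 2 1, 0), (0, 1)}"
      by (auto simp: Basis_prod_def Basis2)
    show ?thesis unfolding B using ne by (simp add: sum_2 inner_axis)
  qed
qed

lemma C_on_SucD:
  fixes v :: "(real^2) \<times> real \<Rightarrow> real"
  assumes "C_on (Suc n) (spacetime T) v"
  obtains vx vt where "\<And>t. t \<in> {0..<T} \<Longrightarrow> has_grad (\<lambda>x. v (x, t)) (\<lambda>i x. vx i (x, t))"
    "\<And>x t. t \<in> {0..<T} \<Longrightarrow> ((\<lambda>t. v (x, t)) has_real_derivative vt (x, t)) (at t within {0..<T})"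
    "\<And>i. C_on n (spacetime T) (vx i)" "C_on n (spacetime T) vt"
proof -
  obtain D where D: "\<And>z. z \<in> spacetime T \<Longrightarrow> (v has_derivative (\<lambda>h. \<Sum>b\<in>Basis. (h \<bullet> b) * D b z)) (at z within spacetime T)"
    and Dn: "\<And>b. b \<in> Basis \<Longrightarrow> C_on n (spacetime T) (D b)"
    using assms by auto
  have D': "(v has_derivative (\<lambda>(a, c). (\<Sum>i\<in>UNIV. a $ i * D (axis i 1, 0) (x, t)) + c * D (0, 1) (x, t))) (at (x, t) within spacetime T)"
    if "t \<in> {0..<T}" for x t
  proof -
    have "(\<lambda>h. \<Sum>b\<in>Basis. (h \<bullet> b) * D b (x, t)) = (\<lambda>(a, c). (\<Sum>i\<in>UNIV. a $ i * D (axis i 1, 0) (x, t)) + c * D (0, 1) (x, t))"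
      unfolding fun_eq_iff by (auto simp: spacetime_sum)
    then show ?thesis using D[of "(x, t)"] that by (simp add: spacetime_def)
  qed
  show thesis
  proof (rule that[of "\<lambda>i. D (axis i 1, 0)" "D (0, 1)"])
    fix t assume t: "t \<in> {0..<T}"
    show "has_grad (\<lambda>x. v (x, t)) (\<lambda>i x. D (axis i 1, 0) (x, t))"
      unfolding has_grad_def
    proof
      fix x :: "real^2"
      have 1: "((\<lambda>x. (x, t)) has_derivative (\<lambda>h. (h, 0))) (at x within UNIV)" by (auto intro!: derivative_eq_intros)
      have "(\<lambda>x. (x, t)) ` UNIV \<subseteq> spacetime T" using t by (auto simp: spacetime_def)
      from has_derivative_in_compose[OF 1 has_derivative_subset[OF D'[OF t] this]]
      show "((\<lambda>x. v (x, t)) has_derivative (\<lambda>h. \<Sum>i\<in>UNIV. h $ i * D (axis i 1, 0) (x, t))) (at x)" by simp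
    qed
    fix x :: "real^2"
    have 1: "((\<lambda>s. (x, s)) has_derivative (\<lambda>h. (0, h))) (at t within {0..<T})" by (auto intro!: derivative_eq_intros)
    have "(\<lambda>s. (x, s)) ` {0..<T} \<subseteq> spacetime T" by (auto simp: spacetime_def)
    from has_derivative_in_compose[OF 1 has_derivative_subset[OF D'[OF t] this]]
    show "((\<lambda>t. v (x, t)) has_real_derivative D (0, 1) (x, t)) (at t within {0..<T})"
      by (simp add: has_field_derivative_def mult.commute[of _ "D (0, 1) (x, t)"])
  next
    show "C_on n (spacetime T) (D (axis i 1, 0))" for i by (intro Dn) (simp add: Basis_prod_def axis_in_Basis_iff)
    show "C_on n (spacetime T) (D (0, 1))" by (intro Dn) (simp add: Basis_prod_def)
  qed
qed

lemma C_on_SucI: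
  fixes v :: "(real^2) \<times> real \<Rightarrow> real"
  assumes g: "\<And>t. t \<in> {0..<T} \<Longrightarrow> has_grad (\<lambda>x. v (x, t)) (\<lambda>i x. vx i (x, t))"
    and d: "\<And>x t. t \<in> {0..<T} \<Longrightarrow> ((\<lambda>t. v (x, t)) has_real_derivative vt (x, t)) (at t within {0..<T})"
    and n: "\<And>i. C_on n (spacetime T) (vx i)" "C_on n (spacetime T) vt"
  shows "C_on (Suc n) (spacetime T) v"
proof -
  \<comment> \<open>The time component separates the spatial basis vectors from the temporal one; at
    \<open>axis j 1\<close> the sum reduces to \<open>vx j\<close>.\<close>
  define D where "D b = (if snd b = 0 then (\<lambda>z. \<Sum>i\<in>UNIV. fst b $ i * vx i z) else vt)" for b :: "(real^2) \<times> real"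
  have D1: "D (axis j 1, 0) = vx j" for j
    using exhaust_2[of j] by (auto simp: D_def sum_2 axis_def fun_eq_iff)
  have D2: "D (0, 1) = vt" by (simp add: D_def)
  have "(v has_derivative (\<lambda>h. \<Sum>b\<in>Basis. (h \<bullet> b) * D b z)) (at z within spacetime T)" if z: "z \<in> spacetime T" for z
  proof -
    obtain x t where xt: "z = (x, t)" "t \<in> {0..<T}" using z by (auto simp: spacetime_def)
    have "((\<lambda>(x, t). v (x, t)) has_derivative (\<lambda>(tx, ty). (\<Sum>i\<in>UNIV. tx $ i * vx i (x, t)) + blinfun_scaleR_left (vt (x, t)) ty)) (at (x, t) within UNIV \<times> {0..<T})"
    proof (rule has_derivative_partialsI[where fy="\<lambda>x t. blinfun_scaleR_left (vt (x, t))"])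
      show "((\<lambda>x. v (x, t)) has_derivative (\<lambda>tx. \<Sum>i\<in>UNIV. tx $ i * vx i (x, t))) (at x within UNIV)"
        using g[OF xt(2)] by (simp add: has_grad_def)
      show "((\<lambda>y. v (x, y)) has_derivative blinfun_apply (blinfun_scaleR_left (vt (x, y)))) (at y within {0..<T})" if "y \<in> {0..<T}" for x y
      proof -
        have "(*) (vt (x, y)) = (\<lambda>r. r * vt (x, y))" by (simp add: fun_eq_iff)
        then show ?thesis using d[OF that, of x] by (simp add: has_field_derivative_def)
      qed
      have "continuous_on (UNIV \<times> {0..<T}) (\<lambda>z. blinfun_scaleR_left (vt z))"
        using C_on_continuous[OF n(2)] by (intro continuous_intros) (simp add: spacetime_def)
      then show "continuous (at (x, t) within UNIV \<times> {0..<T}) (\<lambda>(x, t). blinfun_scaleR_left (vt (x, t)))"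
        using xt by (auto simp: continuous_on_eq_continuous_within split_beta')
    qed (use xt in auto)
    moreover have "(\<lambda>(tx, ty). (\<Sum>i\<in>UNIV. tx $ i * vx i (x, t)) + blinfun_scaleR_left (vt (x, t)) ty) = (\<lambda>h. \<Sum>b\<in>Basis. (h \<bullet> b) * D b z)"
      unfolding fun_eq_iff by (auto simp: spacetime_sum D1 D2 xt)
    ultimately show ?thesis by (simp add: xt spacetime_def case_prod_eta)
  qed
  moreover have "C_on n (spacetime T) (D b)" if "b \<in> Basis" for b
  proof -
    have "b \<in> {(axis 1 1, 0), (axis 2 1, 0), (0, 1)}" using that by (auto simp: Basis_prod_def Basis2)
    then show ?thesis using n by (auto simp: D1 D2)
  qed
  ultimately show ?thesis
    unfolding C_on.simps by (intro exI[of _ D] conjI ballI)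
qed

text \<open>\<open>dt\<close> is a derivative within the closed half-line, whereas derivatives are
  known within {0..<T}; for t < T the two filters coincide. Since f and g are compared before T
  only, f may itself be a function \<open>dt v\<close>.\<close>

lemma vector_derivative_half_line:
  assumes t: "t \<in> {0..<T}" and d: "(g has_real_derivative d) (at t within {0..<T})" and e: "\<And>s. s \<in> {0..<T} \<Longrightarrow> f s = g s"
  shows "vector_derivative f (at t within {0..}) = d"
proof -
  have at: "at t within {0..} = at t within {0..<T}"
    by (rule at_within_nhd[of _ "{..<T}"]) (use t in auto)
  have "(f has_real_derivative d) (at t within {0..<T})"
    by (rule has_field_derivative_transform_within[OF d zero_less_one t]) (simp add: e)
  then have "(f has_vector_derivative d) (at t within {0..})"
    unfolding at by (simp add: has_real_derivative_iff_has_vector_derivative)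
  moreover have "at t within {0..} \<noteq> bot"
  proof -
    have "t islimpt {t<..<t + 1}" by (rule islimpt_greaterThanLessThan1) simp
    then have "t islimpt {0..}" by (rule islimpt_subset) (use t in auto)
    then show ?thesis by (simp add: trivial_limit_within)
  qed
  ultimately show ?thesis by (intro vector_derivative_within)
qed

lemma dt_eq:
  assumes "t \<in> {0..<T}" "((\<lambda>t. v (x, t)) has_real_derivative d) (at t within {0..<T})"
  shows "dt v (x, t) = d"
  unfolding dt_def by (simp, rule vector_derivative_half_line[OF assms]) simp

lemma dt_dt_eq:
  assumes t: "t \<in> {0..<T}" and v: "\<And>t. t \<in> {0..<T} \<Longrightarrow> ((\<lambda>t. v (x, t)) has_real_derivative vt (x, t)) (at t within {0..<T})"
    and vt: "((\<lambda>t. vt (x, t)) has_real_derivative d) (at t within {0..<T})"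
  shows "dt (dt v) (x, t) = d"
  unfolding dt_def[of "dt v"] by (simp, rule vector_derivative_half_line[OF t vt]) (rule dt_eq[OF _ v])

lemma dx_eq:
  assumes "has_grad (\<lambda>x. v (x, t)) (\<lambda>i x. vx i (x, t))"
  shows "dx i v (x, t) = vx i (x, t)"
proof -
  have "((\<lambda>s. v (x + s *\<^sub>R axis i 1, t)) has_vector_derivative vx i (x, t)) (at 0)"
    using has_grad_line[OF assms, of x i 0 UNIV] by (simp add: has_real_derivative_iff_has_vector_derivative)
  then show ?thesis unfolding dx_def by (simp add: vector_derivative_at)
qed

lemma laplacian_eq:
  assumes g: "has_grad (\<lambda>x. v (x, t)) (\<lambda>i x. vx i (x, t))"
    and gg: "\<And>i. has_grad (\<lambda>x. vx i (x, t)) (\<lambda>j x. vxx i j (x, t))"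
  shows "laplacian v (x, t) = (\<Sum>i\<in>UNIV. vxx i i (x, t))"
proof -
  have "dx i (dx i v) (x, t) = vxx i i (x, t)" for i
  proof (rule dx_eq[where vx="vxx i"])
    have "(\<lambda>x. dx i v (x, t)) = (\<lambda>x. vx i (x, t))" using dx_eq[OF g] by simp
    then show "has_grad (\<lambda>x. dx i v (x, t)) (\<lambda>ia x. vxx i ia (x, t))" using gg by simp
  qed
  then show ?thesis by (simp add: laplacian_def)
qed

lemma has_grad_unique:
  assumes "has_grad \<phi> D" "has_grad \<phi> E" shows "D i x = E i x"
  using DERIV_unique[OF has_grad_line[OF assms(1), of x i 0 UNIV] has_grad_line[OF assms(2), of x i 0 UNIV]] by simp

lemma cstrip_of_spacetime:
  assumes "continuous_on (spacetime T) v" "T' < T"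
  shows "cstrip T' (\<lambda>x t. v (x, t))"
  unfolding cstrip_def case_prod_eta
  by (rule continuous_on_subset[OF assms(1)]) (use assms(2) in \<open>auto simp: spacetime_def\<close>)

lemma spacetime_of_cstrip:
  assumes "cstrip T (\<lambda>x t. v (x, t))" shows "continuous_on (spacetime T) v"
  using assms unfolding cstrip_def case_prod_eta
  by (rule continuous_on_subset) (auto simp: spacetime_def)

section \<open>Powers\<close>

lemma powr_lipschitz:
  fixes a b M p :: real
  assumes "0 \<le> a" "a \<le> M" "0 \<le> b" "b \<le> M" "1 \<le> p"
  shows "\<bar>a powr p - b powr p\<bar> \<le> p * M powr (p - 1) * \<bar>a - b\<bar>"
proof -
  have *: "b powr p - a powr p \<le> p * M powr (p - 1) * (b - a)" if ab: "0 \<le> a" "a < b" "b \<le> M" for a b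
  proof -
    have "\<exists>l z. a < z \<and> z < b \<and> DERIV (\<lambda>x. x powr p) z :> l \<and> b powr p - a powr p = (b - a) * l"
    proof (rule MVT[OF ab(2)])
      show "continuous_on {a..b} (\<lambda>x. x powr p)" using assms ab by (intro continuous_on_powr' continuous_intros) auto
      show "(\<lambda>x. x powr p) differentiable (at x)" if "a < x" "x < b" for x
        using has_real_derivative_powr[of x p] that ab by (auto simp: real_differentiable_def)
    qed
    then obtain l z where z: "a < z" "z < b" "DERIV (\<lambda>x. x powr p) z :> l" "b powr p - a powr p = (b - a) * l" by blast
    have "l = p * z powr (p - 1)" using DERIV_unique[OF z(3) has_real_derivative_powr[of z p]] z ab by simp
    moreover have "z powr (p - 1) \<le> M powr (p - 1)" using z ab assms by (intro powr_mono2) auto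
    ultimately have "l \<le> p * M powr (p - 1)" using assms by (simp add: mult_left_mono)
    then have "(b - a) * l \<le> (b - a) * (p * M powr (p - 1))" using ab by (intro mult_left_mono) auto
    then show ?thesis using z(4) by (simp add: mult.commute)
  qed
  have mono: "a powr p \<le> b powr p" if "0 \<le> a" "a \<le> b" for a b using that assms(5) by (intro powr_mono2) auto
  consider "a < b" | "a = b" | "b < a" by linarith
  then show ?thesis
    using *[of a b] *[of b a] mono[of a b] mono[of b a] assms by cases auto
qed

text \<open>Positive and negative parts replace the sign function, which makes the continuity of the
  derivative evident. At y = 0 the difference quotient is bounded by |h|^(p - 1), which tends to 0
  because p > 1.\<close>

lemma abs_powr_deriv:
  assumes p: "1 < (p::real)"
  shows "((\<lambda>y. \<bar>y\<bar> powr p) has_real_derivative p * ((max y 0) powr (p - 1) - (max (- y) 0) powr (p - 1))) (at y)"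
proof -
  consider "y > 0" | "y < 0" | "y = 0" by linarith
  then show ?thesis
  proof cases
    case 1
    have "((\<lambda>y. y powr p) has_real_derivative p * y powr (p - 1)) (at y)" using 1 by (rule has_real_derivative_powr)
    then have "((\<lambda>y. \<bar>y\<bar> powr p) has_real_derivative p * y powr (p - 1)) (at y)"
      by (rule DERIV_cong_ev[OF refl _ refl, THEN iffD1, rotated])
        (use 1 in \<open>auto simp: eventually_nhds intro!: exI[of _ "{0<..}"]\<close>)
    then show ?thesis using 1 by (simp add: max_def)
  next
    case 2
    have "((\<lambda>y. (- y) powr p) has_real_derivative (p * (- y) powr (p - 1)) * - 1) (at y)"
      by (rule DERIV_chain2[where f="\<lambda>y. y powr p", OF has_real_derivative_powr]) (use 2 in \<open>auto intro!: derivative_eq_intros\<close>)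
    then have "((\<lambda>y. \<bar>y\<bar> powr p) has_real_derivative (p * (- y) powr (p - 1)) * - 1) (at y)"
      by (rule DERIV_cong_ev[OF refl _ refl, THEN iffD1, rotated])
        (use 2 in \<open>auto simp: eventually_nhds intro!: exI[of _ "{..<0}"]\<close>)
    then show ?thesis using 2 by (simp add: max_def)
  next
    case 3
    have "(\<lambda>h::real. \<bar>h\<bar> powr (p - 1)) \<midarrow>0\<rightarrow> \<bar>0\<bar> powr (p - 1)"
      using p by (intro tendsto_powr' tendsto_intros) auto
    then have t: "(\<lambda>h::real. \<bar>h\<bar> powr (p - 1)) \<midarrow>0\<rightarrow> 0" by simp
    have "(\<lambda>h. (\<bar>0 + h\<bar> powr p - \<bar>0\<bar> powr p) / h) \<midarrow>0\<rightarrow> 0"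
    proof (rule Lim_null_comparison[OF _ t])
      show "\<forall>\<^sub>F h in at 0. norm ((\<bar>0 + h\<bar> powr p - \<bar>0\<bar> powr p) / h) \<le> \<bar>h\<bar> powr (p - 1)"
        unfolding eventually_at
      proof (intro exI[of _ 1] conjI ballI impI)
        fix h :: real assume "h \<noteq> 0 \<and> dist h 0 < 1"
        then show "norm ((\<bar>0 + h\<bar> powr p - \<bar>0\<bar> powr p) / h) \<le> \<bar>h\<bar> powr (p - 1)"
          by (simp add: abs_divide powr_diff)
      qed simp
    qed
    then show ?thesis using 3 by (simp add: DERIV_def)
  qed
qed

lemma continuous_abs_powr_deriv:
  assumes "1 < (p::real)"
  shows "continuous_on UNIV (\<lambda>y. p * ((max y 0) powr (p - 1) - (max (- y) 0) powr (p - 1)))"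
  using assms by (intro continuous_on_mult continuous_on_diff continuous_on_const continuous_on_powr' continuous_intros) auto

lemma powr_add_le:
  fixes a b p :: real
  assumes "0 \<le> a" "0 \<le> b" "0 \<le> p"
  shows "(a + b) powr p \<le> 2 powr p * (a powr p + b powr p)"
proof -
  have "(a + b) powr p \<le> (2 * max a b) powr p" using assms by (intro powr_mono2) auto
  also have "\<dots> = 2 powr p * (max a b) powr p" by (rule powr_mult)
  also have "\<dots> \<le> 2 powr p * (a powr p + b powr p)" by (intro mult_left_mono) (auto simp: max_def)
  finally show ?thesis .
qed

text \<open>On the compact backward cone both functions are bounded, so the power is Lipschitz on
  their values, and \<open>gronwall_cone\<close> with \<eta> = 0 applies to the difference.
  Solutions of arbitrary growth in x are covered.\<close>

lemma integral_equation_unique: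
  assumes u: "cstrip T u" and v: "cstrip T v" and p: "1 \<le> p" and t0: "t0 \<in> {0..T}"
    and eu: "\<And>x t. t \<in> {0..T} \<Longrightarrow> u x t = A x t + calL (\<lambda>x \<tau>. (1 + \<tau>) powr (1 - p) * \<bar>u x \<tau>\<bar> powr p) x t"
    and ev: "\<And>x t. t \<in> {0..T} \<Longrightarrow> v x t = A x t + calL (\<lambda>x \<tau>. (1 + \<tau>) powr (1 - p) * \<bar>v x \<tau>\<bar> powr p) x t"
  shows "u x0 t0 = v x0 t0"
proof -
  define F where "F w x \<tau> = (1 + \<tau>) powr (1 - p) * \<bar>w x \<tau>\<bar> powr p" for w :: "real^2 \<Rightarrow> real \<Rightarrow> real" and x \<tau>
  have cF: "cstrip T (F w)" if "cstrip T w" for w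
  proof -
    have "cstrip T (\<lambda>x t. \<bar>w x t\<bar> powr p)"
      using that p unfolding cstrip_def split_beta by (intro continuous_on_powr' continuous_intros) auto
    then show ?thesis unfolding F_def[abs_def]
      by (intro cstrip_mult cstrip_time continuous_intros) auto
  qed
  let ?K = "cball x0 T \<times> {0..T}"
  have "compact ?K" by (intro compact_Times) auto
  then have "bounded ((\<lambda>(x, t). u x t) ` ?K)" "bounded ((\<lambda>(x, t). v x t) ` ?K)"
    using u v unfolding cstrip_def
    by (auto intro!: compact_imp_bounded compact_continuous_image elim!: continuous_on_subset)
  then obtain M1 M2 where "\<forall>z\<in>?K. \<bar>u (fst z) (snd z)\<bar> \<le> M1" "\<forall>z\<in>?K. \<bar>v (fst z) (snd z)\<bar> \<le> M2"
    unfolding bounded_iff by (auto simp: split_beta)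
  then have M: "\<bar>u x t\<bar> \<le> max M1 M2" "\<bar>v x t\<bar> \<le> max M1 M2" if "dist x0 x \<le> T" "t \<in> {0..T}" for x t
    using that by (auto simp: le_max_iff_disj)
  define C where "C = p * (max M1 M2) powr (p - 1)"
  have C: "0 \<le> C" using p by (simp add: C_def)
  define e where "e x t = u x t - v x t" for x t
  have ce: "cstrip T e" unfolding e_def[abs_def] by (intro cstrip_diff u v)
  have "\<bar>e x0 t0\<bar> \<le> 2 * 0 * exp (sqrt (2 * C + 1) * t0)"
  proof (rule gronwall_cone[OF ce C _ t0])
    fix x t assume xt: "0 \<le> t" "t \<le> t0" "dist x0 x \<le> t0 - t"
    have t: "t \<in> {0..T}" using xt t0 by auto
    have "e x t = calL (F u) x t - calL (F v) x t"
      using eu[OF t] ev[OF t] by (simp add: e_def F_def[abs_def])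
    also have "\<dots> = calL (\<lambda>x t. F u x t - F v x t) x t" by (rule calL_diff[OF cF[OF u] cF[OF v] t, symmetric])
    also have "\<bar>\<dots>\<bar> \<le> calL (\<lambda>x t. C * \<bar>e x t\<bar>) x t"
    proof (rule calL_abs[OF cstrip_diff[OF cF[OF u] cF[OF v]] _ t])
      show "cstrip T (\<lambda>x t. C * \<bar>e x t\<bar>)" by (intro cstrip_intros ce)
      fix y \<tau> assume y: "0 \<le> \<tau>" "\<tau> \<le> t" "dist x y \<le> t - \<tau>"
      have "dist x0 y \<le> T" using y xt t0 dist_triangle[of x0 y x] by auto
      then have b: "\<bar>u y \<tau>\<bar> \<le> max M1 M2" "\<bar>v y \<tau>\<bar> \<le> max M1 M2" using M y t by auto
      have "\<bar>F u y \<tau> - F v y \<tau>\<bar> = (1 + \<tau>) powr (1 - p) * \<bar>\<bar>u y \<tau>\<bar> powr p - \<bar>v y \<tau>\<bar> powr p\<bar>"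
        by (simp add: F_def abs_mult flip: right_diff_distrib)
      also have "\<dots> \<le> 1 * (C * \<bar>\<bar>u y \<tau>\<bar> - \<bar>v y \<tau>\<bar>\<bar>)"
      proof (rule mult_mono)
        show "(1 + \<tau>) powr (1 - p) \<le> 1" using powr_mono[of "1 - p" 0 "1 + \<tau>"] p y by simp
        show "\<bar>\<bar>u y \<tau>\<bar> powr p - \<bar>v y \<tau>\<bar> powr p\<bar> \<le> C * \<bar>\<bar>u y \<tau>\<bar> - \<bar>v y \<tau>\<bar>\<bar>"
          unfolding C_def by (intro powr_lipschitz b p) auto
      qed auto
      also have "\<dots> \<le> C * \<bar>e y \<tau>\<bar>" using C by (simp add: e_def mult_left_mono)
      finally show "\<bar>F u y \<tau> - F v y \<tau>\<bar> \<le> C * \<bar>e y \<tau>\<bar>" .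
    qed
    finally show "\<bar>e x t\<bar> \<le> 0 + C * calL (\<lambda>x t. \<bar>e x t\<bar>) x t" by (simp add: calL_cmult)
  qed simp
  then show ?thesis by (simp add: e_def)
qed

section \<open>The nonlinear problem\<close>

lemma cutpow_powr_le:
  assumes "1 \<le> p" "0 \<le> s" shows "cutpow s j \<beta> powr p \<le> cutpow s j \<beta>"
  using powr_mono'[of 1 p "cutpow s j \<beta>"] cutpow_nonneg[of s j \<beta>] cutpow_le_one[OF assms(2), of j \<beta>] assms
  by simp

text \<open>The power multiplies the decay exponent by p, whereas the cut-off factor, being at most
  one, may keep its order j.\<close>

lemma cutpow_powr_le_cutpow:
  assumes p: "1 \<le> p" and j: "0 < j" shows "cutpow s j \<beta> powr p \<le> cutpow (s * p) j \<beta>"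
proof (cases "1 < \<beta>")
  case True
  define q where "q = (1 - 1 / \<beta>) ^ j"
  have q: "0 \<le> q" "q \<le> 1" using True by (auto simp: q_def power_le_one)
  have "cutpow s j \<beta> powr p = \<beta> powr (- s * p) * q powr p"
    using True by (simp add: cutpow_ge1 q_def[symmetric] powr_mult powr_powr)
  also have "\<dots> \<le> \<beta> powr (- s * p) * q"
    using powr_mono'[of 1 p q] q p by (intro mult_left_mono) auto
  finally show ?thesis using True by (simp add: cutpow_ge1 q_def)
qed (use p j in \<open>simp add: cutpow_le1\<close>)

section \<open>A priori bound and existence\<close>

context free_wave
begin

text \<open>The first profile bounds the free solution (with a = \<epsilon> C), the second the
  Duhamel term. They are kept apart because in the nonlinearity only the second loses a power of
  T.\<close>

definition upper :: "real \<Rightarrow> real \<Rightarrow> real \<Rightarrow> real^2 \<Rightarrow> real \<Rightarrow> real" where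
  "upper a b n x t = (k + 2 + t) powr (- 1 / 2) * (a * cutpow (3 / 2) 3 (bt x (k + 2 + t)) + b * cutpow n 3 (bt x (k + 2 + t)))"

lemma upper_nonneg: "0 \<le> a \<Longrightarrow> 0 \<le> b \<Longrightarrow> 0 \<le> upper a b n x t"
  by (simp add: upper_def cutpow_nonneg)

lemma upper_le:
  assumes "0 \<le> a" "0 \<le> b" "0 \<le> n" "0 \<le> t" shows "upper a b n x t \<le> a + b"
proof -
  have "upper a b n x t \<le> 1 * (a * 1 + b * 1)"
    unfolding upper_def
  proof (rule mult_mono)
    show "(k + 2 + t) powr (- 1 / 2) \<le> 1" using powr_mono[of "- 1 / 2" 0 "k + 2 + t"] k assms by simp
    show "a * cutpow (3 / 2) 3 (bt x (k + 2 + t)) + b * cutpow n 3 (bt x (k + 2 + t)) \<le> a * 1 + b * 1"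
      using assms by (intro add_mono mult_left_mono cutpow_le_one) auto
  qed (use assms in \<open>auto simp: cutpow_nonneg\<close>)
  then show ?thesis by simp
qed

lemma cstrip_upper:
  assumes "0 \<le> T" shows "cstrip T (upper a b n)"
  unfolding cstrip_def split_beta upper_def using assms k
  by (intro continuous_intros continuous_on_bt1) auto

text \<open>Weight and t'^(-p/2) combine to r^(1 - 3p/2), which is traded for r^(-3/2 - n) at the
  price H. The p-th power of the first profile is a source for \<open>source_cone\<close>; that of
  the second decays like \<beta>^(-np) = \<beta>^(\<kappa> - 1) and is a source for
  \<open>source_spread\<close>. Hypothesis \<open>R\<close> says that the constants add up to at
  most b.\<close>

lemma upper_self_consistent:
  assumes p: "1 < p" "p \<le> 2" and n: "1 / 4 \<le> n" "n < 1 / 2" and \<kappa>: "0 < \<kappa>" "\<kappa> \<le> 1" "\<kappa> = 1 - n * p"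
    and a: "0 \<le> a" and b: "0 \<le> b" and H0: "0 \<le> H"
    and H: "\<And>r. 1 \<le> r \<Longrightarrow> r \<le> k + 2 + T \<Longrightarrow> r powr (1 - 3 * p / 2) \<le> H * r powr (- 3 / 2 - n)"
    and R: "(k + 2) * H * 2 powr p / (1 / 2 - n) * (102 * a powr p + 24 * (k + 2 + T) powr \<kappa> / \<kappa> * b powr p) \<le> b"
    and t: "t \<in> {0..T}"
  shows "calL (\<lambda>x \<tau>. (1 + \<tau>) powr (1 - p) * upper a b n x \<tau> powr p) x t
    \<le> b * ((k + 2 + t) powr (- 1 / 2) * cutpow n 3 (bt x (k + 2 + t)))"
proof -
  define K where "K = k + 2"
  have K: "1 \<le> K" using k by (simp add: K_def)
  define c where "c = K * H * 2 powr p"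
  have c: "0 \<le> c" using K H0 by (simp add: c_def)
  let ?G = "\<lambda>s y \<tau>. (K + \<tau>) powr (- 3 / 2 - n) * cutpow s 3 (bt y (K + \<tau>))"
  have cG: "cstrip T (?G s)" for s using t K by (intro cstrip_cut) auto
  have cU: "cstrip T (\<lambda>x \<tau>. (1 + \<tau>) powr (1 - p) * upper a b n x \<tau> powr p)"
  proof (rule cstrip_mult)
    show "cstrip T (\<lambda>x \<tau>. (1 + \<tau>) powr (1 - p))" by (intro cstrip_time continuous_intros) auto
    show "cstrip T (\<lambda>x \<tau>. upper a b n x \<tau> powr p)"
      using cstrip_upper[of T a b n] t p upper_nonneg[OF a b, of n] unfolding cstrip_def split_beta
      by (intro continuous_on_powr' continuous_intros) auto
  qed
  have "calL (\<lambda>x \<tau>. (1 + \<tau>) powr (1 - p) * upper a b n x \<tau> powr p) x t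
    \<le> calL (\<lambda>x \<tau>. c * (a powr p * ?G (3 / 2) x \<tau> + b powr p * ?G (1 - \<kappa>) x \<tau>)) x t"
  proof (rule calL_mono[OF cU _ t])
    show "cstrip T (\<lambda>x \<tau>. c * (a powr p * ?G (3 / 2) x \<tau> + b powr p * ?G (1 - \<kappa>) x \<tau>))"
      by (intro cstrip_mult[OF cstrip_const] cstrip_add cG)
    fix y \<tau> assume \<tau>: "0 \<le> \<tau>" "\<tau> \<le> t"
    define r where "r = K + \<tau>"
    have r: "1 \<le> r" "r \<le> k + 2 + T" using \<tau> K t by (auto simp: r_def K_def)
    define A where "A = cutpow (3 / 2) 3 (bt y r)"
    define B where "B = cutpow n 3 (bt y r)"
    have AB: "0 \<le> A" "0 \<le> B" by (simp_all add: A_def B_def cutpow_nonneg)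
    have up: "upper a b n y \<tau> = r powr (- 1 / 2) * (a * A + b * B)"
      by (simp add: upper_def r_def K_def A_def B_def)
    \<comment> \<open>The weight in 1 + \<tau> is replaced by one in K + \<tau>. The cost K^(p - 1)
      is at most K because p is at most 2.\<close>
    have 1: "(1 + \<tau>) powr (1 - p) \<le> K * r powr (1 - p)"
    proof -
      have "r \<le> K * (1 + \<tau>)" using K \<tau> mult_right_mono[OF K \<tau>(1)] by (simp add: r_def algebra_simps)
      then have "(K * (1 + \<tau>)) powr (1 - p) \<le> r powr (1 - p)" using r p by (intro powr_mono2') auto
      then have "K powr (p - 1) * (K * (1 + \<tau>)) powr (1 - p) \<le> K powr (p - 1) * r powr (1 - p)" by (intro mult_left_mono) auto
      also have "\<dots> \<le> K powr 1 * r powr (1 - p)" using K p by (intro mult_right_mono powr_mono) auto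
      also have "K powr (p - 1) * (K * (1 + \<tau>)) powr (1 - p) = (1 + \<tau>) powr (1 - p)"
      proof -
        have "K powr (p - 1) * K powr (1 - p) = 1" using K by (simp flip: powr_add)
        then show ?thesis by (simp add: powr_mult mult.assoc[symmetric])
      qed
      finally show ?thesis using K by simp
    qed
    have 2: "upper a b n y \<tau> powr p \<le> r powr (- p / 2) * (2 powr p * (a powr p * A + b powr p * cutpow (1 - \<kappa>) 3 (bt y r)))"
    proof -
      have "upper a b n y \<tau> powr p = r powr (- p / 2) * (a * A + b * B) powr p"
        by (simp add: up powr_mult powr_powr)
      also have "\<dots> \<le> r powr (- p / 2) * (2 powr p * ((a * A) powr p + (b * B) powr p))"
        using a b AB p by (intro mult_left_mono powr_add_le) auto
      also have "\<dots> \<le> r powr (- p / 2) * (2 powr p * (a powr p * A + b powr p * cutpow (1 - \<kappa>) 3 (bt y r)))"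
      proof (intro mult_left_mono add_mono)
        show "(a * A) powr p \<le> a powr p * A"
          unfolding powr_mult A_def using p by (intro mult_left_mono cutpow_powr_le) auto
        show "(b * B) powr p \<le> b powr p * cutpow (1 - \<kappa>) 3 (bt y r)"
          unfolding powr_mult B_def using p \<kappa>(3) cutpow_powr_le_cutpow[of p 3 n "bt y r"] by (intro mult_left_mono) auto
      qed auto
      finally show ?thesis .
    qed
    define Z where "Z = 2 powr p * (a powr p * A + b powr p * cutpow (1 - \<kappa>) 3 (bt y r))"
    have Z: "0 \<le> Z" using AB by (simp add: Z_def cutpow_nonneg)
    have "(1 + \<tau>) powr (1 - p) * upper a b n y \<tau> powr p \<le> K * r powr (1 - p) * (r powr (- p / 2) * Z)"
      using 2 K unfolding Z_def[symmetric] by (intro mult_mono 1) auto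
    also have "\<dots> = K * (r powr (1 - 3 * p / 2) * Z)"
    proof -
      have "r powr (1 - p) * r powr (- p / 2) = r powr (1 - 3 * p / 2)" unfolding powr_add[symmetric] by (rule arg_cong[where f="\<lambda>s. r powr s"]) simp
      then show ?thesis by (simp add: mult.assoc[symmetric])
    qed
    also have "\<dots> \<le> K * ((H * r powr (- 3 / 2 - n)) * Z)"
      using K Z by (intro mult_left_mono mult_right_mono H r) auto
    also have "\<dots> = c * (a powr p * ?G (3 / 2) y \<tau> + b powr p * ?G (1 - \<kappa>) y \<tau>)"
      unfolding c_def Z_def A_def r_def by (simp add: algebra_simps)
    finally show "(1 + \<tau>) powr (1 - p) * upper a b n y \<tau> powr p \<le> c * (a powr p * ?G (3 / 2) y \<tau> + b powr p * ?G (1 - \<kappa>) y \<tau>)" .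
  qed
  also have "\<dots> = c * (a powr p * calL (?G (3 / 2)) x t + b powr p * calL (?G (1 - \<kappa>)) x t)"
    unfolding calL_cmult calL_add[OF cstrip_mult[OF cstrip_const cG] cstrip_mult[OF cstrip_const cG] t] ..
  also have "\<dots> \<le> c * (a powr p * (102 / (1 / 2 - n) * ((K + t) powr (- 1 / 2) * cutpow n 3 (bt x (K + t))))
      + b powr p * (24 * (K + T) powr \<kappa> / \<kappa> / (1 / 2 - n) * ((K + t) powr (- 1 / 2) * cutpow n 3 (bt x (K + t)))))"
  proof (intro mult_left_mono add_mono c)
    show "calL (?G (3 / 2)) x t \<le> 102 / (1 / 2 - n) * ((K + t) powr (- 1 / 2) * cutpow n 3 (bt x (K + t)))"
      using t by (intro source_cone_shifted n K) auto
    have "calL (?G (1 - \<kappa>)) x t \<le> 24 * (K + t) powr \<kappa> / \<kappa> / (1 / 2 - n) * ((K + t) powr (- 1 / 2) * cutpow n 3 (bt x (K + t)))"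
      using t by (intro source_spread_shifted n K \<kappa>) auto
    also have "\<dots> \<le> 24 * (K + T) powr \<kappa> / \<kappa> / (1 / 2 - n) * ((K + t) powr (- 1 / 2) * cutpow n 3 (bt x (K + t)))"
      using t K \<kappa> n by (intro mult_right_mono divide_right_mono mult_left_mono powr_mono2 mult_nonneg_nonneg) (auto simp: cutpow_nonneg)
    finally show "calL (?G (1 - \<kappa>)) x t \<le> 24 * (K + T) powr \<kappa> / \<kappa> / (1 / 2 - n) * ((K + t) powr (- 1 / 2) * cutpow n 3 (bt x (K + t)))" .
  qed auto
  also have "\<dots> = (K * H * 2 powr p / (1 / 2 - n) * (102 * a powr p + 24 * (K + T) powr \<kappa> / \<kappa> * b powr p)) * ((K + t) powr (- 1 / 2) * cutpow n 3 (bt x (K + t)))"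
  proof -
    have id: "c * (A * (102 / m * X) + B * (E / m * X)) = c / m * (102 * A + E * B) * X" for c A B E m X :: real
      by (simp add: algebra_simps add_divide_distrib)
    show ?thesis unfolding c_def by (rule id)
  qed
  also have "\<dots> \<le> b * ((K + t) powr (- 1 / 2) * cutpow n 3 (bt x (K + t)))"
    using R by (intro mult_right_mono) (auto simp: K_def cutpow_nonneg)
  finally show ?thesis by (simp add: K_def)
qed

lemma solution_exists:
  assumes p: "1 < p" "p \<le> 2" and n: "1 / 4 \<le> n" "n < 1 / 2" and \<kappa>: "0 < \<kappa>" "\<kappa> \<le> 1" "\<kappa> = 1 - n * p"
    and C: "0 < C" "\<And>x t. 0 \<le> t \<Longrightarrow> \<bar>w x t\<bar> \<le> C * ((k + 2 + t) powr (- 1 / 2) * cutpow (3 / 2) 3 (bt x (k + 2 + t)))"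
    and e: "0 < \<epsilon>" and b: "0 \<le> b" and H0: "0 \<le> H" and T: "0 \<le> T"
    and H: "\<And>r. 1 \<le> r \<Longrightarrow> r \<le> k + 2 + T \<Longrightarrow> r powr (1 - 3 * p / 2) \<le> H * r powr (- 3 / 2 - n)"
    and R: "(k + 2) * H * 2 powr p / (1 / 2 - n) * (102 * (\<epsilon> * C) powr p + 24 * (k + 2 + T) powr \<kappa> / \<kappa> * b powr p) \<le> b"
  obtains u M where "cstrip T u" "\<And>x t. t \<in> {0..T} \<Longrightarrow> \<bar>u x t\<bar> \<le> M"
    "\<And>x t. t \<in> {0..T} \<Longrightarrow> u x t = \<epsilon> * w x t + calL (\<lambda>x \<tau>. (1 + \<tau>) powr (1 - p) * \<bar>u x \<tau>\<bar> powr p) x t"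
proof -
  obtain M0 where M0: "0 \<le> M0" "\<forall>x. \<forall>t\<ge>0. \<bar>w x t\<bar> \<le> M0 * (1 + t) \<and> \<bar>wt x t\<bar> \<le> M0 * (1 + t) \<and>
    (\<forall>i. \<bar>wx i x t\<bar> \<le> M0 * (1 + t)) \<and> (\<forall>i j. \<bar>wxx i j x t\<bar> \<le> M0 * (1 + t))"
    using w_bound by (elim exE conjE)
  define U where "U = upper (\<epsilon> * C) b n"
  have a0: "0 \<le> \<epsilon> * C" using e C by simp
  have U0: "0 \<le> U x t" for x t unfolding U_def by (rule upper_nonneg[OF a0 b])
  have UM: "U x t \<le> \<epsilon> * C + b" if "0 \<le> t" for x t unfolding U_def using n by (intro upper_le a0 b that) auto
  have cU: "cstrip T U" unfolding U_def by (rule cstrip_upper[OF T])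
  define B where "B x t y = (1 + t) powr (1 - p) * (min \<bar>y\<bar> (U x t)) powr p" for x t y
  \<comment> \<open>The Lipschitz constant of the power on [0, \<epsilon> C + b], the range of the
    cut-off argument.\<close>
  define Cl where "Cl = p * (\<epsilon> * C + b) powr (p - 1)"
  have Cl: "0 \<le> Cl" using p by (simp add: Cl_def)
  have pw: "(1 + t) powr (1 - p) \<le> 1" if "0 \<le> t" for t using powr_mono[of "1 - p" 0 "1 + t"] p that by simp
  have cpw: "cstrip T (\<lambda>x t. (1 + t) powr (1 - p))" by (intro cstrip_time continuous_intros) auto
  have cB: "cstrip T (\<lambda>x t. B x t (v x t))" if "cstrip T v" for v
    unfolding B_def
  proof (rule cstrip_mult[OF cpw])
    show "cstrip T (\<lambda>x t. min \<bar>v x t\<bar> (U x t) powr p)"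
      using that cU p U0 unfolding cstrip_def split_beta by (intro continuous_on_powr' continuous_intros) auto
  qed
  obtain u M where u: "cstrip T u" "\<And>x t. t \<in> {0..T} \<Longrightarrow> \<bar>u x t\<bar> \<le> M"
    and eq: "\<And>x t. t \<in> {0..T} \<Longrightarrow> u x t = \<epsilon> * w x t + calL (\<lambda>x t. B x t (u x t)) x t"
  proof (rule volterra_fixpoint[of T "\<lambda>x t. \<epsilon> * w x t" "\<epsilon> * (M0 * (1 + T))" B Cl 0])
    show "cstrip T (\<lambda>x t. \<epsilon> * w x t)" by (intro cstrip_mult[OF cstrip_const] cstrip_w)
    show "\<bar>\<epsilon> * w x t\<bar> \<le> \<epsilon> * (M0 * (1 + T))" if "t \<in> {0..T}" for x t
    proof -
      have "\<bar>w x t\<bar> \<le> M0 * (1 + t)" using M0 that by simp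
      also have "\<dots> \<le> M0 * (1 + T)" using M0 that by (intro mult_left_mono) auto
      finally show ?thesis using e by (simp add: abs_mult)
    qed
    show "\<bar>B x t y - B x t z\<bar> \<le> Cl * \<bar>y - z\<bar>" if "t \<in> {0..T}" for x t y z
    proof -
      have t: "0 \<le> t" using that by simp
      have "\<bar>B x t y - B x t z\<bar> = (1 + t) powr (1 - p) * \<bar>min \<bar>y\<bar> (U x t) powr p - min \<bar>z\<bar> (U x t) powr p\<bar>"
        by (simp add: B_def abs_mult flip: right_diff_distrib)
      also have "\<dots> \<le> 1 * (Cl * \<bar>min \<bar>y\<bar> (U x t) - min \<bar>z\<bar> (U x t)\<bar>)"
        unfolding Cl_def using UM[OF t, of x] U0[of x t] p
        by (intro mult_mono pw[OF t] powr_lipschitz) (auto simp: min_le_iff_disj)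
      also have "\<dots> \<le> Cl * \<bar>y - z\<bar>" using Cl by (auto intro!: mult_left_mono)
      finally show ?thesis .
    qed
    show "\<bar>B x t 0\<bar> \<le> 0" for x t using U0[of x t] by (simp add: B_def min_def)
  qed (use cB T Cl in auto)
  \<comment> \<open>No continuity argument in time occurs: the truncated nonlinearity is bounded by
    the weighted power of U for every u, so the Duhamel term is bounded at once by the second part
    of U.\<close>
  have uU: "\<bar>u x t\<bar> \<le> U x t" if t: "t \<in> {0..T}" for x t
  proof -
    have "\<bar>calL (\<lambda>x t. B x t (u x t)) x t\<bar> \<le> calL (\<lambda>x \<tau>. (1 + \<tau>) powr (1 - p) * U x \<tau> powr p) x t"
    proof (rule calL_abs[OF cB[OF u(1)] _ t])
      show "cstrip T (\<lambda>x \<tau>. (1 + \<tau>) powr (1 - p) * U x \<tau> powr p)"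
      proof (rule cstrip_mult[OF cpw])
        show "cstrip T (\<lambda>x \<tau>. U x \<tau> powr p)"
          using cU p U0 unfolding cstrip_def split_beta by (intro continuous_on_powr' continuous_intros) auto
      qed
      show "\<bar>B y \<tau> (u y \<tau>)\<bar> \<le> (1 + \<tau>) powr (1 - p) * U y \<tau> powr p" for y \<tau>
        unfolding B_def using p U0[of y \<tau>] by (auto simp: abs_mult intro!: mult_left_mono powr_mono2)
    qed
    also have "\<dots> \<le> b * ((k + 2 + t) powr (- 1 / 2) * cutpow n 3 (bt x (k + 2 + t)))"
      unfolding U_def by (rule upper_self_consistent[OF p n \<kappa> a0 b H0 H R t])
    finally have "\<bar>calL (\<lambda>x t. B x t (u x t)) x t\<bar> \<le> b * ((k + 2 + t) powr (- 1 / 2) * cutpow n 3 (bt x (k + 2 + t)))" .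
    moreover have "\<bar>\<epsilon> * w x t\<bar> \<le> \<epsilon> * (C * ((k + 2 + t) powr (- 1 / 2) * cutpow (3 / 2) 3 (bt x (k + 2 + t))))"
      using C(2)[of t x] e t by (simp add: abs_mult)
    ultimately show ?thesis unfolding eq[OF t] U_def upper_def by (simp add: algebra_simps)
  qed
  show thesis
  proof (rule that[OF u])
    fix x t assume t: "t \<in> {0..T}"
    have "calL (\<lambda>x t. B x t (u x t)) x t = calL (\<lambda>x \<tau>. (1 + \<tau>) powr (1 - p) * \<bar>u x \<tau>\<bar> powr p) x t"
      using t uU by (intro calL_cong) (simp add: B_def min_absorb1)
    then show "u x t = \<epsilon> * w x t + calL (\<lambda>x \<tau>. (1 + \<tau>) powr (1 - p) * \<bar>u x \<tau>\<bar> powr p) x t"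
      using eq[OF t, of x] by simp
  qed
qed

section \<open>Regularity of the solution\<close>

context
  fixes p \<epsilon> T M :: real and u :: "real^2 \<Rightarrow> real \<Rightarrow> real"
  assumes p: "1 < p" and T: "0 < T" and e: "0 < \<epsilon>" and u: "cstrip T u" and ub: "\<And>x t. t \<in> {0..T} \<Longrightarrow> \<bar>u x t\<bar> \<le> M"
    and eq: "\<And>x t. t \<in> {0..T} \<Longrightarrow> u x t = \<epsilon> * w x t + calL (\<lambda>x \<tau>. (1 + \<tau>) powr (1 - p) * \<bar>u x \<tau>\<bar> powr p) x t"
begin

lemma w_uniform_bound: obtains a where "\<And>i x t. t \<in> {0..T} \<Longrightarrow> \<bar>\<epsilon> * wx i x t\<bar> \<le> a" "\<And>i j x t. t \<in> {0..T} \<Longrightarrow> \<bar>\<epsilon> * wxx i j x t\<bar> \<le> a"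
proof -
  obtain M0 where M0: "0 \<le> M0" "\<forall>x. \<forall>t\<ge>0. \<bar>w x t\<bar> \<le> M0 * (1 + t) \<and> \<bar>wt x t\<bar> \<le> M0 * (1 + t) \<and>
    (\<forall>i. \<bar>wx i x t\<bar> \<le> M0 * (1 + t)) \<and> (\<forall>i j. \<bar>wxx i j x t\<bar> \<le> M0 * (1 + t))"
    using w_bound by (elim exE conjE)
  have "\<bar>\<epsilon> * y\<bar> \<le> \<epsilon> * (M0 * (1 + T))" if "t \<in> {0..T}" "\<bar>y\<bar> \<le> M0 * (1 + t)" for y t
  proof -
    have "M0 * (1 + t) \<le> M0 * (1 + T)" using M0 that by (intro mult_left_mono) auto
    then show ?thesis using e that by (simp add: abs_mult)
  qed
  then show thesis using M0 by (intro that[of "\<epsilon> * (M0 * (1 + T))"]) auto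
qed

lemma time_weight: "cstrip T (\<lambda>x t. (1 + t) powr (1 - p))" "\<bar>(1 + t) powr (1 - p)\<bar> \<le> 1" if "t \<in> {0..T}" for t
  using powr_mono[of "1 - p" 0 "1 + t"] p that by (auto intro!: cstrip_time continuous_intros)

lemma ut_deriv:
  assumes "\<And>i. cstrip T (D i)" "\<And>\<tau>. \<tau> \<in> {0..T} \<Longrightarrow> has_grad (\<lambda>x. (1 + \<tau>) powr (1 - p) * \<bar>u x \<tau>\<bar> powr p) (\<lambda>i x. D i x \<tau>)"
    and F: "cstrip T (\<lambda>x \<tau>. (1 + \<tau>) powr (1 - p) * \<bar>u x \<tau>\<bar> powr p)" and t: "t \<in> {0..<T}"
  shows "((\<lambda>t. u x t) has_real_derivative \<epsilon> * wt x t + calLd (\<lambda>x \<tau>. (1 + \<tau>) powr (1 - p) * \<bar>u x \<tau>\<bar> powr p) D x t) (at t within {0..<T})"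
proof -
  have tT: "t \<in> {0..T}" using t by auto
  have "((\<lambda>t. \<epsilon> * w x t + calL (\<lambda>x \<tau>. (1 + \<tau>) powr (1 - p) * \<bar>u x \<tau>\<bar> powr p) x t) has_real_derivative
      \<epsilon> * wt x t + calLd (\<lambda>x \<tau>. (1 + \<tau>) powr (1 - p) * \<bar>u x \<tau>\<bar> powr p) D x t) (at t within {0..T})"
    by (intro DERIV_add DERIV_cmult w_deriv_t calL_deriv_t[OF F assms(1,2) tT])
  then have "((\<lambda>t. u x t) has_real_derivative
      \<epsilon> * wt x t + calLd (\<lambda>x \<tau>. (1 + \<tau>) powr (1 - p) * \<bar>u x \<tau>\<bar> powr p) D x t) (at t within {0..T})"
    by (rule has_field_derivative_transform_within[OF _ zero_less_one tT]) (simp add: eq)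
  then show ?thesis by (rule DERIV_subset) auto
qed

text \<open>One application of \<open>volterra_differentiable\<close> gives the gradient, and the
  time derivative is read off from the Duhamel term. For p < 2 the function |y|^p has no second
  derivative at 0, which is why only C^1 is claimed there.\<close>

lemma solution_C1: "C_on 1 (spacetime T) (\<lambda>(x, t). u x t)"
proof -
  let ?N = "\<lambda>y::real. \<bar>y\<bar> powr p"
  let ?N' = "\<lambda>y::real. p * ((max y 0) powr (p - 1) - (max (- y) 0) powr (p - 1))"
  let ?F = "\<lambda>x \<tau>. (1 + \<tau>) powr (1 - p) * ?N (u x \<tau>)"
  obtain a where a: "\<And>i x t. t \<in> {0..T} \<Longrightarrow> \<bar>\<epsilon> * wx i x t\<bar> \<le> a" using w_uniform_bound by metis
  have T0: "0 \<le> T" using T by simp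
  have cpw: "cstrip T (\<lambda>x t. (1 + t) powr (1 - p))" using time_weight(1)[of 0] T by simp
  obtain v where v: "\<And>i. cstrip T (v i)" and gv: "\<And>t. t \<in> {0..T} \<Longrightarrow> has_grad (\<lambda>x. u x t) (\<lambda>i x. v i x t)"
  proof (rule volterra_differentiable[OF T0 u ub, of "\<lambda>x t. \<epsilon> * w x t" "\<lambda>x t. (1 + t) powr (1 - p)" ?N "\<lambda>i x t. \<epsilon> * wx i x t" a "\<lambda>i x t. 0" 1 ?N'])
    show "u x t = \<epsilon> * w x t + calL ?F x t" if "t \<in> {0..T}" for x t by (rule eq[OF that])
    show "has_grad (\<lambda>x. \<epsilon> * w x t) (\<lambda>i x. \<epsilon> * wx i x t)" for t by (intro has_grad_cmult w_grad)
    show "cstrip T (\<lambda>x t. \<epsilon> * wx i x t)" for i by (intro cstrip_mult[OF cstrip_const] cstrip_w)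
    show "has_grad (\<lambda>x. (1 + t) powr (1 - p)) (\<lambda>i x. 0)" for t by (simp add: has_grad_def)
    show "(?N has_real_derivative ?N' y) (at y)" for y by (rule abs_powr_deriv[OF p])
    show "continuous_on UNIV ?N'" by (rule continuous_abs_powr_deriv[OF p])
    show "\<bar>(1 + t) powr (1 - p)\<bar> \<le> 1" if "t \<in> {0..T}" for t by (rule time_weight(2)[OF that])
    show "\<bar>\<epsilon> * wx i x t\<bar> \<le> a" if "t \<in> {0..T}" for i x t by (rule a[OF that])
    fix v :: "2 \<Rightarrow> real^2 \<Rightarrow> real \<Rightarrow> real" assume 1: "\<And>i. cstrip T (v i)" and 2: "\<And>t. t \<in> {0..T} \<Longrightarrow> has_grad (\<lambda>x. u x t) (\<lambda>i x. v i x t)"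
    show thesis by (rule that[OF 1 2])
  qed (assumption | rule cpw | rule cstrip_const | simp)+
  have cN: "cstrip T (\<lambda>x t. ?N (u x t))"
    using u p unfolding cstrip_def split_beta by (intro continuous_on_powr' continuous_intros) auto
  have cN': "cstrip T (\<lambda>x t. ?N' (u x t))"
    using u unfolding cstrip_def split_beta by (auto intro!: continuous_on_compose2[OF continuous_abs_powr_deriv[OF p]])
  define D where "D i x \<tau> = (1 + \<tau>) powr (1 - p) * (?N' (u x \<tau>) * v i x \<tau>)" for i x \<tau>
  have cF: "cstrip T ?F" by (intro cstrip_mult cpw cN)
  have cD: "cstrip T (D i)" for i unfolding D_def[abs_def] by (intro cstrip_mult cpw cN' v)
  have gF: "has_grad (\<lambda>x. ?F x \<tau>) (\<lambda>i x. D i x \<tau>)" if "\<tau> \<in> {0..T}" for \<tau>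
    unfolding D_def by (intro has_grad_cmult has_grad_compose[where S="?N"] gv[OF that] abs_powr_deriv[OF p])
  show ?thesis
    unfolding One_nat_def
  proof (rule C_on_SucI[where vx="\<lambda>i (x, t). v i x t" and vt="\<lambda>(x, t). \<epsilon> * wt x t + calLd ?F D x t"])
    show "has_grad (\<lambda>x. case (x, t) of (x, t) \<Rightarrow> u x t) (\<lambda>i x. case (x, t) of (x, t) \<Rightarrow> v i x t)" if "t \<in> {0..<T}" for t
      using gv[of t] that by simp
    show "((\<lambda>t. case (x, t) of (x, t) \<Rightarrow> u x t) has_real_derivative (case (x, t) of (x, t) \<Rightarrow> \<epsilon> * wt x t + calLd ?F D x t)) (at t within {0..<T})"
      if "t \<in> {0..<T}" for x t
      using ut_deriv[OF cD gF cF that] by simp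
    show "C_on 0 (spacetime T) (\<lambda>(x, t). v i x t)" for i
      by (simp, rule spacetime_of_cstrip) (simp add: v)
    show "C_on 0 (spacetime T) (\<lambda>(x, t). \<epsilon> * wt x t + calLd ?F D x t)"
      by (simp, rule spacetime_of_cstrip) (auto intro!: cstrip_intros cstrip_w cstrip_calLd cF cD)
  qed
qed

text \<open>For p = 2 the nonlinearity is the smooth function u^2. The equation for the gradient is
  linear with differentiable coefficients, so the differentiability lemma can be applied a second
  time.\<close>

lemma solution_C2:
  assumes p2: "p = 2" and hg: "\<And>x. h x = f x + g x"
  shows "solves_IVP 2 f g \<epsilon> T (\<lambda>(x, t). u x t)"
proof -
  define c where "c t = (1 + t) powr (1 - p)" for t :: real
  define F where "F x \<tau> = c \<tau> * (u x \<tau>)\<^sup>2" for x \<tau>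
  have Feq: "(1 + \<tau>) powr (1 - p) * \<bar>u x \<tau>\<bar> powr p = F x \<tau>" for x \<tau>
    by (simp add: F_def c_def p2)
  have eq2: "u x t = \<epsilon> * w x t + calL F x t" if "t \<in> {0..T}" for x t
    using eq[OF that] unfolding Feq by simp
  obtain a where a: "\<And>i x t. t \<in> {0..T} \<Longrightarrow> \<bar>\<epsilon> * wx i x t\<bar> \<le> a" "\<And>i j x t. t \<in> {0..T} \<Longrightarrow> \<bar>\<epsilon> * wxx i j x t\<bar> \<le> a"
    by (rule w_uniform_bound) blast
  have T0: "0 \<le> T" using T by simp
  have cc: "cstrip T (\<lambda>x t. c t)" using time_weight(1)[of 0] T by (simp add: c_def)
  have c1: "\<bar>c t\<bar> \<le> 1" if "t \<in> {0..T}" for t using time_weight(2)[OF that] by (simp add: c_def)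
  have cst: "has_grad (\<lambda>x. r) (\<lambda>i x. 0)" for r by (simp add: has_grad_def)
  obtain v V where v: "\<And>i. cstrip T (v i)" and vb: "\<And>i x t. t \<in> {0..T} \<Longrightarrow> \<bar>v i x t\<bar> \<le> V"
    and gv: "\<And>t. t \<in> {0..T} \<Longrightarrow> has_grad (\<lambda>x. u x t) (\<lambda>i x. v i x t)"
    and ev: "\<And>i x t. t \<in> {0..T} \<Longrightarrow> v i x t = \<epsilon> * wx i x t + calL (\<lambda>x t. c t * (2 * u x t) * v i x t) x t"
  proof (rule volterra_differentiable[OF T0 u ub, of "\<lambda>x t. \<epsilon> * w x t" "\<lambda>x t. c t" "\<lambda>y. y\<^sup>2" "\<lambda>i x t. \<epsilon> * wx i x t" a "\<lambda>i x t. 0" 1 "\<lambda>y. 2 * y"])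
    show "u x t = \<epsilon> * w x t + calL (\<lambda>x t. c t * (u x t)\<^sup>2) x t" if "t \<in> {0..T}" for x t
      using eq2[OF that] unfolding F_def[abs_def] .
    show "has_grad (\<lambda>x. \<epsilon> * w x t) (\<lambda>i x. \<epsilon> * wx i x t)" for t by (intro has_grad_cmult w_grad)
    show "cstrip T (\<lambda>x t. \<epsilon> * wx i x t)" for i by (intro cstrip_mult[OF cstrip_const] cstrip_w)
    show "((\<lambda>y. y\<^sup>2) has_real_derivative 2 * y) (at y)" for y by (auto intro!: derivative_eq_intros)
    show "continuous_on UNIV (\<lambda>y::real. 2 * y)" by (intro continuous_intros)
    show "\<bar>\<epsilon> * wx i x t\<bar> \<le> a" if "t \<in> {0..T}" for i x t by (rule a(1)[OF that])
    show "\<bar>c t\<bar> \<le> 1" if "t \<in> {0..T}" for t by (rule c1[OF that])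
    fix v V assume 1: "\<And>i. cstrip T (v i)" "\<And>i x t. t \<in> {0..T} \<Longrightarrow> \<bar>v i x t\<bar> \<le> V"
       "\<And>t. t \<in> {0..T} \<Longrightarrow> has_grad (\<lambda>x. u x t) (\<lambda>i x. v i x t)"
      and 2: "\<And>i x t. t \<in> {0..T} \<Longrightarrow> v i x t = \<epsilon> * wx i x t + calL (\<lambda>x t. 0 * (u x t)\<^sup>2 + c t * (2 * u x t) * v i x t) x t"
    show thesis by (rule that[OF 1 2[unfolded mult_zero_left add_0_left]])
  qed (assumption | rule cc cst | rule cstrip_const | simp)+
  define D where "D i x \<tau> = c \<tau> * (2 * u x \<tau>) * v i x \<tau>" for i x \<tau>
  have ev2: "v i x t = \<epsilon> * wx i x t + calL (D i) x t" if "t \<in> {0..T}" for i x t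
    using ev[OF that] unfolding D_def[abs_def] .
  have cb: "\<bar>c t * (2 * y)\<bar> \<le> max (2 * M) (2 * V)" if "t \<in> {0..T}" "\<bar>y\<bar> \<le> M \<or> \<bar>y\<bar> \<le> V" for t y
  proof -
    have "\<bar>c t * (2 * y)\<bar> \<le> 1 * (2 * \<bar>y\<bar>)" unfolding abs_mult by (intro mult_mono c1 that) auto
    then show ?thesis using that(2) by auto
  qed
  \<comment> \<open>The equation of \<open>v i\<close> is an instance with N the identity and
    coefficient c t * (2 u), whose gradient is known from the first application. The bound max (2 M)
    (2 V) covers the coefficient and its gradient.\<close>
  have "\<exists>v2. (\<forall>j. cstrip T (v2 j)) \<and> (\<forall>t\<in>{0..T}. has_grad (\<lambda>x. v i x t) (\<lambda>j x. v2 j x t))" for i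
  proof (rule volterra_differentiable[OF T0 v[where i=i] vb[where i=i], of "\<lambda>x t. \<epsilon> * wx i x t" "\<lambda>x t. c t * (2 * u x t)" "\<lambda>y. y" "\<lambda>j x t. \<epsilon> * wxx i j x t" a "\<lambda>j x t. c t * (2 * v j x t)" "max (2 * M) (2 * V)" "\<lambda>y. 1"])
    show "v i x t = \<epsilon> * wx i x t + calL (\<lambda>x t. c t * (2 * u x t) * v i x t) x t" if "t \<in> {0..T}" for x t by (rule ev[OF that])
    show "has_grad (\<lambda>x. \<epsilon> * wx i x t) (\<lambda>j x. \<epsilon> * wxx i j x t)" for t by (intro has_grad_cmult w_grad)
    show "cstrip T (\<lambda>x t. \<epsilon> * wxx i j x t)" for j by (intro cstrip_mult[OF cstrip_const] cstrip_w)
    show "cstrip T (\<lambda>x t. c t * (2 * u x t))" by (intro cstrip_mult cstrip_const cc u)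
    show "cstrip T (\<lambda>x t. c t * (2 * v j x t))" for j by (intro cstrip_mult cstrip_const cc v)
    show "has_grad (\<lambda>x. c t * (2 * u x t)) (\<lambda>j x. c t * (2 * v j x t))" if "t \<in> {0..T}" for t
      by (intro has_grad_cmult gv that)
    show "\<bar>\<epsilon> * wxx i j x t\<bar> \<le> a" if "t \<in> {0..T}" for j x t by (rule a(2)[OF that])
    show "\<bar>c t * (2 * u x t)\<bar> \<le> max (2 * M) (2 * V)" if "t \<in> {0..T}" for x t using ub[OF that] by (intro cb that disjI1)
    show "\<bar>c t * (2 * v j x t)\<bar> \<le> max (2 * M) (2 * V)" if "t \<in> {0..T}" for j x t using vb[OF that] by (intro cb that disjI2)
    fix v' V' assume 1: "\<And>j. cstrip T (v' j)" "\<And>t. t \<in> {0..T} \<Longrightarrow> has_grad (\<lambda>x. v i x t) (\<lambda>j x. v' j x t)"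
    show ?thesis by (rule exI[of _ v']) (simp add: 1)
  qed (assumption | rule DERIV_ident | rule continuous_on_const)+
  then obtain v2 where v2: "\<And>i j. cstrip T (v2 i j)" and gv2: "\<And>i t. t \<in> {0..T} \<Longrightarrow> has_grad (\<lambda>x. v i x t) (\<lambda>j x. v2 i j x t)"
    using choice[of "\<lambda>i v2. (\<forall>j. cstrip T (v2 j)) \<and> (\<forall>t\<in>{0..T}. has_grad (\<lambda>x. v i x t) (\<lambda>j x. v2 j x t))"] by blast
  define E where "E i j x \<tau> = (c \<tau> * (2 * v j x \<tau>)) * v i x \<tau> + (c \<tau> * (2 * u x \<tau>)) * v2 i j x \<tau>" for i j x \<tau>
  have cF: "cstrip T F" unfolding F_def[abs_def] power2_eq_square by (intro cstrip_mult cc u)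
  have cD: "cstrip T (D i)" for i unfolding D_def[abs_def] by (intro cstrip_mult cstrip_const cc u v)
  have cE: "cstrip T (E i j)" for i j unfolding E_def[abs_def] by (intro cstrip_add cstrip_mult cstrip_const cc u v v2)
  have gF: "has_grad (\<lambda>x. F x \<tau>) (\<lambda>i x. D i x \<tau>)" if "\<tau> \<in> {0..T}" for \<tau>
    by (rule has_grad_cong[OF has_grad_cmult[OF has_grad_mult[OF gv[OF that] gv[OF that]], of "c \<tau>"]])
      (simp_all add: F_def D_def power2_eq_square algebra_simps)
  have gD: "has_grad (\<lambda>x. D i x \<tau>) (\<lambda>j x. E i j x \<tau>)" if "\<tau> \<in> {0..T}" for i \<tau>
    unfolding D_def E_def by (intro has_grad_mult has_grad_cmult gv gv2 that)
  \<comment> \<open>The second derivatives found abstractly are identified with the differentiated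
    integral formula by uniqueness of the gradient. The wave equation is checked on this explicit
    form.\<close>
  have v2eq: "v2 i j x t = \<epsilon> * wxx i j x t + calL (E i j) x t" if t: "t \<in> {0..T}" for i j x t
  proof -
    have "has_grad (\<lambda>x. \<epsilon> * wx i x t + calL (D i) x t) (\<lambda>j x. \<epsilon> * wxx i j x t + calL (E i j) x t)"
      by (intro has_grad_add has_grad_cmult w_grad calL_has_grad[OF cD cE gD t])
    then have "has_grad (\<lambda>x. v i x t) (\<lambda>j x. \<epsilon> * wxx i j x t + calL (E i j) x t)"
      using ev2[OF t] by simp
    from has_grad_unique[OF gv2[OF t] this] show ?thesis .
  qed
  define ut where "ut x t = \<epsilon> * wt x t + calLd F D x t" for x t
  define utt where "utt x t = \<epsilon> * wtt x t + (F x t + calL (\<lambda>x \<tau>. \<Sum>i\<in>UNIV. E i i x \<tau>) x t)" for x t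
  define vt where "vt i x t = \<epsilon> * wxt i x t + calLd (D i) (E i) x t" for i x t
  define utx where "utx i x t = \<epsilon> * wtx i x t + calLd (D i) (E i) x t" for i x t
  have dut: "((\<lambda>t. u x t) has_real_derivative ut x t) (at t within {0..<T})" if t: "t \<in> {0..<T}" for x t
  proof -
    have g': "has_grad (\<lambda>x. (1 + \<tau>) powr (1 - p) * \<bar>u x \<tau>\<bar> powr p) (\<lambda>i x. D i x \<tau>)" if "\<tau> \<in> {0..T}" for \<tau>
      unfolding Feq by (rule gF[OF that])
    show ?thesis using ut_deriv[OF cD g' _ t, of x] cF unfolding Feq ut_def by simp
  qed
  have sub: "(q has_real_derivative q') (at t within {0..<T})"
    if t: "t \<in> {0..<T}" and d: "(r has_real_derivative q') (at t within {0..T})" and e: "\<And>t. t \<in> {0..T} \<Longrightarrow> q t = r t" for q r q' t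
  proof -
    have t': "t \<in> {0..T}" using t by simp
    have "(q has_real_derivative q') (at t within {0..T})"
      by (rule has_field_derivative_transform_within[OF d zero_less_one t']) (simp add: e)
    then show ?thesis by (rule DERIV_subset) auto
  qed
  have dutt: "((\<lambda>t. ut x t) has_real_derivative utt x t) (at t within {0..<T})" if t: "t \<in> {0..<T}" for x t
  proof (rule sub[OF t])
    have t': "t \<in> {0..T}" using t by simp
    show "((\<lambda>t. \<epsilon> * wt x t + calLd F D x t) has_real_derivative utt x t) (at t within {0..T})"
      unfolding utt_def by (intro DERIV_add DERIV_cmult w_deriv_t calLd_deriv_t[OF cF cD gF cE gD t'])
  qed (simp add: ut_def)
  have dvt: "((\<lambda>t. v i x t) has_real_derivative vt i x t) (at t within {0..<T})" if t: "t \<in> {0..<T}" for i x t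
  proof (rule sub[OF t])
    have t': "t \<in> {0..T}" using t by simp
    show "((\<lambda>t. \<epsilon> * wx i x t + calL (D i) x t) has_real_derivative vt i x t) (at t within {0..T})"
      unfolding vt_def by (intro DERIV_add DERIV_cmult w_deriv_t calL_deriv_t[OF cD cE gD t'])
  qed (rule ev2)
  have gut: "has_grad (\<lambda>x. ut x t) (\<lambda>i x. utx i x t)" if t: "t \<in> {0..T}" for t
    unfolding ut_def utx_def by (intro has_grad_add has_grad_cmult w_grad calLd_has_grad[OF cF cD gF cE gD t])
  have cont: "C_on 0 (spacetime T) (\<lambda>(x, t). v2 i j x t)" "C_on 0 (spacetime T) (\<lambda>(x, t). vt i x t)"
    "C_on 0 (spacetime T) (\<lambda>(x, t). utx i x t)" "C_on 0 (spacetime T) (\<lambda>(x, t). utt x t)" for i j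
    by (simp, rule spacetime_of_cstrip,
        simp add: v2 vt_def utx_def utt_def,
        (intro cstrip_add cstrip_mult[OF cstrip_const] cstrip_w cstrip_calLd cstrip_calL cstrip_sum cF cD cE)?)+
  have C1: "C_on (Suc 0) (spacetime T) (\<lambda>(x, t). v i x t)" for i
  proof (rule C_on_SucI[where vx="\<lambda>j (x, t). v2 i j x t" and vt="\<lambda>(x, t). vt i x t", OF _ _ cont(1,2)])
    show "has_grad (\<lambda>x. case (x, t) of (x, t) \<Rightarrow> v i x t) (\<lambda>j x. case (x, t) of (x, t) \<Rightarrow> v2 i j x t)" if "t \<in> {0..<T}" for t
      using gv2[of t i] that by simp
    show "((\<lambda>t. case (x, t) of (x, t) \<Rightarrow> v i x t) has_real_derivative (case (x, t) of (x, t) \<Rightarrow> vt i x t)) (at t within {0..<T})"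
      if "t \<in> {0..<T}" for x t using dvt[OF that] by simp
  qed
  have C1': "C_on (Suc 0) (spacetime T) (\<lambda>(x, t). ut x t)"
  proof (rule C_on_SucI[where vx="\<lambda>j (x, t). utx j x t" and vt="\<lambda>(x, t). utt x t", OF _ _ cont(3,4)])
    show "has_grad (\<lambda>x. case (x, t) of (x, t) \<Rightarrow> ut x t) (\<lambda>j x. case (x, t) of (x, t) \<Rightarrow> utx j x t)" if "t \<in> {0..<T}" for t
      using gut[of t] that by simp
    show "((\<lambda>t. case (x, t) of (x, t) \<Rightarrow> ut x t) has_real_derivative (case (x, t) of (x, t) \<Rightarrow> utt x t)) (at t within {0..<T})"
      if "t \<in> {0..<T}" for x t using dutt[OF that] by simp
  qed
  have g1: "has_grad (\<lambda>x. case (x, t) of (x, t) \<Rightarrow> u x t) (\<lambda>j x. case (x, t) of (x, t) \<Rightarrow> v j x t)" if "t \<in> {0..<T}" for t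
    using gv[of t] that by simp
  have g2: "has_grad (\<lambda>x. case (x, t) of (x, t) \<Rightarrow> v i x t) (\<lambda>j x. case (x, t) of (x, t) \<Rightarrow> v2 i j x t)" if "t \<in> {0..<T}" for t i
    using gv2[of t i] that by simp
  have d1: "((\<lambda>t. case (x, t) of (x, t) \<Rightarrow> u x t) has_real_derivative (case (x, t) of (x, t) \<Rightarrow> ut x t)) (at t within {0..<T})"
    if "t \<in> {0..<T}" for x t using dut[OF that] by simp
  have d2: "((\<lambda>t. case (x, t) of (x, t) \<Rightarrow> ut x t) has_real_derivative utt x t) (at t within {0..<T})"
    if "t \<in> {0..<T}" for x t using dutt[OF that] by simp
  have C2: "C_on 2 (spacetime T) (\<lambda>(x, t). u x t)"
    unfolding numeral_2_eq_2
    by (rule C_on_SucI[where vx="\<lambda>j (x, t). v j x t" and vt="\<lambda>(x, t). ut x t", OF g1 d1 C1 C1'])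
  have wave: "dt (dt (\<lambda>(x, t). u x t)) (x, t) - laplacian (\<lambda>(x, t). u x t) (x, t) = \<bar>u x t\<bar> powr 2 / (1 + t) powr (2 - 1)"
    if t: "t \<in> {0..<T}" for x t
  proof -
    have t': "t \<in> {0..T}" using t by simp
    have 1: "dt (dt (\<lambda>(x, t). u x t)) (x, t) = utt x t"
      by (rule dt_dt_eq[where vt="\<lambda>(x, t). ut x t", OF t d1 d2[OF t]])
    have 2: "laplacian (\<lambda>(x, t). u x t) (x, t) = (\<Sum>i\<in>UNIV. v2 i i x t)"
      using laplacian_eq[where vx="\<lambda>j (x, t). v j x t" and vxx="\<lambda>i j (x, t). v2 i j x t", OF g1[OF t] g2[OF t]] by simp
    have 3: "calL (\<lambda>x \<tau>. \<Sum>i\<in>UNIV. E i i x \<tau>) x t = calL (E 1 1) x t + calL (E 2 2) x t"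
      using calL_add[OF cE[of 1 1] cE[of 2 2] t', of x] by (simp only: sum_2)
    have 4: "F x t = \<bar>u x t\<bar> powr 2 / (1 + t) powr (2 - 1)"
      using t powr_minus_divide[of "1 + t" 1] by (simp add: F_def c_def p2)
    show ?thesis unfolding 1 2 4[symmetric] utt_def w_wave sum_2 v2eq[OF t'] using 3[unfolded sum_2] by (simp add: algebra_simps)
  qed
  have "u x 0 = \<epsilon> * f x" for x using eq2[of 0 x] T by (simp add: w_0 calL_def)
  moreover have "dt (\<lambda>(x, t). u x t) (x, 0) = \<epsilon> * (f x + g x)" for x
    using dt_eq[OF _ d1, of 0 x] T by (simp add: ut_def w_0 calLd_def hg)
  ultimately show ?thesis
    using wave C2 unfolding solves_IVP_def by (auto simp: spacetime_def)
qed

end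

end

section \<open>Equivalence with the integral equation, and uniqueness\<close>

lemma (in free_wave) integral_form:
  assumes hg: "\<And>x. h x = f x + g x" and g: "continuous_on UNIV g" and p: "1 < p"
    and v: "cstrip t (\<lambda>x \<tau>. v (x, \<tau>))" and t: "0 \<le> t"
  shows "\<epsilon> * u_L f g x t + L p (\<lambda>z. \<bar>v z\<bar> powr p) x t
    = \<epsilon> * w x t + calL (\<lambda>x \<tau>. (1 + \<tau>) powr (1 - p) * \<bar>v (x, \<tau>)\<bar> powr p) x t"
proof -
  have "h = (\<lambda>y. f y + g y)" using hg by auto
  then have "u_L f g x t = w x t" unfolding w_def using u_L_eq[OF f1 cf(2) g] by simp
  moreover have "cstrip t (\<lambda>x \<tau>. \<bar>v (x, \<tau>)\<bar> powr p)"
    using v p unfolding cstrip_def split_beta by (intro continuous_on_powr' continuous_intros) auto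
  ultimately show ?thesis using L_eq_calL[of t "\<lambda>z. \<bar>v z\<bar> powr p"] t by simp
qed

text \<open>Duhamel's formula on [0, t] with t < T makes every classical solution a solution of the
  integral equation, so uniqueness for the initial value problem is inherited from there.\<close>

lemma (in free_wave) IVP_integral_form:
  assumes v: "solves_IVP 2 f g \<epsilon> T v" and hg: "\<And>x. h x = f x + g x" and t: "0 \<le> t" "t < T"
  shows "v (x, t) = \<epsilon> * w x t + calL (\<lambda>x \<tau>. (1 + \<tau>) powr (1 - 2) * \<bar>v (x, \<tau>)\<bar> powr 2) x t"
proof -
  have C2: "C_on (Suc (Suc 0)) (spacetime T) v" and v0: "\<And>x. v (x, 0) = \<epsilon> * f x" and vt0: "\<And>x. dt v (x, 0) = \<epsilon> * (f x + g x)"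
    and wave: "\<And>x t. t \<in> {0..<T} \<Longrightarrow> dt (dt v) (x, t) - laplacian v (x, t) = \<bar>v (x, t)\<bar> powr 2 / (1 + t) powr (2 - 1)"
    using v by (auto simp: solves_IVP_def numeral_2_eq_2 spacetime_def)
  obtain vx vt where gv: "\<And>t. t \<in> {0..<T} \<Longrightarrow> has_grad (\<lambda>x. v (x, t)) (\<lambda>i x. vx i (x, t))"
    and dv: "\<And>x t. t \<in> {0..<T} \<Longrightarrow> ((\<lambda>t. v (x, t)) has_real_derivative vt (x, t)) (at t within {0..<T})"
    and C1: "\<And>i. C_on (Suc 0) (spacetime T) (vx i)" "C_on (Suc 0) (spacetime T) vt"
    by (rule C_on_SucD[OF C2]) blast
  have "\<exists>q. (\<forall>t\<in>{0..<T}. has_grad (\<lambda>x. vx i (x, t)) (\<lambda>j x. q j (x, t))) \<and> (\<forall>j. C_on 0 (spacetime T) (q j))" for i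
    by (rule C_on_SucD[OF C1(1)[of i]]) blast
  then obtain vxx where gvx: "\<And>i t. t \<in> {0..<T} \<Longrightarrow> has_grad (\<lambda>x. vx i (x, t)) (\<lambda>j x. vxx i j (x, t))"
    and Cxx: "\<And>i j. C_on 0 (spacetime T) (vxx i j)"
    using choice[of "\<lambda>i q. (\<forall>t\<in>{0..<T}. has_grad (\<lambda>x. vx i (x, t)) (\<lambda>j x. q j (x, t))) \<and> (\<forall>j. C_on 0 (spacetime T) (q j))"] by blast
  obtain vtx vtt where gvt: "\<And>t. t \<in> {0..<T} \<Longrightarrow> has_grad (\<lambda>x. vt (x, t)) (\<lambda>i x. vtx i (x, t))"
    and dvt: "\<And>x t. t \<in> {0..<T} \<Longrightarrow> ((\<lambda>t. vt (x, t)) has_real_derivative vtt (x, t)) (at t within {0..<T})"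
    and Ct: "\<And>i. C_on 0 (spacetime T) (vtx i)" "C_on 0 (spacetime T) vtt"
    by (rule C_on_SucD[OF C1(2)]) blast
  have T: "0 < T" using t by simp
  have strip: "cstrip t (\<lambda>x t. q (x, t))" if "C_on n (spacetime T) q" for n q
    by (rule cstrip_of_spacetime[OF C_on_continuous[OF that] t(2)])
  have sub: "{0..t} \<subseteq> {0..<T}" using t by auto
  have "v (x, t) = Rd (\<lambda>y. v (y, 0)) (\<lambda>i y. vx i (y, 0)) x t + Rm (\<lambda>y. vt (y, 0)) x t
    + calL (\<lambda>y \<tau>. vtt (y, \<tau>) - (\<Sum>i\<in>UNIV. vxx i i (y, \<tau>))) x t"
  proof (rule duhamel[where T=t and v="\<lambda>x t. v (x, t)" and vx="\<lambda>i x t. vx i (x, t)" and vxx="\<lambda>i j x t. vxx i j (x, t)"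
        and vt="\<lambda>x t. vt (x, t)" and vtx="\<lambda>i x t. vtx i (x, t)" and vtt="\<lambda>x t. vtt (x, t)"])
    show "cstrip t (\<lambda>x t. v (x, t))" "cstrip t (\<lambda>x t. vx i (x, t))" "cstrip t (\<lambda>x t. vxx i j (x, t))"
      "cstrip t (\<lambda>x t. vt (x, t))" "cstrip t (\<lambda>x t. vtx i (x, t))" "cstrip t (\<lambda>x t. vtt (x, t))" for i j
      by (rule strip, rule C2 C1 Cxx Ct)+
    fix x \<tau> assume \<tau>: "\<tau> \<in> {0..t}"
    then have \<tau>': "\<tau> \<in> {0..<T}" using sub by blast
    show "has_grad (\<lambda>x. v (x, \<tau>)) (\<lambda>i x. vx i (x, \<tau>))" "has_grad (\<lambda>x. vx i (x, \<tau>)) (\<lambda>j x. vxx i j (x, \<tau>))"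
      "has_grad (\<lambda>x. vt (x, \<tau>)) (\<lambda>i x. vtx i (x, \<tau>))" for i
      by (rule gv[OF \<tau>'] gvx[OF \<tau>'] gvt[OF \<tau>'])+
    show "((\<lambda>t. v (x, t)) has_real_derivative vt (x, \<tau>)) (at \<tau> within {0..t})"
      "((\<lambda>t. vt (x, t)) has_real_derivative vtt (x, \<tau>)) (at \<tau> within {0..t})"
      by (rule DERIV_subset[OF dv[OF \<tau>'] sub] DERIV_subset[OF dvt[OF \<tau>'] sub])+
  qed (use t in auto)
  moreover have "Rd (\<lambda>y. v (y, 0)) (\<lambda>i y. vx i (y, 0)) x t = \<epsilon> * Rd f f1 x t"
  proof -
    have "has_grad (\<lambda>x. \<epsilon> * f x) (\<lambda>i x. vx i (x, 0))" using gv[of 0] T by (simp add: v0)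
    then have "vx i (y, 0) = \<epsilon> * f1 i y" for i y by (rule has_grad_unique) (intro has_grad_cmult f1)
    then show ?thesis by (simp add: v0 Rd_cmult)
  qed
  moreover have "vt (y, 0) = \<epsilon> * h y" for y
    using vt0[of y] dt_eq[OF _ dv, of 0 y] T by (simp add: hg)
  moreover have "calL (\<lambda>y \<tau>. vtt (y, \<tau>) - (\<Sum>i\<in>UNIV. vxx i i (y, \<tau>))) x t
    = calL (\<lambda>x \<tau>. (1 + \<tau>) powr (1 - 2) * \<bar>v (x, \<tau>)\<bar> powr 2) x t"
  proof (rule calL_cong)
    fix y \<tau> assume "0 \<le> \<tau>" "\<tau> \<le> t"
    then have \<tau>: "\<tau> \<in> {0..<T}" using t by simp
    have "dt (dt v) (y, \<tau>) = vtt (y, \<tau>)" by (rule dt_dt_eq[OF \<tau> dv dvt[OF \<tau>]])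
    moreover have "laplacian v (y, \<tau>) = (\<Sum>i\<in>UNIV. vxx i i (y, \<tau>))" by (rule laplacian_eq[OF gv[OF \<tau>] gvx[OF \<tau>]])
    ultimately show "vtt (y, \<tau>) - (\<Sum>i\<in>UNIV. vxx i i (y, \<tau>)) = (1 + \<tau>) powr (1 - 2) * \<bar>v (y, \<tau>)\<bar> powr 2"
      using wave[OF \<tau>, of y] \<tau> powr_minus_divide[of "1 + \<tau>" 1] by simp
  qed
  ultimately show ?thesis by (simp add: w_def Rm_cmult algebra_simps)
qed

lemma (in free_wave) unique_solution:
  assumes hg: "\<And>x. h x = f x + g x" and g: "continuous_on UNIV g" and p: "1 < p" and T: "0 < T" and e: "0 < \<epsilon>"
    and u: "cstrip T u" and ub: "\<And>x t. t \<in> {0..T} \<Longrightarrow> \<bar>u x t\<bar> \<le> M"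
    and eq: "\<And>x t. t \<in> {0..T} \<Longrightarrow> u x t = \<epsilon> * w x t + calL (\<lambda>x \<tau>. (1 + \<tau>) powr (1 - p) * \<bar>u x \<tau>\<bar> powr p) x t"
  shows "admits_unique_solution T (solves_integral_eq p f g \<epsilon> T)"
    and "p = 2 \<Longrightarrow> admits_unique_solution T (solves_IVP p f g \<epsilon> T)"
proof -
  have unique: "v z = (\<lambda>(x, t). u x t) z"
    if v: "continuous_on (spacetime T) v" and ev: "\<And>x t. 0 \<le> t \<Longrightarrow> t < T \<Longrightarrow>
        v (x, t) = \<epsilon> * w x t + calL (\<lambda>x \<tau>. (1 + \<tau>) powr (1 - p) * \<bar>v (x, \<tau>)\<bar> powr p) x t" and z: "z \<in> spacetime T" for v z
  proof -
    obtain x t where xt: "z = (x, t)" "0 \<le> t" "t < T" using z by (auto simp: spacetime_def)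
    \<comment> \<open>Uniqueness is applied on [0, t] for each t < T separately, as v is known to be
      continuous on the half-open interval only.\<close>
    have "(\<lambda>x t. v (x, t)) x t = u x t"
    proof (rule integral_equation_unique[of t "\<lambda>x t. v (x, t)" u p t "\<lambda>x t. \<epsilon> * w x t"])
      show "cstrip t (\<lambda>x t. v (x, t))" by (rule cstrip_of_spacetime[OF v xt(3)])
      show "cstrip t u" using u xt by (intro cstrip_mono[OF u]) simp
      show "v (y, s) = \<epsilon> * w y s + calL (\<lambda>x \<tau>. (1 + \<tau>) powr (1 - p) * \<bar>v (x, \<tau>)\<bar> powr p) y s" if "s \<in> {0..t}" for y s
        using that xt by (intro ev) auto
      show "u y s = \<epsilon> * w y s + calL (\<lambda>x \<tau>. (1 + \<tau>) powr (1 - p) * \<bar>u x \<tau>\<bar> powr p) y s" if "s \<in> {0..t}" for y s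
        using that xt by (intro eq) auto
    qed (use p xt in auto)
    then show ?thesis by (simp add: xt)
  qed
  have form: "\<epsilon> * u_L f g x t + L p (\<lambda>z. \<bar>v z\<bar> powr p) x t
      = \<epsilon> * w x t + calL (\<lambda>x \<tau>. (1 + \<tau>) powr (1 - p) * \<bar>v (x, \<tau>)\<bar> powr p) x t"
    if v: "continuous_on (spacetime T) v" and t: "0 \<le> t" "t < T" for v x t
    by (rule integral_form[OF hg g p cstrip_of_spacetime[OF v t(2)] t(1)])
  have C1: "C_on 1 (spacetime T) (\<lambda>(x, t). u x t)" by (rule solution_C1[OF p T e u ub eq])
  have "solves_integral_eq p f g \<epsilon> T (\<lambda>(x, t). u x t)"
    unfolding solves_integral_eq_def
  proof (intro conjI C1 ballI)
    fix z assume "z \<in> spacetime T"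
    then obtain x t where xt: "z = (x, t)" "0 \<le> t" "t < T" by (auto simp: spacetime_def)
    show "case z of (x, t) \<Rightarrow> (\<lambda>(x, t). u x t) (x, t) = \<epsilon> * u_L f g x t + L p (\<lambda>z. \<bar>(\<lambda>(x, t). u x t) z\<bar> powr p) x t"
      using form[OF C_on_continuous[OF C1] xt(2,3), of x] eq[of t x] xt by simp
  qed
  then show "admits_unique_solution T (solves_integral_eq p f g \<epsilon> T)"
    unfolding admits_unique_solution_def
  proof (intro exI[of _ "\<lambda>(x, t). u x t"] conjI allI impI ballI)
    fix v z assume v: "solves_integral_eq p f g \<epsilon> T v" and z: "z \<in> spacetime T"
    have c: "continuous_on (spacetime T) v" using v C_on_continuous by (auto simp only: solves_integral_eq_def)
    show "v z = (\<lambda>(x, t). u x t) z"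
    proof (rule unique[OF c _ z])
      fix x t assume t: "0 \<le> t" "t < T"
      have "v (x, t) = \<epsilon> * u_L f g x t + L p (\<lambda>z. \<bar>v z\<bar> powr p) x t"
        using v t by (auto simp: solves_integral_eq_def spacetime_def)
      then show "v (x, t) = \<epsilon> * w x t + calL (\<lambda>x \<tau>. (1 + \<tau>) powr (1 - p) * \<bar>v (x, \<tau>)\<bar> powr p) x t"
        unfolding form[OF c t] .
    qed
  qed
  show "admits_unique_solution T (solves_IVP p f g \<epsilon> T)" if p2: "p = 2"
    unfolding admits_unique_solution_def p2
  proof (intro exI[of _ "\<lambda>(x, t). u x t"] conjI allI impI ballI)
    show "solves_IVP 2 f g \<epsilon> T (\<lambda>(x, t). u x t)" by (rule solution_C2[OF p T e u ub eq p2 hg])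
    fix v z assume v: "solves_IVP 2 f g \<epsilon> T v" and z: "z \<in> spacetime T"
    have c: "continuous_on (spacetime T) v" using v C_on_continuous by (auto simp only: solves_IVP_def)
    show "v z = (\<lambda>(x, t). u x t) z"
      by (rule unique[OF c _ z]) (unfold p2, rule IVP_integral_form[OF v hg])
  qed
qed

section \<open>Lifespan\<close>

lemma power_lifespan:
  fixes \<delta> K \<gamma> s :: real
  assumes \<delta>: "0 < \<delta>" and K: "0 < K" and \<gamma>: "0 < \<gamma>" and s: "0 < s"
  shows "\<exists>\<epsilon>\<^sub>0>0. \<exists>c>0. \<forall>\<epsilon> T. 0 < \<epsilon> \<longrightarrow> \<epsilon> \<le> \<epsilon>\<^sub>0 \<longrightarrow> 0 < T \<longrightarrow> T \<le> c * \<epsilon> powr (- (2 * s / \<gamma>)) \<longrightarrow>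
    \<epsilon> powr s * (K + T) powr (\<gamma> / 2) \<le> \<delta>"
proof -
  \<comment> \<open>Chosen such that (2 c \<epsilon>^(-e))^(\<gamma>/2) = \<delta> \<epsilon>^(-s).
    The factor 2 leaves room for K, since small \<epsilon> makes K at most c
    \<epsilon>^(-e).\<close>
  define c where "c = \<delta> powr (2 / \<gamma>) / 2"
  define e where "e = 2 * s / \<gamma>"
  have c: "0 < c" using \<delta> by (simp add: c_def)
  have e: "0 < e" using s \<gamma> by (simp add: e_def)
  have main: "\<epsilon> powr s * (K + T) powr (\<gamma> / 2) \<le> \<delta>"
    if \<epsilon>: "0 < \<epsilon>" "\<epsilon> \<le> (c / K) powr (1 / e)" and T: "0 < T" "T \<le> c * \<epsilon> powr (- e)" for \<epsilon> T
  proof -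
    have "\<epsilon> powr e \<le> ((c / K) powr (1 / e)) powr e" using \<epsilon> e by (intro powr_mono2) auto
    also have "\<dots> = c / K" using e c K by (simp add: powr_powr)
    finally have "K \<le> c * \<epsilon> powr (- e)" using K \<epsilon> c by (simp add: powr_minus field_simps)
    with T have "(K + T) powr (\<gamma> / 2) \<le> (2 * c * \<epsilon> powr (- e)) powr (\<gamma> / 2)" using \<gamma> K by (intro powr_mono2) auto
    also have "\<dots> = \<delta> * \<epsilon> powr (- s)"
      using \<delta> \<gamma> by (simp add: c_def e_def powr_mult powr_powr)
    finally have "\<epsilon> powr s * (K + T) powr (\<gamma> / 2) \<le> \<epsilon> powr s * (\<delta> * \<epsilon> powr (- s))" by (intro mult_left_mono) auto
    also have "\<dots> = \<delta>" using \<epsilon> by (simp add: powr_minus)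
    finally show "\<epsilon> powr s * (K + T) powr (\<gamma> / 2) \<le> \<delta>" .
  qed
  have "0 < (c / K) powr (1 / e)" using c K by simp
  then show ?thesis
    unfolding e_def[symmetric]
    by (rule exI[of _ "(c / K) powr (1 / e)", OF conjI], intro exI[of _ c]) (auto intro: c main)
qed

lemma exponential_lifespan:
  fixes \<delta> K :: real
  assumes \<delta>: "0 < \<delta>" and K: "1 \<le> K"
  shows "\<exists>\<epsilon>\<^sub>0>0. \<exists>c>0. \<forall>\<epsilon> T. 0 < \<epsilon> \<longrightarrow> \<epsilon> \<le> \<epsilon>\<^sub>0 \<longrightarrow> 0 < T \<longrightarrow> T \<le> exp (c * \<epsilon> powr (- (2 / 3))) \<longrightarrow>
    \<epsilon>\<^sup>2 * (4 + ln (K + T)) ^ 3 \<le> \<delta>"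
proof -
  \<comment> \<open>With X = c \<epsilon>^(-2/3), the quantity 4 + ln (K + T) is at most L + X,
    hence at most 2X for small \<epsilon>, and (2X)^3 = 8 c^3 \<epsilon>^(-2) = \<delta>
    \<epsilon>^(-2).\<close>
  define c where "c = (\<delta> / 8) powr (1 / 3)"
  define L where "L = 4 + ln (K + 1)"
  have c: "0 < c" using \<delta> by (simp add: c_def)
  have "0 \<le> ln (K + 1)" using K by simp
  then have L: "0 < L" unfolding L_def by linarith
  have main: "\<epsilon>\<^sup>2 * (4 + ln (K + T)) ^ 3 \<le> \<delta>"
    if \<epsilon>: "0 < \<epsilon>" "\<epsilon> \<le> (c / L) powr (3 / 2)" and T: "0 < T" "T \<le> exp (c * \<epsilon> powr (- (2 / 3)))" for \<epsilon> T
  proof -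
    define X where "X = c * \<epsilon> powr (- (2 / 3))"
    have X: "0 \<le> X" using c by (simp add: X_def)
    have "\<epsilon> powr (2 / 3) \<le> ((c / L) powr (3 / 2)) powr (2 / 3)" using \<epsilon> by (intro powr_mono2) auto
    also have "\<dots> = c / L" using c L by (simp add: powr_powr)
    finally have LX: "L \<le> X" using L \<epsilon> c by (simp add: X_def powr_minus field_simps)
    have "K * 1 \<le> K * exp X" using K X by (intro mult_left_mono) auto
    then have "K + T \<le> (K + 1) * exp X" using T by (simp add: X_def algebra_simps)
    then have "ln (K + T) \<le> ln ((K + 1) * exp X)" using K T by (subst ln_le_cancel_iff) auto
    also have "\<dots> = ln (K + 1) + X" using K by (simp add: ln_mult)
    finally have "4 + ln (K + T) \<le> 2 * X" using LX by (simp add: L_def)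
    moreover have "0 \<le> ln (K + T)" using K T by simp
    then have "0 \<le> 4 + ln (K + T)" by linarith
    ultimately have "(4 + ln (K + T)) ^ 3 \<le> (2 * X) ^ 3" by (intro power_mono)
    also have "\<dots> = \<delta> * \<epsilon> powr (- 2)"
    proof -
      have "c ^ 3 = \<delta> / 8" using \<delta> by (simp add: c_def powr_powr flip: powr_realpow)
      moreover have "(\<epsilon> powr (- (2 / 3))) ^ 3 = \<epsilon> powr (- 2)" using \<epsilon> by (simp add: powr_powr flip: powr_realpow)
      ultimately show ?thesis by (simp add: X_def power_mult_distrib)
    qed
    finally have "\<epsilon>\<^sup>2 * (4 + ln (K + T)) ^ 3 \<le> \<epsilon>\<^sup>2 * (\<delta> * \<epsilon> powr (- 2))" by (intro mult_left_mono) auto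
    also have "\<dots> = \<delta>" using \<epsilon> by (simp add: powr_minus powr_realpow)
    finally show "\<epsilon>\<^sup>2 * (4 + ln (K + T)) ^ 3 \<le> \<delta>" .
  qed
  have "0 < (c / L) powr (3 / 2)" using c L by simp
  then show ?thesis
    by (rule exI[of _ "(c / L) powr (3 / 2)", OF conjI], intro exI[of _ c]) (auto intro: c main)
qed

context free_wave
begin

text \<open>b is twice the contribution of the free solution, hence 204 = 2 * 102 in
  \<open>bb\<close>. Hypothesis \<open>R\<close> says that the feedback of the Duhamel term is at
  most as large as that contribution, which closes the estimate.\<close>

lemma small_data_solution:
  assumes hg: "\<And>x. h x = f x + g x" and g: "continuous_on UNIV g"
    and p: "1 < p" "p \<le> 2" and n: "1 / 4 \<le> n" "n < 1 / 2" and \<kappa>: "0 < \<kappa>" "\<kappa> \<le> 1" "\<kappa> = 1 - n * p"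
    and C: "0 < C" "\<And>x t. 0 \<le> t \<Longrightarrow> \<bar>w x t\<bar> \<le> C * ((k + 2 + t) powr (- 1 / 2) * cutpow (3 / 2) 3 (bt x (k + 2 + t)))"
    and e: "0 < \<epsilon>" and b: "0 \<le> b" and H0: "0 \<le> H" and T: "0 < T"
    and H: "\<And>r. 1 \<le> r \<Longrightarrow> r \<le> k + 2 + T \<Longrightarrow> r powr (1 - 3 * p / 2) \<le> H * r powr (- 3 / 2 - n)"
    and bb: "b = 204 * (k + 2) * 2 powr p / (1 / 2 - n) * (\<epsilon> * C) powr p * H"
    and R: "24 * (k + 2 + T) powr \<kappa> / \<kappa> * b powr p \<le> 102 * (\<epsilon> * C) powr p"
  shows "admits_unique_solution T (solves_integral_eq p f g \<epsilon> T)"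
    and "p = 2 \<Longrightarrow> admits_unique_solution T (solves_IVP p f g \<epsilon> T)"
proof -
  have "(k + 2) * H * 2 powr p / (1 / 2 - n) * (102 * (\<epsilon> * C) powr p + 24 * (k + 2 + T) powr \<kappa> / \<kappa> * b powr p)
    \<le> (k + 2) * H * 2 powr p / (1 / 2 - n) * (204 * (\<epsilon> * C) powr p)"
    using k H0 n R by (intro mult_left_mono) auto
  also have "\<dots> = b" unfolding bb by simp
  finally have R': "(k + 2) * H * 2 powr p / (1 / 2 - n) * (102 * (\<epsilon> * C) powr p + 24 * (k + 2 + T) powr \<kappa> / \<kappa> * b powr p) \<le> b" .
  have T0: "0 \<le> T" using T by simp
  obtain u M where u: "cstrip T u" "\<And>x t. t \<in> {0..T} \<Longrightarrow> \<bar>u x t\<bar> \<le> M"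
    and eq: "\<And>x t. t \<in> {0..T} \<Longrightarrow> u x t = \<epsilon> * w x t + calL (\<lambda>x \<tau>. (1 + \<tau>) powr (1 - p) * \<bar>u x \<tau>\<bar> powr p) x t"
  proof (rule solution_exists[OF p n \<kappa> C e b H0 T0 H R'])
    fix u M assume 1: "cstrip T u" "\<And>x t. t \<in> {0..T} \<Longrightarrow> \<bar>u x t\<bar> \<le> M"
      and 2: "\<And>x t. t \<in> {0..T} \<Longrightarrow> u x t = \<epsilon> * w x t + calL (\<lambda>x \<tau>. (1 + \<tau>) powr (1 - p) * \<bar>u x \<tau>\<bar> powr p) x t"
    show thesis by (rule that[OF 1 2])
  qed
  show "admits_unique_solution T (solves_integral_eq p f g \<epsilon> T)"
    by (rule unique_solution(1)[OF hg g p(1) T e u eq])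
  show "admits_unique_solution T (solves_IVP p f g \<epsilon> T)" if "p = 2"
    by (rule unique_solution(2)[OF hg g p(1) T e u eq that])
qed

text \<open>The comparison requires n at least 1/4, which may exceed q. The excess costs H = X^(n -
  q), which enters the feedback with power p. The total exponent \<kappa> + (n - q) p = 1 - q p =
  \<gamma>/2 does not depend on n, so raising n does not affect the lifespan.\<close>

lemma subcritical_lifespan:
  assumes hg: "\<And>x. h x = f x + g x" and g: "continuous_on UNIV g" and p: "1 < p" "p < 2"
  shows "\<exists>\<epsilon>\<^sub>0>0. \<exists>c>0. \<forall>\<epsilon> T. 0 < \<epsilon> \<longrightarrow> \<epsilon> \<le> \<epsilon>\<^sub>0 \<longrightarrow> 0 < T \<longrightarrow>
    T \<le> c * \<epsilon> powr (- (2 * (p * (p - 1)) / strauss_gamma p 4)) \<longrightarrow> admits_unique_solution T (solves_integral_eq p f g \<epsilon> T)"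
proof -
  obtain C where C: "0 < C" "\<And>x t. 0 \<le> t \<Longrightarrow> \<bar>w x t\<bar> \<le> C * ((k + 2 + t) powr (- 1 / 2) * cutpow (3 / 2) 3 (bt x (k + 2 + t)))"
    by (rule w_decay) blast
  \<comment> \<open>Determined by 1 - 3p/2 = -3/2 - q, the decay of the source in t'; q < 1/2
    amounts to p < 2.\<close>
  define q where "q = (3 * p - 5) / 2"
  define n where "n = max q (1 / 4)"
  have "q < 1 / 2" using p by (simp add: q_def)
  then have n: "1 / 4 \<le> n" "n < 1 / 2" "q \<le> n" by (auto simp: n_def)
  define \<kappa> where "\<kappa> = 1 - n * p"
  have "n * p < 1 / 2 * 2" using p n by (intro mult_strict_mono) auto
  moreover have "0 \<le> n * p" using p n by simp
  ultimately have \<kappa>: "0 < \<kappa>" "\<kappa> \<le> 1" by (auto simp: \<kappa>_def)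
  define \<gamma> where "\<gamma> = strauss_gamma p 4"
  have \<gamma>2: "\<gamma> = 2 * (\<kappa> + (n - q) * p)"
    by (simp add: \<gamma>_def strauss_gamma_def \<kappa>_def q_def power2_eq_square field_simps)
  have \<gamma>: "0 < \<gamma>" unfolding \<gamma>2 using \<kappa> n p by (intro mult_pos_pos add_pos_nonneg mult_nonneg_nonneg) auto
  define B where "B = 204 * (k + 2) * 2 powr p / (1 / 2 - n) * C powr p"
  have B: "0 < B" using k n C by (simp add: B_def)
  \<comment> \<open>The value of \<epsilon>^(p(p - 1)) X^(\<gamma>/2) at which the feedback
    condition of \<open>small_data_solution\<close> becomes an equality.\<close>
  define \<delta> where "\<delta> = 102 * C powr p * \<kappa> / 24 / B powr p"
  have \<delta>: "0 < \<delta>" using B C \<kappa> by (simp add: \<delta>_def)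
  have life: "\<exists>\<epsilon>\<^sub>0>0. \<exists>c>0. \<forall>\<epsilon> T. 0 < \<epsilon> \<longrightarrow> \<epsilon> \<le> \<epsilon>\<^sub>0 \<longrightarrow> 0 < T \<longrightarrow> T \<le> c * \<epsilon> powr (- (2 * (p * (p - 1)) / \<gamma>)) \<longrightarrow>
    \<epsilon> powr (p * (p - 1)) * (k + 2 + T) powr (\<gamma> / 2) \<le> \<delta>"
    using k p by (intro power_lifespan \<delta> \<gamma>) auto
  have sol: "admits_unique_solution T (solves_integral_eq p f g \<epsilon> T)"
    if e: "0 < \<epsilon>" and T: "0 < T" and sm: "\<epsilon> powr (p * (p - 1)) * (k + 2 + T) powr (\<gamma> / 2) \<le> \<delta>" for \<epsilon> T
  proof (rule small_data_solution(1)[OF hg g p(1) _ n(1,2) \<kappa> \<kappa>_def C e _ _ T _ refl])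
    define X where "X = k + 2 + T"
    define H where "H = X powr (n - q)"
    have X: "0 < X" using k T by (simp add: X_def)
    show "0 \<le> H" by (simp add: H_def)
    show "0 \<le> 204 * (k + 2) * 2 powr p / (1 / 2 - n) * (\<epsilon> * C) powr p * H" using k n by (simp add: H_def)
    show "r powr (1 - 3 * p / 2) \<le> H * r powr (- 3 / 2 - n)" if r: "1 \<le> r" "r \<le> k + 2 + T" for r
    proof -
      have "r powr (1 - 3 * p / 2) = r powr (n - q) * r powr (- 3 / 2 - n)"
        unfolding powr_add[symmetric] by (rule arg_cong[where f="\<lambda>s. r powr s"]) (simp add: q_def field_simps)
      also have "\<dots> \<le> H * r powr (- 3 / 2 - n)"
        unfolding H_def X_def using r n by (intro mult_right_mono powr_mono2) auto
      finally show ?thesis .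
    qed
    have "(204 * (k + 2) * 2 powr p / (1 / 2 - n) * (\<epsilon> * C) powr p * H) powr p = (B * \<epsilon> powr p * H) powr p"
      by (simp add: B_def powr_mult mult_ac)
    also have "\<dots> = B powr p * (\<epsilon> powr p * \<epsilon> powr (p * (p - 1))) * X powr ((n - q) * p)"
    proof -
      have "\<epsilon> powr p * \<epsilon> powr (p * (p - 1)) = \<epsilon> powr (p * p)"
        unfolding powr_add[symmetric] by (rule arg_cong[where f="\<lambda>s. \<epsilon> powr s"]) (simp add: algebra_simps)
      then show ?thesis by (simp add: powr_mult powr_powr H_def)
    qed
    finally have bp: "(204 * (k + 2) * 2 powr p / (1 / 2 - n) * (\<epsilon> * C) powr p * H) powr p
      = B powr p * (\<epsilon> powr p * \<epsilon> powr (p * (p - 1))) * X powr ((n - q) * p)" .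
    have "\<gamma> / 2 = \<kappa> + (n - q) * p" using \<gamma>2 by simp
    then have "X powr (\<gamma> / 2) = X powr \<kappa> * X powr ((n - q) * p)" by (simp only: powr_add)
    then have "24 * X powr \<kappa> / \<kappa> * (B powr p * (\<epsilon> powr p * \<epsilon> powr (p * (p - 1))) * X powr ((n - q) * p))
      = 24 / \<kappa> * B powr p * \<epsilon> powr p * (\<epsilon> powr (p * (p - 1)) * X powr (\<gamma> / 2))"
      by simp
    also have "\<dots> \<le> 24 / \<kappa> * B powr p * \<epsilon> powr p * \<delta>"
      using sm \<kappa> unfolding X_def by (intro mult_left_mono) auto
    also have "\<dots> = 102 * (\<epsilon> * C) powr p"
      using \<kappa> B by (simp add: \<delta>_def powr_mult)
    finally show "24 * (k + 2 + T) powr \<kappa> / \<kappa> * (204 * (k + 2) * 2 powr p / (1 / 2 - n) * (\<epsilon> * C) powr p * H) powr p \<le> 102 * (\<epsilon> * C) powr p"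
      unfolding bp X_def .
  qed (use p in auto)
  show ?thesis using life sol unfolding \<gamma>_def by meson
qed

lemma critical_lifespan:
  assumes hg: "\<And>x. h x = f x + g x" and g: "continuous_on UNIV g"
  shows "\<exists>\<epsilon>\<^sub>0>0. \<exists>c>0. \<forall>\<epsilon> T. 0 < \<epsilon> \<longrightarrow> \<epsilon> \<le> \<epsilon>\<^sub>0 \<longrightarrow> 0 < T \<longrightarrow>
    T \<le> exp (c * \<epsilon> powr (- (2 / 3))) \<longrightarrow> admits_unique_solution T (solves_IVP 2 f g \<epsilon> T)"
proof -
  obtain C where C: "0 < C" "\<And>x t. 0 \<le> t \<Longrightarrow> \<bar>w x t\<bar> \<le> C * ((k + 2 + t) powr (- 1 / 2) * cutpow (3 / 2) 3 (bt x (k + 2 + t)))"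
    by (rule w_decay) blast
  \<comment> \<open>816 = 204 * 2^2; as 1/(1/2 - n) will be l, the size b becomes B \<epsilon>^2
    l.\<close>
  define B where "B = 816 * (k + 2) * C\<^sup>2"
  have B: "0 < B" using k C by (simp add: B_def)
  \<comment> \<open>108 = 24 * 9 / 2, where 9 bounds t'^\<kappa> through exp 2 and 1/\<kappa> =
    l/2.\<close>
  define \<delta> where "\<delta> = 102 * C\<^sup>2 / (108 * B\<^sup>2)"
  have \<delta>: "0 < \<delta>" using B C by (simp add: \<delta>_def)
  have life: "\<exists>\<epsilon>\<^sub>0>0. \<exists>c>0. \<forall>\<epsilon> T. 0 < \<epsilon> \<longrightarrow> \<epsilon> \<le> \<epsilon>\<^sub>0 \<longrightarrow> 0 < T \<longrightarrow> T \<le> exp (c * \<epsilon> powr (- (2 / 3))) \<longrightarrow>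
    \<epsilon>\<^sup>2 * (4 + ln (k + 2 + T)) ^ 3 \<le> \<delta>"
    using k by (intro exponential_lifespan \<delta>) auto
  have sol: "admits_unique_solution T (solves_IVP 2 f g \<epsilon> T)"
    if e: "0 < \<epsilon>" and T: "0 < T" and sm: "\<epsilon>\<^sup>2 * (4 + ln (k + 2 + T)) ^ 3 \<le> \<delta>" for \<epsilon> T
  proof -
    \<comment> \<open>The summand 4 makes n at least 1/4, and the logarithm keeps \<kappa> ln t' at
      most 2.\<close>
    define l where "l = 4 + ln (k + 2 + T)"
    have lnp: "0 < ln (k + 2 + T)" using k T by simp
    then have l: "4 < l" by (simp add: l_def)
    define n where "n = 1 / 2 - 1 / l" \<comment> \<open>balances the factors 1 / (1 / 2 - n) and 1 / \<kappa> against the growth of t' powr \<kappa>\<close>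
    define \<kappa> where "\<kappa> = 2 / l"
    have n: "1 / 4 \<le> n" "n < 1 / 2" using l by (auto simp: n_def field_simps)
    have \<kappa>: "0 < \<kappa>" "\<kappa> \<le> 1" "\<kappa> = 1 - n * 2" using l by (auto simp: n_def \<kappa>_def field_simps)
    show ?thesis
    proof (rule small_data_solution(2)[OF hg g _ _ n \<kappa> C e _ zero_le_one T _ refl])
      show "r powr (1 - 3 * 2 / 2) \<le> 1 * r powr (- 3 / 2 - n)" if "1 \<le> r" for r
        using that n by (simp add: powr_mono)
      show "0 \<le> 204 * (k + 2) * 2 powr 2 / (1 / 2 - n) * (\<epsilon> * C) powr 2 * 1" using k n by simp
      have b: "204 * (k + 2) * 2 powr 2 / (1 / 2 - n) * (\<epsilon> * C) powr 2 * 1 = B * \<epsilon>\<^sup>2 * l"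
        using e C by (simp add: B_def n_def power_mult_distrib)
      have "ln (k + 2 + T) \<le> l" by (simp add: l_def)
      then have "\<kappa> * ln (k + 2 + T) \<le> 2" using l by (simp add: \<kappa>_def field_simps)
      then have "(k + 2 + T) powr \<kappa> \<le> exp 2" using k T by (simp add: powr_def)
      also have "exp (2::real) = exp 1 ^ 2" by (simp flip: exp_of_nat_mult)
      also have "\<dots> \<le> 3\<^sup>2" using exp_le by (intro power_mono) auto
      finally have X: "(k + 2 + T) powr \<kappa> \<le> 9" by simp
      have "24 * (k + 2 + T) powr \<kappa> / \<kappa> * (B * \<epsilon>\<^sup>2 * l) powr 2 \<le> 24 * 9 / \<kappa> * (B * \<epsilon>\<^sup>2 * l) powr 2"
        using X \<kappa> by (intro mult_right_mono divide_right_mono mult_left_mono) auto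
      also have "\<dots> = 108 * B\<^sup>2 * \<epsilon>\<^sup>2 * (\<epsilon>\<^sup>2 * l ^ 3)"
        using B l by (simp add: \<kappa>_def power_mult_distrib power2_eq_square power3_eq_cube)
      also have "\<dots> \<le> 108 * B\<^sup>2 * \<epsilon>\<^sup>2 * \<delta>"
        using sm unfolding l_def by (intro mult_left_mono) auto
      also have "\<dots> = 102 * (\<epsilon> * C) powr 2" using B e C by (simp add: \<delta>_def power_mult_distrib)
      finally show "24 * (k + 2 + T) powr \<kappa> / \<kappa> * (204 * (k + 2) * 2 powr 2 / (1 / 2 - n) * (\<epsilon> * C) powr 2 * 1) powr 2 \<le> 102 * (\<epsilon> * C) powr 2"
        unfolding b .
    qed auto
  qed
  show ?thesis using life sol by meson
qed

end

lemma free_wave_of_data: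
  assumes "1 \<le> k" "f \<in> C0 3" "g \<in> C0 2" and supp: "supp (\<lambda>x. (f x, g x)) \<subseteq> {x. norm x \<le> k}"
    and mean: "(LINT x|lborel. f x + g x) = 0"
  shows "\<exists>f1 f2 f3 h1 h2. free_wave f f1 f2 f3 (\<lambda>x. f x + g x) h1 h2 k"
proof -
  have Cf: "C_on (Suc (Suc (Suc 0))) UNIV f" and Cg: "C_on (Suc (Suc 0)) UNIV g"
    using assms by (auto simp: C0_def numeral_3_eq_3 numeral_2_eq_2)
  have ex: "\<exists>D. has_grad \<phi> D \<and> (\<forall>i. C_on n UNIV (D i))" if "C_on (Suc n) UNIV \<phi>" for n \<phi>
    by (rule C_on_has_grad[OF that]) blast
  have ex1: "\<exists>D. \<forall>i. has_grad (\<phi> i) (D i) \<and> (\<forall>j. C_on n UNIV (D i j))" if "\<And>i. C_on (Suc n) UNIV (\<phi> i)" for n and \<phi> :: "'i \<Rightarrow> real^2 \<Rightarrow> real"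
    using ex[OF that] by (rule choice[OF allI])
  obtain f1 where f1: "has_grad f f1" "\<And>i. C_on (Suc (Suc 0)) UNIV (f1 i)" using ex[OF Cf] by blast
  obtain f2 where f2: "\<And>i. has_grad (f1 i) (f2 i)" "\<And>i j. C_on (Suc 0) UNIV (f2 i j)" using ex1[of _ f1, OF f1(2)] by blast
  \<comment> \<open>The two indices are joined into a pair, so that one use of the choice statement
    \<open>ex1\<close> yields the third derivatives.\<close>
  have "C_on (Suc 0) UNIV (f2 (fst z) (snd z))" for z by (rule f2(2))
  from ex1[of _ "\<lambda>z. f2 (fst z) (snd z)", OF this]
  obtain f3 where f3: "\<And>z. has_grad (f2 (fst z) (snd z)) (f3 z)" "\<And>z l. C_on 0 UNIV (f3 z l)" by blast
  obtain g1 where g1: "has_grad g g1" "\<And>i. C_on (Suc 0) UNIV (g1 i)" using ex[OF Cg] by blast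
  obtain g2 where g2: "\<And>i. has_grad (g1 i) (g2 i)" "\<And>i j. C_on 0 UNIV (g2 i j)" using ex1[of _ g1, OF g1(2)] by blast
  have z: "f y = 0" "g y = 0" if "k < norm y" for y
  proof -
    have "y \<notin> supp (\<lambda>x. (f x, g x))" using supp that by auto
    moreover have "{x. (f x, g x) \<noteq> 0} \<subseteq> supp (\<lambda>x. (f x, g x))" unfolding supp_def by (rule closure_subset)
    ultimately have "(f y, g y) = 0" by (metis (mono_tags, lifting) mem_Collect_eq subsetD)
    then show "f y = 0" "g y = 0" by (simp_all add: zero_prod_def)
  qed
  have "free_wave f f1 f2 (\<lambda>i j. f3 (i, j)) (\<lambda>x. f x + g x) (\<lambda>i x. f1 i x + g1 i x) (\<lambda>i j x. f2 i j x + g2 i j x) k"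
  proof
    show "continuous_on UNIV (f3 (i, j) l)" for i j l using f3(2) by simp
    show f3': "has_grad (f2 i j) (f3 (i, j))" for i j using f3(1)[of "(i, j)"] by simp
    show "has_grad (\<lambda>x. f x + g x) (\<lambda>i x. f1 i x + g1 i x)" by (rule has_grad_add[OF f1(1) g1(1)])
    show "has_grad (\<lambda>x. f1 i x + g1 i x) (\<lambda>j x. f2 i j x + g2 i j x)" for i by (rule has_grad_add[OF f2(1) g2(1)])
    show "continuous_on UNIV (\<lambda>x. f2 i j x + g2 i j x)" for i j
      using g2(2) has_grad_cont[OF f3'] by (intro continuous_on_add) auto
  qed (use f1 f2 z mean assms(1) in auto)
  then show ?thesis by blast
qed

theorem theorem2p2:
  fixes p k :: real and f g :: "real^2 \<Rightarrow> real"
  assumes "1 < p" and "p \<le> 2" and "1 \<le> k"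
    and "f \<in> C0 3" and "g \<in> C0 2"
    and "supp (\<lambda>x. (f x, g x)) \<subseteq> {x. norm x \<le> k}"
    and "(LINT x|lborel. f x + g x) = 0"
  shows "\<exists>\<epsilon>\<^sub>0>0. \<exists>c>0. \<forall>\<epsilon> T. 0 < \<epsilon> \<longrightarrow> \<epsilon> \<le> \<epsilon>\<^sub>0 \<longrightarrow> 0 < T \<longrightarrow>
    T \<le> (if p < 2 then c * \<epsilon> powr (- (2 * p * (p - 1) / strauss_gamma p 4))
         else exp (c * \<epsilon> powr (- (2 / 3)))) \<longrightarrow>
    (p = 2 \<longrightarrow> admits_unique_solution T (solves_IVP p f g \<epsilon> T)) \<and>
    (p < 2 \<longrightarrow> admits_unique_solution T (solves_integral_eq p f g \<epsilon> T))"
proof -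
  obtain f1 f2 f3 h1 h2 where fw: "free_wave f f1 f2 f3 (\<lambda>x. f x + g x) h1 h2 k"
    using free_wave_of_data[OF assms(3-7)] by blast
  have cg: "continuous_on UNIV g" using assms(5) C_on_continuous by (auto simp only: C0_def)
  show ?thesis
  proof (cases "p < 2")
    case True
    then show ?thesis
      using free_wave.subcritical_lifespan[OF fw refl cg assms(1) True] by (simp add: mult.assoc)
  next
    case False
    then have "p = 2" using assms(2) by simp
    then show ?thesis using free_wave.critical_lifespan[OF fw refl cg] by simp
  qed
qed

end
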